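(* Let $(R,\mathfrak{m})$ be an $n$-dimensional regular local domain essentially of finite type over a field of characteristic zero, and let $I\subseteq R$ be an $\mathfrak{m}$-primary ideal with Rees valuations $\nu_1,\dots,\nu_r$. Put $e_i=\nu_i(I)=\min_{f\in I}\nu_i(f)$. Then the multiplicity $e(I)$ of $I$ satisfies $$e(I)^{1/n}\ \le\ e_1\,\mathrm{vol}_R(\nu_1)^{1/n}+\dots+e_r\,\mathrm{vol}_R(\nu_r)^{1/n}.$$
   Context: Rees valuations: let $X$ be the normalized blow-up of $I$ and write $I\mathcal{O}_X=\mathcal{O}_X(-e_1E_1-\dots-e_rE_r)$ with $E_i$ distinct prime Weil divisors of $X$ and $e_i$ positive integers; then $\nu_i$ is the valuation on the fraction field of $R$ given by order of vanishing along $E_i$. For a rank one (real-valued) valuation $\nu$ centered on $R$ (non-negative on $R$, positive on $\mathfrak{m}$), set $\mathfrak{a}_m=\{f\in R\mid\nu(f)\ge m\}$; the volume of $\nu$ on $R$ is $$\mathrm{vol}_R(\nu)=\limsup_{m\to\infty}\frac{\mathrm{length}(R/\mathfrak{a}_m)}{m^n/n!}.$$ The multiplicity $e(I)$ is the Hilbert–Samuel multiplicity. *)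

theory Defs
  imports "HOL-Algebra.Algebra" "HOL-Library.Extended_Real"
begin

section \<open>Local rings, dimension, length, multiplicity\<close>

definition prime_chain :: "('a, 'b) ring_scheme \<Rightarrow> (nat \<Rightarrow> 'a set) \<Rightarrow> nat \<Rightarrow> bool"
  where "prime_chain R P l \<longleftrightarrow>
    (\<forall>i\<le>l. primeideal (P i) R) \<and> (\<forall>i<l. P i \<subset> P (Suc i))"

definition krull_dim :: "('a, 'b) ring_scheme \<Rightarrow> enat"
  where "krull_dim R = Sup {enat l | l. \<exists>P. prime_chain R P l}"

definition prime_height :: "('a, 'b) ring_scheme \<Rightarrow> 'a set \<Rightarrow> enat"
  where "prime_height R Q = Sup {enat l | l. \<exists>P. prime_chain R P l \<and> P l = Q}"

definition local_ring :: "('a, 'b) ring_scheme \<Rightarrow> 'a set \<Rightarrow> bool"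
  where "local_ring R M \<longleftrightarrow>
    cring R \<and> maximalideal M R \<and> (\<forall>N. maximalideal N R \<longrightarrow> N = M)"

definition regular_local_ring :: "('a, 'b) ring_scheme \<Rightarrow> 'a set \<Rightarrow> bool"
  where "regular_local_ring R M \<longleftrightarrow>
    noetherian_ring R \<and> local_ring R M \<and>
    (\<exists>S \<subseteq> carrier R. finite S \<and> enat (card S) = krull_dim R \<and> M = Idl\<^bsub>R\<^esub> S)"

definition ideal_radical :: "('a, 'b) ring_scheme \<Rightarrow> 'a set \<Rightarrow> 'a set"
  where "ideal_radical R Q = {a \<in> carrier R. \<exists>k::nat. a [^]\<^bsub>R\<^esub> k \<in> Q}"

definition primary_ideal :: "('a, 'b) ring_scheme \<Rightarrow> 'a set \<Rightarrow> 'a set \<Rightarrow> bool"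
  where "primary_ideal R P Q \<longleftrightarrow>
    ideal Q R \<and> Q \<noteq> carrier R \<and>
    (\<forall>a\<in>carrier R. \<forall>b\<in>carrier R. a \<otimes>\<^bsub>R\<^esub> b \<in> Q \<longrightarrow> a \<in> Q \<or> b \<in> ideal_radical R Q) \<and>
    ideal_radical R Q = P"

definition module_length :: "('a, 'b) ring_scheme \<Rightarrow> ('a, 'c, 'd) module_scheme \<Rightarrow> enat"
  where "module_length R M = Sup {enat l | l. \<exists>N.
    (\<forall>i\<le>l. submodule (N i) R M) \<and> (\<forall>i<l. N i \<subset> N (Suc i))}"

definition quot_module :: "('a, 'b) ring_scheme \<Rightarrow> 'a set \<Rightarrow> ('a, 'a set) module"
  where "quot_module R J =
    ring.extend (R Quot J) (module.fields (\<lambda>r c. (J +>\<^bsub>R\<^esub> r) \<otimes>\<^bsub>R Quot J\<^esub> c))"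

definition hs_multiplicity :: "('a, 'b) ring_scheme \<Rightarrow> nat \<Rightarrow> 'a set \<Rightarrow> ereal"
  where "hs_multiplicity R n I =
    lim (\<lambda>m. ereal_of_enat (module_length R (quot_module R (I [^]\<^bsub>ideals_set R\<^esub> m)))
              / ereal (real m ^ n / fact n))"

text \<open>Valuations take values in the extended reals, with value \<open>\<infinity>\<close> at zero.\<close>

definition val_of_ideal :: "('a \<Rightarrow> ereal) \<Rightarrow> 'a set \<Rightarrow> ereal"
  where "val_of_ideal \<nu> I = (INF f\<in>I. \<nu> f)"

definition val_ideal :: "('a, 'b) ring_scheme \<Rightarrow> ('a \<Rightarrow> ereal) \<Rightarrow> nat \<Rightarrow> 'a set"
  where "val_ideal R \<nu> m = {f \<in> carrier R. ereal (real m) \<le> \<nu> f}"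

definition val_volume :: "('a, 'b) ring_scheme \<Rightarrow> nat \<Rightarrow> ('a \<Rightarrow> ereal) \<Rightarrow> ereal"
  where "val_volume R n \<nu> =
    limsup (\<lambda>m. ereal_of_enat (module_length R (quot_module R (val_ideal R \<nu> m)))
              / ereal (real m ^ n / fact n))"


section \<open>Subrings of a field\<close>

text \<open>From here on \<open>K\<close> is a field, and all rings are subrings of \<open>K\<close>, given by their
  carrier sets.\<close>

definition localization :: "('a, 'b) ring_scheme \<Rightarrow> 'a set \<Rightarrow> 'a set \<Rightarrow> 'a set"
  where "localization K A W = {a \<otimes>\<^bsub>K\<^esub> inv\<^bsub>K\<^esub> w | a w. a \<in> A \<and> w \<in> W}"

definition integral_closure :: "('a, 'b) ring_scheme \<Rightarrow> 'a set \<Rightarrow> 'a set"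
  where "integral_closure K A = {x \<in> carrier K.
    \<exists>p. polynomial\<^bsub>K\<^esub> A p \<and> p \<noteq> [] \<and> lead_coeff p = \<one>\<^bsub>K\<^esub> \<and> ring.eval K p x = \<zero>\<^bsub>K\<^esub>}"

text \<open>\<open>R\<close> is a localization of a finitely generated \<open>k\<close>-algebra.\<close>

definition ess_finite_type :: "('a, 'b) ring_scheme \<Rightarrow> 'a set \<Rightarrow> 'a set \<Rightarrow> bool"
  where "ess_finite_type K k R \<longleftrightarrow>
    (\<exists>S W. finite S \<and> S \<subseteq> carrier K \<and>
       submonoid W K \<and> W \<subseteq> generate_ring K (k \<union> S) \<and> \<zero>\<^bsub>K\<^esub> \<notin> W \<and>
       R = localization K (generate_ring K (k \<union> S)) W)"

text \<open>The normalized discrete valuation of a discrete valuation ring \<open>V\<close> with fraction field \<open>K\<close>: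
  \<open>x = u \<pi>\<^sup>l\<close> with \<open>u\<close> a unit and \<open>\<pi>\<close> a generator of the maximal ideal.\<close>

definition dvr_ord :: "('a, 'b) ring_scheme \<Rightarrow> 'a set \<Rightarrow> 'a \<Rightarrow> ereal"
  where "dvr_ord K V x = (if x = \<zero>\<^bsub>K\<^esub> then \<infinity> else
    ereal (real_of_int (THE l::int. \<exists>\<pi>\<in>V. \<exists>u\<in>Units (K\<lparr>carrier := V\<rparr>).
      maximalideal (PIdl\<^bsub>K\<lparr>carrier := V\<rparr>\<^esub> \<pi>) (K\<lparr>carrier := V\<rparr>) \<and>
      x = u \<otimes>\<^bsub>K\<^esub> (\<pi> [^]\<^bsub>K\<^esub> l))))"


section \<open>Rees valuations\<close>

text \<open>Let \<open>R\<close> have fraction field \<open>K\<close>. The blow-up of \<open>I\<close> is covered by the spectra of the rings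
  \<open>R[I/f]\<close> for nonzero \<open>f \<in> I\<close>, and its normalization \<open>X\<close> by the spectra of their integral
  closures in \<open>K\<close>. As \<open>X\<close> is integral and separated with function field \<open>K\<close>, a point of \<open>X\<close> is
  determined by its local ring as a subring of \<open>K\<close>; a prime divisor \<open>E\<close> is encoded by the local
  ring at its generic point, which is the localization of a chart at a prime of height one.\<close>

definition normalized_chart :: "('a, 'b) ring_scheme \<Rightarrow> 'a set \<Rightarrow> 'a set \<Rightarrow> 'a \<Rightarrow> 'a set"
  where "normalized_chart K R I f =
    integral_closure K (generate_ring K (R \<union> {g \<otimes>\<^bsub>K\<^esub> inv\<^bsub>K\<^esub> f | g. g \<in> I}))"

definition blowup_prime_divisors :: "('a, 'b) ring_scheme \<Rightarrow> 'a set \<Rightarrow> 'a set \<Rightarrow> 'a set set"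
  where "blowup_prime_divisors K R I =
    {localization K B (B - P) | B P. (\<exists>f \<in> I - {\<zero>\<^bsub>K\<^esub>}. B = normalized_chart K R I f) \<and>
       primeideal P (K\<lparr>carrier := B\<rparr>) \<and> prime_height (K\<lparr>carrier := B\<rparr>) P = 1}"

text \<open>The coefficient of \<open>E\<close> in the divisor of \<open>I \<O>\<^sub>X\<close> is the minimal order of
  vanishing along \<open>E\<close> of the elements of \<open>I\<close>. The Rees valuations belong to the \<open>E\<close> for which it
  is positive.\<close>

definition rees_valuations :: "('a, 'b) ring_scheme \<Rightarrow> 'a set \<Rightarrow> 'a set \<Rightarrow> ('a \<Rightarrow> ereal) set"
  where "rees_valuations K R I =
    {dvr_ord K V | V. V \<in> blowup_prime_divisors K R I \<and> 0 < val_of_ideal (dvr_ord K V) I}"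

end

(* Idea. For parameters x_1, ..., x_n of R, sending f to its lexicographically smallest exponent
   turns an ideal J of finite colength into a set of exponents with length(R/J) gaps. So e(I) and
   vol(nu) are n! times the limits of (number of gaps at level m) / m^n for graded families of
   monomial ideals. Cutting the orthant into thin cones, such a limit is up to O(1/T) a sum of n-th
   powers of the radii rad(q) at which the family is reached along rays q. A product of elements
   g_i with nu_i(g_i) >= e_i L is integral over I^L by the valuative criterion; hence
   rad_I(q) <= sum_i e_i rad_i(q), and Minkowski's inequality for the L^n norm gives the theorem.
   The valuative criterion holds because a normalized chart is a localization of a finite module
   over a polynomial ring (Noether normalization, trace form), hence noetherian and normal, hence
   the intersection of the discrete valuation rings at its height one primes. *)

theory Submission
  imports Defs "HOL-Algebra.Algebraic_Closure_Type"
begin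

text \<open>The divisors in the statement are local rings of normalized charts, taken as subsets of
  a field in the sense of HOL-Algebra, whereas the trace form argument wants all conjugates of an
  element, hence an algebraically closed type of characteristic zero. So the commutative algebra is
  done for subsets of a type, and the field is embedded into a type made for this purpose.
  Finiteness of the set of Rees valuations has to be proved as well: the sum in the statement would
  be 0 over an infinite set. Integral dependence of \<open>h\<close> on \<open>I^L\<close> enters
  only asymptotically: there are \<open>D\<close> and \<open>N\<close> such that
  \<open>z h^t\<close> lies in \<open>I^(L (t - D))\<close> for all \<open>t\<close> and all
  \<open>z\<close> in \<open>I^N\<close>. The factor \<open>z\<close> and the shift \<open>D\<close>
  are bounded, so they disappear from radii when \<open>t\<close> tends to infinity. The parameters
  admit no expansion of elements into power series with coefficients in a fixed field. Leading
  exponents are therefore a relation between elements and exponents, and lengths are counted by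
  colon ideals.\<close>

section \<open>Subrings, modules and finite generation inside a commutative ring\<close>

definition subr :: "'a::comm_ring_1 set \<Rightarrow> bool" where
  "subr D \<longleftrightarrow> 1 \<in> D \<and> (\<forall>x\<in>D. \<forall>y\<in>D. x - y \<in> D \<and> x * y \<in> D)"

definition dmod :: "'a::comm_ring_1 set \<Rightarrow> 'a set \<Rightarrow> bool" where
  "dmod D E \<longleftrightarrow> 0 \<in> E \<and> (\<forall>x\<in>E. \<forall>y\<in>E. x + y \<in> E) \<and> (\<forall>d\<in>D. \<forall>x\<in>E. d * x \<in> E)"

inductive_set dspan :: "'a::comm_ring_1 set \<Rightarrow> 'a set \<Rightarrow> 'a set" for D G where
  dspan_0: "0 \<in> dspan D G"
| dspan_step: "d \<in> D \<Longrightarrow> g \<in> G \<Longrightarrow> x \<in> dspan D G \<Longrightarrow> d * g + x \<in> dspan D G"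

definition noeth :: "'a::comm_ring_1 set \<Rightarrow> bool" where
  "noeth D \<longleftrightarrow> (\<forall>E. E \<subseteq> D \<longrightarrow> dmod D E \<longrightarrow> (\<exists>G. finite G \<and> G \<subseteq> E \<and> E \<subseteq> dspan D G))"

text \<open>The module form of integrality: multiplication by \<open>x\<close> preserves a finitely
  generated module containing 1. Sums and products are then immediate, and over a noetherian
  \<open>D\<close> a monic equation comes back from finite generation, without determinants.\<close>

definition integ :: "'a::comm_ring_1 set \<Rightarrow> 'a \<Rightarrow> bool" where
  "integ D x \<longleftrightarrow> (\<exists>G. finite G \<and> 1 \<in> dspan D G \<and> (\<forall>g\<in>G. x * g \<in> dspan D G))"

definition frac :: "'a::field set \<Rightarrow> 'a set" where
  "frac D = {a / b | a b. a \<in> D \<and> b \<in> D \<and> b \<noteq> 0}"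

text \<open>Complete integral closedness: an element whose powers have a common denominator is in
  the ring. For noetherian domains this is normality; this form passes to polynomial rings by
  comparing leading coefficients, and it is what makes the valuations below discrete.\<close>

definition cic :: "'a::field set \<Rightarrow> bool" where
  "cic D \<longleftrightarrow> (\<forall>x\<in>frac D. (\<exists>d\<in>D. d \<noteq> 0 \<and> (\<forall>j::nat. d * x ^ j \<in> D)) \<longrightarrow> x \<in> D)"

definition good :: "'a::field set \<Rightarrow> bool" where
  "good D \<longleftrightarrow> subr D \<and> noeth D \<and> cic D"

definition adj :: "'a::comm_ring_1 set \<Rightarrow> 'a \<Rightarrow> 'a set" where
  "adj D y = dspan D (range (\<lambda>i::nat. y ^ i))"

lemma subr_0: "subr D \<Longrightarrow> 0 \<in> D" unfolding subr_def by (metis diff_self)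
lemma subr_1: "subr D \<Longrightarrow> 1 \<in> D" unfolding subr_def by blast
lemma subr_diff: "subr D \<Longrightarrow> x \<in> D \<Longrightarrow> y \<in> D \<Longrightarrow> x - y \<in> D" unfolding subr_def by blast
lemma subr_mult: "subr D \<Longrightarrow> x \<in> D \<Longrightarrow> y \<in> D \<Longrightarrow> x * y \<in> D" unfolding subr_def by blast
lemma subr_minus: "subr D \<Longrightarrow> x \<in> D \<Longrightarrow> - x \<in> D" using subr_diff[of D 0 x] subr_0[of D] by simp
lemma subr_add: "subr D \<Longrightarrow> x \<in> D \<Longrightarrow> y \<in> D \<Longrightarrow> x + y \<in> D"
  using subr_diff[of D x "-y"] subr_minus[of D y] by simp
lemma subr_pow: "subr D \<Longrightarrow> x \<in> D \<Longrightarrow> x ^ n \<in> D" by (induction n) (auto intro: subr_1 subr_mult)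
lemma subr_of_nat: "subr D \<Longrightarrow> of_nat n \<in> D" by (induction n) (auto intro: subr_1 subr_add subr_0)
lemma subr_sum: "subr D \<Longrightarrow> (\<And>i. i \<in> A \<Longrightarrow> f i \<in> D) \<Longrightarrow> sum f A \<in> D"
  by (induction A rule: infinite_finite_induct) (auto intro: subr_0 subr_add)
lemma subr_prod: "subr D \<Longrightarrow> (\<And>i. i \<in> A \<Longrightarrow> f i \<in> D) \<Longrightarrow> prod f A \<in> D"
  by (induction A rule: infinite_finite_induct) (auto intro: subr_1 subr_mult)
lemmas subr_closed = subr_0 subr_1 subr_diff subr_mult subr_minus subr_add subr_pow subr_of_nat

lemma dmod_self: "subr D \<Longrightarrow> dmod D D" unfolding dmod_def by (auto intro: subr_closed)
lemma dmod_diff: "subr D \<Longrightarrow> dmod D E \<Longrightarrow> x \<in> E \<Longrightarrow> y \<in> E \<Longrightarrow> x - y \<in> E"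
  unfolding dmod_def using subr_minus[OF _ subr_1, of D] by (metis add.commute mult_minus1 uminus_add_conv_diff)
lemma dmod_mono: "dmod D E \<Longrightarrow> D' \<subseteq> D \<Longrightarrow> dmod D' E" unfolding dmod_def by blast
lemma dmod_int: "dmod D E \<Longrightarrow> dmod D E' \<Longrightarrow> dmod D (E \<inter> E')" unfolding dmod_def by blast

lemma dspan_add: assumes "x \<in> dspan D G" "y \<in> dspan D G" shows "x + y \<in> dspan D G" using assms(1)
proof (induction rule: dspan.induct)
  case (dspan_step d g x)
  thus ?case using dspan.dspan_step[of d D g G "x + y"] by (simp add: add.assoc)
qed (use assms(2) in simp)

lemma dspan_smult: assumes "subr D" "d \<in> D" "x \<in> dspan D G" shows "d * x \<in> dspan D G" using assms(3)
proof (induction rule: dspan.induct)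
  case (dspan_step e g x)
  have "d * (e * g + x) = (d * e) * g + d * x" by (simp add: algebra_simps)
  thus ?case using dspan.dspan_step[OF subr_mult[OF assms(1,2) dspan_step(1)] dspan_step(2,4)] by simp
qed (simp add: dspan.dspan_0)

lemma dmod_dspan: "subr D \<Longrightarrow> dmod D (dspan D G)" unfolding dmod_def by (auto intro: dspan_add dspan_smult dspan_0)

lemma dspan_incl: "subr D \<Longrightarrow> g \<in> G \<Longrightarrow> g \<in> dspan D G" using dspan_step[of 1 D g G 0] by (auto intro: dspan_0 subr_1)

lemma dspan_min: assumes "dmod D E" "G \<subseteq> E" shows "dspan D G \<subseteq> E"
proof
  fix x assume "x \<in> dspan D G" thus "x \<in> E" by (induction rule: dspan.induct) (use assms in "auto simp: dmod_def")
qed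

lemma dspan_mono: assumes "D \<subseteq> D'" "G \<subseteq> G'" "x \<in> dspan D G" shows "x \<in> dspan D' G'" using assms(3)
proof (induction rule: dspan.induct)
  case dspan_0 show ?case by (rule dspan.dspan_0)
next
  case (dspan_step d g x)
  show ?case by (rule dspan.dspan_step) (use dspan_step assms(1,2) in auto)
qed

lemma dspan_trans: "subr D \<Longrightarrow> G \<subseteq> dspan D H \<Longrightarrow> dspan D G \<subseteq> dspan D H" by (rule dspan_min[OF dmod_dspan])

lemma dspan_insert: assumes "subr D" "x \<in> dspan D (insert g G)" shows "\<exists>d\<in>D. \<exists>y\<in>dspan D G. x = d * g + y" using assms(2)
proof (induction rule: dspan.induct)
  case dspan_0 show ?case by (intro bexI[of _ 0]) (use assms(1) in "simp_all add: subr_0 dspan.dspan_0")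
next
  case (dspan_step d h x)
  then obtain e y where e: "e \<in> D" "y \<in> dspan D G" "x = e * g + y" by auto
  show ?case
  proof (cases "h = g")
    case True
    hence eq: "d * h + x = (d + e) * g + y" using e by (simp add: algebra_simps)
    show ?thesis by (rule bexI[of _ "d + e"], rule bexI[of _ y]) (use subr_add[OF assms(1) dspan_step(1) e(1)] e(2) eq in simp_all)
  next
    case False
    hence eq: "d * h + x = e * g + (d * h + y)" "h \<in> G" using e(3) dspan_step(2) by (simp_all add: algebra_simps)
    show ?thesis by (rule bexI[of _ e], rule bexI[of _ "d * h + y"]) (use e(1) dspan.dspan_step[OF dspan_step(1) _ e(2), of h] eq in simp_all)
  qed
qed

lemma dspan_empty: "dspan D {} = {0}"
proof -
  have "x = 0" if "x \<in> dspan D {}" for x using that by (induction rule: dspan.induct) auto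
  thus ?thesis by (auto intro: dspan_0)
qed

lemma dspan_finite: "x \<in> dspan D G \<Longrightarrow> \<exists>H. finite H \<and> H \<subseteq> G \<and> x \<in> dspan D H"
proof (induction rule: dspan.induct)
  case dspan_0 show ?case by (rule exI[of _ "{}"]) (simp add: dspan_empty)
next
  case (dspan_step d g x)
  then obtain H where H: "finite H" "H \<subseteq> G" "x \<in> dspan D H" by blast
  hence "x \<in> dspan D (insert g H)" using dspan_mono[of D D H "insert g H"] by blast
  hence "d * g + x \<in> dspan D (insert g H)" using dspan_step(1) dspan.dspan_step[of d D g "insert g H"] by simp
  thus ?case using dspan_step(2) H by (intro exI[of _ "insert g H"]) simp
qed

lemma dspan_mult_set: assumes "subr D" "x \<in> dspan D G" "y \<in> dspan D H" shows "x * y \<in> dspan D {g * h | g h. g \<in> G \<and> h \<in> H}"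
proof -
  have 1: "g * y \<in> dspan D {g * h | g h. g \<in> G \<and> h \<in> H}" if "g \<in> G" for g using assms(3)
  proof (induction rule: dspan.induct)
    case (dspan_step d h z)
    have "g * (d * h + z) = d * (g * h) + g * z" by (simp add: algebra_simps)
    moreover have "d * (g * h) + g * z \<in> dspan D {g * h | g h. g \<in> G \<and> h \<in> H}" by (rule dspan.dspan_step) (use dspan_step that in auto)
    ultimately show ?case by simp
  qed (simp add: dspan.dspan_0)
  show ?thesis using assms(2)
  proof (induction rule: dspan.induct)
    case (dspan_step d g z)
    have "(d * g + z) * y = d * (g * y) + z * y" by (simp add: algebra_simps)
    thus ?case using dspan_add[OF dspan_smult[OF assms(1) dspan_step(1) 1[OF dspan_step(2)]] dspan_step(4)] by simp
  qed (simp add: dspan.dspan_0)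
qed

lemma dspan_mult_closed: assumes "subr D" "\<forall>g\<in>G. x * g \<in> dspan D H" "y \<in> dspan D G" shows "x * y \<in> dspan D H" using assms(3)
proof (induction rule: dspan.induct)
  case (dspan_step d g z)
  have "x * (d * g + z) = d * (x * g) + x * z" by (simp add: algebra_simps)
  thus ?case using dspan_step assms dspan_add dspan_smult by metis
qed (simp add: dspan.dspan_0)

lemma finite_setmult: assumes "finite G" "finite H" shows "finite {g * h | g h. g \<in> G \<and> h \<in> H}"
proof -
  have "{g * h | g h. g \<in> G \<and> h \<in> H} \<subseteq> (\<lambda>(g, h). g * h) ` (G \<times> H)" by force
  thus ?thesis using finite_subset[OF _ finite_imageI[OF finite_cartesian_product[OF assms]]] by blast
qed

text \<open>Used with \<open>A\<close> generating an ideal of leading coefficients and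
  \<open>e a\<close> an element with leading coefficient \<open>a\<close>: the lifts of generators
  yield a lift of every member of the ideal.\<close>

lemma dspan_lift:
  assumes "subr D" "x \<in> dspan D A" "\<forall>a\<in>A. e a - a * t \<in> dspan D H" shows "\<exists>z\<in>dspan D (e ` A). z - x * t \<in> dspan D H"
  using assms(2)
proof (induction rule: dspan.induct)
  case dspan_0 show ?case by (intro bexI[of _ 0]) (simp_all add: dspan.dspan_0)
next
  case (dspan_step d a x)
  then obtain z where z: "z \<in> dspan D (e ` A)" "z - x * t \<in> dspan D H" by auto
  have "(d * e a + z) - (d * a + x) * t = d * (e a - a * t) + (z - x * t)" by (simp add: algebra_simps)
  hence "(d * e a + z) - (d * a + x) * t \<in> dspan D H"
    using dspan_add[OF dspan_smult[OF assms(1) dspan_step(1), of "e a - a * t" H] z(2)] assms(3) dspan_step(2) by metis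
  thus ?case using z dspan_step by (intro bexI[of _ "d * e a + z"]) (simp_all add: dspan.dspan_step)
qed

lemma noethD: "noeth D \<Longrightarrow> E \<subseteq> D \<Longrightarrow> dmod D E \<Longrightarrow> \<exists>G. finite G \<and> G \<subseteq> E \<and> E \<subseteq> dspan D G"
  unfolding noeth_def by simp

text \<open>Splitting off one generator \<open>g\<close>, the coefficients of \<open>g\<close> in
  elements of \<open>E\<close> form an ideal. Lifts of its generators, together with generators of
  the part of \<open>E\<close> in the span of the other generators, generate
  \<open>E\<close>.\<close>

lemma fg_submodule:
  assumes D: "subr D" "noeth D" and "finite G"
  shows "E \<subseteq> dspan D G \<Longrightarrow> dmod D E \<Longrightarrow> \<exists>H. finite H \<and> H \<subseteq> E \<and> E \<subseteq> dspan D H"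
  using assms(3)
proof (induction G arbitrary: E)
  case empty
  thus ?case by (intro exI[of _ "{}"]) auto
next
  case (insert g G)
  define I where "I = {d\<in>D. \<exists>x\<in>dspan D G. d * g + x \<in> E}"
  have "dmod D I" unfolding dmod_def
  proof (intro conjI ballI)
    have "0 * g + 0 \<in> E" using insert.prems(2) unfolding dmod_def by simp
    thus "0 \<in> I" using subr_0[OF D(1)] dspan.dspan_0[of D G] unfolding I_def by (auto intro!: bexI[of _ 0])
    fix x y assume "x \<in> I" "y \<in> I"
    then obtain u v where "x \<in> D" "y \<in> D" "u \<in> dspan D G" "v \<in> dspan D G" "x * g + u \<in> E" "y * g + v \<in> E" unfolding I_def by auto
    note uv = this
    have "(x * g + u) + (y * g + v) \<in> E" using insert.prems(2) uv unfolding dmod_def by blast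
    hence "(x + y) * g + (u + v) \<in> E" by (simp add: algebra_simps)
    thus "x + y \<in> I" unfolding I_def using subr_add[OF D(1), of x y] dspan_add[of u D G v] uv by (auto intro!: bexI[of _ "u + v"])
  next
    fix d x assume "d \<in> D" "x \<in> I"
    then obtain u where "x \<in> D" "u \<in> dspan D G" "x * g + u \<in> E" unfolding I_def by auto
    note u = this
    have "d * (x * g + u) \<in> E" using insert.prems(2) \<open>d \<in> D\<close> u unfolding dmod_def by blast
    hence "(d * x) * g + d * u \<in> E" by (simp add: algebra_simps)
    thus "d * x \<in> I" unfolding I_def using subr_mult[OF D(1) \<open>d \<in> D\<close>, of x] dspan_smult[OF D(1) \<open>d \<in> D\<close>, of u G] u
      by (auto intro!: bexI[of _ "d * u"])
  qed
  moreover have "I \<subseteq> D" unfolding I_def by auto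
  ultimately obtain A where A: "finite A" "A \<subseteq> I" "I \<subseteq> dspan D A" using noethD[OF D(2), of I] by meson
  have "\<forall>a\<in>A. \<exists>e. e \<in> E \<and> e - a * g \<in> dspan D G"
  proof
    fix a assume "a \<in> A"
    hence "a \<in> I" using A(2) by blast
    then obtain x where "x \<in> dspan D G" "a * g + x \<in> E" unfolding I_def by blast
    thus "\<exists>e. e \<in> E \<and> e - a * g \<in> dspan D G" by (intro exI[of _ "a * g + x"]) auto
  qed
  then obtain e where e: "\<forall>a\<in>A. e a \<in> E \<and> e a - a * g \<in> dspan D G" by metis
  have "dmod D (E \<inter> dspan D G)" by (rule dmod_int[OF insert.prems(2) dmod_dspan[OF D(1)]])
  then obtain H where H: "finite H" "H \<subseteq> E \<inter> dspan D G" "E \<inter> dspan D G \<subseteq> dspan D H"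
    using insert.IH[of "E \<inter> dspan D G"] by auto
  have "E \<subseteq> dspan D (e ` A \<union> H)"
  proof
    fix x assume x: "x \<in> E"
    hence "x \<in> dspan D (insert g G)" using insert.prems(1) by blast
    from dspan_insert[OF D(1) this] obtain d y where d: "d \<in> D" "y \<in> dspan D G" "x = d * g + y" by blast
    hence "d \<in> I" using x unfolding I_def by blast
    hence "d \<in> dspan D A" using A(3) by blast
    then obtain z where z: "z \<in> dspan D (e ` A)" "z - d * g \<in> dspan D G" using dspan_lift[OF D(1), of d A e g G] e by auto
    have zE: "z \<in> E" using z dspan_min[OF insert.prems(2), of "e ` A"] e by auto
    have "x - z = y - (z - d * g)" using d by (simp add: algebra_simps)
    hence "x - z \<in> dspan D G" using dmod_diff[OF D(1) dmod_dspan[OF D(1)] d(2) z(2)] by (simp only:)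
    hence "x - z \<in> dspan D H" using H(3) dmod_diff[OF D(1) insert.prems(2) x zE] by blast
    hence "z + (x - z) \<in> dspan D (e ` A \<union> H)" using dspan_mono[of D D "e ` A" "e ` A \<union> H" z] dspan_mono[of D D H "e ` A \<union> H" "x - z"] z(1)
      by (intro dspan_add) auto
    thus "x \<in> dspan D (e ` A \<union> H)" by simp
  qed
  thus ?case using A H e by (intro exI[of _ "e ` A \<union> H"]) auto
qed

subsection \<open>Integral elements\<close>

lemma integ_mem: "subr D \<Longrightarrow> x \<in> D \<Longrightarrow> integ D x" unfolding integ_def by (rule exI[of _ "{1}"])
    (use dspan_step[of x D 1 "{1}" 0] in "auto intro: dspan_0 dspan_incl")

lemma integ_two:
  assumes D: "subr D" and "integ D x" "integ D y"
  obtains G where "finite G" "1 \<in> dspan D G" "\<forall>g\<in>G. x * g \<in> dspan D G" "\<forall>g\<in>G. y * g \<in> dspan D G"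
proof -
  obtain G where G: "finite G" "1 \<in> dspan D G" "\<forall>g\<in>G. x * g \<in> dspan D G" using assms(2) unfolding integ_def by auto
  obtain H where H: "finite H" "1 \<in> dspan D H" "\<forall>g\<in>H. y * g \<in> dspan D H" using assms(3) unfolding integ_def by auto
  let ?P = "{g * h | g h. g \<in> G \<and> h \<in> H}"
  have "1 \<in> dspan D ?P" using dspan_mult_set[OF D G(2) H(2)] by simp
  moreover have "x * (g * h) \<in> dspan D ?P" if "g \<in> G" "h \<in> H" for g h
    using dspan_mult_set[OF D, of "x * g" G h H] G(3) that dspan_incl[OF D] by (simp add: mult.assoc)
  moreover have "y * (g * h) \<in> dspan D ?P" if "g \<in> G" "h \<in> H" for g h
    using dspan_mult_set[OF D, of g G "y * h" H] H(3) that dspan_incl[OF D] by (simp add: mult.left_commute)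
  ultimately show ?thesis using that[of ?P] finite_setmult[OF G(1) H(1)] by blast
qed

lemma integ_mult: assumes "subr D" "integ D x" "integ D y" shows "integ D (x * y)"
proof -
  obtain G where "finite G" "1 \<in> dspan D G" "\<forall>g\<in>G. x * g \<in> dspan D G" "\<forall>g\<in>G. y * g \<in> dspan D G"
    using integ_two[OF assms] by blast
  thus ?thesis unfolding integ_def using dspan_mult_closed[OF assms(1), of G x G] by (intro exI[of _ G]) (auto simp: mult.assoc)
qed

lemma integ_diff: assumes "subr D" "integ D x" "integ D y" shows "integ D (x - y)"
proof -
  obtain G where "finite G" "1 \<in> dspan D G" "\<forall>g\<in>G. x * g \<in> dspan D G" "\<forall>g\<in>G. y * g \<in> dspan D G"
    using integ_two[OF assms] by blast
  thus ?thesis unfolding integ_def using dmod_diff[OF assms(1) dmod_dspan[OF assms(1)]] by (intro exI[of _ G]) (auto simp: left_diff_distrib)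
qed

lemma subr_integ: "subr D \<Longrightarrow> subr {x. integ D x}" unfolding subr_def[of "{x. integ D x}"] by (auto intro: integ_mult integ_diff integ_mem subr_1)

lemma integ_pow_mem: assumes "subr D" "1 \<in> dspan D G" "\<forall>g\<in>G. x * g \<in> dspan D G" shows "x ^ j \<in> dspan D G"
  by (induction j) (use assms dspan_mult_closed[OF assms(1,3)] in auto)

text \<open>\<open>D[x]\<close> lies in a finitely generated module, so it is finitely generated
  itself. Finitely many generators involve only powers of \<open>x\<close> below some
  \<open>n\<close>, and \<open>x ^ n\<close> is a combination of them.\<close>

lemma powers_monic:
  assumes D: "subr D" "noeth D" and "finite G" "\<forall>j. x ^ j \<in> dspan D G" shows "\<exists>n. x ^ n \<in> dspan D ((\<lambda>i. x ^ i) ` {..<n})"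
proof -
  have "adj D x \<subseteq> dspan D G" unfolding adj_def by (rule dspan_trans) (use assms in auto)
  moreover have "dmod D (adj D x)" unfolding adj_def by (rule dmod_dspan[OF D(1)])
  ultimately obtain H where H: "finite H" "H \<subseteq> adj D x" "adj D x \<subseteq> dspan D H" using fg_submodule[OF D assms(3)] by meson
  have "\<exists>m. h \<in> dspan D ((\<lambda>i. x ^ i) ` {..<m})" if "h \<in> H" for h
  proof -
    have "h \<in> dspan D (range (\<lambda>i. x ^ i))" using that H(2) unfolding adj_def by (rule rev_subsetD)
    from dspan_finite[OF this] obtain A where A: "finite A" "A \<subseteq> range (\<lambda>i. x ^ i)" "h \<in> dspan D A" by blast
    from finite_subset_image[OF A(1,2)] obtain C where C: "finite C" "A = (\<lambda>i. x ^ i) ` C" by metis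
    have "C \<subseteq> {..<Suc (Max C)}" using C(1) by (auto simp: less_Suc_eq_le)
    hence "A \<subseteq> (\<lambda>i. x ^ i) ` {..<Suc (Max C)}" using C(2) by blast
    thus ?thesis using dspan_mono[OF order.refl _ A(3)] by meson
  qed
  then obtain m where m: "\<forall>h\<in>H. h \<in> dspan D ((\<lambda>i. x ^ i) ` {..<m h})" by metis
  define n where "n = (if H = {} then 0 else Max (m ` H))"
  have "h \<in> dspan D ((\<lambda>i. x ^ i) ` {..<n})" if "h \<in> H" for h
  proof -
    have "m h \<le> n" using that H unfolding n_def by auto
    hence "(\<lambda>i. x ^ i) ` {..<m h} \<subseteq> (\<lambda>i. x ^ i) ` {..<n}" by auto
    from dspan_mono[OF order.refl this] show ?thesis using m that by simp
  qed
  hence "adj D x \<subseteq> dspan D ((\<lambda>i. x ^ i) ` {..<n})" using H(3) dspan_trans[OF D(1), of H] by blast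
  moreover have "x ^ n \<in> adj D x" unfolding adj_def by (rule dspan_incl[OF D(1)]) auto
  ultimately show ?thesis by auto
qed

lemma integ_monic:
  assumes D: "subr D" "noeth D" and "integ D x" shows "\<exists>n. x ^ n \<in> dspan D ((\<lambda>i. x ^ i) ` {..<n})"
  using assms(3) powers_monic[OF D] integ_pow_mem[OF D(1)] unfolding integ_def by meson

text \<open>Each coefficient from \<open>E\<close> that occurs in \<open>y\<close> preserves a
  finite module over \<open>D\<close>; \<open>H\<close> generates the product of these modules, and
  multiplying by it absorbs the coefficients, so that only \<open>D\<close> remains.\<close>

lemma integ_coeffs:
  assumes D: "subr D" and "\<forall>e\<in>E. integ D e" "y \<in> dspan E G"
  shows "\<exists>H. finite H \<and> 1 \<in> dspan D H \<and> (\<forall>h\<in>H. h * y \<in> dspan D {g * h | g h. g \<in> H \<and> h \<in> G})" using assms(3)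
proof (induction rule: dspan.induct)
  case dspan_0 show ?case by (rule exI[of _ "{1}"]) (simp add: dspan.dspan_0 dspan_incl[OF D])
next
  case (dspan_step e g x)
  then obtain H where H: "finite H" "1 \<in> dspan D H" "\<forall>h\<in>H. h * x \<in> dspan D {g * h | g h. g \<in> H \<and> h \<in> G}" by auto
  obtain L where L: "finite L" "1 \<in> dspan D L" "\<forall>h\<in>L. e * h \<in> dspan D L" using assms(2) dspan_step(1) unfolding integ_def by auto
  let ?P = "{g * h | g h. g \<in> L \<and> h \<in> H}"
  let ?Q = "{g * h | g h. g \<in> ?P \<and> h \<in> G}"
  have 1: "1 \<in> dspan D ?P" using dspan_mult_set[OF D L(2) H(2)] by simp
  have "l * h * (e * g + x) \<in> dspan D ?Q" if "l \<in> L" "h \<in> H" for l h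
  proof -
    have "(e * l) * h \<in> dspan D ?P" using L(3) that dspan_incl[OF D] by (intro dspan_mult_set[OF D]) auto
    hence el: "(e * l) * h * g \<in> dspan D ?Q" using dspan_mult_set[OF D _ dspan_incl[OF D dspan_step(2)]] by blast
    have "l * (h * x) \<in> dspan D {a * b | a b. a \<in> L \<and> b \<in> {g * h | g h. g \<in> H \<and> h \<in> G}}"
      using dspan_mult_set[OF D dspan_incl[OF D that(1)]] H(3) that(2) by blast
    moreover have "{a * b | a b. a \<in> L \<and> b \<in> {g * h | g h. g \<in> H \<and> h \<in> G}} \<subseteq> ?Q"
    proof
      fix z assume "z \<in> {a * b | a b. a \<in> L \<and> b \<in> {g * h | g h. g \<in> H \<and> h \<in> G}}"
      then obtain a b c where "a \<in> L" "b \<in> H" "c \<in> G" "z = a * (b * c)" by auto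
      hence "z = (a * b) * c" "a * b \<in> ?P" "c \<in> G" by (auto simp: mult.assoc)
      thus "z \<in> ?Q" by blast
    qed
    ultimately have "l * (h * x) \<in> dspan D ?Q" using dspan_mono[OF order.refl] by meson
    with el have "(e * l) * h * g + l * (h * x) \<in> dspan D ?Q" by (rule dspan_add)
    thus ?thesis by (simp add: algebra_simps)
  qed
  thus ?case using 1 finite_setmult[OF L(1) H(1)] by (intro exI[of _ ?P]) blast
qed

text \<open>The module that witnesses integrality is generated by the products
  \<open>h * x ^ i\<close> with \<open>h\<close> in \<open>H\<close> and \<open>i < n\<close>:
  multiplication by \<open>x\<close> stays inside except at \<open>i = n - 1\<close>, where
  \<open>H\<close> absorbs the coefficients of the equation.\<close>

lemma integ_trans:
  assumes D: "subr (D::'a::field set)" and "\<forall>e\<in>E. integ D e" "x ^ n \<in> dspan E ((\<lambda>i. x ^ i) ` {..<n})" shows "integ D x"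
proof (cases "n = 0")
  case True thus ?thesis using assms(3) by (simp add: dspan_empty)
next
  case False
  let ?G = "(\<lambda>i. x ^ i) ` {..<n}"
  obtain H where H: "finite H" "1 \<in> dspan D H" "\<forall>h\<in>H. h * x ^ n \<in> dspan D {g * h | g h. g \<in> H \<and> h \<in> ?G}"
    using integ_coeffs[OF assms] by blast
  let ?Q = "{g * h | g h. g \<in> H \<and> h \<in> ?G}"
  have "x ^ 0 \<in> ?G" using False by (intro imageI) auto
  hence "x ^ 0 \<in> dspan D ?G" by (rule dspan_incl[OF D])
  from dspan_mult_set[OF D H(2) this] have "1 \<in> dspan D ?Q" by simp
  moreover have "x * (h * x ^ i) \<in> dspan D ?Q" if "h \<in> H" "i < n" for h i
  proof (cases "Suc i < n")
    case True
    hence "h * x ^ (Suc i) \<in> ?Q" using that by blast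
    hence "h * x ^ (Suc i) \<in> dspan D ?Q" by (rule dspan_incl[OF D])
    thus ?thesis by (simp add: mult.left_commute)
  next
    case False
    hence "Suc i = n" using that by auto
    hence eq: "x * (h * x ^ i) = h * x ^ n" by (auto simp: mult.left_commute)
    show ?thesis unfolding eq using H(3) that(1) by (rule bspec)
  qed
  moreover have "finite ?Q" using finite_setmult[OF H(1), of ?G] by simp
  ultimately show ?thesis unfolding integ_def by (intro exI[of _ ?Q]) blast
qed

subsection \<open>Adjoining an element\<close>

definition PD :: "'a::comm_ring_1 set \<Rightarrow> 'a poly set" where
  "PD D = {p. \<forall>i. coeff p i \<in> D}"

lemma subr_PD: assumes "subr D" shows "subr (PD D)"
proof -
  have "coeff (p * q) i \<in> D" if "p \<in> PD D" "q \<in> PD D" for p q i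
    unfolding coeff_mult using that by (intro subr_sum[OF assms] subr_mult[OF assms]) (auto simp: PD_def)
  moreover have "coeff (1::'a poly) i \<in> D" for i using subr_0[OF assms] subr_1[OF assms] by (simp add: coeff_1)
  ultimately show ?thesis unfolding subr_def by (auto simp: PD_def subr_diff[OF assms])
qed

lemma PD_monom: "subr D \<Longrightarrow> c \<in> D \<Longrightarrow> monom c n \<in> PD D" unfolding PD_def by (auto simp: subr_0)

lemma PD_coeff: "p \<in> PD D \<Longrightarrow> coeff p i \<in> D" unfolding PD_def by simp

lemma PD_mono: "D \<subseteq> D' \<Longrightarrow> p \<in> PD D \<Longrightarrow> p \<in> PD D'" unfolding PD_def by blast

lemma dspan_sum: assumes "subr D" "\<And>i. i \<in> A \<Longrightarrow> f i \<in> dspan D G" shows "sum f A \<in> dspan D G"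
  using assms(2) by (induction A rule: infinite_finite_induct) (simp_all add: dspan.dspan_0 dspan_add)

lemma poly_in_dspan: assumes "subr D" "p \<in> PD D" "\<And>i. i \<le> degree p \<Longrightarrow> y ^ i \<in> dspan D G" shows "poly p y \<in> dspan D G"
  unfolding poly_altdef by (rule dspan_sum[OF assms(1)], rule dspan_smult[OF assms(1)]) (use assms in "auto simp: PD_def")

lemma adj_poly: assumes "subr D" shows "x \<in> adj D y \<longleftrightarrow> (\<exists>p\<in>PD D. x = poly p y)"
proof
  assume "x \<in> adj D y"
  thus "\<exists>p\<in>PD D. x = poly p y" unfolding adj_def
  proof (induction rule: dspan.induct)
    case dspan_0 show ?case by (rule bexI[of _ 0]) (simp_all add: PD_def subr_0[OF assms])
  next
    case (dspan_step d g x)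
    then obtain p i where p: "p \<in> PD D" "x = poly p y" "g = y ^ i" by auto
    show ?case by (rule bexI[of _ "monom d i + p"]) (use p dspan_step subr_add[OF subr_PD[OF assms] PD_monom[OF assms]] in "simp_all add: poly_monom")
  qed
next
  assume "\<exists>p\<in>PD D. x = poly p y"
  then obtain p where "p \<in> PD D" "x = poly p y" by auto
  thus "x \<in> adj D y" unfolding adj_def using poly_in_dspan[OF assms, of p y "range (\<lambda>i. y ^ i)"] dspan_incl[OF assms] by simp
qed

lemma subr_adj: assumes "subr D" shows "subr (adj D y)" unfolding subr_def
proof (intro conjI ballI)
  note P = subr_PD[OF assms]
  show "1 \<in> adj D y" unfolding adj_poly[OF assms] using subr_1[OF P] by (intro bexI[of _ 1]) auto
  fix a b assume "a \<in> adj D y" "b \<in> adj D y"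
  then obtain p q where "p \<in> PD D" "a = poly p y" "q \<in> PD D" "b = poly q y" unfolding adj_poly[OF assms] by auto
  thus "a - b \<in> adj D y" "a * b \<in> adj D y" unfolding adj_poly[OF assms]
    using subr_diff[OF P, of p q] subr_mult[OF P, of p q] poly_diff[of p q y] poly_mult[of p q y] by metis+
qed

lemma adj_base: assumes "subr D" "d \<in> D" shows "d \<in> adj D y"
proof -
  have "d = poly (monom d 0) y" by (simp add: poly_monom)
  thus ?thesis unfolding adj_poly[OF assms(1)] using PD_monom[OF assms] by blast
qed

lemma adj_gen: assumes "subr D" shows "y \<in> adj D y"
proof -
  have "y ^ 1 \<in> adj D y" unfolding adj_def by (rule dspan_incl[OF assms]) (rule rangeI)
  thus ?thesis by simp
qed

lemma adj_mono: "D \<subseteq> D' \<Longrightarrow> adj D y \<subseteq> adj D' y" unfolding adj_def using dspan_mono[of D D'] by (metis order.refl subsetI)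

lemma adj_min: assumes "subr D" "subr E" "D \<subseteq> E" "y \<in> E" shows "adj D y \<subseteq> E" unfolding adj_def
  by (rule dspan_min) (use assms subr_pow[OF assms(2,4)] in "auto simp: dmod_def intro: subr_0 subr_add subr_mult")

subsection \<open>Hilbert's basis theorem\<close>

text \<open>The leading coefficient argument, carried out in \<open>D[y]\<close> rather than in a
  polynomial ring. As \<open>y\<close> may be algebraic, elements have no degree; the filtration by
  the spans \<open>P i\<close> of the powers below \<open>i\<close> takes its place.\<close>

theorem noeth_adj: assumes D: "subr D" "noeth D" shows "noeth (adj D y)"
  unfolding noeth_def
proof (intro allI impI)
  fix E assume E: "E \<subseteq> adj D y" "dmod (adj D y) E"
  define P where "P i = dspan D ((\<lambda>j. y ^ j) ` {..<i::nat})" for i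
  have A: "subr (adj D y)" by (rule subr_adj[OF D(1)])
  have ED: "dmod D E" using dmod_mono[OF E(2)] adj_base[OF D(1)] by (metis subsetI)
  have Pm: "dmod D (P i)" for i unfolding P_def by (rule dmod_dspan[OF D(1)])
  have Pmono: "P i \<subseteq> P j" if "i \<le> j" for i j
    unfolding P_def using dspan_mono[OF order.refl, of "(\<lambda>j. y ^ j) ` {..<i}" "(\<lambda>k. y ^ k) ` {..<j}"] that
    by (metis image_mono lessThan_subset_iff subsetI)
  have Pshift: "y ^ k * z \<in> P (i + k)" if "z \<in> P i" for z i k using that unfolding P_def
  proof (rule dspan_mult_closed[OF D(1), rotated])
    show "\<forall>g\<in>(\<lambda>j. y ^ j) ` {..<i}. y ^ k * g \<in> dspan D ((\<lambda>j. y ^ j) ` {..<i + k})"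
    proof
      fix g assume "g \<in> (\<lambda>j. y ^ j) ` {..<i}"
      then obtain j where j: "j < i" "g = y ^ j" by auto
      have "y ^ (k + j) \<in> (\<lambda>j. y ^ j) ` {..<i + k}" using j by (intro imageI) auto
      from dspan_incl[OF D(1) this] show "y ^ k * g \<in> dspan D ((\<lambda>j. y ^ j) ` {..<i + k})" using j by (simp add: power_add)
    qed
  qed
  have Pin: "\<exists>i. x \<in> P i" if "x \<in> E" for x
  proof -
    have "x \<in> adj D y" using that E(1) by (rule rev_subsetD)
    then obtain p where p: "p \<in> PD D" "x = poly p y" unfolding adj_poly[OF D(1)] by auto
    have "x \<in> P (Suc (degree p))" unfolding p(2) P_def by (rule poly_in_dspan[OF D(1) p(1)], rule dspan_incl[OF D(1)]) auto
    thus ?thesis by blast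
  qed
  \<comment> \<open>The coefficients of \<open>y ^ i\<close> in elements of \<open>E\<close> that
    lie in the span of the powers up to \<open>i\<close>. Multiplication by \<open>y\<close> makes
    these ideals increase with \<open>i\<close>.\<close>
  define L where "L i = {c\<in>D. \<exists>z\<in>P i. c * y ^ i + z \<in> E}" for i
  have Lm: "dmod D (L i)" for i unfolding dmod_def
  proof (intro conjI ballI)
    have "0 * y ^ i + 0 \<in> E" "0 \<in> P i" using ED Pm[of i] unfolding dmod_def by auto
    thus "0 \<in> L i" unfolding L_def using subr_0[OF D(1)] by (auto intro: bexI[of _ 0])
    fix a b assume "a \<in> L i" "b \<in> L i"
    then obtain u v where u: "a \<in> D" "b \<in> D" "u \<in> P i" "v \<in> P i" "a * y ^ i + u \<in> E" "b * y ^ i + v \<in> E" unfolding L_def by auto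
    have "(a * y ^ i + u) + (b * y ^ i + v) \<in> E" using ED u unfolding dmod_def by auto
    hence "(a + b) * y ^ i + (u + v) \<in> E" by (simp add: algebra_simps)
    moreover have "u + v \<in> P i" using Pm[of i] u unfolding dmod_def by auto
    ultimately show "a + b \<in> L i" unfolding L_def using u subr_add[OF D(1), of a b] by (auto intro: bexI[of _ "u + v"])
  next
    fix d a assume "d \<in> D" "a \<in> L i"
    then obtain u where u: "a \<in> D" "u \<in> P i" "a * y ^ i + u \<in> E" unfolding L_def by auto
    have "d * (a * y ^ i + u) \<in> E" using ED u \<open>d \<in> D\<close> unfolding dmod_def by auto
    hence "(d * a) * y ^ i + d * u \<in> E" by (simp add: algebra_simps)
    moreover have "d * u \<in> P i" using Pm[of i] u \<open>d \<in> D\<close> unfolding dmod_def by auto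
    ultimately show "d * a \<in> L i" unfolding L_def using u \<open>d \<in> D\<close> subr_mult[OF D(1), of d a] by (auto intro: bexI[of _ "d * u"])
  qed
  have Lmono: "L i \<subseteq> L (i + k)" for i k
  proof
    fix a assume "a \<in> L i"
    then obtain u where u: "a \<in> D" "u \<in> P i" "a * y ^ i + u \<in> E" unfolding L_def by auto
    have "y ^ k \<in> adj D y" by (rule subr_pow[OF A adj_gen[OF D(1)]])
    hence "y ^ k * (a * y ^ i + u) \<in> E" using E(2) u(3) unfolding dmod_def by auto
    hence "a * y ^ (i + k) + y ^ k * u \<in> E" by (simp add: algebra_simps power_add)
    thus "a \<in> L (i + k)" unfolding L_def using u(1) Pshift[OF u(2)] by (auto intro: bexI[of _ "y ^ k * u"])
  qed
  have Lmono': "L i \<subseteq> L j" if "i \<le> j" for i j using Lmono[of i "j - i"] that by simp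
  define LL where "LL = (\<Union>i. L i)"
  have "dmod D LL" unfolding dmod_def
  proof (intro conjI ballI)
    show "0 \<in> LL" using Lm[of 0] unfolding LL_def dmod_def by auto
    fix a b assume "a \<in> LL" "b \<in> LL"
    then obtain i j where "a \<in> L i" "b \<in> L j" unfolding LL_def by auto
    hence "a \<in> L (max i j)" "b \<in> L (max i j)" using Lmono'[of i "max i j"] Lmono'[of j "max i j"] by auto
    thus "a + b \<in> LL" using Lm[of "max i j"] unfolding LL_def dmod_def by auto
  next
    fix d a assume "d \<in> D" "a \<in> LL"
    thus "d * a \<in> LL" using Lm unfolding LL_def dmod_def by (metis UN_E UN_I)
  qed
  moreover have "LL \<subseteq> D" unfolding LL_def L_def by auto
  ultimately obtain S where S: "finite S" "S \<subseteq> LL" "LL \<subseteq> dspan D S" using noethD[OF D(2), of LL] by meson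
  have "\<forall>a\<in>S. \<exists>i. a \<in> L i" using S(2) unfolding LL_def by auto
  then obtain h where h: "\<forall>a\<in>S. a \<in> L (h a)" by metis
  define N where "N = (if S = {} then 0 else Max (h ` S))"
  have SN: "S \<subseteq> L N"
  proof
    fix a assume "a \<in> S"
    hence "h a \<le> N" using S(1) unfolding N_def by auto
    thus "a \<in> L N" using h \<open>a \<in> S\<close> Lmono'[of "h a" N] by auto
  qed
  have "\<forall>a\<in>S. \<exists>e. e \<in> E \<and> e - a * y ^ N \<in> P N"
  proof
    fix a assume "a \<in> S"
    hence "a \<in> L N" using SN by (rule rev_subsetD)
    then obtain u where "u \<in> P N" "a * y ^ N + u \<in> E" unfolding L_def by auto
    thus "\<exists>e. e \<in> E \<and> e - a * y ^ N \<in> P N" by (intro exI[of _ "a * y ^ N + u"]) auto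
  qed
  then obtain e where e: "\<forall>a\<in>S. e a \<in> E \<and> e a - a * y ^ N \<in> P N" by metis
  have "E \<inter> P N \<subseteq> dspan D ((\<lambda>j. y ^ j) ` {..<N})" unfolding P_def by simp
  from fg_submodule[OF D _ this dmod_int[OF ED Pm]] obtain H where H: "finite H" "H \<subseteq> E \<inter> P N" "E \<inter> P N \<subseteq> dspan D H" by auto
  let ?G = "e ` S \<union> H"
  have DA: "D \<subseteq> adj D y" using adj_base[OF D(1)] by (rule subsetI)
  have base: "x \<in> dspan (adj D y) ?G" if "x \<in> E" "x \<in> P N" for x using dspan_mono[OF DA, of H ?G x] H(3) that by auto
  \<comment> \<open>Above level \<open>N\<close> the leading coefficient is matched by
    \<open>y ^ (i - N)\<close> times a combination of the \<open>e a\<close>, which lowers the level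
    by one; up to level \<open>N\<close> the generators \<open>H\<close> suffice.\<close>
  have step: "x \<in> dspan (adj D y) ?G" if "x \<in> E" "x \<in> P i" for x i using that
  proof (induction i arbitrary: x)
    case 0
    thus ?case using Pmono[of 0 N] base by auto
  next
    case (Suc i)
    show ?case
    proof (cases "Suc i \<le> N")
      case True thus ?thesis using Suc Pmono[of "Suc i" N] base by auto
    next
      case False
      hence iN: "N \<le> i" by simp
      have "x \<in> dspan D (insert (y ^ i) ((\<lambda>j. y ^ j) ` {..<i}))" using Suc(3) unfolding P_def by (simp add: lessThan_Suc)
      from dspan_insert[OF D(1) this] obtain c z where c: "c \<in> D" "z \<in> P i" "x = c * y ^ i + z" unfolding P_def by auto
      hence "c \<in> L i" using Suc(2) unfolding L_def by auto
      hence "c \<in> dspan D S" using S(3) unfolding LL_def by auto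
      from dspan_lift[OF D(1) this, of e "y ^ N" "(\<lambda>j. y ^ j) ` {..<N}"] e
      obtain g where g: "g \<in> dspan D (e ` S)" "g - c * y ^ N \<in> P N" unfolding P_def by auto
      have gE: "g \<in> E" using dspan_min[OF ED, of "e ` S"] e g(1) by auto
      let ?y = "y ^ (i - N)"
      have yA: "?y \<in> adj D y" by (rule subr_pow[OF A adj_gen[OF D(1)]])
      hence yg: "?y * g \<in> E" using E(2) gE unfolding dmod_def by auto
      have "?y * (g - c * y ^ N) \<in> P (N + (i - N))" by (rule Pshift[OF g(2)])
      moreover have "?y * (g - c * y ^ N) = ?y * g - c * y ^ i" using iN by (simp add: algebra_simps power_add[symmetric])
      ultimately have "?y * g - c * y ^ i \<in> P i" using iN by simp
      hence "z - (?y * g - c * y ^ i) \<in> P i" using dmod_diff[OF D(1) Pm c(2)] by simp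
      moreover have "z - (?y * g - c * y ^ i) = x - ?y * g" using c(3) by simp
      ultimately have "x - ?y * g \<in> P i" by simp
      moreover have "x - ?y * g \<in> E" by (rule dmod_diff[OF D(1) ED Suc(2) yg])
      ultimately have "x - ?y * g \<in> dspan (adj D y) ?G" using Suc.IH by simp
      moreover have "?y * g \<in> dspan (adj D y) ?G" using dspan_smult[OF A yA] dspan_mono[OF DA _ g(1), of ?G] by auto
      ultimately have "?y * g + (x - ?y * g) \<in> dspan (adj D y) ?G" using dspan_add by metis
      thus ?thesis by simp
    qed
  qed
  have "E \<subseteq> dspan (adj D y) ?G" using step Pin by (metis subsetI)
  moreover have "finite ?G" "?G \<subseteq> E" using S(1) H e by auto
  ultimately show "\<exists>G. finite G \<and> G \<subseteq> E \<and> E \<subseteq> dspan (adj D y) G" by metis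
qed

subsection \<open>Complete integral closedness of polynomial rings\<close>

definition sfield :: "'a::field set \<Rightarrow> bool" where
  "sfield F \<longleftrightarrow> subr F \<and> (\<forall>x\<in>F. inverse x \<in> F)"

lemma sfield_div: "sfield F \<Longrightarrow> x \<in> F \<Longrightarrow> y \<in> F \<Longrightarrow> x / y \<in> F"
  unfolding sfield_def divide_inverse by (auto intro: subr_mult)

lemma sfield_frac: assumes D: "subr D" shows "sfield (frac D)" unfolding sfield_def subr_def
proof (intro conjI ballI)
  show "1 \<in> frac D" unfolding frac_def using subr_1[OF D] by (intro CollectI exI[of _ 1]) auto
  fix x y assume "x \<in> frac D" "y \<in> frac D"
  then obtain a b c d where x: "x = a / b" "y = c / d" "a \<in> D" "b \<in> D" "c \<in> D" "d \<in> D" "b \<noteq> 0" "d \<noteq> 0" unfolding frac_def by auto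
  have "x - y = (a * d - c * b) / (b * d)" "x * y = (a * c) / (b * d)" using x by (auto simp: field_simps)
  moreover have "a * d - c * b \<in> D" "a * c \<in> D" "b * d \<in> D" "b * d \<noteq> 0" using x D by (auto intro!: subr_diff subr_mult)
  ultimately show "x - y \<in> frac D" "x * y \<in> frac D" unfolding frac_def by blast+
next
  fix x assume "x \<in> frac D"
  then obtain a b where x: "x = a / b" "a \<in> D" "b \<in> D" "b \<noteq> 0" unfolding frac_def by auto
  show "inverse x \<in> frac D"
  proof (cases "a = 0")
    case True hence "inverse x = a / b" using x(1) by simp
    thus ?thesis using x unfolding frac_def by blast
  next
    case False hence "inverse x = b / a" using x(1) by simp
    thus ?thesis using x False unfolding frac_def by blast
  qed
qed

lemma frac_base: "subr D \<Longrightarrow> x \<in> D \<Longrightarrow> x \<in> frac D"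
  unfolding frac_def using subr_1[of D] by (intro CollectI exI[of _ x] exI[of _ 1]) auto

lemma PD_division:
  assumes F: "sfield F" "p \<in> PD F" "p \<noteq> 0" and "q \<in> PD F"
  shows "\<exists>s r. s \<in> PD F \<and> r \<in> PD F \<and> q = s * p + r \<and> (r = 0 \<or> degree r < degree p)" using assms(4)
proof (induction "degree q" arbitrary: q rule: less_induct)
  case less
  note D = F(1)[unfolded sfield_def, THEN conjunct1]
  note P = subr_PD[OF D]
  show ?case
  proof (cases "q = 0 \<or> degree q < degree p")
    case True
    thus ?thesis using less.prems subr_0[OF P] by (intro exI[of _ 0] exI[of _ q]) auto
  next
    case False
    define m where "m = monom (lead_coeff q / lead_coeff p) (degree q - degree p)"
    have m: "m \<in> PD F" unfolding m_def by (rule PD_monom[OF D sfield_div[OF F(1)]]) (auto intro: PD_coeff less.prems F(2))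
    define q' where "q' = q - m * p"
    have q': "q' \<in> PD F" unfolding q'_def by (rule subr_diff[OF P less.prems subr_mult[OF P m F(2)]])
    have mp: "m \<noteq> 0" using False F(3) unfolding m_def by simp
    have "lead_coeff q / lead_coeff p \<noteq> 0" using False F(3) by simp
    hence "degree m = degree q - degree p" unfolding m_def by (rule degree_monom_eq)
    hence "degree (m * p) = degree q" using False F(3) mp by (simp add: degree_mult_eq)
    moreover have "lead_coeff m = lead_coeff q / lead_coeff p" unfolding m_def by (rule lead_coeff_monom)
    hence "lead_coeff (m * p) = lead_coeff q" using F(3) unfolding lead_coeff_mult by simp
    ultimately have "q' = 0 \<or> degree q' < degree q" unfolding q'_def
      using eq_zero_or_degree_less[of "q - m * p" "degree q"] degree_diff_le[of q "degree q" "m * p"] by simp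
    thus ?thesis
    proof
      assume "q' = 0"
      thus ?thesis using m subr_0[OF P] unfolding q'_def by (intro exI[of _ m] exI[of _ 0]) simp
    next
      assume "degree q' < degree q"
      from less.hyps[OF this q'] obtain s r where "s \<in> PD F" "r \<in> PD F" "q' = s * p + r" "r = 0 \<or> degree r < degree p" by metis
      thus ?thesis using m subr_add[OF P, of s m] unfolding q'_def by (intro exI[of _ "s + m"] exI[of _ r]) (auto simp: algebra_simps)
    qed
  qed
qed

definition trans_over :: "'a::comm_ring_1 set \<Rightarrow> 'a \<Rightarrow> bool" where
  "trans_over D y \<longleftrightarrow> (\<forall>p\<in>PD D. poly p y = 0 \<longrightarrow> p = 0)"

text \<open>Over a field every ideal of \<open>F[y]\<close> is principal. The multiples
  \<open>d * x ^ j\<close> generate an ideal \<open>E\<close> that is stable under \<open>x\<close>;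
  if \<open>e\<close> generates it then \<open>x * e\<close> is a multiple of \<open>e\<close>, so
  \<open>x\<close> is in \<open>F[y]\<close>.\<close>

lemma cic_adj_field:
  assumes F: "sfield F" and y: "trans_over F y" shows "cic (adj F y)" unfolding cic_def
proof (intro ballI impI)
  have D: "subr F" using F unfolding sfield_def by simp
  note P = subr_PD[OF D]
  fix x assume "\<exists>d\<in>adj F y. d \<noteq> 0 \<and> (\<forall>j. d * x ^ j \<in> adj F y)"
  then obtain d where d: "d \<in> adj F y" "d \<noteq> 0" "\<forall>j. d * x ^ j \<in> adj F y" by auto
  have A: "subr (adj F y)" by (rule subr_adj[OF D])
  define E where "E = dspan (adj F y) (range (\<lambda>j. d * x ^ j))"
  have E: "dmod (adj F y) E" unfolding E_def by (rule dmod_dspan[OF A])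
  have EA: "E \<subseteq> adj F y" unfolding E_def by (rule dspan_min[OF dmod_self[OF A]]) (use d in auto)
  have "d * x ^ 0 \<in> E" unfolding E_def by (rule dspan_incl[OF A]) (rule rangeI)
  hence dE: "d \<in> E" by simp
  have "\<exists>n p. p \<in> PD F \<and> p \<noteq> 0 \<and> poly p y \<in> E \<and> degree p = n"
  proof -
    obtain p where "p \<in> PD F" "d = poly p y" using d(1) unfolding adj_poly[OF D] by auto
    thus ?thesis using dE d(2) by (intro exI[of _ "degree p"] exI[of _ p]) auto
  qed
  from exists_least_iff[THEN iffD1, OF this] obtain n where
    n: "\<exists>p. p \<in> PD F \<and> p \<noteq> 0 \<and> poly p y \<in> E \<and> degree p = n"
       "\<forall>m<n. \<not> (\<exists>p. p \<in> PD F \<and> p \<noteq> 0 \<and> poly p y \<in> E \<and> degree p = m)" by blast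
  then obtain p where p: "p \<in> PD F" "p \<noteq> 0" "poly p y \<in> E" "degree p = n" by blast
  define e where "e = poly p y"
  have e0: "e \<noteq> 0" using y p unfolding e_def trans_over_def by auto
  have mult: "\<exists>h\<in>adj F y. z = h * e" if z: "z \<in> E" for z
  proof -
    have "z \<in> adj F y" using EA z by auto
    then obtain q where q: "q \<in> PD F" "z = poly q y" unfolding adj_poly[OF D] by auto
    from PD_division[OF F p(1,2) q(1)] obtain s r where s: "s \<in> PD F" "r \<in> PD F" "q = s * p + r" "r = 0 \<or> degree r < degree p" by auto
    have sA: "poly s y \<in> adj F y" unfolding adj_poly[OF D] using s(1) by auto
    hence "poly s y * e \<in> E" using E p(3) unfolding dmod_def e_def by auto
    hence "z - poly s y * e \<in> E" by (rule dmod_diff[OF A E z])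
    moreover have "z - poly s y * e = poly r y" using q s(3) unfolding e_def by simp
    ultimately have "poly r y \<in> E" by simp
    hence "r = 0" using n(2) s p(4) by auto
    hence "z = poly s y * e" using q s(3) unfolding e_def by simp
    thus ?thesis using sA by auto
  qed
  have "x * z \<in> E" if "z \<in> E" for z
  proof -
    have "\<forall>g\<in>range (\<lambda>j. d * x ^ j). x * g \<in> E"
    proof
      fix g assume "g \<in> range (\<lambda>j. d * x ^ j)"
      then obtain j where j: "g = d * x ^ j" by auto
      have "d * x ^ Suc j \<in> E" unfolding E_def by (rule dspan_incl[OF A]) (rule rangeI)
      thus "x * g \<in> E" unfolding j by (simp add: mult.left_commute)
    qed
    thus ?thesis using dspan_mult_closed[OF A, of "range (\<lambda>j. d * x ^ j)" x _ z] that unfolding E_def by auto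
  qed
  hence "x * e \<in> E" using p(3) unfolding e_def by auto
  from mult[OF this] obtain h where "h \<in> adj F y" "x * e = h * e" by auto
  thus "x \<in> adj F y" using e0 by auto
qed

text \<open>The field case makes \<open>x\<close> a polynomial over the fraction field. Comparing
  leading coefficients in \<open>d * x ^ j\<close>, the leading coefficient of \<open>x\<close> has
  powers with a common denominator in \<open>D\<close>, so it is in \<open>D\<close>; the leading
  term is then removed.\<close>

lemma cic_adj:
  assumes D: "subr D" "cic D" and y: "trans_over (frac D) y" shows "cic (adj D y)" unfolding cic_def
proof (intro ballI impI)
  let ?F = "frac D"
  have F: "sfield ?F" by (rule sfield_frac[OF D(1)])
  hence Fs: "subr ?F" unfolding sfield_def by simp
  have DF: "D \<subseteq> ?F" using frac_base[OF D(1)] by auto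
  note A = subr_adj[OF D(1)]
  fix x assume x: "x \<in> frac (adj D y)" "\<exists>d\<in>adj D y. d \<noteq> 0 \<and> (\<forall>j. d * x ^ j \<in> adj D y)"
  then obtain d where d: "d \<in> adj D y" "d \<noteq> 0" "\<forall>j. d * x ^ j \<in> adj D y" by auto
  have "x \<in> frac (adj ?F y)" using x(1) adj_mono[OF DF, of y] unfolding frac_def by blast
  moreover have "\<exists>d\<in>adj ?F y. d \<noteq> 0 \<and> (\<forall>j. d * x ^ j \<in> adj ?F y)" using d adj_mono[OF DF, of y] by (intro bexI[of _ d]) auto
  ultimately have "x \<in> adj ?F y" using cic_adj_field[OF F y] unfolding cic_def by auto
  then obtain p where p: "p \<in> PD ?F" "x = poly p y" unfolding adj_poly[OF Fs] by auto
  obtain q where q: "q \<in> PD D" "d = poly q y" using d(1) unfolding adj_poly[OF D(1)] by auto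
  have "p \<in> PD D" if "p \<in> PD ?F" "\<forall>j. d * (poly p y) ^ j \<in> adj D y" for p using that
  proof (induction "degree p" arbitrary: p rule: less_induct)
    case less
    note P = subr_PD[OF Fs]
    have "lead_coeff q * (lead_coeff p) ^ j \<in> D" for j
    proof -
      obtain r where r: "r \<in> PD D" "d * (poly p y) ^ j = poly r y" using less.prems(2) unfolding adj_poly[OF D(1)] by metis
      have "q * p ^ j - r \<in> PD ?F" using q(1) r(1) PD_mono[OF DF] less.prems(1) by (intro subr_diff[OF P] subr_mult[OF P] subr_pow[OF P]) auto
      moreover have "poly (q * p ^ j - r) y = 0" using r(2) q(2) by simp
      ultimately have "q * p ^ j = r" using y unfolding trans_over_def by auto
      hence "lead_coeff r = lead_coeff q * lead_coeff p ^ j" by (metis lead_coeff_mult lead_coeff_power)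
      thus ?thesis using PD_coeff[OF r(1)] by metis
    qed
    moreover have "lead_coeff q \<in> D" "lead_coeff q \<noteq> 0" using q PD_coeff[OF q(1)] d(2) by auto
    moreover have "lead_coeff p \<in> ?F" by (rule PD_coeff[OF less.prems(1)])
    ultimately have lc: "lead_coeff p \<in> D" using D(2) unfolding cic_def by blast
    define m where "m = monom (lead_coeff p) (degree p)"
    have m: "m \<in> PD D" unfolding m_def by (rule PD_monom[OF D(1) lc])
    show ?case
    proof (cases "degree p = 0")
      case True
      hence "p = m" unfolding m_def using degree_0_id[of p] by (simp add: monom_0)
      thus ?thesis using m by simp
    next
      case False
      define p' where "p' = p - m"
      have "p' = 0 \<or> degree p' < degree p" unfolding p'_def by (rule eq_zero_or_degree_less, rule degree_diff_le) (simp_all add: m_def degree_monom_le)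
      hence "degree p' < degree p" using False by auto
      moreover have "p' \<in> PD ?F" unfolding p'_def using less.prems(1) m PD_mono[OF DF] by (intro subr_diff[OF P]) auto
      \<comment> \<open>By the binomial theorem \<open>d\<close> remains a common denominator after
        the removal of a term with coefficient in \<open>D\<close>, so the induction hypothesis
        applies to \<open>p'\<close>.\<close>
      moreover have "d * (poly p' y) ^ j \<in> adj D y" for j
      proof -
        have mA: "poly m y \<in> adj D y" using m unfolding adj_poly[OF D(1)] by auto
        have "d * (poly p' y) ^ j = d * (poly p y + (- poly m y)) ^ j" unfolding p'_def by simp
        also have "\<dots> = (\<Sum>k\<le>j. of_nat (j choose k) * (d * poly p y ^ k) * (- poly m y) ^ (j - k))"
          unfolding binomial_ring sum_distrib_left by (intro sum.cong) (auto simp: mult_ac)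
        also have "\<dots> \<in> adj D y"
        proof (rule subr_sum[OF A])
          fix k
          have "of_nat (j choose k) * (d * poly p y ^ k) \<in> adj D y" by (rule subr_mult[OF A subr_of_nat[OF A]]) (use less.prems(2) in blast)
          thus "of_nat (j choose k) * (d * poly p y ^ k) * (- poly m y) ^ (j - k) \<in> adj D y" by (rule subr_mult[OF A _ subr_pow[OF A subr_minus[OF A mA]]])
        qed
        finally show ?thesis .
      qed
      ultimately have "p' \<in> PD D" using less.hyps by auto
      hence "p' + m \<in> PD D" using m by (rule subr_add[OF subr_PD[OF D(1)]])
      thus ?thesis unfolding p'_def by simp
    qed
  qed
  hence "p \<in> PD D" using p d(3) by auto
  thus "x \<in> adj D y" unfolding adj_poly[OF D(1)] using p(2) by auto
qed

subsection \<open>Noether normalization\<close>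

fun gen :: "'a::comm_ring_1 set \<Rightarrow> 'a list \<Rightarrow> 'a set" where
  "gen k [] = k"
| "gen k (s # ss) = adj (gen k ss) s"

fun mon :: "'a::comm_ring_1 list \<Rightarrow> nat list \<Rightarrow> 'a" where
  "mon (s # ss) (a # as) = s ^ a * mon ss as"
| "mon _ _ = 1"

definition indep :: "'a::comm_ring_1 set \<Rightarrow> 'a list \<Rightarrow> bool" where
  "indep k ss \<longleftrightarrow> (\<forall>A c. finite A \<longrightarrow> A \<subseteq> {as. length as = length ss} \<longrightarrow> (\<forall>l\<in>A. c l \<in> k) \<longrightarrow>
     (\<Sum>l\<in>A. c l * mon ss l) = 0 \<longrightarrow> (\<forall>l\<in>A. c l = 0))"

lemma subr_gen: "subr k \<Longrightarrow> subr (gen k ss)" by (induction ss) (auto intro: subr_adj)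

lemma gen_base: "subr k \<Longrightarrow> x \<in> k \<Longrightarrow> x \<in> gen k ss" by (induction ss) (auto intro: adj_base subr_gen)

lemma gen_mem: "subr k \<Longrightarrow> s \<in> set ss \<Longrightarrow> s \<in> gen k ss" by (induction ss) (auto intro: adj_base adj_gen subr_gen)

lemma gen_min: assumes "subr k" "subr E" "k \<subseteq> E" shows "set ss \<subseteq> E \<Longrightarrow> gen k ss \<subseteq> E"
proof (induction ss)
  case (Cons s ss)
  thus ?case using adj_min[OF subr_gen[OF assms(1)] assms(2), of ss s] by simp
qed (use assms in simp)

lemma gen_expand: assumes "subr k"
  shows "x \<in> gen k ss \<Longrightarrow> \<exists>A c. finite A \<and> A \<subseteq> {as. length as = length ss} \<and> (\<forall>l\<in>A. c l \<in> k) \<and>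
    x = (\<Sum>l\<in>A. c l * mon ss l)"
proof -
  let ?L = "{as :: nat list. length as = length ss}"
  have 1: "gen k ss \<subseteq> dspan k (mon ss ` {as. length as = length ss})"
  proof (induction ss)
    case Nil
    have "x \<in> dspan k {1}" if "x \<in> k" for x using dspan.dspan_step[OF that, of 1 "{1}" 0] dspan.dspan_0[of k "{1}"] by simp
    moreover have "mon [] ` {as :: nat list. length as = length ([]::'a list)} = {1::'a}" by auto
    ultimately show ?case by (metis gen.simps(1) subsetI)
  next
    case (Cons s ss)
    let ?M = "mon (s # ss) ` {as. length as = length (s # ss)}"
    have M: "s ^ i * g \<in> ?M" if g: "g \<in> mon ss ` {as. length as = length ss}" for g i
    proof -
      obtain as where "length as = length ss" "g = mon ss as" using g by auto
      hence "s ^ i * g = mon (s # ss) (i # as)" "i # as \<in> {as. length as = length (s # ss)}" by auto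
      thus ?thesis by (metis imageI)
    qed
    have "x \<in> dspan k ?M" if "x \<in> gen k (s # ss)" for x using that unfolding gen.simps adj_def
    proof (induction rule: dspan.induct)
      case (dspan_step d g x)
      obtain i where i: "g = s ^ i" using dspan_step(2) by auto
      have "d \<in> dspan k (mon ss ` {as. length as = length ss})" using dspan_step(1) Cons.IH by (rule rev_subsetD)
      moreover have "\<forall>h\<in>mon ss ` {as. length as = length ss}. g * h \<in> dspan k ?M" unfolding i by (intro ballI dspan_incl[OF assms] M)
      ultimately have "g * d \<in> dspan k ?M" by (intro dspan_mult_closed[OF assms])
      thus ?case using dspan_add[OF _ dspan_step(4)] by (simp add: mult.commute)
    qed (simp add: dspan.dspan_0)
    thus ?case by (rule subsetI)
  qed
  assume "x \<in> gen k ss"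
  hence "x \<in> dspan k (mon ss ` ?L)" using 1 by (rule rev_subsetD)
  thus ?thesis
  proof (induction rule: dspan.induct)
    case dspan_0 show ?case by (rule exI[of _ "{}"]) simp
  next
    case (dspan_step d g x)
    then obtain A c where A: "finite A" "A \<subseteq> ?L" "\<forall>l\<in>A. c l \<in> k" "x = (\<Sum>l\<in>A. c l * mon ss l)" by auto
    obtain l' where b: "l' \<in> ?L" "g = mon ss l'" using dspan_step(2) by auto
    define c' where "c' = c(l' := (if l' \<in> A then c l' else 0) + d)"
    have "(\<Sum>l\<in>insert l' A. c' l * mon ss l) = c' l' * mon ss l' + (\<Sum>l\<in>A - {l'}. c' l * mon ss l)" using A(1) by (simp add: sum.insert_remove)
    also have "(\<Sum>l\<in>A - {l'}. c' l * mon ss l) = (\<Sum>l\<in>A - {l'}. c l * mon ss l)" by (rule sum.cong) (auto simp: c'_def)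
    also have "c' l' * mon ss l' = d * mon ss l' + (if l' \<in> A then c l' else 0) * mon ss l'" unfolding c'_def by (simp add: algebra_simps)
    finally have "(\<Sum>l\<in>insert l' A. c' l * mon ss l) =
      d * mon ss l' + ((if l' \<in> A then c l' else 0) * mon ss l' + (\<Sum>l\<in>A - {l'}. c l * mon ss l))" by (simp add: add.assoc)
    also have "(if l' \<in> A then c l' else 0) * mon ss l' + (\<Sum>l\<in>A - {l'}. c l * mon ss l) = x"
      using A(1,4) by (cases "l' \<in> A") (auto simp: sum.remove)
    finally have "d * g + x = (\<Sum>l\<in>insert l' A. c' l * mon ss l)" using b by simp
    moreover have "\<forall>l\<in>insert l' A. c' l \<in> k" using A(3) dspan_step(1) subr_add[OF assms] subr_0[OF assms] unfolding c'_def by auto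
    ultimately show ?case using A(1,2) b(1) by (intro exI[of _ "insert l' A"] exI[of _ c']) auto
  qed
qed

lemma indepD: "indep k ss \<Longrightarrow> finite A \<Longrightarrow> A \<subseteq> {as. length as = length ss} \<Longrightarrow> \<forall>l\<in>A. c l \<in> k \<Longrightarrow>
    (\<Sum>l\<in>A. c l * mon ss l) = 0 \<Longrightarrow> \<forall>l\<in>A. c l = 0" unfolding indep_def by simp

lemma indep_tail: assumes "indep k (s # ss)" shows "indep k ss" unfolding indep_def
proof (intro allI impI)
  fix A c assume A: "finite A" "A \<subseteq> {as. length as = length ss}" "\<forall>l\<in>A. c l \<in> k" "(\<Sum>l\<in>A. c l * mon ss l) = 0"
  have "(\<Sum>l'\<in>(#) 0 ` A. c (tl l') * mon (s # ss) l') = (\<Sum>l\<in>A. c l * mon ss l)" by (subst sum.reindex) (auto simp: inj_on_def)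
  hence "(\<Sum>l'\<in>(#) 0 ` A. c (tl l') * mon (s # ss) l') = 0" using A(4) by simp
  hence "\<forall>l'\<in>(#) 0 ` A. c (tl l') = 0" by (intro indepD[OF assms, of "(#) 0 ` A" "\<lambda>l'. c (tl l')"]) (use A in auto)
  thus "\<forall>l\<in>A. c l = 0" by auto
qed

text \<open>A relation for \<open>s\<close> over \<open>k[ss]\<close> becomes a relation between
  monomials in \<open>s # ss\<close> once its coefficients are expanded; the exponents
  \<open>i # l\<close> are distinct for distinct pairs.\<close>

lemma indep_trans: assumes k: "subr k" and "indep k (s # ss)" shows "trans_over (gen k ss) s" unfolding trans_over_def
proof (intro ballI impI)
  fix p assume p: "p \<in> PD (gen k ss)" "poly p s = 0"
  have "\<forall>i. \<exists>A c. finite A \<and> A \<subseteq> {as. length as = length ss} \<and> (\<forall>l\<in>A. c l \<in> k) \<and>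
    coeff p i = (\<Sum>l\<in>A. c l * mon ss l)" using gen_expand[OF k PD_coeff[OF p(1)]] by (rule allI)
  from choice[OF this] obtain A where "\<forall>i. \<exists>c. finite (A i) \<and> A i \<subseteq> {as. length as = length ss} \<and>
    (\<forall>l\<in>A i. c l \<in> k) \<and> coeff p i = (\<Sum>l\<in>A i. c l * mon ss l)" by (elim exE)
  from choice[OF this] obtain c where Ac: "\<forall>i. finite (A i) \<and> A i \<subseteq> {as. length as = length ss} \<and>
    (\<forall>l\<in>A i. c i l \<in> k) \<and> coeff p i = (\<Sum>l\<in>A i. c i l * mon ss l)" by (elim exE)
  have A: "\<And>i. finite (A i)" "\<And>i. A i \<subseteq> {as. length as = length ss}"
     "\<And>i. \<forall>l\<in>A i. c i l \<in> k" "\<And>i. coeff p i = (\<Sum>l\<in>A i. c i l * mon ss l)" using Ac by simp_all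
  define B where "B = (\<lambda>(i, l). i # l) ` (SIGMA i:{..degree p}. A i)"
  have "(\<Sum>l'\<in>B. c (hd l') (tl l') * mon (s # ss) l') =
      (\<Sum>(i, l)\<in>(SIGMA i:{..degree p}. A i). c i l * (s ^ i * mon ss l))" unfolding B_def by (subst sum.reindex) (auto simp: inj_on_def intro!: sum.cong)
  also have "\<dots> = (\<Sum>i\<le>degree p. \<Sum>l\<in>A i. c i l * (s ^ i * mon ss l))" using A(1) by (intro sum.Sigma[symmetric]) auto
  also have "\<dots> = poly p s" unfolding poly_altdef A(4) sum_distrib_right by (intro sum.cong) (auto simp: mult_ac)
  finally have "(\<Sum>l'\<in>B. c (hd l') (tl l') * mon (s # ss) l') = 0" using p(2) by simp
  moreover have "finite B" unfolding B_def using A(1) by auto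
  moreover have "B \<subseteq> {as. length as = length (s # ss)}"
  proof
    fix l' assume "l' \<in> B"
    then obtain i l where "l \<in> A i" "l' = i # l" unfolding B_def by auto
    thus "l' \<in> {as. length as = length (s # ss)}" using A(2)[of i] by auto
  qed
  moreover have "\<forall>l'\<in>B. c (hd l') (tl l') \<in> k" unfolding B_def using A(3) by auto
  ultimately have B0: "\<forall>l'\<in>B. c (hd l') (tl l') = 0" by (intro indepD[OF assms(2), of B "\<lambda>l'. c (hd l') (tl l')"])
  have "coeff p i = 0" if i: "i \<le> degree p" for i
  proof -
    have "c i l = 0" if "l \<in> A i" for l
    proof -
      have "i # l \<in> B" unfolding B_def using i that by (intro image_eqI[of _ _ "(i, l)"]) auto
      thus ?thesis using B0 by force
    qed
    thus ?thesis unfolding A(4) by simp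
  qed
  hence "lead_coeff p = 0" by simp
  thus "p = 0" by simp
qed

lemma common_denom: assumes D: "subr D" and "\<forall>i\<le>(n::nat). f i \<in> frac D"
  shows "\<exists>d\<in>D. d \<noteq> 0 \<and> (\<forall>i\<le>n. d * f i \<in> D)" using assms(2)
proof (induction n)
  case 0
  hence "f 0 \<in> frac D" by simp
  then obtain a b where "a \<in> D" "b \<in> D" "b \<noteq> 0" "f 0 = a / b" unfolding frac_def by auto
  thus ?case by (intro bexI[of _ b]) auto
next
  case (Suc n)
  then obtain d where d: "d \<in> D" "d \<noteq> 0" "\<forall>i\<le>n. d * f i \<in> D" by auto
  have "f (Suc n) \<in> frac D" using Suc by simp
  then obtain a b where b: "a \<in> D" "b \<in> D" "b \<noteq> 0" "f (Suc n) = a / b" unfolding frac_def by auto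
  have "(b * d) * f i \<in> D" if "i \<le> Suc n" for i
  proof (cases "i = Suc n")
    case True
    hence "(b * d) * f i = d * a" using b by simp
    thus ?thesis using subr_mult[OF D d(1) b(1)] by (simp only:)
  next
    case False
    hence "d * f i \<in> D" using d that by auto
    thus ?thesis using subr_mult[OF D b(2)] by (simp add: mult.assoc)
  qed
  thus ?case using b d subr_mult[OF D b(2) d(1)] by (intro bexI[of _ "b * d"]) auto
qed

lemma trans_over_frac: assumes D: "subr D" and "trans_over D y" shows "trans_over (frac D) y" unfolding trans_over_def
proof (intro ballI impI)
  fix p assume p: "p \<in> PD (frac D)" "poly p y = 0"
  obtain d where d: "d \<in> D" "d \<noteq> 0" "\<forall>i\<le>degree p. d * coeff p i \<in> D"
    using common_denom[OF D, of "degree p" "coeff p"] PD_coeff[OF p(1)] by auto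
  have "coeff (smult d p) i \<in> D" for i using d subr_0[OF D] by (cases "i \<le> degree p") (auto simp: coeff_eq_0)
  hence "smult d p \<in> PD D" unfolding PD_def by simp
  moreover have "poly (smult d p) y = 0" using p by simp
  ultimately have "smult d p = 0" using assms(2) unfolding trans_over_def by blast
  thus "p = 0" using d(2) by simp
qed

lemma good_adj: assumes "good D" "trans_over D y" shows "good (adj D y)" using assms noeth_adj subr_adj cic_adj trans_over_frac unfolding good_def by blast

lemma good_sfield: assumes k: "sfield k" shows "good k" unfolding good_def
proof (intro conjI)
  show s: "subr k" using k unfolding sfield_def by simp
  show "noeth k" unfolding noeth_def
  proof (intro allI impI)
    fix E assume E: "E \<subseteq> k" "dmod k E"
    show "\<exists>G. finite G \<and> G \<subseteq> E \<and> E \<subseteq> dspan k G"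
    proof (cases "E \<subseteq> {0}")
      case True thus ?thesis by (intro exI[of _ "{}"]) (auto simp: dspan_empty)
    next
      case False
      then obtain e where e: "e \<in> E" "e \<noteq> 0" by auto
      have "x \<in> dspan k {e}" if "x \<in> E" for x
      proof -
        have "x / e \<in> k" using sfield_div[OF k] e that E by auto
        thus ?thesis using dspan.dspan_step[of "x / e" k e "{e}" 0] dspan.dspan_0[of k "{e}"] e by simp
      qed
      thus ?thesis using e by (intro exI[of _ "{e}"]) auto
    qed
  qed
  show "cic k" unfolding cic_def frac_def using sfield_div[OF k] by auto
qed

lemma good_gen: "sfield k \<Longrightarrow> indep k ss \<Longrightarrow> good (gen k ss)"
proof (induction ss)
  case Nil thus ?case by (simp add: good_sfield)
next
  case (Cons s ss)
  have "subr k" using Cons.prems(1) unfolding sfield_def by simp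
  thus ?case using Cons.IH[OF Cons.prems(1) indep_tail[OF Cons.prems(2)]] good_adj indep_trans[OF _ Cons.prems(2)] by simp
qed

text \<open>The number with digits \<open>as\<close> in base \<open>N\<close>. It is the degree in
  \<open>t\<close> of a monomial after the substitution of Nagata, which adds to the variables the
  powers \<open>t ^ N\<close>, \<open>t ^ (N * N)\<close> and so on. Distinct exponents with entries
  below \<open>N\<close> have distinct degrees.\<close>

fun wgt :: "nat \<Rightarrow> nat list \<Rightarrow> nat" where
  "wgt N [] = 0"
| "wgt N (a # as) = a + N * wgt N as"

lemma wgt_inj: "length as = length bs \<Longrightarrow> \<forall>a\<in>set as. a < N \<Longrightarrow> \<forall>b\<in>set bs. b < N \<Longrightarrow> wgt N as = wgt N bs \<Longrightarrow> as = bs"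
proof (induction as bs rule: list_induct2)
  case (Cons a as b bs)
  have "a mod N = a" "b mod N = b" using Cons.prems by auto
  moreover have "(a + N * wgt N as) mod N = a mod N" "(b + N * wgt N bs) mod N = b mod N" by auto
  ultimately have "a = b" using Cons.prems(3) by (metis wgt.simps(2))
  moreover have "wgt N as = wgt N bs" using Cons.prems \<open>a = b\<close> by auto
  ultimately show ?case using Cons by auto
qed simp

fun shift :: "'a::comm_ring_1 \<Rightarrow> nat \<Rightarrow> nat \<Rightarrow> 'a list \<Rightarrow> 'a list" where
  "shift t N M [] = []"
| "shift t N M (u # us) = (u - t ^ M) # shift t N (N * M) us"

lemma length_shift [simp]: "length (shift t N M us) = length us" by (induction us arbitrary: M) auto

context
  fixes E :: "'a::comm_ring_1 set" and t :: 'a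
  assumes E: "subr E"
begin

definition below :: "nat \<Rightarrow> 'a set" where
  "below m = dspan E ((\<lambda>i. t ^ i) ` {..<m})"

text \<open>\<open>x\<close> is monic of degree \<open>m\<close> in \<open>t\<close> over
  \<open>E\<close>, up to lower powers. As \<open>t\<close> will turn out to be integral over
  \<open>E\<close>, this is a relation and not a degree.\<close>

definition leads :: "nat \<Rightarrow> 'a \<Rightarrow> bool" where
  "leads m x \<longleftrightarrow> x - t ^ m \<in> below m"

lemma below_mult: assumes "x \<in> below m" "y \<in> below n" shows "x * y \<in> below (m + n)"
proof -
  have "x * y \<in> dspan E {g * h | g h. g \<in> (\<lambda>i. t ^ i) ` {..<m} \<and> h \<in> (\<lambda>i. t ^ i) ` {..<n}}"
    by (rule dspan_mult_set[OF E assms[unfolded below_def]])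
  moreover have "{g * h | g h. g \<in> (\<lambda>i. t ^ i) ` {..<m} \<and> h \<in> (\<lambda>i. t ^ i) ` {..<n}} \<subseteq> (\<lambda>i. t ^ i) ` {..<m + n}"
  proof
    fix z assume "z \<in> {g * h | g h. g \<in> (\<lambda>i. t ^ i) ` {..<m} \<and> h \<in> (\<lambda>i. t ^ i) ` {..<n}}"
    then obtain i j where "i < m" "j < n" "z = t ^ i * t ^ j" by auto
    thus "z \<in> (\<lambda>i. t ^ i) ` {..<m + n}" by (intro image_eqI[of _ _ "i + j"]) (auto simp: power_add)
  qed
  ultimately show ?thesis unfolding below_def by (rule dspan_mono[OF order.refl, rotated])
qed

lemma below_pow: assumes "y \<in> below n" shows "t ^ m * y \<in> below (m + n)"
proof -
  have "\<forall>g\<in>(\<lambda>i. t ^ i) ` {..<n}. t ^ m * g \<in> below (m + n)"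
  proof
    fix g assume "g \<in> (\<lambda>i. t ^ i) ` {..<n}"
    then obtain i where "i < n" "g = t ^ i" by auto
    hence "t ^ m * g \<in> (\<lambda>i. t ^ i) ` {..<m + n}" by (intro image_eqI[of _ _ "m + i"]) (auto simp: power_add)
    thus "t ^ m * g \<in> below (m + n)" unfolding below_def by (rule dspan_incl[OF E])
  qed
  thus ?thesis using assms unfolding below_def by (rule dspan_mult_closed[OF E])
qed

lemma leads_mult: assumes "leads m x" "leads n y" shows "leads (m + n) (x * y)"
proof -
  let ?u = "x - t ^ m" and ?v = "y - t ^ n"
  have u: "?u \<in> below m" "?v \<in> below n" using assms unfolding leads_def by auto
  have "x * y - t ^ (m + n) = ?u * ?v + t ^ m * ?v + t ^ n * ?u" by (simp add: algebra_simps power_add)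
  moreover have "?u * ?v \<in> below (m + n)" "t ^ m * ?v \<in> below (m + n)" "t ^ n * ?u \<in> below (m + n)"
    using below_mult[OF u] below_pow[OF u(2), of m] below_pow[OF u(1), of n] by (auto simp: add.commute)
  ultimately show ?thesis unfolding leads_def below_def by (simp only: dspan_add)
qed

lemma leads_1: "leads 0 1" unfolding leads_def below_def by (simp add: dspan.dspan_0)

lemma leads_t: "leads m (t ^ m)" unfolding leads_def below_def by (simp add: dspan.dspan_0)

lemma leads_pow: "leads m x \<Longrightarrow> leads (a * m) (x ^ a)" by (induction a) (auto intro: leads_1 leads_mult)

text \<open>\<open>M\<close> is the power of \<open>t\<close> attached to the first variable of the
  list; it is multiplied by \<open>N\<close> along the list, which produces the positional
  weight.\<close>

lemma leads_mono: "length as = length us \<Longrightarrow> M > 0 \<Longrightarrow> N > 0 \<Longrightarrow> set (shift t N M us) \<subseteq> E \<Longrightarrow> leads (M * wgt N as) (mon us as)"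
proof (induction as us arbitrary: M rule: list_induct2)
  case Nil thus ?case by (simp add: leads_1)
next
  case (Cons a as u us)
  have "u - t ^ M \<in> E" using Cons.prems by simp
  moreover have "t ^ 0 \<in> below M" unfolding below_def by (rule dspan_incl[OF E]) (use Cons.prems in blast)
  ultimately have "(u - t ^ M) * t ^ 0 \<in> below M" unfolding below_def by (intro dspan_smult[OF E])
  hence "leads M u" unfolding leads_def by simp
  hence 1: "leads (a * M) (u ^ a)" by (rule leads_pow)
  have 2: "leads (N * M * wgt N as) (mon us as)" by (rule Cons.IH) (use Cons.prems in auto)
  have "a * M + N * M * wgt N as = M * wgt N (a # as)" by (simp add: algebra_simps)
  thus ?case using leads_mult[OF 1 2] by simp
qed

lemma below_mono: "m \<le> n \<Longrightarrow> x \<in> below m \<Longrightarrow> x \<in> below n"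
  unfolding below_def by (rule dspan_mono[OF order.refl, of "(\<lambda>i. t ^ i) ` {..<m}" "(\<lambda>i. t ^ i) ` {..<n}"]) auto

lemma leads_below: "leads m x \<Longrightarrow> m < n \<Longrightarrow> x \<in> below n"
proof -
  assume a: "leads m x" "m < n"
  have "x - t ^ m \<in> below n" using a unfolding leads_def by (intro below_mono[of m n]) auto
  moreover have "t ^ m \<in> below n" unfolding below_def by (rule dspan_incl[OF E]) (use a in auto)
  ultimately have "(x - t ^ m) + t ^ m \<in> below n" unfolding below_def by (rule dspan_add)
  thus ?thesis by simp
qed

end

lemma shift_recover: "set (shift t N M us) \<subseteq> S \<Longrightarrow> t \<in> S \<Longrightarrow> subr S \<Longrightarrow> set us \<subseteq> S"
proof (induction us arbitrary: M)
  case (Cons u us)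
  have "(u - t ^ M) + t ^ M \<in> S" using Cons.prems by (intro subr_add subr_pow) auto
  thus ?case using Cons by auto
qed simp

lemma shift_mem: "set us \<subseteq> S \<Longrightarrow> t \<in> S \<Longrightarrow> subr S \<Longrightarrow> set (shift t N M us) \<subseteq> S"
  by (induction us arbitrary: M) (auto intro: subr_diff subr_pow)

text \<open>Given a nontrivial relation, subtracting suitable powers of the first generator
  \<open>t\<close> from the others makes \<open>t\<close> integral over the algebra of the new
  elements, which has one generator fewer. Without a relation the algebra is a polynomial ring and
  is its own normalization.\<close>

theorem noether_normalization:
  fixes k :: "'a::field set"
  assumes k: "sfield k" shows "\<exists>D. good D \<and> k \<subseteq> D \<and> D \<subseteq> gen k ss \<and> (\<forall>x\<in>gen k ss. integ D x)"
proof (induction "length ss" arbitrary: ss rule: less_induct)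
  case less
  have ks: "subr k" using k unfolding sfield_def by simp
  show ?case
  proof (cases "indep k ss")
    case True
    thus ?thesis using good_gen[OF k True] gen_base[OF ks] integ_mem[OF subr_gen[OF ks]] by (intro exI[of _ "gen k ss"]) auto
  next
    case False
    hence "\<exists>A c. finite A \<and> A \<subseteq> {as. length as = length ss} \<and> (\<forall>l\<in>A. c l \<in> k) \<and>
      (\<Sum>l\<in>A. c l * mon ss l) = 0 \<and> \<not> (\<forall>l\<in>A. c l = 0)" unfolding indep_def by (simp only: not_all not_imp)
    then obtain A c where A: "finite A" "A \<subseteq> {as. length as = length ss}" "\<forall>l\<in>A. c l \<in> k"
      "(\<Sum>l\<in>A. c l * mon ss l) = 0" "\<not> (\<forall>l\<in>A. c l = 0)" by (elim exE conjE)
    define A' where "A' = {l\<in>A. c l \<noteq> 0}"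
    have A': "finite A'" "A' \<noteq> {}" using A unfolding A'_def by auto
    have "(\<Sum>l\<in>A'. c l * mon ss l) = (\<Sum>l\<in>A. c l * mon ss l)" by (rule sum.mono_neutral_left) (auto simp: A'_def A(1))
    hence S0: "(\<Sum>l\<in>A'. c l * mon ss l) = 0" using A(4) by simp
    have "ss \<noteq> []"
    proof
      assume "ss = []"
      hence "A' \<subseteq> {[]}" using A(2) unfolding A'_def by auto
      hence "A' = {[]}" using A'(2) by auto
      thus False using S0 unfolding A'_def by auto
    qed
    then obtain t us where ss: "ss = t # us" by (cases ss) auto
    \<comment> \<open>Larger than every exponent in the relation, so that the monomials in it have
      distinct weights.\<close>
    define N where "N = Suc (Max (\<Union>l\<in>A'. insert 0 (set l)))"
    have N: "a < N" if "l \<in> A'" "a \<in> set l" for l a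
    proof -
      have "a \<le> Max (\<Union>l\<in>A'. insert 0 (set l))" using that A'(1) by (intro Max_ge) auto
      thus ?thesis unfolding N_def by simp
    qed
    have N0: "N > 0" unfolding N_def by simp
    define us' where "us' = shift t N N us"
    define E where "E = gen k us'"
    have E: "subr E" unfolding E_def by (rule subr_gen[OF ks])
    have usE: "set us' \<subseteq> E" unfolding E_def using gen_mem[OF ks] by auto
    have kE: "k \<subseteq> E" unfolding E_def using gen_base[OF ks] by auto
    note Lm = leads_mono[OF E] and Lt = leads_t[OF E]
    have lead: "leads E t (wgt N l) (mon ss l)" if "l \<in> A'" for l
    proof -
      have "length l = Suc (length us)" using that A(2) ss unfolding A'_def by auto
      then obtain a as where al: "l = a # as" "length as = length us" by (cases l) auto
      have "leads E t (N * wgt N as) (mon us as)" using Lm[OF al(2) N0 N0] usE unfolding us'_def by blast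
      from leads_mult[OF E Lt[of t a] this] show ?thesis unfolding ss al(1) by simp
    qed
    have "Max (wgt N ` A') \<in> wgt N ` A'" using A' by (intro Max_in) auto
    then obtain l' where b: "l' \<in> A'" "Max (wgt N ` A') = wgt N l'" by auto
    hence b: "l' \<in> A'" "\<forall>l\<in>A'. wgt N l \<le> wgt N l'" using A'(1) Max_ge[of "wgt N ` A'"] by (simp, metis finite_imageI imageI)
    let ?W = "wgt N l'"
    have rest: "c l * mon ss l \<in> below E t ?W" if "l \<in> A' - {l'}" for l
    proof -
      have "length l = length l'" using that b(1) subsetD[OF A(2), of l] subsetD[OF A(2), of l'] unfolding A'_def by simp
      hence "wgt N l \<noteq> ?W" using wgt_inj[of l l' N] that b(1) N by auto
      hence "wgt N l < ?W" using b(2) that by (meson DiffD1 le_neq_implies_less)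
      hence "mon ss l \<in> below E t ?W" using leads_below[OF E lead] that by blast
      moreover have "c l \<in> E" using that A(3) kE unfolding A'_def by auto
      ultimately show ?thesis unfolding below_def[OF E] by (intro dspan_smult[OF E])
    qed
    have "(\<Sum>l\<in>A' - {l'}. c l * mon ss l) \<in> below E t ?W" using rest unfolding below_def[OF E] by (rule dspan_sum[OF E])
    moreover have cb: "c l' * mon ss l' = - (\<Sum>l\<in>A' - {l'}. c l * mon ss l)"
      using S0 sum.remove[OF A'(1) b(1), of "\<lambda>l. c l * mon ss l"] by (simp add: eq_neg_iff_add_eq_0)
    ultimately have "(- inverse (c l')) * (\<Sum>l\<in>A' - {l'}. c l * mon ss l) \<in> below E t ?W"
      unfolding below_def[OF E] using b(1) A(3) k kE unfolding A'_def sfield_def by (intro dspan_smult[OF E] subr_minus[OF E]) auto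
    moreover have "(- inverse (c l')) * (\<Sum>l\<in>A' - {l'}. c l * mon ss l) = mon ss l'" using cb b(1) unfolding A'_def by (simp add: field_simps)
    ultimately have "mon ss l' \<in> below E t ?W" by simp
    moreover have "mon ss l' - t ^ ?W \<in> below E t ?W" using lead[OF b(1)] unfolding leads_def[OF E] .
    ultimately have "mon ss l' - (mon ss l' - t ^ ?W) \<in> below E t ?W" unfolding below_def[OF E] by (rule dmod_diff[OF E dmod_dspan[OF E]])
    \<comment> \<open>The monomial of largest weight equals \<open>t ^ ?W\<close> up to lower
      powers; by the relation, divided by its coefficient, it also equals a combination of lower
      powers. The difference is a monic equation for \<open>t\<close>.\<close>
    hence tW: "t ^ ?W \<in> dspan E ((\<lambda>i. t ^ i) ` {..<?W})" unfolding below_def[OF E] by simp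
    have "length us' < length ss" unfolding us'_def ss by simp
    from less.hyps[OF this] obtain D where D: "good D" "k \<subseteq> D" "D \<subseteq> E" "\<forall>x\<in>E. integ D x" unfolding E_def by blast
    have Ds: "subr D" using D(1) unfolding good_def by simp
    let ?O = "{x. integ D x}"
    have O: "subr ?O" by (rule subr_integ[OF Ds])
    have tO: "t \<in> ?O" using integ_trans[OF Ds D(4) tW] by simp
    have "set us \<subseteq> ?O" using shift_recover[of t N N us ?O] usE D(4) tO O unfolding us'_def by auto
    hence "gen k ss \<subseteq> ?O" using tO D(2) integ_mem[OF Ds] unfolding ss by (intro gen_min[OF ks O]) auto
    moreover have "E \<subseteq> gen k ss" unfolding E_def us'_def
    proof (rule gen_min[OF ks subr_gen[OF ks]])
      show "k \<subseteq> gen k ss" using gen_base[OF ks] by (rule subsetI)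
      have "set us \<subseteq> gen k ss" "t \<in> gen k ss" using gen_mem[OF ks, of _ ss] ss by (simp_all add: subset_iff del: gen.simps)
      thus "set (shift t N N us) \<subseteq> gen k ss" by (rule shift_mem[OF _ _ subr_gen[OF ks]])
    qed
    ultimately show ?thesis using D by (intro exI[of _ D]) auto
  qed
qed

subsection \<open>Integral closure in a finite separable extension\<close>

definition minp :: "'a::field set \<Rightarrow> 'a \<Rightarrow> 'a poly \<Rightarrow> bool" where
  "minp F x g \<longleftrightarrow> g \<in> PD F \<and> lead_coeff g = 1 \<and> poly g x = 0 \<and>
     (\<forall>q\<in>PD F. q \<noteq> 0 \<longrightarrow> poly q x = 0 \<longrightarrow> degree g \<le> degree q)"

lemma sfield_subr: "sfield F \<Longrightarrow> subr F" unfolding sfield_def by simp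

lemma PD_smult: "subr D \<Longrightarrow> c \<in> D \<Longrightarrow> p \<in> PD D \<Longrightarrow> smult c p \<in> PD D" unfolding PD_def by (simp add: subr_mult)

lemma PD_pderiv: fixes p :: "'a::{comm_ring_1,semiring_no_zero_divisors} poly"
  assumes "subr D" "p \<in> PD D" shows "pderiv p \<in> PD D" unfolding PD_def
proof (intro CollectI allI)
  fix i show "coeff (pderiv p) i \<in> D" unfolding coeff_pderiv by (rule subr_mult[OF assms(1) subr_of_nat[OF assms(1)] PD_coeff[OF assms(2)]])
qed

lemma minp_exists: assumes F: "sfield F" and "p \<in> PD F" "p \<noteq> 0" "poly p x = 0" shows "\<exists>g. minp F x g"
proof -
  have "\<exists>n p. p \<in> PD F \<and> p \<noteq> 0 \<and> poly p x = 0 \<and> degree p = n" using assms by auto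
  from exists_least_iff[THEN iffD1, OF this] obtain n p where
    n: "p \<in> PD F" "p \<noteq> 0" "poly p x = 0" "degree p = n"
       "\<forall>m<n. \<not> (\<exists>p. p \<in> PD F \<and> p \<noteq> 0 \<and> poly p x = 0 \<and> degree p = m)" by (elim exE conjE)
  define g where "g = smult (inverse (lead_coeff p)) p"
  have lp: "lead_coeff p \<noteq> 0" "lead_coeff p \<in> F" using n PD_coeff by auto
  have "inverse (lead_coeff p) \<in> F" using F lp unfolding sfield_def by simp
  hence "g \<in> PD F" unfolding g_def by (intro PD_smult[OF sfield_subr[OF F] _ n(1)])
  moreover have "lead_coeff g = 1" "poly g x = 0" "degree g = n" using lp n(3,4) unfolding g_def by auto
  moreover have "degree g \<le> degree q" if "q \<in> PD F" "q \<noteq> 0" "poly q x = 0" for q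
  proof (rule ccontr)
    assume "\<not> degree g \<le> degree q"
    thus False using n(5) that \<open>degree g = n\<close> by (metis not_le)
  qed
  ultimately show ?thesis unfolding minp_def by auto
qed

lemma minp_dvd: assumes F: "sfield F" and g: "minp F x g" and "q \<in> PD F" "poly q x = 0" shows "\<exists>s\<in>PD F. q = s * g"
proof -
  have g0: "g \<in> PD F" "g \<noteq> 0" using g unfolding minp_def by auto
  from PD_division[OF F g0 assms(3)] obtain s r where s: "s \<in> PD F" "r \<in> PD F" "q = s * g + r" "r = 0 \<or> degree r < degree g" by auto
  have "poly r x = 0" using assms(4) s(3) g unfolding minp_def by simp
  hence "r = 0" using g s(2,4) unfolding minp_def by (metis leD)
  thus ?thesis using s by auto
qed

text \<open>Conjugates share their minimal polynomial: that of \<open>y\<close> divides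
  \<open>g\<close>, and the cofactor has too small a degree to vanish at \<open>x\<close>.\<close>

lemma minp_root:
  assumes F: "sfield F" and g: "minp F x g" and "poly g y = 0" shows "minp F y g"
proof -
  have g0: "g \<in> PD F" "g \<noteq> 0" "lead_coeff g = 1" "poly g x = 0" using g unfolding minp_def by auto
  from minp_exists[OF F g0(1,2) assms(3)] obtain q where q: "minp F y q" by auto
  from minp_dvd[OF F q g0(1) assms(3)] obtain s where s: "s \<in> PD F" "g = s * q" by auto
  have sq: "s \<noteq> 0" "q \<noteq> 0" using s g0(2) by auto
  have deg: "degree g = degree s + degree q" using s(2) sq by (simp add: degree_mult_eq)
  have q0: "q \<in> PD F" "poly q y = 0" "lead_coeff q = 1" using q unfolding minp_def by auto
  have "degree q \<noteq> 0"
  proof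
    assume "degree q = 0"
    then obtain c where "q = [:c:]" using degree_eq_zeroE by blast
    thus False using q0(2) sq by simp
  qed
  have "poly s x \<noteq> 0"
  proof
    assume "poly s x = 0"
    hence "degree g \<le> degree s" using g s(1) sq unfolding minp_def by blast
    thus False using deg \<open>degree q \<noteq> 0\<close> by simp
  qed
  hence "poly q x = 0" using g0(4) s(2) by simp
  hence "degree g \<le> degree q" using g q0(1) sq unfolding minp_def by blast
  thus ?thesis using q g0 assms(3) unfolding minp_def by auto
qed

lemma minp_separable:
  fixes g :: "'a::field_char_0 poly"
  assumes F: "sfield F" and g: "minp F x g" shows "poly (pderiv g) x \<noteq> 0"
proof
  assume 0: "poly (pderiv g) x = 0"
  have "degree g \<noteq> 0"
  proof
    assume "degree g = 0"
    then obtain c where "g = [:c:]" using degree_eq_zeroE by blast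
    thus False using g unfolding minp_def by auto
  qed
  hence "pderiv g \<noteq> 0" by (simp add: pderiv_eq_0_iff)
  moreover have "pderiv g \<in> PD F" using PD_pderiv[OF sfield_subr[OF F]] g unfolding minp_def by blast
  ultimately have "degree g \<le> degree (pderiv g)" using g 0 unfolding minp_def by blast
  thus False using \<open>degree g \<noteq> 0\<close> by (simp add: degree_pderiv)
qed

lemma separable_split:
  fixes g :: "'a::{alg_closed_field,field_char_0} poly"
  assumes "lead_coeff g = 1" "\<And>x. poly g x = 0 \<Longrightarrow> poly (pderiv g) x \<noteq> 0"
  shows "finite {x. poly g x = 0}" "card {x. poly g x = 0} = degree g" "g = (\<Prod>x\<in>{x. poly g x = 0}. [:- x, 1:])"
proof -
  let ?S = "{x. poly g x = 0}"
  have g0: "g \<noteq> 0" using assms(1) by auto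
  show fin: "finite ?S" by (rule poly_roots_finite[OF g0])
  obtain A where A: "size A = degree g" "g = (\<Prod>x\<in>#A. [:-x, 1:])" using alg_closed_imp_factorization[OF g0] assms(1) by auto
  have "set_mset A = ?S"
  proof -
    have "poly (\<Prod>x\<in>#A. [:-x, 1:]) y = 0 \<longleftrightarrow> y \<in># A" for y by (induction A) auto
    thus ?thesis using A(2) by auto
  qed
  moreover have "count A x \<le> 1" for x
  proof (rule ccontr)
    assume "\<not> count A x \<le> 1"
    hence "{#x, x#} \<subseteq># A" by (auto simp: subseteq_mset_def)
    then obtain B where B: "A = {#x, x#} + B" using mset_subset_eq_exists_conv by blast
    define h where "h = [:-x, 1:] * (\<Prod>x\<in>#B. [:-x, 1:])"
    have gh: "g = [:-x, 1:] * h" using A(2) unfolding B h_def by (simp add: mult_ac)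
    have hx: "poly h x = 0" unfolding h_def by simp
    have "poly g x = 0" using gh by simp
    moreover have "poly (pderiv g) x = 0" unfolding gh pderiv_mult using hx by (simp add: pderiv_pCons)
    ultimately show False using assms(2) by blast
  qed
  ultimately have "A = mset_set ?S"
  proof (intro multiset_eqI)
    fix x assume a: "set_mset A = ?S" "\<And>x. count A x \<le> 1"
    show "count A x = count (mset_set ?S) x"
    proof (cases "x \<in> ?S")
      case True
      hence "count A x \<noteq> 0" using a(1) by (metis not_in_iff)
      hence "count A x = 1" using a(2)[of x] by linarith
      thus ?thesis using True fin by simp
    next
      case False
      hence "count A x = 0" using a(1) by (metis not_in_iff)
      thus ?thesis using False by simp
    qed
  qed
  hence AS: "A = mset_set ?S" .
  show "card ?S = degree g" using A(1) arg_cong[OF AS, of size] by (simp only: size_mset_set)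
  show "g = (\<Prod>x\<in>?S. [:- x, 1:])" using A(2) unfolding prod_unfold_prod_mset AS[symmetric] .
qed

text \<open>With \<open>x = a / b\<close> and a monic equation of degree \<open>N\<close>, the
  element \<open>b ^ N\<close> is a common denominator of all powers of \<open>x\<close>.\<close>

lemma good_integ: assumes "good D" "x \<in> frac D" "integ D x" shows "x \<in> D"
proof -
  have D: "subr D" "noeth D" "cic D" using assms(1) unfolding good_def by auto
  obtain n where n: "x ^ n \<in> dspan D ((\<lambda>i. x ^ i) ` {..<n})" using integ_monic[OF D(1,2) assms(3)] by auto
  obtain a b where x: "x = a / b" "a \<in> D" "b \<in> D" "b \<noteq> 0" using assms(2) unfolding frac_def by auto
  obtain G where G: "finite G" "1 \<in> dspan D G" "\<forall>g\<in>G. x * g \<in> dspan D G" using assms(3) unfolding integ_def by auto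
  obtain N where N: "x ^ N \<in> dspan D ((\<lambda>i. x ^ i) ` {..<N})" using n by auto
  let ?P = "dspan D ((\<lambda>i. x ^ i) ` {..<N})"
  have xP: "x * y \<in> ?P" if "y \<in> ?P" for y
  proof (rule dspan_mult_closed[OF D(1) _ that], rule ballI)
    fix g assume "g \<in> (\<lambda>i. x ^ i) ` {..<N}"
    then obtain i where i: "i < N" "g = x ^ i" by auto
    show "x * g \<in> ?P"
    proof (cases "Suc i < N")
      case True
      hence "x ^ Suc i \<in> ?P" by (intro dspan_incl[OF D(1)]) blast
      thus ?thesis using i by simp
    next
      case False
      hence "Suc i = N" using i by simp
      thus ?thesis using N i by (metis power_Suc)
    qed
  qed
  have pw: "x ^ j \<in> ?P" for j
  proof (induction j)
    case 0
    show ?case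
    proof (cases "N = 0")
      case True thus ?thesis using N by (simp add: dspan_empty)
    next
      case False thus ?thesis by (intro dspan_incl[OF D(1)]) blast
    qed
  next
    case (Suc j) thus ?case using xP by simp
  qed
  have "b ^ N * y \<in> D" if "y \<in> ?P" for y
  proof -
    have "\<forall>g\<in>(\<lambda>i. x ^ i) ` {..<N}. b ^ N * g \<in> dspan D {1}"
    proof
      fix g assume "g \<in> (\<lambda>i. x ^ i) ` {..<N}"
      then obtain i where i: "i < N" "g = x ^ i" by auto
      have "b ^ N * g = b ^ (N - i) * a ^ i" using i x by (simp add: power_divide power_diff field_simps)
      also have "\<dots> \<in> D" using x by (intro subr_mult[OF D(1)] subr_pow[OF D(1)])
      finally have "b ^ N * g \<in> D" .
      thus "b ^ N * g \<in> dspan D {1}" using dspan.dspan_step[of "b ^ N * g" D 1 "{1}" 0] dspan.dspan_0[of D "{1}"] by simp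
    qed
    from dspan_mult_closed[OF D(1) this that] have "b ^ N * y \<in> dspan D {1}" .
    moreover have "dspan D {1} \<subseteq> D" by (rule dspan_min[OF dmod_self[OF D(1)]]) (simp add: subr_1[OF D(1)])
    ultimately show ?thesis by (rule rev_subsetD)
  qed
  hence "\<forall>j. b ^ N * x ^ j \<in> D" using pw by simp
  moreover have "b ^ N \<in> D" "b ^ N \<noteq> 0" using x subr_pow[OF D(1)] by auto
  ultimately show ?thesis using D(3) assms(2) unfolding cic_def by blast
qed

lemma integ_poly: assumes D: "subr D" "noeth D" and "integ D x" shows "\<exists>p\<in>PD D. lead_coeff p = 1 \<and> poly p x = 0"
proof -
  obtain n where n: "x ^ n \<in> dspan D ((\<lambda>i. x ^ i) ` {..<n})" using integ_monic[OF assms] by auto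
  have "\<exists>q\<in>PD D. (q = 0 \<or> degree q < n) \<and> y = poly q x" if "y \<in> dspan D ((\<lambda>i. x ^ i) ` {..<n})" for y using that
  proof (induction rule: dspan.induct)
    case dspan_0 show ?case using subr_0[OF subr_PD[OF D(1)]] by (intro bexI[of _ 0]) auto
  next
    case (dspan_step d g y)
    then obtain i q where i: "i < n" "g = x ^ i" "q \<in> PD D" "q = 0 \<or> degree q < n" "y = poly q x" by auto
    have "monom d i + q \<in> PD D" using subr_add[OF subr_PD[OF D(1)] PD_monom[OF D(1) dspan_step(1)] i(3)] .
    moreover have "degree (monom d i + q) < n" using i(1,4) degree_monom_le[of d i] by (intro degree_add_less) auto
    moreover have "d * g + y = poly (monom d i + q) x" using i by (simp add: poly_monom)
    ultimately show ?case by blast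
  qed
  from this[OF n] obtain q where q: "q \<in> PD D" "q = 0 \<or> degree q < n" "x ^ n = poly q x" by auto
  define p where "p = monom 1 n - q"
  have "p \<in> PD D" unfolding p_def by (intro subr_diff[OF subr_PD[OF D(1)]] PD_monom[OF D(1)] subr_1[OF D(1)] q(1))
  moreover have "poly p x = 0" unfolding p_def using q(3) by (simp add: poly_monom)
  moreover have "coeff p n = 1" using q(2) unfolding p_def by (auto simp: coeff_eq_0)
  moreover have "degree p \<le> n" using q(2) degree_monom_le[of "1::'a" n] unfolding p_def by (intro degree_diff_le) auto
  ultimately have "lead_coeff p = 1" by (metis le_degree le_antisym one_neq_zero)
  thus ?thesis using \<open>p \<in> PD D\<close> \<open>poly p x = 0\<close> by blast
qed

lemma monic_dspan: assumes D: "subr D" and "p \<in> PD D" "lead_coeff p = 1" "poly p x = 0" shows "x ^ degree p \<in> dspan D ((\<lambda>i. x ^ i) ` {..<degree p})"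
proof -
  have "poly p x = x ^ degree p + (\<Sum>i<degree p. coeff p i * x ^ i)"
    unfolding poly_altdef using assms(3) by (simp add: lessThan_Suc_atMost[symmetric] add.commute)
  hence "x ^ degree p = (\<Sum>i<degree p. (- coeff p i) * x ^ i)" using assms(4) by (simp add: sum_negf eq_neg_iff_add_eq_0)
  also have "\<dots> \<in> dspan D ((\<lambda>i. x ^ i) ` {..<degree p})"
    by (intro dspan_sum[OF D] dspan_smult[OF D] subr_minus[OF D] PD_coeff[OF assms(2)] dspan_incl[OF D]) auto
  finally show ?thesis .
qed

lemma monic_integ: assumes D: "subr D" and "p \<in> PD D" "lead_coeff p = 1" "poly p x = 0" shows "integ (D::'a::field set) x"
  by (rule integ_trans[OF D _ monic_dspan[OF assms]]) (use integ_mem[OF D] in simp)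

lemma PD_pcompose: assumes "subr F" "p \<in> PD F" "q \<in> PD F" shows "pcompose p q \<in> PD F" using assms(2)
proof (induction p)
  case 0 thus ?case by simp
next
  case (pCons a p)
  have "a \<in> F" using PD_coeff[OF pCons.prems, of 0] by simp
  moreover have "p \<in> PD F" unfolding PD_def using PD_coeff[OF pCons.prems, of "Suc _"] by simp
  moreover have "[:a:] \<in> PD F" using PD_monom[OF assms(1) \<open>a \<in> F\<close>, of 0] by (simp add: monom_0)
  ultimately show ?case using pCons.IH subr_add[OF subr_PD[OF assms(1)]] subr_mult[OF subr_PD[OF assms(1)] assms(3)] by (simp add: pcompose_pCons)
qed

text \<open>The constant term of an equation of least degree for \<open>b\<close> is nonzero and a
  multiple of \<open>b\<close> in \<open>D[b]\<close>. Hence denominators in the fraction field of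
  an integral extension may be taken from \<open>D\<close>.\<close>

lemma integ_inverse_multiple:
  assumes D: "subr D" "noeth D" and b: "integ D b" "(b::'a::field) \<noteq> 0" shows "\<exists>c\<in>adj D b. \<exists>d\<in>D. d \<noteq> 0 \<and> b * c = d"
proof -
  obtain p where "p \<in> PD D" "lead_coeff p = 1" "poly p b = 0" using integ_poly[OF D b(1)] by auto
  hence "\<exists>n p. p \<in> PD D \<and> p \<noteq> 0 \<and> poly p b = 0 \<and> degree p = n" by auto
  from exists_least_iff[THEN iffD1, OF this] obtain n p where
    n: "p \<in> PD D" "p \<noteq> 0" "poly p b = 0" "degree p = n"
       "\<forall>m<n. \<not> (\<exists>p. p \<in> PD D \<and> p \<noteq> 0 \<and> poly p b = 0 \<and> degree p = m)" by (elim exE conjE)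
  obtain d r where pd: "p = pCons d r" by (cases p)
  have d: "d \<in> D" using PD_coeff[OF n(1), of 0] pd by simp
  have r: "r \<in> PD D" unfolding PD_def using PD_coeff[OF n(1), of "Suc _"] pd by simp
  have eq: "b * poly r b = - d" using n(3) pd by (simp add: eq_neg_iff_add_eq_0 add.commute)
  have "d \<noteq> 0"
  proof
    assume d0: "d = 0"
    hence "r \<noteq> 0" "poly r b = 0" using n(2) pd eq b(2) by auto
    moreover have "degree r < n" using n(4) pd \<open>r \<noteq> 0\<close> by simp
    ultimately show False using n(5) r by blast
  qed
  moreover have "poly r b \<in> adj D b" unfolding adj_poly[OF D(1)] using r by blast
  ultimately show ?thesis using eq subr_minus[OF D(1) d] by (intro bexI[of _ "poly r b"] bexI[of _ "- d"]) auto
qed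

text \<open>The trace form argument in the shape of Lagrange interpolation. With \<open>g\<close>
  the minimal polynomial of \<open>\<theta>\<close> and \<open>\<delta> = g'(\<theta>)\<close>,
  every integral \<open>z\<close> has the form \<open>h(\<theta>) / \<delta>\<close> with
  \<open>h\<close> over \<open>D\<close>. So the integral closure lies in a finitely generated
  \<open>D\<close>-module.\<close>

theorem good_extension:
  fixes D :: "'a::{alg_closed_field,field_char_0} set"
  assumes g: "good D" and \<theta>: "integ D \<theta>" shows "good {z\<in>frac (adj D \<theta>). integ D z}"
proof -
  have D: "subr D" "noeth D" "cic D" using g unfolding good_def by auto
  let ?F = "frac D" and ?O = "{z. integ D z}"
  have F: "sfield ?F" by (rule sfield_frac[OF D(1)])
  note Fs = sfield_subr[OF F]
  have DF: "D \<subseteq> ?F" using frac_base[OF D(1)] by auto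
  have O: "subr ?O" by (rule subr_integ[OF D(1)])
  have A: "subr (adj D \<theta>)" by (rule subr_adj[OF D(1)])
  have AO: "adj D \<theta> \<subseteq> ?O" by (rule adj_min[OF D(1) O]) (use \<theta> integ_mem[OF D(1)] in auto)
  obtain P0 where P0: "P0 \<in> PD D" "lead_coeff P0 = 1" "poly P0 \<theta> = 0" using integ_poly[OF D(1,2) \<theta>] by auto
  have "P0 \<noteq> 0" using P0(2) by auto
  then obtain g where g: "minp ?F \<theta> g" using minp_exists[OF F PD_mono[OF DF P0(1)] _ P0(3)] by blast
  define S where "S = {x. poly g x = 0}"
  have gm: "lead_coeff g = 1" "g \<in> PD ?F" "poly g \<theta> = 0" "g \<noteq> 0" using g unfolding minp_def by auto
  have sep: "poly (pderiv g) x \<noteq> 0" if "poly g x = 0" for x using minp_separable[OF F minp_root[OF F g that]] .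
  have S: "finite S" "card S = degree g" "g = (\<Prod>x\<in>S. [:- x, 1:])" using separable_split[OF gm(1) sep] unfolding S_def by blast+
  \<comment> \<open>A monic equation of \<open>Z(\<theta>)\<close>, composed with \<open>Z\<close>,
    is divisible by \<open>g\<close>, hence holds for the value of \<open>Z\<close> at every
    conjugate.\<close>
  have root_int: "integ D (poly Z x)" if x: "x \<in> S" and Z: "Z \<in> PD ?F" "integ D (poly Z \<theta>)" for x Z
  proof -
    obtain P where P: "P \<in> PD D" "lead_coeff P = 1" "poly P (poly Z \<theta>) = 0" using integ_poly[OF D(1,2) Z(2)] by auto
    have "pcompose P Z \<in> PD ?F" by (rule PD_pcompose[OF Fs PD_mono[OF DF P(1)] Z(1)])
    moreover have "poly (pcompose P Z) \<theta> = 0" using P(3) by (simp add: poly_pcompose)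
    ultimately obtain s where "pcompose P Z = s * g" using minp_dvd[OF F g] by blast
    hence "poly (pcompose P Z) x = 0" using x unfolding S_def by simp
    thus ?thesis using monic_integ[OF D(1) P(1,2)] by (simp add: poly_pcompose)
  qed
  define \<delta> where "\<delta> = poly (pderiv g) \<theta>"
  have \<delta>: "\<delta> \<noteq> 0" unfolding \<delta>_def by (rule sep[OF gm(3)])
  let ?D' = "{z\<in>frac (adj D \<theta>). integ D z}"
  let ?G = "(\<lambda>i. \<theta> ^ i / \<delta>) ` {..degree g}"
  have rep: "\<exists>Z\<in>PD ?F. z = poly Z \<theta>" if z: "z \<in> frac (adj D \<theta>)" for z
  proof -
    obtain a b where ab: "a \<in> adj D \<theta>" "b \<in> adj D \<theta>" "b \<noteq> 0" "z = a / b" using z unfolding frac_def by auto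
    have "integ D b" using ab(2) AO by auto
    from integ_inverse_multiple[OF D(1,2) this ab(3)] obtain c d where cd: "c \<in> adj D b" "d \<in> D" "d \<noteq> 0" "b * c = d" by auto
    have "adj D b \<subseteq> adj D \<theta>" by (rule adj_min[OF D(1) A _ ab(2)]) (use adj_base[OF D(1)] in auto)
    hence "a * c \<in> adj D \<theta>" using cd(1) ab(1) by (auto intro: subr_mult[OF A])
    then obtain Z where Z: "Z \<in> PD D" "a * c = poly Z \<theta>" unfolding adj_poly[OF D(1)] by auto
    have "z = inverse d * (a * c)" using ab cd by (auto simp: field_simps)
    hence "z = poly (smult (inverse d) Z) \<theta>" using Z by simp
    moreover have "inverse d \<in> ?F" using F DF cd unfolding sfield_def by auto
    ultimately show ?thesis using PD_smult[OF Fs _ PD_mono[OF DF Z(1)]] by blast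
  qed
  have key: "z \<in> dspan D ?G" if z: "z \<in> ?D'" for z
  proof -
    obtain Z where Z: "Z \<in> PD ?F" "z = poly Z \<theta>" using rep z by auto
    have zi: "integ D (poly Z \<theta>)" using z Z(2) by auto
    have pF: "pderiv g \<in> PD ?F" by (rule PD_pderiv[OF Fs gm(2)])
    have "Z * pderiv g \<in> PD ?F" by (rule subr_mult[OF subr_PD[OF Fs] Z(1) pF])
    \<comment> \<open>\<open>h\<close> is the remainder of \<open>Z g'\<close> modulo
      \<open>g\<close>. Its coefficients lie in the fraction field by construction; interpolation
      shows next that they are also integral over \<open>D\<close>.\<close>
    from PD_division[OF F gm(2,4) this] obtain s h where h: "h \<in> PD ?F" "Z * pderiv g = s * g + h" "h = 0 \<or> degree h < degree g" by auto
    have hval: "poly h x = poly Z x * poly (pderiv g) x" if "x \<in> S" for x using arg_cong[OF h(2), of "\<lambda>p. poly p x"] that unfolding S_def by simp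
    define Q where "Q x = (\<Prod>y\<in>S - {x}. [:- y, 1:])" for x
    have gQ: "g = [:- x, 1:] * Q x" if "x \<in> S" for x unfolding Q_def using S(3) prod.remove[OF S(1) that, of "\<lambda>y. [:- y, 1:]"] by simp
    have pdQ: "poly (pderiv g) x = poly (Q x) x" if "x \<in> S" for x by (subst gQ[OF that], simp only: pderiv_mult) (simp add: pderiv_pCons)
    have Q0: "poly (Q x) y = 0" if "y \<in> S" "y \<noteq> x" for x y unfolding Q_def poly_prod using that S(1) by (auto intro!: prod_zero)
    have Qdeg: "degree (Q x) < degree g" if "x \<in> S" for x
    proof -
      have "Q x \<noteq> 0" using gQ[OF that] gm(4) by auto
      hence "degree g = degree [:- x, 1:] + degree (Q x)" using arg_cong[OF gQ[OF that], of degree] by (simp add: degree_mult_eq del: mult_pCons_left)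
      thus ?thesis by simp
    qed
    \<comment> \<open>The interpolation polynomial with the values \<open>Z(x) g'(x)\<close> at the
      roots, since \<open>Q x\<close> is \<open>g\<close> divided by \<open>X - x\<close> and takes
      the value \<open>g'(x)\<close> at \<open>x\<close>. Both polynomials have degree below the
      number of roots, so they agree.\<close>
    define hL where "hL = (\<Sum>x\<in>S. smult (poly Z x) (Q x))"
    have "\<theta> \<in> S" using gm(3) unfolding S_def by simp
    hence dg: "degree g > 0" using Qdeg by fastforce
    have "h = hL"
    proof (rule ccontr)
      assume "h \<noteq> hL"
      hence ne: "h - hL \<noteq> 0" by simp
      have "poly hL x = poly h x" if x: "x \<in> S" for x
      proof -
        have "poly hL x = (\<Sum>y\<in>S. poly Z y * poly (Q y) x)" unfolding hL_def by (simp add: poly_sum)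
        also have "\<dots> = (\<Sum>y\<in>{x}. poly Z y * poly (Q y) x)" by (rule sum.mono_neutral_right[OF S(1)]) (use x Q0 in auto)
        finally show ?thesis using hval[OF x] pdQ[OF x] by simp
      qed
      hence "S \<subseteq> {x. poly (h - hL) x = 0}" by auto
      hence "card S \<le> card {x. poly (h - hL) x = 0}" by (intro card_mono poly_roots_finite[OF ne])
      also have "\<dots> \<le> degree (h - hL)" by (rule card_poly_roots_bound[OF ne])
      also have "degree (h - hL) < degree g"
      proof (rule degree_diff_less)
        show "degree h < degree g" using h(3) dg by auto
        have "degree (smult (poly Z x) (Q x)) < degree g" if "x \<in> S" for x using Qdeg[OF that] degree_smult_le le_less_trans by blast
        thus "degree hL < degree g" unfolding hL_def by (intro degree_sum_less dg)
      qed
      finally show False using S(2) by simp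
    qed
    have SO: "x \<in> ?O" if "x \<in> S" for x
    proof -
      obtain s where "P0 = s * g" using minp_dvd[OF F g PD_mono[OF DF P0(1)] P0(3)] by auto
      hence "poly P0 x = 0" using that unfolding S_def by simp
      thus ?thesis using monic_integ[OF D(1) P0(1,2)] by simp
    qed
    have "[:- x, 1:] \<in> PD ?O" if "x \<in> S" for x unfolding PD_def using SO[OF that] subr_minus[OF O] subr_1[OF O] subr_0[OF O]
      by (auto simp: coeff_pCons split: nat.splits)
    hence "Q x \<in> PD ?O" if "x \<in> S" for x unfolding Q_def by (intro subr_prod[OF subr_PD[OF O]]) auto
    hence "hL \<in> PD ?O" unfolding hL_def using root_int[OF _ Z(1) zi] by (intro subr_sum[OF subr_PD[OF O]] PD_smult[OF O]) auto
    hence "coeff h i \<in> D" for i using good_integ[OF assms(1), of "coeff h i"] PD_coeff[OF h(1), of i] unfolding \<open>h = hL\<close> PD_def by auto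
    hence hD: "h \<in> PD D" unfolding PD_def by simp
    have "poly h \<theta> = z * \<delta>" using hval[OF \<open>\<theta> \<in> S\<close>] Z(2) unfolding \<delta>_def by simp
    hence "z = (\<Sum>i\<le>degree h. coeff h i * (\<theta> ^ i / \<delta>))" using \<delta> by (simp add: poly_altdef sum_divide_distrib[symmetric] field_simps)
    also have "\<dots> \<in> dspan D ?G" using h(3) dg by (intro dspan_sum[OF D(1)] dspan_smult[OF D(1) PD_coeff[OF hD]] dspan_incl[OF D(1)]) auto
    finally show ?thesis .
  qed
  have sub': "subr ?D'" using O sfield_subr[OF sfield_frac[OF A]] unfolding subr_def by auto
  have DD': "D \<subseteq> ?D'" using integ_mem[OF D(1)] frac_base[OF A] adj_base[OF D(1)] by auto
  have finG: "finite ?G" by simp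
  have "noeth ?D'" unfolding noeth_def
  proof (intro allI impI)
    fix E assume E: "E \<subseteq> ?D'" "dmod ?D' E"
    have "E \<subseteq> dspan D ?G" using E(1) key by (meson subsetD subsetI)
    from fg_submodule[OF D(1,2) finG this dmod_mono[OF E(2) DD']] obtain H where
      H: "finite H" "H \<subseteq> E" "E \<subseteq> dspan D H" by auto
    have "dspan D H \<subseteq> dspan ?D' H" using dspan_mono[OF DD' order.refl] by (rule subsetI)
    thus "\<exists>G. finite G \<and> G \<subseteq> E \<and> E \<subseteq> dspan ?D' G" using H by (intro exI[of _ H]) simp
  qed
  moreover have "cic ?D'" unfolding cic_def
  proof (intro ballI impI)
    fix x assume x: "x \<in> frac ?D'" "\<exists>d\<in>?D'. d \<noteq> 0 \<and> (\<forall>j. d * x ^ j \<in> ?D')"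
    then obtain d where d: "d \<noteq> 0" "\<forall>j. d * x ^ j \<in> ?D'" by auto
    have "x \<in> frac (adj D \<theta>)"
    proof -
      obtain a b where "a \<in> ?D'" "b \<in> ?D'" "x = a / b" using x(1) unfolding frac_def by auto
      thus ?thesis using sfield_div[OF sfield_frac[OF A]] by auto
    qed
    \<comment> \<open>All powers of \<open>x\<close> lie in \<open>1 / d\<close> times the integral
      closure, which is contained in the module over \<open>D\<close> generated by
      \<open>?H\<close>; this makes \<open>x\<close> integral over \<open>D\<close>.\<close>
    let ?H = "(\<lambda>g. g / d) ` ?G"
    have "x ^ j \<in> dspan D ?H" for j
    proof -
      have "\<forall>g\<in>?G. inverse d * g \<in> dspan D ?H"
      proof
        fix g assume "g \<in> ?G"
        hence "g / d \<in> dspan D ?H" by (intro dspan_incl[OF D(1)] imageI)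
        thus "inverse d * g \<in> dspan D ?H" by (simp add: divide_inverse mult.commute)
      qed
      from dspan_mult_closed[OF D(1) this key] have "inverse d * (d * x ^ j) \<in> dspan D ?H" using d(2) by blast
      moreover have "inverse d * (d * x ^ j) = x ^ j" using d(1) by simp
      ultimately show ?thesis by (simp only:)
    qed
    then obtain n where "x ^ n \<in> dspan D ((\<lambda>i. x ^ i) ` {..<n})" using powers_monic[OF D(1,2), of ?H x] by auto
    hence "integ D x" using integ_trans[OF D(1), of D] integ_mem[OF D(1)] by blast
    thus "x \<in> ?D'" using \<open>x \<in> frac (adj D \<theta>)\<close> by simp
  qed
  ultimately show ?thesis using sub' unfolding good_def by simp
qed

lemma integ_trans_ring:
  assumes D: "subr (D::'a::field set)" "subr E" "noeth E" and "\<forall>e\<in>E. integ D e" "integ E x" shows "integ D x"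
  using integ_monic[OF D(2,3) assms(5)] integ_trans[OF D(1) assms(4)] by blast

text \<open>The elements are adjoined one at a time, the ring being replaced each time by its
  integral closure in the enlarged fraction field; transitivity keeps everything integral over the
  initial ring.\<close>

theorem good_closure_list:
  fixes D :: "'a::{alg_closed_field,field_char_0} set"
  assumes K: "sfield K"
  shows "good D \<Longrightarrow> D \<subseteq> K \<Longrightarrow> set ss \<subseteq> K \<Longrightarrow> \<forall>s\<in>set ss. integ D s \<Longrightarrow>
    \<exists>B. good B \<and> D \<subseteq> B \<and> B \<subseteq> K \<and> set ss \<subseteq> B \<and> (\<forall>z\<in>B. integ D z)"
proof (induction ss arbitrary: D)
  case Nil
  thus ?case using integ_mem unfolding good_def by (intro exI[of _ D]) auto
next
  case (Cons s ss)
  have D: "subr D" using Cons.prems(1) unfolding good_def by simp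
  define E where "E = {z\<in>frac (adj D s). integ D z}"
  have E: "good E" unfolding E_def using Cons.prems by (intro good_extension) auto
  have A: "subr (adj D s)" by (rule subr_adj[OF D])
  have AK: "adj D s \<subseteq> K" by (rule adj_min[OF D sfield_subr[OF K] Cons.prems(2)]) (use Cons.prems in simp)
  hence EK: "E \<subseteq> K" using sfield_div[OF K] unfolding E_def frac_def by auto
  have DE: "D \<subseteq> E" unfolding E_def using integ_mem[OF D] frac_base[OF A] adj_base[OF D] by auto
  have sE: "s \<in> E" unfolding E_def using Cons.prems frac_base[OF A adj_gen[OF D]] by auto
  have up: "integ E z" if "integ D z" for z using that dspan_mono[OF DE order.refl] unfolding integ_def by meson
  from Cons.IH[OF E EK] Cons.prems(3,4) up obtain B where
    B: "good B" "E \<subseteq> B" "B \<subseteq> K" "set ss \<subseteq> B" "\<forall>z\<in>B. integ E z" by auto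
  have Egood: "subr E" "noeth E" using E unfolding good_def by auto
  have "\<forall>e\<in>E. integ D e" unfolding E_def by simp
  hence "\<forall>z\<in>B. integ D z" using B(5) integ_trans_ring[OF D Egood] by blast
  thus ?case using B DE sE by (intro exI[of _ B]) auto
qed

subsection \<open>The Krull property of noetherian normal domains\<close>

text \<open>A normalized discrete valuation, as a function on the nonzero elements; the value at 0
  is arbitrary and excluded everywhere.\<close>

definition dval :: "'a::field set \<Rightarrow> ('a \<Rightarrow> int) \<Rightarrow> bool" where
  "dval K w \<longleftrightarrow> (\<forall>x\<in>K - {0}. \<forall>y\<in>K - {0}. w (x * y) = w x + w y \<and> (x + y \<noteq> 0 \<longrightarrow> min (w x) (w y) \<le> w (x + y))) \<and>
     (\<exists>x\<in>K - {0}. w x = 1)"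

definition krull :: "'a::field set \<Rightarrow> 'a set \<Rightarrow> ('a \<Rightarrow> int) set \<Rightarrow> bool" where
  "krull K B W \<longleftrightarrow> (\<forall>w\<in>W. dval K w) \<and> (\<forall>x\<in>K - {0}. finite {w\<in>W. w x \<noteq> 0}) \<and>
     (\<forall>x\<in>K - {0}. x \<in> B \<longleftrightarrow> (\<forall>w\<in>W. 0 \<le> w x))"

lemma dval_mult: "dval K w \<Longrightarrow> x \<in> K \<Longrightarrow> x \<noteq> 0 \<Longrightarrow> y \<in> K \<Longrightarrow> y \<noteq> 0 \<Longrightarrow> w (x * y) = w x + w y"
  unfolding dval_def by blast
lemma dval_one: "dval K w \<Longrightarrow> 1 \<in> K \<Longrightarrow> w 1 = 0" using dval_mult[of K w 1 1] by simp
lemma dval_inverse: "dval K w \<Longrightarrow> sfield K \<Longrightarrow> x \<in> K \<Longrightarrow> x \<noteq> 0 \<Longrightarrow> w (inverse x) = - w x"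
  using dval_mult[of K w x "inverse x"] dval_one[of K w] subr_1[OF sfield_subr, of K] unfolding sfield_def by simp
lemma dval_pow: assumes "dval K w" "sfield K" "x \<in> K" "x \<noteq> 0" shows "w (x ^ n) = int n * w x"
proof (induction n)
  case 0 thus ?case using dval_one[OF assms(1) subr_1[OF sfield_subr[OF assms(2)]]] by simp
next
  case (Suc n)
  have "w (x * x ^ n) = w x + w (x ^ n)" by (rule dval_mult[OF assms(1,3,4)]) (use subr_pow[OF sfield_subr[OF assms(2)] assms(3)] assms(4) in auto)
  thus ?case using Suc by (simp add: algebra_simps)
qed
lemma sfield_powi: assumes "sfield K" "x \<in> K" shows "x powi j \<in> K"
  using subr_pow[OF sfield_subr[OF assms(1)] assms(2)] assms(1) unfolding power_int_def sfield_def by (simp add: power_inverse)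
lemma dval_powi: assumes "dval K w" "sfield K" "x \<in> K" "x \<noteq> 0" shows "w (x powi j) = j * w x"
  using dval_pow[OF assms] dval_inverse[OF assms(1,2) subr_pow[OF sfield_subr[OF assms(2)] assms(3)]] assms(4) by (simp add: power_int_def power_inverse)

text \<open>If \<open>w\<close> nonnegative implies \<open>v\<close> nonnegative, elements of
  \<open>w\<close>-value 0 have \<open>v\<close>-value 0, so \<open>v\<close> is a multiple of
  \<open>w\<close>; as both take the value 1, the factor is 1.\<close>

lemma dval_eqI:
  assumes K: "sfield K" and w: "dval K w" "dval K v" and le: "\<forall>x\<in>K - {0}. 0 \<le> w x \<longrightarrow> 0 \<le> v x" and x: "x \<in> K" "x \<noteq> 0"
  shows "w x = v x"
proof -
  note Ks = sfield_subr[OF K]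
  have z: "v y = 0" if y: "y \<in> K" "y \<noteq> 0" "w y = 0" for y
  proof -
    have i: "inverse y \<in> K" "inverse y \<noteq> 0" using y K unfolding sfield_def by auto
    have "0 \<le> v y" using le y by auto
    moreover have "0 \<le> v (inverse y)" using le i y dval_inverse[OF w(1) K y(1,2)] by auto
    ultimately show ?thesis using dval_inverse[OF w(2) K y(1,2)] by simp
  qed
  obtain p where p: "p \<in> K" "p \<noteq> 0" "w p = 1" using w(1) unfolding dval_def by auto
  have m: "v y = w y * v p" if y: "y \<in> K" "y \<noteq> 0" for y
  proof -
    have q: "p powi (- w y) \<in> K" "p powi (- w y) \<noteq> 0" using sfield_powi[OF K p(1)] p(2) by auto
    have "w (y * p powi (- w y)) = 0" using dval_mult[OF w(1) y q] dval_powi[OF w(1) K p(1,2)] p(3) by simp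
    hence "v (y * p powi (- w y)) = 0" using z[of "y * p powi (- w y)"] y q subr_mult[OF Ks] by simp
    thus ?thesis using dval_mult[OF w(2) y q] dval_powi[OF w(2) K p(1,2)] by simp
  qed
  obtain q where q: "q \<in> K" "q \<noteq> 0" "v q = 1" using w(2) unfolding dval_def by auto
  have "w q * v p = 1" using m[OF q(1,2)] q(3) by simp
  moreover have "0 \<le> v p" using le p by auto
  ultimately have "v p = 1" using zmult_eq_1_iff[of "w q" "v p"] by auto
  thus ?thesis using m[OF x] by simp
qed

text \<open>Zorn's lemma: a finite generating set of the union of a chain already lies in one
  member, which is therefore the union.\<close>

lemma noeth_maximal:
  assumes D: "noeth D" and S: "S \<noteq> {}" "\<forall>E\<in>S. E \<subseteq> D \<and> dmod D E"
  shows "\<exists>M\<in>S. \<forall>E\<in>S. M \<subseteq> E \<longrightarrow> E = M"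
proof (rule subset_Zorn_nonempty[OF S(1)])
  fix C assume C: "C \<noteq> {}" "subset.chain S C"
  have CS: "C \<subseteq> S" and ch: "\<And>x y. x \<in> C \<Longrightarrow> y \<in> C \<Longrightarrow> x \<subseteq> y \<or> y \<subseteq> x" using C(2) unfolding subset_chain_def by auto
  have "dmod D (\<Union>C)" unfolding dmod_def
  proof (intro conjI ballI)
    obtain E where E: "E \<in> C" using C(1) by auto
    hence "0 \<in> E" using CS S(2) unfolding dmod_def by auto
    thus "0 \<in> \<Union>C" using E by auto
    fix x y assume "x \<in> \<Union>C" "y \<in> \<Union>C"
    then obtain E E' where EE: "E \<in> C" "E' \<in> C" "x \<in> E" "y \<in> E'" by auto
    then obtain E'' where "E'' \<in> C" "x \<in> E''" "y \<in> E''" using ch[of E E'] by auto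
    hence "x + y \<in> E''" using CS S(2) unfolding dmod_def by (meson subsetD)
    thus "x + y \<in> \<Union>C" using \<open>E'' \<in> C\<close> by auto
  next
    fix d x assume "d \<in> D" "x \<in> \<Union>C"
    then obtain E where "E \<in> C" "x \<in> E" by auto
    hence "d * x \<in> E" using CS S(2) \<open>d \<in> D\<close> unfolding dmod_def by (meson subsetD)
    thus "d * x \<in> \<Union>C" using \<open>E \<in> C\<close> by auto
  qed
  moreover have "\<Union>C \<subseteq> D" using CS S(2) by auto
  ultimately obtain G where G: "finite G" "G \<subseteq> \<Union>C" "\<Union>C \<subseteq> dspan D G" using noethD[OF D, of "\<Union>C"] by meson
  have "\<exists>E\<in>C. G \<subseteq> E" using G(1,2)
  proof (induction G)
    case empty thus ?case using C(1) by auto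
  next
    case (insert g G)
    then obtain E E' where "E \<in> C" "G \<subseteq> E" "E' \<in> C" "g \<in> E'" by auto
    thus ?case using ch[of E E'] by (metis insert_subset subset_trans subsetD)
  qed
  then obtain E where E: "E \<in> C" "G \<subseteq> E" by auto
  have ES: "E \<in> S" using CS E(1) by (rule subsetD)
  hence "dspan D G \<subseteq> E" using S(2) by (intro dspan_min[OF _ E(2)]) auto
  hence "\<Union>C \<subseteq> E" using G(3) by (rule subset_trans[rotated])
  hence "\<Union>C = E" using E(1) by (simp add: Union_upper subset_antisym)
  thus "\<Union>C \<in> S" using ES by simp
qed

section \<open>Denominator ideals and their discrete valuations\<close>

context
  fixes D :: "'a::field set"
  assumes gD: "good D"
begin

lemma D_subr: "subr D" and D_noeth: "noeth D" and D_cic: "cic D" using gD unfolding good_def by auto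

lemma K_sfield: "sfield (frac D)" by (rule sfield_frac[OF D_subr])
lemma K_subr: "subr (frac D)" by (rule sfield_subr[OF K_sfield])
lemma D_sub_K: "x \<in> D \<Longrightarrow> x \<in> frac D" by (rule frac_base[OF D_subr])

text \<open>The denominator ideal of \<open>x\<close>, that is, the colon ideal of \<open>D\<close>
  by \<open>x\<close>.\<close>

definition PP :: "'a \<Rightarrow> 'a set" where "PP x = {b\<in>D. b * x \<in> D}"

text \<open>Fractions outside \<open>D\<close> whose denominator ideal is prime. Each gives a
  discrete valuation ring, the localization of \<open>D\<close> at that prime, in which
  \<open>1 / x\<close> is a uniformizer.\<close>

definition XX :: "'a set" where
  "XX = {x\<in>frac D - D. \<forall>a\<in>D. \<forall>b\<in>D. a * b \<in> PP x \<longrightarrow> a \<in> PP x \<or> b \<in> PP x}"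

definition UU :: "'a \<Rightarrow> 'a set" where "UU x = {a / b | a b. a \<in> D - PP x \<and> b \<in> D - PP x}"

text \<open>As \<open>1 / x\<close> is a uniformizer, \<open>z\<close> has value \<open>j\<close>
  when \<open>z * x powi j\<close> is a unit of the localization at \<open>PP x\<close>. The default
  0 elsewhere makes two such functions equal as soon as they agree on the nonzero fractions, so that
  a set of these functions counts each valuation once.\<close>

definition vv :: "'a \<Rightarrow> 'a \<Rightarrow> int" where
  "vv x z = (if z \<in> frac D - {0} then (THE j. z * x powi j \<in> UU x) else 0)"

lemma PP_dmod: "dmod D (PP x)" unfolding dmod_def PP_def using D_subr by (auto simp: distrib_right mult.assoc intro: subr_0 subr_add subr_mult)

context
  fixes x assumes x: "x \<in> XX"
begin

lemma xK: "x \<in> frac D" "x \<notin> D" "x \<noteq> 0" using x subr_0[OF D_subr] unfolding XX_def by auto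

lemma one_P: "1 \<in> D - PP x" using xK subr_1[OF D_subr] unfolding PP_def by auto

lemma zero_P: "0 \<in> PP x" using subr_0[OF D_subr] unfolding PP_def by simp

lemma nP_mult: "a \<in> D - PP x \<Longrightarrow> b \<in> D - PP x \<Longrightarrow> a * b \<in> D - PP x" using x subr_mult[OF D_subr] unfolding XX_def by blast

lemma nP_pow: "a \<in> D - PP x \<Longrightarrow> a ^ n \<in> D - PP x" by (induction n) (use one_P nP_mult in auto)

lemma nP_nz: "a \<in> D - PP x \<Longrightarrow> a \<noteq> 0" using zero_P by auto

lemma P_mult: "a \<in> D \<Longrightarrow> b \<in> PP x \<Longrightarrow> a * b \<in> PP x" using PP_dmod unfolding dmod_def by blast

text \<open>Otherwise every \<open>b * x ^ j\<close> would lie in \<open>PP x\<close>, hence in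
  \<open>D\<close>, and \<open>b\<close> would be a common denominator of the powers of
  \<open>x\<close>, forcing \<open>x\<close> into \<open>D\<close>.\<close>

lemma pow_ex: assumes "b \<in> D" "b \<noteq> 0" shows "\<exists>j::nat. b * x ^ j \<in> D - PP x"
proof (rule ccontr)
  assume n: "\<not> ?thesis"
  have "b * x ^ j \<in> D" for j
  proof (induction j)
    case (Suc j)
    hence "b * x ^ j \<in> PP x" using n by blast
    hence "b * x ^ j * x \<in> D" unfolding PP_def by simp
    thus ?case by (simp add: mult_ac)
  qed (use assms in simp)
  hence "x \<in> D" using D_cic assms xK(1) unfolding cic_def by blast
  thus False using xK by simp
qed

text \<open>A denominator \<open>b\<close> of \<open>x\<close> lies in \<open>PP x\<close>. At the
  first \<open>j\<close> with \<open>b * x ^ j\<close> outside \<open>PP x\<close>, the preceding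
  product is the desired \<open>p\<close>.\<close>

lemma uniformizer: "\<exists>p\<in>PP x. p * x \<in> D - PP x"
proof -
  obtain a b where ab: "a \<in> D" "b \<in> D" "b \<noteq> 0" "x = a / b" using xK(1) unfolding frac_def by auto
  have bP: "b \<in> PP x" unfolding PP_def using ab by simp
  from pow_ex[OF ab(2,3)] have ex: "\<exists>j. b * x ^ j \<in> D - PP x" .
  define j where "j = (LEAST j. b * x ^ j \<in> D - PP x)"
  have j: "b * x ^ j \<in> D - PP x" unfolding j_def by (rule LeastI_ex[OF ex])
  hence "j \<noteq> 0" using bP by (cases j) auto
  then obtain i where i: "j = Suc i" by (cases j) auto
  have "b * x ^ k \<in> PP x" if "k < j" for k using that
  proof (induction k)
    case (Suc k)
    hence "b * x ^ k \<in> PP x" by simp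
    hence "b * x ^ k * x \<in> D" unfolding PP_def by simp
    hence "b * x ^ Suc k \<in> D" by (simp add: mult_ac)
    moreover have "b * x ^ Suc k \<notin> D - PP x" using Suc.prems not_less_Least unfolding j_def by blast
    ultimately show ?case by blast
  qed (use bP in simp)
  hence "b * x ^ i \<in> PP x" using i by simp
  moreover have "b * x ^ i * x \<in> D - PP x" using j i by (simp add: mult_ac)
  ultimately show ?thesis by blast
qed

lemma UU_mult: "a \<in> UU x \<Longrightarrow> b \<in> UU x \<Longrightarrow> a * b \<in> UU x"
proof -
  assume "a \<in> UU x" "b \<in> UU x"
  then obtain a1 a2 b1 b2 where "a1 \<in> D - PP x" "a2 \<in> D - PP x" "b1 \<in> D - PP x" "b2 \<in> D - PP x" "a = a1 / a2" "b = b1 / b2" unfolding UU_def by auto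
  hence "a * b = (a1 * b1) / (a2 * b2)" "a1 * b1 \<in> D - PP x" "a2 * b2 \<in> D - PP x" using nP_mult by auto
  thus ?thesis unfolding UU_def by blast
qed

lemma UU_div: "a \<in> UU x \<Longrightarrow> b \<in> UU x \<Longrightarrow> a / b \<in> UU x"
proof -
  assume a: "a \<in> UU x" and "b \<in> UU x"
  then obtain b1 b2 where "b1 \<in> D - PP x" "b2 \<in> D - PP x" "b = b1 / b2" unfolding UU_def by auto
  hence "inverse b = b2 / b1" "b2 / b1 \<in> UU x" unfolding UU_def by auto
  thus ?thesis using UU_mult[OF a, of "inverse b"] by (simp add: divide_inverse)
qed

lemma UU_D: "a \<in> D - PP x \<Longrightarrow> a \<in> UU x" unfolding UU_def using one_P by (metis (mono_tags, lifting) div_by_1 mem_Collect_eq)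

text \<open>For \<open>p\<close> from \<open>uniformizer\<close>, the relation
  \<open>x ^ m = a / b\<close> gives \<open>(p * x) ^ m * b = p ^ m * a\<close>, whose left side is
  outside the prime ideal and whose right side is inside if \<open>m > 0\<close>.\<close>

lemma UU_pow: assumes "x powi j \<in> UU x" shows "j = 0"
proof -
  have pos: False if m: "m > 0" "x ^ m \<in> UU x" for m :: nat
  proof -
    obtain a b where ab: "a \<in> D - PP x" "b \<in> D - PP x" "x ^ m = a / b" using m(2) unfolding UU_def by auto
    obtain p where p: "p \<in> PP x" "p * x \<in> D - PP x" using uniformizer by auto
    have "(p * x) ^ m * b = p ^ m * a" using ab nP_nz[OF ab(2)] by (simp add: power_mult_distrib)
    moreover have "(p * x) ^ m * b \<in> D - PP x" by (rule nP_mult[OF nP_pow[OF p(2)] ab(2)])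
    moreover have "p ^ m * a \<in> PP x"
    proof -
      obtain l where "m = Suc l" using m(1) by (cases m) auto
      hence "p ^ m * a = (p ^ l * a) * p" by simp
      moreover have "p ^ l * a \<in> D" using ab(1) p(1) unfolding PP_def by (intro subr_mult[OF D_subr] subr_pow[OF D_subr]) auto
      ultimately show ?thesis using P_mult[OF _ p(1), of "p ^ l * a"] by (simp only:)
    qed
    ultimately show False by simp
  qed
  have "1 \<in> UU x" by (rule UU_D[OF one_P])
  hence "x powi (- j) \<in> UU x" using UU_div[of 1 "x powi j"] assms by (simp add: power_int_minus divide_inverse)
  thus ?thesis using pos[of "nat j"] pos[of "nat (- j)"] assms by (cases j "0::int" rule: linorder_cases) (auto simp: power_int_def)
qed

lemma vv_eq: assumes z: "z \<in> frac D" "z \<noteq> 0" and j: "z * x powi j \<in> UU x" shows "vv x z = j"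
proof -
  have "j' = j" if "z * x powi j' \<in> UU x" for j'
  proof -
    have "(z * x powi j') / (z * x powi j) \<in> UU x" by (rule UU_div[OF that j])
    moreover have "(z * x powi j') / (z * x powi j) = x powi (j' - j)" using z xK(3) by (simp add: power_int_diff)
    ultimately have "j' - j = 0" using UU_pow by metis
    thus ?thesis by simp
  qed
  hence "(THE j. z * x powi j \<in> UU x) = j" using j by (intro the_equality)
  thus ?thesis unfolding vv_def using z by simp
qed

lemma vv_ex: assumes z: "z \<in> frac D" "z \<noteq> 0" shows "z * x powi (vv x z) \<in> UU x"
proof -
  obtain a b where ab: "a \<in> D" "b \<in> D" "b \<noteq> 0" "z = a / b" using z(1) unfolding frac_def by auto
  have "a \<noteq> 0" using z(2) ab by auto
  from pow_ex[OF ab(1) this] obtain i where i: "a * x ^ i \<in> D - PP x" by auto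
  from pow_ex[OF ab(2,3)] obtain j where j: "b * x ^ j \<in> D - PP x" by auto
  have "(a * x ^ i) / (b * x ^ j) \<in> UU x" by (rule UU_div[OF UU_D[OF i] UU_D[OF j]])
  moreover have "(a * x ^ i) / (b * x ^ j) = z * x powi (int i - int j)" using ab(4) xK(3) by (simp add: power_int_diff)
  ultimately have "z * x powi (int i - int j) \<in> UU x" by simp
  thus ?thesis using vv_eq[OF z] by metis
qed

lemma vv_mult: assumes "a \<in> frac D" "a \<noteq> 0" "b \<in> frac D" "b \<noteq> 0" shows "vv x (a * b) = vv x a + vv x b"
proof (rule vv_eq)
  show "a * b \<in> frac D" "a * b \<noteq> 0" using assms subr_mult[OF K_subr] by auto
  have "(a * x powi vv x a) * (b * x powi vv x b) \<in> UU x" by (rule UU_mult) (use vv_ex assms in auto)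
  thus "a * b * x powi (vv x a + vv x b) \<in> UU x" using xK(3) by (simp add: power_int_add mult_ac)
qed

lemma vv_x: "vv x x = - 1" using UU_D[OF one_P] xK(3) by (intro vv_eq[OF xK(1,3)]) (simp add: power_int_minus)

lemma vv_D: assumes "b \<in> D" "b \<noteq> 0" shows "0 \<le> vv x b" "0 < vv x b \<longleftrightarrow> b \<in> PP x"
proof -
  obtain j where j: "b * x ^ j \<in> D - PP x" using pow_ex[OF assms] by auto
  have v: "vv x b = int j" by (rule vv_eq) (use assms D_sub_K UU_D[OF j] in auto)
  thus "0 \<le> vv x b" by simp
  show "0 < vv x b \<longleftrightarrow> b \<in> PP x"
  proof
    assume "0 < vv x b"
    show "b \<in> PP x"
    proof (rule ccontr)
      assume "b \<notin> PP x"
      hence "vv x b = 0" by (intro vv_eq) (use assms D_sub_K UU_D[of b] in auto)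
      thus False using \<open>0 < vv x b\<close> by simp
    qed
  next
    assume "b \<in> PP x"
    hence "j \<noteq> 0" using j by (cases j) auto
    thus "0 < vv x b" using v by simp
  qed
qed

text \<open>The valuation ring of \<open>vv x\<close> is the localization of \<open>D\<close> at
  \<open>PP x\<close>. For value \<open>j\<close>, the denominator is \<open>(p * x) ^ j\<close>
  times the one in the unit \<open>z * x ^ j\<close>, where \<open>p\<close> comes from
  \<open>uniformizer\<close>.\<close>

lemma vv_nonneg_iff: assumes z: "z \<in> frac D" "z \<noteq> 0" shows "0 \<le> vv x z \<longleftrightarrow> (\<exists>s\<in>D - PP x. s * z \<in> D)"
proof
  assume v: "0 \<le> vv x z"
  define j where "j = nat (vv x z)"
  have "z * x ^ j \<in> UU x" using vv_ex[OF z] v unfolding j_def by (simp add: power_int_def)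
  then obtain a b where ab: "a \<in> D - PP x" "b \<in> D - PP x" "z * x ^ j = a / b" unfolding UU_def by auto
  obtain p where p: "p \<in> PP x" "p * x \<in> D - PP x" using uniformizer by auto
  have pD: "p \<in> D" using p(1) unfolding PP_def by simp
  have "b * (p * x) ^ j * z = b * p ^ j * (z * x ^ j)" by (simp add: power_mult_distrib mult_ac)
  also have "\<dots> = p ^ j * a" using ab nP_nz[OF ab(2)] by simp
  finally have "b * (p * x) ^ j * z \<in> D" using ab(1) pD subr_mult[OF D_subr] subr_pow[OF D_subr] by auto
  moreover have "b * (p * x) ^ j \<in> D - PP x" by (rule nP_mult[OF ab(2) nP_pow[OF p(2)]])
  ultimately show "\<exists>s\<in>D - PP x. s * z \<in> D" by blast
next
  assume "\<exists>s\<in>D - PP x. s * z \<in> D"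
  then obtain s where s: "s \<in> D - PP x" "s * z \<in> D" by auto
  have s0: "s \<noteq> 0" by (rule nP_nz[OF s(1)])
  have "vv x s = 0" using vv_D[of s] s(1) s0 by auto
  moreover have "vv x (s * z) = vv x s + vv x z" by (rule vv_mult) (use s s0 z D_sub_K in auto)
  moreover have "0 \<le> vv x (s * z)" by (rule vv_D(1)[OF s(2)]) (use s0 z in simp)
  ultimately show "0 \<le> vv x z" by simp
qed

lemma vv_add_le: assumes "a \<in> frac D" "a \<noteq> 0" "b \<in> frac D" "b \<noteq> 0" "a + b \<noteq> 0" "vv x a \<le> vv x b" shows "vv x a \<le> vv x (a + b)"
proof -
  have ba: "b / a \<in> frac D" "b / a \<noteq> 0" using assms sfield_div[OF K_sfield] by auto
  have "vv x (b / a * a) = vv x (b / a) + vv x a" by (rule vv_mult[OF ba assms(1,2)])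
  hence "0 \<le> vv x (b / a)" using assms by simp
  then obtain s where s: "s \<in> D - PP x" "s * (b / a) \<in> D" using vv_nonneg_iff[OF ba] by auto
  have eq: "(1 + b / a) * a = a + b" using assms(2) by (simp add: field_simps)
  have n: "1 + b / a \<in> frac D" by (rule subr_add[OF K_subr subr_1[OF K_subr] ba(1)])
  have n: "1 + b / a \<in> frac D" "1 + b / a \<noteq> 0" using n eq assms(5) by (simp, metis mult_zero_left)
  have "s * (1 + b / a) \<in> D" using s subr_add[OF D_subr] by (simp add: distrib_left)
  hence "0 \<le> vv x (1 + b / a)" using vv_nonneg_iff[OF n] s by blast
  moreover have "vv x ((1 + b / a) * a) = vv x (1 + b / a) + vv x a" by (rule vv_mult[OF n assms(1,2)])
  ultimately show ?thesis unfolding eq by linarith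
qed

lemma vv_dval: "dval (frac D) (vv x)" unfolding dval_def
proof (intro conjI ballI impI)
  fix a b assume ab: "a \<in> frac D - {0}" "b \<in> frac D - {0}"
  thus "vv x (a * b) = vv x a + vv x b" using vv_mult by simp
  assume "a + b \<noteq> 0"
  thus "min (vv x a) (vv x b) \<le> vv x (a + b)" using vv_add_le[of a b] vv_add_le[of b a] ab by (cases "vv x a \<le> vv x b") (auto simp: add.commute)
next
  have i: "inverse x \<in> frac D" using xK(1) K_sfield unfolding sfield_def by simp
  have e: "inverse x * x powi 1 = 1" "inverse x \<noteq> 0" using xK(3) by simp_all
  have "inverse x * x powi 1 \<in> UU x" unfolding e(1) by (rule UU_D[OF one_P])
  from vv_eq[OF i e(2) this] have v1: "vv x (inverse x) = 1" .
  show "\<exists>y\<in>frac D - {0}. vv x y = 1" by (rule bexI[of _ "inverse x"], rule v1) (use i e(2) in simp)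
qed

end

text \<open>Distinct valuations have no inclusion between their denominator primes, so some
  \<open>c\<close> in \<open>PP x\<close> is a unit for \<open>vv y\<close>. Since
  \<open>c * x\<close> is in \<open>D\<close>, the element \<open>x\<close> has no pole at
  \<open>vv y\<close>: its only pole is at its own valuation.\<close>

lemma vv_other: assumes "x \<in> XX" "y \<in> XX" "vv x \<noteq> vv y" shows "0 \<le> vv y x"
proof -
  have "\<not> PP x \<subseteq> PP y"
  proof
    assume sub: "PP x \<subseteq> PP y"
    have "vv y z = vv x z" if z: "z \<in> frac D" "z \<noteq> 0" for z
    proof (rule dval_eqI[OF K_sfield vv_dval[OF assms(2)] vv_dval[OF assms(1)] _ z])
      show "\<forall>z\<in>frac D - {0}. 0 \<le> vv y z \<longrightarrow> 0 \<le> vv x z"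
      proof (intro ballI impI)
        fix z assume z: "z \<in> frac D - {0}" "0 \<le> vv y z"
        then obtain s where "s \<in> D - PP y" "s * z \<in> D" using vv_nonneg_iff[OF assms(2), of z] by auto
        hence "\<exists>s\<in>D - PP x. s * z \<in> D" using sub by (intro bexI[of _ s]) auto
        thus "0 \<le> vv x z" using vv_nonneg_iff[OF assms(1), of z] z(1) by simp
      qed
    qed
    moreover have "vv y z = vv x z" if "\<not> (z \<in> frac D \<and> z \<noteq> 0)" for z using that unfolding vv_def by auto
    ultimately have "vv x = vv y" by (intro ext) metis
    thus False using assms(3) by simp
  qed
  then obtain c where c: "c \<in> PP x" "c \<notin> PP y" by auto
  have cD: "c \<in> D" "c * x \<in> D" "c \<noteq> 0" using c zero_P[OF assms(2)] unfolding PP_def by auto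
  have "vv y c = 0" using vv_D[OF assms(2) cD(1,3)] c(2) by auto
  moreover have "vv y (c * x) = vv y c + vv y x" by (rule vv_mult[OF assms(2)]) (use cD xK[OF assms(1)] D_sub_K in auto)
  moreover have "0 \<le> vv y (c * x)" using vv_D(1)[OF assms(2) cD(2)] cD(3) xK(3)[OF assms(1)] by simp
  ultimately show ?thesis by simp
qed

text \<open>Among the denominator ideals of the multiples \<open>c * y\<close> outside
  \<open>D\<close> there is a maximal one, and maximality makes it prime. Its valuation is
  \<open>- 1\<close> at \<open>c * y\<close> and nonnegative at \<open>c\<close>, hence negative at
  \<open>y\<close>.\<close>

lemma vv_separates: assumes y: "y \<in> frac D" "y \<notin> D" shows "\<exists>x\<in>XX. vv x y < 0"
proof -
  define S where "S = {PP (c * y) | c. c \<in> D \<and> c * y \<notin> D}"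
  have "PP (1 * y) \<in> S" unfolding S_def using y subr_1[OF D_subr] by (intro CollectI exI[of _ 1]) auto
  hence "S \<noteq> {}" by auto
  moreover have "\<forall>E\<in>S. E \<subseteq> D \<and> dmod D E" unfolding S_def using PP_dmod unfolding PP_def by auto
  ultimately have "\<exists>M\<in>S. \<forall>E\<in>S. M \<subseteq> E \<longrightarrow> E = M" by (rule noeth_maximal[OF D_noeth])
  then obtain c where c: "c \<in> D" "c * y \<notin> D" "\<forall>E\<in>S. PP (c * y) \<subseteq> E \<longrightarrow> E = PP (c * y)" unfolding S_def by auto
  have cK: "c * y \<in> frac D" using c y D_sub_K subr_mult[OF K_subr] by auto
  have "c * y \<in> XX" unfolding XX_def
  proof (intro CollectI conjI ballI impI)
    show "c * y \<in> frac D - D" using cK c by simp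
    fix a b assume ab: "a \<in> D" "b \<in> D" "a * b \<in> PP (c * y)"
    show "a \<in> PP (c * y) \<or> b \<in> PP (c * y)"
    proof (cases "b \<in> PP (c * y)")
      case False
      hence "b * c * y \<notin> D" using ab(2) unfolding PP_def by (simp add: mult.assoc)
      hence "PP (b * c * y) \<in> S" unfolding S_def using ab(2) c(1) subr_mult[OF D_subr] by blast
      moreover have "PP (c * y) \<subseteq> PP (b * c * y)"
      proof
        fix z assume "z \<in> PP (c * y)"
        hence "z \<in> D" "b * (z * (c * y)) \<in> D" unfolding PP_def using subr_mult[OF D_subr ab(2)] by auto
        moreover have "b * (z * (c * y)) = z * (b * c * y)" by simp
        ultimately show "z \<in> PP (b * c * y)" unfolding PP_def by simp
      qed
      ultimately have "PP (b * c * y) = PP (c * y)" using c(3) by blast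
      moreover have "a * (b * c * y) = a * b * (c * y)" by simp
      hence "a * (b * c * y) \<in> D" using ab(3) unfolding PP_def by (simp only: mem_Collect_eq)
      hence "a \<in> PP (b * c * y)" using ab(1) unfolding PP_def by simp
      ultimately show ?thesis by simp
    qed simp
  qed
  moreover have "vv (c * y) y < 0"
  proof -
    have "c \<noteq> 0" using c(2) subr_0[OF D_subr] by auto
    moreover have "y \<noteq> 0" using y subr_0[OF D_subr] by auto
    ultimately have "vv (c * y) (c * y) = vv (c * y) c + vv (c * y) y" using vv_mult[OF \<open>c * y \<in> XX\<close>, of c y] c y D_sub_K by simp
    thus ?thesis using vv_x[OF \<open>c * y \<in> XX\<close>] vv_D(1)[OF \<open>c * y \<in> XX\<close> c(1) \<open>c \<noteq> 0\<close>] by simp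
  qed
  ultimately show ?thesis by blast
qed

text \<open>With infinitely many valuations \<open>w i\<close> positive at \<open>a\<close>, the
  ideals of elements of value at least \<open>w i a\<close> for all \<open>i > r\<close> would
  increase strictly with \<open>r\<close>: the product of \<open>a\<close> with the fraction of
  \<open>w (Suc r)\<close> loses value only at \<open>w (Suc r)\<close>.\<close>

lemma vv_finite: assumes a: "a \<in> D" "a \<noteq> 0" shows "finite {w\<in>vv ` XX. w a \<noteq> 0}"
proof (rule ccontr)
  assume "\<not> ?thesis"
  from infinite_countable_subset[OF this] obtain w :: "nat \<Rightarrow> 'a \<Rightarrow> int" where w: "inj w" "range w \<subseteq> {w\<in>vv ` XX. w a \<noteq> 0}" by auto
  have "\<forall>i. \<exists>x. x \<in> XX \<and> w i = vv x" using w(2) by auto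
  then obtain x where x: "\<And>i. x i \<in> XX" "\<And>i. w i = vv (x i)" by metis
  have wa: "0 < w i a" for i
  proof -
    have "w i a \<noteq> 0" using w(2) by auto
    thus ?thesis using vv_D(1)[OF x(1) a, of i] x(2)[of i] by simp
  qed
  define J where "J r = {b\<in>D. b = 0 \<or> (\<forall>i>r. w i a \<le> w i b)}" for r :: nat
  have Jm: "dmod D (J r)" for r unfolding dmod_def
  proof (intro conjI ballI)
    show "0 \<in> J r" unfolding J_def using subr_0[OF D_subr] by simp
    fix b c assume bc: "b \<in> J r" "c \<in> J r"
    show "b + c \<in> J r"
    proof (cases "b = 0 \<or> c = 0 \<or> b + c = 0")
      case True thus ?thesis using bc subr_0[OF D_subr] unfolding J_def by auto
    next
      case False
      have "w i a \<le> w i (b + c)" if "i > r" for i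
      proof -
        have "w i a \<le> w i b" "w i a \<le> w i c" using bc that False unfolding J_def by auto
        moreover have "min (w i b) (w i c) \<le> w i (b + c)" using vv_dval[OF x(1)[of i]] False bc D_sub_K unfolding x(2) dval_def J_def by auto
        ultimately show ?thesis by linarith
      qed
      thus ?thesis using bc subr_add[OF D_subr] unfolding J_def by auto
    qed
  next
    fix d b assume db: "d \<in> D" "b \<in> J r"
    show "d * b \<in> J r"
    proof (cases "d = 0 \<or> b = 0")
      case True thus ?thesis using subr_0[OF D_subr] unfolding J_def by auto
    next
      case False
      have bD: "b \<in> D" using db(2) unfolding J_def by simp
      have "w i a \<le> w i (d * b)" if "i > r" for i
      proof -
        have "w i (d * b) = w i d + w i b" unfolding x(2) by (rule vv_mult[OF x(1)]) (use False db bD D_sub_K in auto)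
        moreover have "0 \<le> w i d" unfolding x(2) using vv_D(1)[OF x(1) db(1)] False by simp
        moreover have "w i a \<le> w i b" using db that False unfolding J_def by auto
        ultimately show ?thesis by linarith
      qed
      thus ?thesis using db bD subr_mult[OF D_subr] unfolding J_def by auto
    qed
  qed
  have "\<exists>M\<in>range J. \<forall>E\<in>range J. M \<subseteq> E \<longrightarrow> E = M" by (rule noeth_maximal[OF D_noeth]) (use Jm in "auto simp: J_def")
  then obtain r where r: "\<forall>E\<in>range J. J r \<subseteq> E \<longrightarrow> E = J r" by auto
  have "J r \<subseteq> J (Suc r)" unfolding J_def by auto
  hence Jeq: "J (Suc r) = J r" using r by blast
  let ?x = "x (Suc r)"
  have xx: "?x \<in> XX" by (rule x(1))
  have "a \<in> PP ?x" using vv_D(2)[OF xx a] wa[of "Suc r"] x(2) by simp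
  hence ax: "a * ?x \<in> D" unfolding PP_def by simp
  have nz: "a * ?x \<noteq> 0" using a xK(3)[OF xx] by simp
  have val: "w i (a * ?x) = w i a + w i ?x" for i unfolding x(2)[of i] by (rule vv_mult[OF x(1)]) (use a xK[OF xx] D_sub_K in auto)
  have "a * ?x \<in> J (Suc r)"
  proof -
    have "w i a \<le> w i (a * ?x)" if "i > Suc r" for i
    proof -
      have "w (Suc r) \<noteq> w i" using w(1) that by (auto dest: injD)
      hence "0 \<le> w i ?x" unfolding x(2) by (intro vv_other[OF xx x(1)])
      thus ?thesis using val[of i] by simp
    qed
    thus ?thesis unfolding J_def using ax by auto
  qed
  moreover have "a * ?x \<notin> J r"
  proof -
    have "w (Suc r) ?x = - 1" unfolding x(2) by (rule vv_x[OF xx])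
    hence "\<not> w (Suc r) a \<le> w (Suc r) (a * ?x)" using val[of "Suc r"] by simp
    thus ?thesis unfolding J_def using nz by auto
  qed
  ultimately show False using Jeq by simp
qed

theorem good_krull: "krull (frac D) D (vv ` XX)"
  unfolding krull_def
proof (intro conjI ballI)
  fix w assume "w \<in> vv ` XX" thus "dval (frac D) w" using vv_dval by auto
next
  fix z assume z: "z \<in> frac D - {0}"
  then obtain a b where ab: "a \<in> D" "b \<in> D" "b \<noteq> 0" "z = a / b" unfolding frac_def by auto
  have a0: "a \<noteq> 0" using z ab by auto
  have "w z = 0" if "w \<in> vv ` XX" "w a = 0" "w b = 0" for w
  proof -
    have "dval (frac D) w" using that(1) vv_dval by auto
    hence "w (z * b) = w z + w b" using dval_mult[of "frac D" w z b] z ab D_sub_K by auto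
    thus ?thesis using that ab by simp
  qed
  hence "{w\<in>vv ` XX. w z \<noteq> 0} \<subseteq> {w\<in>vv ` XX. w a \<noteq> 0} \<union> {w\<in>vv ` XX. w b \<noteq> 0}" by blast
  thus "finite {w\<in>vv ` XX. w z \<noteq> 0}" using vv_finite[OF ab(1) a0] vv_finite[OF ab(2,3)] finite_subset by blast
  show "z \<in> D \<longleftrightarrow> (\<forall>w\<in>vv ` XX. 0 \<le> w z)" using vv_D(1) vv_separates[of z] z by (auto simp: not_le[symmetric])
qed

end

text \<open>The integral closure of an affine domain in its fraction field is obtained from a
  normalization \<open>D\<close> by adjoining the generators and closing up. It is noetherian and
  normal, so it is an intersection of discrete valuation rings of finite character.\<close>

theorem krull_affine:
  fixes k :: "'a::{alg_closed_field,field_char_0} set"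
  assumes k: "sfield k"
  shows "\<exists>W. (\<forall>w\<in>W. dval (frac (gen k ss)) w) \<and> (\<forall>x\<in>frac (gen k ss) - {0}. finite {w\<in>W. w x \<noteq> 0}) \<and>
    (\<forall>x\<in>frac (gen k ss) - {0}. (\<forall>w\<in>W. 0 \<le> w x) \<longleftrightarrow>
        (\<exists>p\<in>PD (gen k ss). lead_coeff p = 1 \<and> poly p x = 0))"
proof -
  have ks: "subr k" by (rule sfield_subr[OF k])
  let ?C = "gen k ss" let ?K = "frac ?C"
  have C: "subr ?C" by (rule subr_gen[OF ks])
  obtain D where D: "good D" "k \<subseteq> D" "D \<subseteq> ?C" "\<forall>x\<in>?C. integ D x" using noether_normalization[OF k] by blast
  have Ds: "subr D" "noeth D" using D(1) unfolding good_def by auto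
  have "\<forall>s\<in>set ss. integ D s" using D(4) gen_mem[OF ks] by blast
  have KK: "sfield ?K" by (rule sfield_frac[OF C])
  have CK: "?C \<subseteq> ?K" using frac_base[OF C] by (rule subsetI)
  have "set ss \<subseteq> ?K" "D \<subseteq> ?K" using gen_mem[OF ks, of _ ss] CK D(3) by auto
  from good_closure_list[OF KK D(1) this(2,1) \<open>\<forall>s\<in>set ss. integ D s\<close>] obtain B where
    B: "good B" "D \<subseteq> B" "B \<subseteq> ?K" "set ss \<subseteq> B" "\<forall>z\<in>B. integ D z" by (elim exE conjE)
  have Bs: "subr B" using B(1) unfolding good_def by simp
  have CB: "?C \<subseteq> B" by (rule gen_min[OF ks Bs]) (use D(2) B in auto)
  have KB: "frac B = ?K"
  proof
    show "frac B \<subseteq> ?K" using sfield_div[OF KK] B(3) unfolding frac_def[of B] by auto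
    show "?K \<subseteq> frac B" using CB unfolding frac_def by blast
  qed
  have kr: "krull ?K B (vv B ` XX B)" using good_krull[OF B(1)] unfolding KB .
  \<comment> \<open>\<open>B\<close> is the integral closure of \<open>?C\<close>: integrality over
    \<open>?C\<close> is integrality over \<open>D\<close>, and the normal ring \<open>B\<close>
    contains every element of \<open>?K\<close> that is integral over \<open>D\<close>.\<close>
  have "x \<in> B \<longleftrightarrow> (\<exists>p\<in>PD ?C. lead_coeff p = 1 \<and> poly p x = 0)" if x: "x \<in> ?K" for x
  proof
    assume "x \<in> B"
    hence "integ D x" using B(5) by simp
    from integ_poly[OF Ds this] show "\<exists>p\<in>PD ?C. lead_coeff p = 1 \<and> poly p x = 0" using PD_mono[OF D(3)] by blast
  next
    assume "\<exists>p\<in>PD ?C. lead_coeff p = 1 \<and> poly p x = 0"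
    then obtain p where "p \<in> PD ?C" "lead_coeff p = 1" "poly p x = 0" by auto
    from integ_trans[OF Ds(1) D(4) monic_dspan[OF C this]] have "integ D x" .
    hence "integ B x" using dspan_mono[OF B(2) order.refl] unfolding integ_def by meson
    thus "x \<in> B" using good_integ[OF B(1)] x unfolding KB by simp
  qed
  thus ?thesis using kr unfolding krull_def by (intro exI[of _ "vv B ` XX B"]) blast
qed

subsection \<open>Transport to HOL-Algebra fields\<close>

definition rval :: "('a, 'b) ring_scheme \<Rightarrow> ('a \<Rightarrow> int) \<Rightarrow> bool" where
  "rval K w \<longleftrightarrow> (\<forall>x\<in>carrier K - {\<zero>\<^bsub>K\<^esub>}. \<forall>y\<in>carrier K - {\<zero>\<^bsub>K\<^esub>}. w (x \<otimes>\<^bsub>K\<^esub> y) = w x + w y \<and>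
       (x \<oplus>\<^bsub>K\<^esub> y \<noteq> \<zero>\<^bsub>K\<^esub> \<longrightarrow> min (w x) (w y) \<le> w (x \<oplus>\<^bsub>K\<^esub> y))) \<and>
     (\<exists>x\<in>carrier K - {\<zero>\<^bsub>K\<^esub>}. w x = 1)"

definition char0 :: "('a, 'b) ring_scheme \<Rightarrow> bool" where
  "char0 K \<longleftrightarrow> (\<forall>j::nat. 0 < j \<longrightarrow> add_pow K j \<one>\<^bsub>K\<^esub> \<noteq> \<zero>\<^bsub>K\<^esub>)"

text \<open>The integral closure of \<open>C\<close> as an intersection of discrete valuation rings.
  Nonnegativity is demanded on \<open>C\<close> only; it extends to integral elements because
  valuation rings are integrally closed.\<close>

definition krull_for :: "('a, 'b) ring_scheme \<Rightarrow> 'a set \<Rightarrow> bool" where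
  "krull_for K C \<longleftrightarrow> (\<exists>W. (\<forall>w\<in>W. rval K w) \<and> (\<forall>x\<in>carrier K - {\<zero>\<^bsub>K\<^esub>}. finite {w\<in>W. w x \<noteq> 0}) \<and>
     (\<forall>c\<in>C - {\<zero>\<^bsub>K\<^esub>}. \<forall>w\<in>W. 0 \<le> w c) \<and>
     (\<forall>x\<in>carrier K - {\<zero>\<^bsub>K\<^esub>}. (\<forall>w\<in>W. 0 \<le> w x) \<longrightarrow> x \<in> integral_closure K C))"

text \<open>A property of the field alone, with the ground field and the generators quantified
  inside, so that a single counterexample can be chosen in the definition of
  \<open>amb\<close>.\<close>

definition affine_krull :: "('a, 'b) ring_scheme \<Rightarrow> bool" where
  "affine_krull K \<longleftrightarrow> (\<forall>k S. k \<subseteq> carrier K \<longrightarrow> \<one>\<^bsub>K\<^esub> \<in> k \<longrightarrow>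
     (\<forall>x\<in>k. \<forall>y\<in>k. x \<ominus>\<^bsub>K\<^esub> y \<in> k \<and> x \<otimes>\<^bsub>K\<^esub> y \<in> k) \<longrightarrow> (\<forall>x\<in>k - {\<zero>\<^bsub>K\<^esub>}. inv\<^bsub>K\<^esub> x \<in> k) \<longrightarrow>
     finite S \<longrightarrow> S \<subseteq> carrier K \<longrightarrow>
     (\<forall>x\<in>carrier K. \<exists>a\<in>generate_ring K (k \<union> S). \<exists>b\<in>generate_ring K (k \<union> S) - {\<zero>\<^bsub>K\<^esub>}. x = a \<otimes>\<^bsub>K\<^esub> inv\<^bsub>K\<^esub> b) \<longrightarrow>
     krull_for K (generate_ring K (k \<union> S)))"

definition emb :: "('a, 'b) ring_scheme \<Rightarrow> ('a \<Rightarrow> 'c::field) \<Rightarrow> bool" where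
  "emb K \<phi> \<longleftrightarrow> inj_on \<phi> (carrier K) \<and> \<phi> \<one>\<^bsub>K\<^esub> = 1 \<and>
     (\<forall>x\<in>carrier K. \<forall>y\<in>carrier K. \<phi> (x \<oplus>\<^bsub>K\<^esub> y) = \<phi> x + \<phi> y \<and> \<phi> (x \<otimes>\<^bsub>K\<^esub> y) = \<phi> x * \<phi> y)"

context
  fixes K :: "('a, 'b) ring_scheme" (structure) and \<phi> :: "'a \<Rightarrow> 'c::field"
  assumes K: "field K" and \<phi>: "emb K \<phi>"
begin

interpretation field K by (rule K)

lemma emb_add: "x \<in> carrier K \<Longrightarrow> y \<in> carrier K \<Longrightarrow> \<phi> (x \<oplus> y) = \<phi> x + \<phi> y" using \<phi> unfolding emb_def by blast
lemma emb_mult: "x \<in> carrier K \<Longrightarrow> y \<in> carrier K \<Longrightarrow> \<phi> (x \<otimes> y) = \<phi> x * \<phi> y" using \<phi> unfolding emb_def by blast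
lemma emb_one: "\<phi> \<one> = 1" using \<phi> unfolding emb_def by blast
lemma emb_inj: "x \<in> carrier K \<Longrightarrow> y \<in> carrier K \<Longrightarrow> \<phi> x = \<phi> y \<Longrightarrow> x = y" using \<phi> unfolding emb_def inj_on_def by blast
lemma emb_zero: "\<phi> \<zero> = 0"
proof -
  have "\<phi> \<zero> + 0 = \<phi> \<zero> + \<phi> \<zero>" using emb_add[of \<zero> \<zero>] by simp
  thus ?thesis by (simp only: add_left_cancel)
qed
lemma emb_eq_0: "x \<in> carrier K \<Longrightarrow> \<phi> x = 0 \<longleftrightarrow> x = \<zero>" using emb_inj[of x \<zero>] emb_zero by auto
lemma emb_neg: "x \<in> carrier K \<Longrightarrow> \<phi> (\<ominus> x) = - \<phi> x"
  using emb_add[of x "\<ominus> x"] emb_zero by (simp add: r_neg eq_neg_iff_add_eq_0 add.commute)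
lemma emb_minus: "x \<in> carrier K \<Longrightarrow> y \<in> carrier K \<Longrightarrow> \<phi> (x \<ominus> y) = \<phi> x - \<phi> y"
  by (simp add: a_minus_def emb_add emb_neg)
lemma emb_inv: assumes "x \<in> carrier K" "x \<noteq> \<zero>" shows "\<phi> (inv x) = inverse (\<phi> x)"
proof -
  have u: "x \<in> Units K" using assms field_Units by auto
  have "\<phi> (x \<otimes> inv x) = 1" using Units_r_inv[OF u] emb_one by simp
  hence "\<phi> x * \<phi> (inv x) = 1" using emb_mult[of x "inv x"] u assms by simp
  thus ?thesis by (metis inverse_unique)
qed
lemma emb_pow: "x \<in> carrier K \<Longrightarrow> \<phi> (x [^] (n::nat)) = \<phi> x ^ n" by (induction n) (simp_all add: emb_one emb_mult mult.commute)

lemma emb_eval: "set q \<subseteq> carrier K \<Longrightarrow> x \<in> carrier K \<Longrightarrow> \<phi> (eval q x) = poly (Poly (rev (map \<phi> q))) (\<phi> x)"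
proof (induction q)
  case (Cons a q)
  have "eval (a # q) x = a \<otimes> x [^] length q \<oplus> eval q x" by simp
  moreover have "eval q x \<in> carrier K" using Cons by (intro eval_in_carrier) auto
  ultimately have "\<phi> (eval (a # q) x) = \<phi> a * \<phi> x ^ length q + poly (Poly (rev (map \<phi> q))) (\<phi> x)"
    using Cons by (simp add: emb_add emb_mult emb_pow)
  thus ?case by (simp add: Poly_append poly_monom mult.commute)
qed (simp add: emb_zero)

lemma emb_sfield:
  assumes "k \<subseteq> carrier K" "\<one> \<in> k" "\<forall>x\<in>k. \<forall>y\<in>k. x \<ominus> y \<in> k \<and> x \<otimes> y \<in> k" "\<forall>x\<in>k - {\<zero>}. inv x \<in> k"
  shows "sfield (\<phi> ` k)"
proof -
  have c: "x \<in> carrier K" if "x \<in> k" for x using assms(1) that by (rule subsetD)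
  have s: "subr (\<phi> ` k)" unfolding subr_def
  proof (intro conjI ballI)
    show "1 \<in> \<phi> ` k" using assms(2) emb_one by (metis imageI)
    fix a b assume "a \<in> \<phi> ` k" "b \<in> \<phi> ` k"
    then obtain x y where x: "x \<in> k" "y \<in> k" "a = \<phi> x" "b = \<phi> y" by auto
    thus "a - b \<in> \<phi> ` k" "a * b \<in> \<phi> ` k" using assms(3) c[of x] c[of y] emb_minus[of x y] emb_mult[of x y] by (metis imageI)+
  qed
  moreover have "inverse a \<in> \<phi> ` k" if a: "a \<in> \<phi> ` k" for a
  proof -
    obtain x where x: "x \<in> k" "a = \<phi> x" using a by auto
    show ?thesis
    proof (cases "x = \<zero>")
      case True thus ?thesis using a x emb_zero by simp
    next
      case False thus ?thesis using emb_inv[OF c[OF x(1)]] x assms(4) by (metis DiffI imageI singletonD)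
    qed
  qed
  ultimately show ?thesis unfolding sfield_def by blast
qed

lemma emb_generate:
  assumes k: "k \<subseteq> carrier K" "subr (\<phi> ` k)" and S: "set sl \<subseteq> carrier K"
  shows "\<phi> ` generate_ring K (k \<union> set sl) = gen (\<phi> ` k) (map \<phi> sl)"
proof
  let ?C = "generate_ring K (k \<union> set sl)"
  have H: "k \<union> set sl \<subseteq> carrier K" using k S by simp
  have c: "x \<in> carrier K" if "x \<in> ?C" for x using generate_ring_in_carrier[OF H that] .
  have g: "subr (gen (\<phi> ` k) (map \<phi> sl))" by (rule subr_gen[OF k(2)])
  have "\<phi> x \<in> gen (\<phi> ` k) (map \<phi> sl)" if "x \<in> ?C" for x using that
  proof (induction rule: generate_ring.induct)
    case one show ?case using emb_one subr_1[OF g] by simp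
  next
    case (incl h) thus ?case using gen_base[OF k(2)] gen_mem[OF k(2), of "\<phi> h" "map \<phi> sl"] by auto
  next
    case (a_inv h) thus ?case using emb_neg[OF c] subr_minus[OF g] by simp
  next
    case (eng_add a b) thus ?case using emb_add[OF c c] subr_add[OF g] by simp
  next
    case (eng_mult a b) thus ?case using emb_mult[OF c c] subr_mult[OF g] by simp
  qed
  thus "\<phi> ` ?C \<subseteq> gen (\<phi> ` k) (map \<phi> sl)" by (rule image_subsetI)
  have "subr (\<phi> ` ?C)" unfolding subr_def
  proof (intro conjI ballI)
    show "1 \<in> \<phi> ` ?C" using emb_one generate_ring.one[of K "k \<union> set sl"] by (metis imageI)
    fix a b assume "a \<in> \<phi> ` ?C" "b \<in> \<phi> ` ?C"
    then obtain x y where x: "x \<in> ?C" "y \<in> ?C" "a = \<phi> x" "b = \<phi> y" by auto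
    have "x \<ominus> y \<in> ?C" unfolding a_minus_def by (intro generate_ring.eng_add generate_ring.a_inv x)
    moreover have "x \<otimes> y \<in> ?C" by (intro generate_ring.eng_mult x)
    ultimately show "a - b \<in> \<phi> ` ?C" "a * b \<in> \<phi> ` ?C" using emb_minus[OF c c, OF x(1,2)] emb_mult[OF c c, OF x(1,2)] x(3,4) by (metis imageI)+
  qed
  moreover have "k \<subseteq> ?C" "set sl \<subseteq> ?C" using generate_ring.incl[of _ "k \<union> set sl" K] by auto
  hence "\<phi> ` k \<subseteq> \<phi> ` ?C" "set (map \<phi> sl) \<subseteq> \<phi> ` ?C" by (auto simp del: subset_image_iff)
  ultimately show "gen (\<phi> ` k) (map \<phi> sl) \<subseteq> \<phi> ` ?C" by (intro gen_min[OF k(2)])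
qed

lemma emb_integral:
  assumes C: "C \<subseteq> carrier K" "\<one> \<in> C" and x: "x \<in> carrier K" and p: "p \<in> PD (\<phi> ` C)" "lead_coeff p = 1" "poly p (\<phi> x) = 0"
  shows "x \<in> integral_closure K C"
proof -
  define \<psi> where "\<psi> = the_inv_into (carrier K) \<phi>"
  have inj: "inj_on \<phi> (carrier K)" using \<phi> unfolding emb_def by simp
  have \<psi>: "\<psi> c \<in> C \<and> \<phi> (\<psi> c) = c" if c: "c \<in> \<phi> ` C" for c
  proof -
    obtain y where y: "y \<in> C" "c = \<phi> y" using c by auto
    hence "\<psi> c = y" unfolding \<psi>_def using the_inv_into_f_f[OF inj] C(1) by (simp add: subset_iff)
    thus ?thesis using y by simp
  qed
  have co: "set (coeffs p) \<subseteq> \<phi> ` C" using PD_coeff[OF p(1)] range_coeff[of p] by (auto simp: coeffs_def)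
  define q where "q = map \<psi> (rev (coeffs p))"
  have p0: "p \<noteq> 0" using p(2) by auto
  have ne: "coeffs p \<noteq> []" using p0 by simp
  have qC: "set q \<subseteq> C" unfolding q_def using co \<psi> by auto
  have "map \<phi> q = rev (coeffs p)" unfolding q_def map_map by (rule map_idI) (use co \<psi> in "auto simp: subset_iff")
  hence "Poly (rev (map \<phi> q)) = p" by simp
  hence "\<phi> (eval q x) = 0" using emb_eval[OF _ x, of q] qC C(1) p(3) by auto
  hence ev: "eval q x = \<zero>" using emb_eq_0 eval_in_carrier[of q x] qC C(1) x by blast
  have "hd q = \<psi> (last (coeffs p))" unfolding q_def using ne by (simp add: hd_map hd_rev)
  hence "hd q = \<psi> 1" using p(2) p0 by (simp add: last_coeffs_eq_coeff_degree)
  moreover have "\<psi> 1 = \<one>" unfolding \<psi>_def using the_inv_into_f_f[OF inj one_closed] emb_one by simp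
  ultimately have hd: "hd q = \<one>" by simp
  have "q \<noteq> []" unfolding q_def using ne by simp
  thus ?thesis unfolding integral_closure_def polynomial_def using qC hd ev x by auto
qed

end

text \<open>The algebra is carried along \<open>\<phi>\<close> to subsets of the type
  \<open>'c\<close>, and the valuations obtained there are pulled back. The assumption on fractions
  identifies the field with the fraction field of the algebra.\<close>

lemma emb_affine_krull:
  fixes \<phi> :: "'a \<Rightarrow> 'c::{alg_closed_field,field_char_0}"
  assumes K: "field K" and \<phi>: "emb K \<phi>" shows "affine_krull K" unfolding affine_krull_def
proof (intro allI impI)
  interpret field K by (rule K)
  fix k S
  let ?C = "generate_ring K (k \<union> S)"
  assume k: "k \<subseteq> carrier K" "\<one>\<^bsub>K\<^esub> \<in> k" "\<forall>x\<in>k. \<forall>y\<in>k. x \<ominus>\<^bsub>K\<^esub> y \<in> k \<and> x \<otimes>\<^bsub>K\<^esub> y \<in> k" "\<forall>x\<in>k - {\<zero>\<^bsub>K\<^esub>}. inv\<^bsub>K\<^esub> x \<in> k"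
    and S: "finite S" "S \<subseteq> carrier K" and fr: "\<forall>x\<in>carrier K. \<exists>a\<in>?C. \<exists>b\<in>?C - {\<zero>\<^bsub>K\<^esub>}. x = a \<otimes>\<^bsub>K\<^esub> inv\<^bsub>K\<^esub> b"
  obtain sl where sl: "S = set sl" using finite_list[OF S(1)] by auto
  note e = emb_add[OF K \<phi>] emb_mult[OF K \<phi>]
  have sf: "sfield (\<phi> ` k)" by (rule emb_sfield[OF K \<phi> k])
  have gC: "\<phi> ` ?C = gen (\<phi> ` k) (map \<phi> sl)" unfolding sl by (rule emb_generate[OF K \<phi> k(1) sfield_subr[OF sf]]) (use S sl in simp)
  have C: "?C \<subseteq> carrier K" by (rule generate_ring_incl) (use k S in simp)
  have cC: "x \<in> carrier K" if "x \<in> ?C" for x using C that by (rule subsetD)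
  let ?F = "frac (gen (\<phi> ` k) (map \<phi> sl))"
  have F: "\<phi> ` carrier K \<subseteq> ?F"
  proof (rule image_subsetI)
    fix x assume "x \<in> carrier K"
    then obtain a b where ab: "a \<in> ?C" "b \<in> ?C" "b \<noteq> \<zero>\<^bsub>K\<^esub>" "x = a \<otimes>\<^bsub>K\<^esub> inv\<^bsub>K\<^esub> b" using fr by blast
    have "inv\<^bsub>K\<^esub> b \<in> carrier K" using cC[OF ab(2)] ab(3) field_Units by auto
    hence "\<phi> x = \<phi> a / \<phi> b" using ab cC emb_mult[OF K \<phi>] emb_inv[OF K \<phi>] by (simp add: divide_inverse)
    moreover have "\<phi> b \<noteq> 0" using ab(3) emb_eq_0[OF K \<phi> cC[OF ab(2)]] by simp
    ultimately show "\<phi> x \<in> ?F" unfolding frac_def gC[symmetric] using ab by blast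
  qed
  obtain W where W: "\<forall>w\<in>W. dval ?F w" "\<forall>x\<in>?F - {0}. finite {w\<in>W. w x \<noteq> 0}"
     "\<forall>x\<in>?F - {0}. (\<forall>w\<in>W. 0 \<le> w x) \<longleftrightarrow> (\<exists>p\<in>PD (gen (\<phi> ` k) (map \<phi> sl)). lead_coeff p = 1 \<and> poly p x = 0)"
    using krull_affine[OF sf, of "map \<phi> sl"] by blast
  have nz: "\<phi> x \<in> ?F - {0}" if "x \<in> carrier K - {\<zero>\<^bsub>K\<^esub>}" for x
  proof -
    have "\<phi> x \<in> ?F" using F that by blast
    thus ?thesis using emb_eq_0[OF K \<phi>] that by simp
  qed
  have FK: "\<exists>x\<in>carrier K - {\<zero>\<^bsub>K\<^esub>}. y = \<phi> x" if y: "y \<in> ?F - {0}" for y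
  proof -
    have "\<exists>a\<in>\<phi> ` ?C. \<exists>b\<in>\<phi> ` ?C. y = a / b \<and> b \<noteq> 0" using y unfolding frac_def gC[symmetric] by auto
    then obtain a b where ab: "a \<in> ?C" "b \<in> ?C" "y = \<phi> a / \<phi> b" "\<phi> b \<noteq> 0" by auto
    have b0: "b \<noteq> \<zero>\<^bsub>K\<^esub>" using ab(4) emb_zero[OF K \<phi>] by auto
    have ib: "inv\<^bsub>K\<^esub> b \<in> carrier K" using cC[OF ab(2)] b0 field_Units by auto
    have "y = \<phi> (a \<otimes>\<^bsub>K\<^esub> inv\<^bsub>K\<^esub> b)"
      using ab emb_mult[OF K \<phi> cC[OF ab(1)] ib] emb_inv[OF K \<phi> cC[OF ab(2)] b0] by (simp add: divide_inverse)
    moreover have "a \<otimes>\<^bsub>K\<^esub> inv\<^bsub>K\<^esub> b \<in> carrier K" using cC[OF ab(1)] ib by simp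
    moreover have "a \<otimes>\<^bsub>K\<^esub> inv\<^bsub>K\<^esub> b \<noteq> \<zero>\<^bsub>K\<^esub>" using calculation y emb_zero[OF K \<phi>] by auto
    ultimately show ?thesis by blast
  qed
  show "krull_for K ?C" unfolding krull_for_def
  proof (intro exI[of _ "(\<lambda>w. w \<circ> \<phi>) ` W"] conjI ballI impI)
    fix w' assume "w' \<in> (\<lambda>w. w \<circ> \<phi>) ` W"
    then obtain w where w: "w \<in> W" "w' = w \<circ> \<phi>" by auto
    hence d: "dval ?F w" using W(1) by blast
    show "rval K w'" unfolding rval_def
    proof (intro conjI ballI impI)
      fix x y assume xy: "x \<in> carrier K - {\<zero>\<^bsub>K\<^esub>}" "y \<in> carrier K - {\<zero>\<^bsub>K\<^esub>}"
      note n = nz[OF xy(1)] nz[OF xy(2)]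
      show "w' (x \<otimes>\<^bsub>K\<^esub> y) = w' x + w' y" using d n e(2)[of x y] xy w(2) unfolding dval_def by auto
      assume "x \<oplus>\<^bsub>K\<^esub> y \<noteq> \<zero>\<^bsub>K\<^esub>"
      hence "\<phi> (x \<oplus>\<^bsub>K\<^esub> y) \<noteq> 0" using emb_eq_0[OF K \<phi>, of "x \<oplus>\<^bsub>K\<^esub> y"] xy by simp
      thus "min (w' x) (w' y) \<le> w' (x \<oplus>\<^bsub>K\<^esub> y)" using d n e(1)[of x y] xy w(2) unfolding dval_def by auto
    next
      obtain y where "y \<in> ?F - {0}" "w y = 1" using d unfolding dval_def by blast
      thus "\<exists>x\<in>carrier K - {\<zero>\<^bsub>K\<^esub>}. w' x = 1" using FK[of y] w(2) by auto
    qed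
  next
    fix x assume x: "x \<in> carrier K - {\<zero>\<^bsub>K\<^esub>}"
    have "{w'\<in>(\<lambda>w. w \<circ> \<phi>) ` W. w' x \<noteq> 0} \<subseteq> (\<lambda>w. w \<circ> \<phi>) ` {w\<in>W. w (\<phi> x) \<noteq> 0}" by auto
    thus "finite {w'\<in>(\<lambda>w. w \<circ> \<phi>) ` W. w' x \<noteq> 0}" using W(2) nz[OF x] finite_subset finite_imageI by meson
  next
    fix c w' assume c: "c \<in> ?C - {\<zero>\<^bsub>K\<^esub>}" and "w' \<in> (\<lambda>w. w \<circ> \<phi>) ` W"
    then obtain w where w: "w \<in> W" "w' = w \<circ> \<phi>" by auto
    have cK: "c \<in> carrier K - {\<zero>\<^bsub>K\<^esub>}" using c cC by simp
    let ?G = "gen (\<phi> ` k) (map \<phi> sl)"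
    have G: "subr ?G" by (rule subr_gen[OF sfield_subr[OF sf]])
    have cG: "\<phi> c \<in> ?G" using c gC by blast
    have "[:- \<phi> c, 1:] \<in> PD ?G" unfolding PD_def using cG subr_minus[OF G] subr_1[OF G] subr_0[OF G] by (auto simp: coeff_pCons split: nat.splits)
    moreover have "lead_coeff [:- \<phi> c, 1:] = 1" "poly [:- \<phi> c, 1:] (\<phi> c) = 0" by simp_all
    ultimately have "\<forall>w\<in>W. 0 \<le> w (\<phi> c)" using W(3) nz[OF cK] by blast
    thus "0 \<le> w' c" using w by simp
  next
    fix x assume x: "x \<in> carrier K - {\<zero>\<^bsub>K\<^esub>}" "\<forall>w'\<in>(\<lambda>w. w \<circ> \<phi>) ` W. 0 \<le> w' x"
    hence "\<forall>w\<in>W. 0 \<le> w (\<phi> x)" by simp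
    then obtain p where p: "p \<in> PD (\<phi> ` ?C)" "lead_coeff p = 1" "poly p (\<phi> x) = 0" using W(3) nz[OF x(1)] unfolding gC by blast
    have "\<one>\<^bsub>K\<^esub> \<in> ?C" by (rule generate_ring.one)
    from emb_integral[OF K \<phi> C this _ p] show "x \<in> integral_closure K ?C" using x(1) by blast
  qed
qed

text \<open>Type definitions cannot depend on a hypothetical field. Instead, the type below is built from
  a counterexample chosen by Hilbert's operator: if the statement fails for some field with
  elements in "'a", then it fails for one that embeds into this type.\<close>

definition amb :: "('a + rat) ring" where
  "amb = (SOME R. field R \<and> char0 R \<and> ((\<exists>K::'a ring. field K \<and> char0 K \<and> \<not> affine_krull K) \<longrightarrow>
     (\<exists>K::'a ring. field K \<and> \<not> affine_krull K \<and> ring_hom_ring K R (Inl :: 'a \<Rightarrow> 'a + rat))))"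

lemma hom_add_pow:
  assumes "ring_hom_ring R S h" shows "h (add_pow R (n::nat) \<one>\<^bsub>R\<^esub>) = add_pow S n \<one>\<^bsub>S\<^esub>"
proof -
  interpret ring_hom_ring R S h by (rule assms)
  show ?thesis by (induction n) (simp_all add: R.add.nat_pow_Suc S.add.nat_pow_Suc)
qed

lemma image_field:
  assumes K: "field K" "char0 K" and f: "inj f" shows "field (image_ring f K)" "char0 (image_ring f K)" "ring_hom_ring K (image_ring f K) f"
proof -
  interpret field K by (rule K(1))
  have inj: "inj_on f (carrier K)" using f inj_on_subset by blast
  show F: "field (image_ring f K)" by (rule inj_imp_image_ring_is_field[OF inj])
  interpret F: field "image_ring f K" by (rule F)
  have "f \<in> ring_iso K (image_ring f K)" by (rule inj_imp_image_ring_iso[OF inj])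
  thus hom: "ring_hom_ring K (image_ring f K) f" unfolding ring_iso_def by (intro ring_hom_ringI2) (auto intro: ring_axioms F.ring_axioms)
  interpret h: ring_hom_ring K "image_ring f K" f by (rule hom)
  show "char0 (image_ring f K)" unfolding char0_def
  proof (intro allI impI notI)
    fix j :: nat assume j: "0 < j" "add_pow (image_ring f K) j \<one>\<^bsub>image_ring f K\<^esub> = \<zero>\<^bsub>image_ring f K\<^esub>"
    hence "f (add_pow K j \<one>\<^bsub>K\<^esub>) = f \<zero>\<^bsub>K\<^esub>" using hom_add_pow[OF hom, of j] h.hom_zero by simp
    thus False using injD[OF f] K(2) j(1) unfolding char0_def by blast
  qed
qed

lemma rat_field: "field (ring_of_type_algebra :: rat ring)" "char0 (ring_of_type_algebra :: rat ring)"
proof -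
  show f: "field (ring_of_type_algebra :: rat ring)" by (rule field_from_type_algebra)
  let ?R = "ring_of_type_algebra :: rat ring"
  interpret field ?R by (rule f)
  have "add_pow ?R n \<one>\<^bsub>?R\<^esub> = of_nat n" for n :: nat by (induction n) (simp_all add: add.nat_pow_Suc, simp_all add: ring_of_type_algebra_def)
  thus "char0 ?R" unfolding char0_def by (simp add: ring_of_type_algebra_def)
qed

text \<open>If there is a counterexample, its image under \<open>Inl\<close> serves; otherwise a
  copy of the rationals under \<open>Inr\<close> does. In both cases the type below is a field of
  characteristic zero, as its class instances require.\<close>

lemma amb_props: "field (amb :: ('a + rat) ring) \<and> char0 (amb :: ('a + rat) ring) \<and>
   ((\<exists>K::'a ring. field K \<and> char0 K \<and> \<not> affine_krull K) \<longrightarrow>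
     (\<exists>K::'a ring. field K \<and> \<not> affine_krull K \<and> ring_hom_ring K amb (Inl :: 'a \<Rightarrow> 'a + rat)))" unfolding amb_def
proof (rule someI_ex, cases "\<exists>K::'a ring. field K \<and> char0 K \<and> \<not> affine_krull K")
  case True
  then obtain K :: "'a ring" where K: "field K" "char0 K" "\<not> affine_krull K" by blast
  have i: "inj (Inl :: 'a \<Rightarrow> 'a + rat)" by simp
  show "\<exists>R :: ('a + rat) ring. field R \<and> char0 R \<and> ((\<exists>K::'a ring. field K \<and> char0 K \<and> \<not> affine_krull K) \<longrightarrow>
     (\<exists>K::'a ring. field K \<and> \<not> affine_krull K \<and> ring_hom_ring K R (Inl :: 'a \<Rightarrow> 'a + rat)))"
    using image_field[OF K(1,2) i] K by (intro exI[of _ "image_ring (Inl :: 'a \<Rightarrow> 'a + rat) K"]) blast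
next
  case False
  have i: "inj (Inr :: rat \<Rightarrow> 'a + rat)" by simp
  show "\<exists>R :: ('a + rat) ring. field R \<and> char0 R \<and> ((\<exists>K::'a ring. field K \<and> char0 K \<and> \<not> affine_krull K) \<longrightarrow>
     (\<exists>K::'a ring. field K \<and> \<not> affine_krull K \<and> ring_hom_ring K R (Inl :: 'a \<Rightarrow> 'a + rat)))"
    using image_field[OF rat_field i] False by (intro exI[of _ "image_ring (Inr :: rat \<Rightarrow> 'a + rat) ring_of_type_algebra"]) blast
qed

lemma amb_field: "Ring.field amb" using amb_props by blast

interpretation amb: domain amb by (rule field.axioms(1)[OF amb_field])

typedef 'a fld = "carrier (amb :: ('a + rat) ring)" by (rule exI[of _ "\<zero>\<^bsub>amb\<^esub>"]) simp

instantiation fld :: (type) field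
begin
definition "zero_fld = Abs_fld \<zero>\<^bsub>amb\<^esub>"
definition "one_fld = Abs_fld \<one>\<^bsub>amb\<^esub>"
definition "plus_fld x y = Abs_fld (Rep_fld x \<oplus>\<^bsub>amb\<^esub> Rep_fld y)"
definition "times_fld x y = Abs_fld (Rep_fld x \<otimes>\<^bsub>amb\<^esub> Rep_fld y)"
definition "uminus_fld x = Abs_fld (\<ominus>\<^bsub>amb\<^esub> Rep_fld x)"
definition "minus_fld (x :: 'a fld) y = x + (- y)"
definition "inverse_fld (x :: 'a fld) = (if x = 0 then 0 else Abs_fld (inv\<^bsub>amb\<^esub> Rep_fld x))"
definition "divide_fld (x :: 'a fld) y = x * inverse y"

lemma Rep_fld_simps: "Rep_fld 0 = \<zero>\<^bsub>amb\<^esub>" "Rep_fld 1 = \<one>\<^bsub>amb\<^esub>" "Rep_fld (x + y) = Rep_fld x \<oplus>\<^bsub>amb\<^esub> Rep_fld y"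
  "Rep_fld (x * y) = Rep_fld x \<otimes>\<^bsub>amb\<^esub> Rep_fld y" "Rep_fld (- x) = \<ominus>\<^bsub>amb\<^esub> Rep_fld x"
  "Rep_fld x \<in> carrier amb" unfolding zero_fld_def one_fld_def plus_fld_def times_fld_def uminus_fld_def
  using Rep_fld[of x] Rep_fld[of y] by (simp_all add: Abs_fld_inverse)

instance
proof
  fix a b c :: "'a fld"
  note s = Rep_fld_simps
  note ext = Rep_fld_inject[THEN iffD1]
  show "a * b * c = a * (b * c)" by (rule ext) (simp add: s amb.m_assoc)
  show "a * b = b * a" by (rule ext) (simp add: s amb.m_comm)
  show "1 * a = a" by (rule ext) (simp add: s)
  show "a + b + c = a + (b + c)" by (rule ext) (simp add: s amb.a_assoc)
  show "a + b = b + a" by (rule ext) (simp add: s amb.a_comm)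
  show "0 + a = a" by (rule ext) (simp add: s)
  show "- a + a = 0" by (rule ext) (simp add: s amb.l_neg)
  show "a - b = a + - b" by (rule minus_fld_def)
  show "(a + b) * c = a * c + b * c" by (rule ext) (simp add: s amb.l_distr)
  show "(0 :: 'a fld) \<noteq> 1" using amb.zero_not_one s(1,2) by metis
  show "inverse a * a = 1" if "a \<noteq> 0"
  proof (rule ext)
    have "Rep_fld a \<noteq> \<zero>\<^bsub>amb\<^esub>" using that s(1) Rep_fld_inject by metis
    hence u: "Rep_fld a \<in> Units amb" using field.field_Units[OF amb_field] s(6) by auto
    hence "Rep_fld (inverse a) = inv\<^bsub>amb\<^esub> Rep_fld a" using that unfolding inverse_fld_def by (simp add: Abs_fld_inverse)
    thus "Rep_fld (inverse a * a) = Rep_fld 1" using u by (simp add: s)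
  qed
  show "a div b = a * inverse b" by (rule divide_fld_def)
  show "inverse (0 :: 'a fld) = 0" unfolding inverse_fld_def by simp
qed

end

instance fld :: (type) field_char_0
proof
  have R: "Rep_fld (of_nat n :: 'a fld) = add_pow amb n \<one>\<^bsub>amb\<^esub>" for n
    by (induction n) (simp_all add: Rep_fld_simps amb.add.nat_pow_Suc amb.a_comm)
  have "of_nat n \<noteq> (0 :: 'a fld)" if "n > 0" for n
  proof
    assume "of_nat n = (0 :: 'a fld)"
    hence "add_pow (amb :: ('a + rat) ring) n \<one>\<^bsub>amb\<^esub> = \<zero>\<^bsub>amb\<^esub>" using R[of n] by (simp add: Rep_fld_simps)
    thus False using amb_props that unfolding char0_def by blast
  qed
  hence "inj (of_nat :: nat \<Rightarrow> 'a fld)" by (metis (no_types, lifting) injI linorder_neqE_nat of_nat_diff less_imp_le right_minus_eq zero_less_diff)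
  thus "inj (of_nat :: nat \<Rightarrow> 'a fld)" .
qed

text \<open>The given field only shows that a counterexample exists. The one selected for
  \<open>amb\<close> embeds into the algebraic closure of \<open>fld\<close>, so it satisfies the
  statement after all.\<close>

lemma affine_krull_ring: fixes K :: "'a ring" assumes "field K" "char0 K" shows "affine_krull K"
proof (rule ccontr)
  assume "\<not> affine_krull K"
  then obtain K :: "'a ring" where K: "field K" "\<not> affine_krull K" "ring_hom_ring K amb (Inl :: 'a \<Rightarrow> 'a + rat)" using assms amb_props by blast
  interpret h: ring_hom_ring K amb "Inl :: 'a \<Rightarrow> 'a + rat" by (rule K(3))
  define \<phi> :: "'a \<Rightarrow> 'a fld alg_closure" where "\<phi> x = to_ac (Abs_fld (Inl x))" for x
  have c: "Inl x \<in> carrier (amb :: ('a + rat) ring)" if "x \<in> carrier K" for x using h.hom_closed that .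
  have "emb K \<phi>" unfolding emb_def
  proof (intro conjI ballI inj_onI)
    fix x y assume xy: "x \<in> carrier K" "y \<in> carrier K"
    { assume "\<phi> x = \<phi> y"
      thus "x = y" unfolding \<phi>_def using Abs_fld_inject[OF c c, OF xy] by simp }
    show "\<phi> (x \<oplus>\<^bsub>K\<^esub> y) = \<phi> x + \<phi> y" "\<phi> (x \<otimes>\<^bsub>K\<^esub> y) = \<phi> x * \<phi> y" unfolding \<phi>_def to_ac_add[symmetric] to_ac_mult[symmetric]
      using xy c by (simp_all add: plus_fld_def times_fld_def Abs_fld_inverse)
  next
    show "\<phi> \<one>\<^bsub>K\<^esub> = 1" unfolding \<phi>_def using h.hom_one one_fld_def to_ac_1 by metis
  qed
  from emb_affine_krull[OF K(1) this] show False using K(2) by simp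
qed

text \<open>The choice behind \<open>amb\<close> ranges over plain ring records, while the theorem
  speaks of record extensions; cutting off the extra fields changes none of the notions
  involved.\<close>

definition trunc :: "('a, 'b) ring_scheme \<Rightarrow> 'a ring" where
  "trunc K = \<lparr>carrier = carrier K, monoid.mult = monoid.mult K, one = one K, ring.zero = ring.zero K, add = add K\<rparr>"

lemma trunc_simps [simp]: "carrier (trunc K) = carrier K" "monoid.mult (trunc K) = monoid.mult K"
  "one (trunc K) = one K" "ring.zero (trunc K) = ring.zero K" "add (trunc K) = add K" by (simp_all add: trunc_def)

lemma trunc_inv [simp]: "m_inv (trunc K) = m_inv K" "a_inv (trunc K) = a_inv K" "a_minus (trunc K) = a_minus K"
  by (simp_all add: fun_eq_iff m_inv_def a_inv_def a_minus_def)

lemma trunc_pow [simp]: "x [^]\<^bsub>trunc K\<^esub> (n::nat) = x [^]\<^bsub>K\<^esub> n" "add_pow (trunc K) n x = add_pow K n x"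
  by (simp_all add: nat_pow_def add_pow_def)

lemma trunc_field: assumes "field K" shows "field (trunc K)"
proof -
  interpret field K by (rule assms)
  have "cring (trunc K)"
  proof (rule cringI)
    show "abelian_group (trunc K)" by (rule abelian_groupI) (auto simp: a_assoc intro: a_comm l_neg[of _] exI dest: a_inv_closed l_neg)
    show "comm_monoid (trunc K)" by (rule comm_monoidI) (auto simp: m_assoc intro: m_comm)
  qed (simp add: l_distr)
  moreover have "Units (trunc K) = Units K" by (simp add: Units_def)
  ultimately show ?thesis by (intro cring.cring_fieldI) (simp_all add: field_Units)
qed

lemma trunc_generate [simp]: "generate_ring (trunc K) H = generate_ring K H"
proof (intro equalityI subsetI)
  fix x assume "x \<in> generate_ring (trunc K) H" thus "x \<in> generate_ring K H" by (induction rule: generate_ring.induct) (auto intro: generate_ring.intros)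
next
  fix x assume "x \<in> generate_ring K H" thus "x \<in> generate_ring (trunc K) H"
  proof (induction rule: generate_ring.induct)
    case one show ?case using generate_ring.one[where R="trunc K" and H=H] by simp
  next
    case (incl h) thus ?case by (rule generate_ring.incl)
  next
    case (a_inv h) show ?case using generate_ring.a_inv[OF a_inv(2)] by simp
  next
    case (eng_add a b) show ?case using generate_ring.eng_add[OF eng_add(3,4)] by simp
  next
    case (eng_mult a b) show ?case using generate_ring.eng_mult[OF eng_mult(3,4)] by simp
  qed
qed

lemma trunc_eval: assumes "ring K" shows "ring.eval (trunc K) p x = ring.eval K p x"
proof -
  interpret ring K by (rule assms)
  have "ring (trunc K)" by (rule ringI) (auto intro!: abelian_groupI monoidI simp: a_assoc m_assoc l_distr r_distr intro: a_comm exI dest: l_neg)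
  then interpret t: ring "trunc K" .
  show ?thesis by (induction p) simp_all
qed

lemma trunc_integral_closure: assumes "ring K" shows "integral_closure (trunc K) C = integral_closure K C"
  unfolding integral_closure_def polynomial_def using trunc_eval[OF assms] by simp

theorem affine_krull: assumes "field K" "char0 K" shows "affine_krull K"
proof -
  interpret field K by (rule assms)
  have "affine_krull (trunc K)" by (rule affine_krull_ring[OF trunc_field[OF assms(1)]]) (use assms(2) in "simp add: char0_def")
  thus ?thesis unfolding affine_krull_def krull_for_def rval_def by (simp add: trunc_integral_closure[OF ring_axioms])
qed

subsection \<open>Discrete valuations of a field\<close>

lemma subring_carrier_ideal:
  assumes R: "ring R" and J: "J \<subseteq> carrier R" "\<zero>\<^bsub>R\<^esub> \<in> J" "\<And>a b. a \<in> J \<Longrightarrow> b \<in> J \<Longrightarrow> a \<oplus>\<^bsub>R\<^esub> b \<in> J"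
    "\<And>a r. a \<in> J \<Longrightarrow> r \<in> carrier R \<Longrightarrow> r \<otimes>\<^bsub>R\<^esub> a \<in> J" "\<And>a r. a \<in> J \<Longrightarrow> r \<in> carrier R \<Longrightarrow> a \<otimes>\<^bsub>R\<^esub> r \<in> J"
  shows "ideal J R"
proof -
  interpret ring R by (rule R)
  show ?thesis
  proof (rule idealI[OF R])
    show "subgroup J (add_monoid R)"
    proof (rule add.subgroupI)
      show "J \<subseteq> carrier R" by (rule J(1))
      show "J \<noteq> {}" using J(2) by auto
      show "a \<oplus>\<^bsub>R\<^esub> b \<in> J" if "a \<in> J" "b \<in> J" for a b using J(3) that .
      show "\<ominus>\<^bsub>R\<^esub> a \<in> J" if a: "a \<in> J" for a
      proof -
        have "a \<in> carrier R" using J(1) a by (rule subsetD)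
        hence "\<ominus>\<^bsub>R\<^esub> a = (\<ominus>\<^bsub>R\<^esub> \<one>\<^bsub>R\<^esub>) \<otimes>\<^bsub>R\<^esub> a" by (simp add: l_minus)
        thus ?thesis using J(4)[OF a, of "\<ominus>\<^bsub>R\<^esub> \<one>\<^bsub>R\<^esub>"] by simp
      qed
    qed
  qed (use J in auto)
qed

lemma ideal_props: assumes "ideal J R"
  shows "J \<subseteq> carrier R" "\<zero>\<^bsub>R\<^esub> \<in> J" "\<And>a b. a \<in> J \<Longrightarrow> b \<in> J \<Longrightarrow> a \<oplus>\<^bsub>R\<^esub> b \<in> J"
    "\<And>a r. a \<in> J \<Longrightarrow> r \<in> carrier R \<Longrightarrow> r \<otimes>\<^bsub>R\<^esub> a \<in> J"
proof -
  interpret ideal J R by (rule assms)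
  show "J \<subseteq> carrier R" by (rule additive_subgroup.a_subset[OF is_additive_subgroup])
  show "\<zero>\<^bsub>R\<^esub> \<in> J" by (rule additive_subgroup.zero_closed[OF is_additive_subgroup])
  show "\<And>a b. a \<in> J \<Longrightarrow> b \<in> J \<Longrightarrow> a \<oplus>\<^bsub>R\<^esub> b \<in> J" by (rule additive_subgroup.a_closed[OF is_additive_subgroup])
  show "\<And>a r. a \<in> J \<Longrightarrow> r \<in> carrier R \<Longrightarrow> r \<otimes>\<^bsub>R\<^esub> a \<in> J" by (rule I_l_closed)
qed

locale kfield = field K for K :: "('a, 'b) ring_scheme" (structure)
begin

definition nz :: "'a set" where "nz = carrier K - {\<zero>}"

definition vring :: "('a \<Rightarrow> int) \<Rightarrow> 'a set" where
  "vring w = {x\<in>carrier K. x = \<zero> \<or> 0 \<le> w x}"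

lemma nzD: "x \<in> nz \<Longrightarrow> x \<in> carrier K" "x \<in> nz \<Longrightarrow> x \<noteq> \<zero>" unfolding nz_def by auto
lemma nzI: "x \<in> carrier K \<Longrightarrow> x \<noteq> \<zero> \<Longrightarrow> x \<in> nz" unfolding nz_def by auto
lemma nz_Units: "nz = Units K" unfolding nz_def by (simp add: field_Units)
lemma nz_mult: "x \<in> nz \<Longrightarrow> y \<in> nz \<Longrightarrow> x \<otimes> y \<in> nz" unfolding nz_def by (auto simp: integral_iff)
lemma nz_one: "\<one> \<in> nz" unfolding nz_def by simp
lemma nz_inv: "x \<in> nz \<Longrightarrow> inv x \<in> nz" unfolding nz_Units by (rule Units_inv_Units)
lemma nz_pow: "x \<in> nz \<Longrightarrow> x [^] (n::nat) \<in> nz" by (induction n) (auto intro: nz_mult nz_one)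
lemma nz_r_inv: "x \<in> nz \<Longrightarrow> x \<otimes> inv x = \<one>" unfolding nz_Units by (rule Units_r_inv)
lemma nz_l_inv: "x \<in> nz \<Longrightarrow> inv x \<otimes> x = \<one>" unfolding nz_Units by (rule Units_l_inv)
lemma div_cancel: "x \<in> nz \<Longrightarrow> a \<in> carrier K \<Longrightarrow> a \<otimes> inv x \<otimes> x = a"
  using nz_l_inv[of x] nzD(1)[OF nz_inv, of x] nzD(1)[of x] by (simp add: m_assoc)
lemma mult_cancel: "x \<in> nz \<Longrightarrow> a \<in> carrier K \<Longrightarrow> x \<otimes> a \<otimes> inv x = a"
  using nz_r_inv[of x] nzD(1)[OF nz_inv, of x] nzD(1)[of x] by (simp add: m_comm[of x a] m_assoc)
lemma mult_nz: "x \<in> carrier K \<Longrightarrow> y \<in> carrier K \<Longrightarrow> x \<otimes> y \<in> nz \<Longrightarrow> x \<in> nz \<and> y \<in> nz"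
  unfolding nz_def by (auto simp: integral_iff)

context
  fixes w :: "'a \<Rightarrow> int"
  assumes w: "rval K w"
begin

lemma rv_mult: "x \<in> nz \<Longrightarrow> y \<in> nz \<Longrightarrow> w (x \<otimes> y) = w x + w y" using w unfolding rval_def nz_def by blast
lemma rv_add: "x \<in> nz \<Longrightarrow> y \<in> nz \<Longrightarrow> x \<oplus> y \<noteq> \<zero> \<Longrightarrow> min (w x) (w y) \<le> w (x \<oplus> y)"
  using w unfolding rval_def nz_def by blast
lemma rv_ex: "\<exists>x\<in>nz. w x = 1" using w unfolding rval_def nz_def by blast
lemma rv_one: "w \<one> = 0" using rv_mult[OF nz_one nz_one] by simp
lemma rv_inv: "x \<in> nz \<Longrightarrow> w (inv x) = - w x" using rv_mult[of x "inv x"] nz_inv[of x] nz_r_inv[of x] rv_one by simp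
lemma rv_div: "x \<in> nz \<Longrightarrow> y \<in> nz \<Longrightarrow> w (x \<otimes> inv y) = w x - w y"
  using rv_mult[of x "inv y"] nz_inv[of y] rv_inv[of y] by simp
lemma rv_pow: "x \<in> nz \<Longrightarrow> w (x [^] (n::nat)) = int n * w x" by (induction n) (auto simp: rv_one rv_mult nz_pow algebra_simps)
lemma rv_neg: assumes x: "x \<in> nz" shows "w (\<ominus> x) = w x"
proof -
  have m: "\<ominus> \<one> \<in> nz" unfolding nz_def by simp
  have "w (\<ominus> \<one> \<otimes> \<ominus> \<one>) = w (\<ominus> \<one>) + w (\<ominus> \<one>)" by (rule rv_mult[OF m m])
  hence "w (\<ominus> \<one>) = 0" using rv_one by (simp add: l_minus)
  moreover have "\<ominus> x = \<ominus> \<one> \<otimes> x" using nzD(1)[OF x] by (simp add: l_minus)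
  ultimately show ?thesis using rv_mult[OF m x] by simp
qed

lemma vring_closed: "x \<in> vring w \<Longrightarrow> y \<in> vring w \<Longrightarrow> x \<oplus> y \<in> vring w"
  "x \<in> vring w \<Longrightarrow> y \<in> vring w \<Longrightarrow> x \<otimes> y \<in> vring w" "x \<in> vring w \<Longrightarrow> \<ominus> x \<in> vring w" "\<one> \<in> vring w" "\<zero> \<in> vring w"
proof -
  show "\<one> \<in> vring w" "\<zero> \<in> vring w" unfolding vring_def using rv_one by auto
  show "x \<in> vring w \<Longrightarrow> \<ominus> x \<in> vring w" unfolding vring_def using rv_neg[of x] nzI[of x] by (cases "x = \<zero>") auto
  assume xy: "x \<in> vring w" "y \<in> vring w"
  hence c: "x \<in> carrier K" "y \<in> carrier K" unfolding vring_def by auto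
  show "x \<oplus> y \<in> vring w"
  proof (cases "x = \<zero> \<or> y = \<zero> \<or> x \<oplus> y = \<zero>")
    case True thus ?thesis using xy c unfolding vring_def by auto
  next
    case False
    thus ?thesis using rv_add[OF nzI nzI, of x y] c xy unfolding vring_def by auto
  qed
  show "x \<otimes> y \<in> vring w"
  proof (cases "x = \<zero> \<or> y = \<zero>")
    case True thus ?thesis using xy c unfolding vring_def by auto
  next
    case False
    thus ?thesis using rv_mult[OF nzI nzI, of x y] c xy unfolding vring_def by auto
  qed
qed

lemma vring_subring: "subring (vring w) K" by (rule subringI) (use vring_closed in "auto simp: vring_def")

lemma vring_nonneg: "x \<in> nz \<Longrightarrow> x \<in> vring w \<longleftrightarrow> 0 \<le> w x" unfolding vring_def nz_def by auto

text \<open>If \<open>x\<close> had negative value, the leading term of the monic equation would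
  have strictly smaller value than all the others together, so they could not cancel.\<close>

lemma monic_nonneg:
  assumes p: "set p \<subseteq> vring w" "p \<noteq> []" "hd p = \<one>" "eval p x = \<zero>" and x: "x \<in> carrier K" shows "x \<in> vring w"
proof (rule ccontr)
  assume n: "x \<notin> vring w"
  hence xnz: "x \<in> nz" and neg: "w x < 0" using x unfolding vring_def nz_def by auto
  \<comment> \<open>As \<open>w x < 0\<close> and the coefficients have nonnegative value, the
    highest power in \<open>q\<close>, which is \<open>length q - 1\<close>, bounds the value from
    below.\<close>
  have le: "eval q x = \<zero> \<or> w (eval q x) \<ge> int (length q - 1) * w x" if "set q \<subseteq> vring w" for q using that
  proof (induction q)
    case (Cons a q)
    have ac: "a \<in> carrier K" "a \<in> vring w" using Cons.prems unfolding vring_def by auto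
    have qc: "eval q x \<in> carrier K" using Cons.prems x by (intro eval_in_carrier) (auto simp: vring_def)
    let ?t = "a \<otimes> x [^] length q"
    have tc: "?t \<in> carrier K" using ac x by simp
    have e: "eval (a # q) x = ?t \<oplus> eval q x" by simp
    have t: "?t = \<zero> \<or> w ?t \<ge> int (length q) * w x"
    proof (cases "a = \<zero>")
      case False
      hence "a \<in> nz" using ac nzI by auto
      thus ?thesis using rv_mult[OF _ nz_pow[OF xnz]] rv_pow[OF xnz] ac(2) vring_nonneg by auto
    qed (use x in simp)
    have q: "eval q x = \<zero> \<or> w (eval q x) \<ge> int (length q) * w x"
    proof -
      have "int (length q - 1) * w x \<ge> int (length q) * w x" using neg by (intro mult_right_mono_neg) auto
      thus ?thesis using Cons by auto
    qed
    show ?case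
    proof (cases "?t = \<zero> \<or> eval q x = \<zero> \<or> eval (a # q) x = \<zero>")
      case True thus ?thesis using t q e tc qc by auto
    next
      case False
      hence "min (w ?t) (w (eval q x)) \<le> w (?t \<oplus> eval q x)" using tc qc e by (intro rv_add nzI) auto
      thus ?thesis using t q e False by auto
    qed
  qed simp
  obtain q where q: "p = \<one> # q" using p(2,3) by (cases p) auto
  have qv: "set q \<subseteq> vring w" using p(1) q by simp
  have qc: "eval q x \<in> carrier K" using qv x by (intro eval_in_carrier) (auto simp: vring_def)
  let ?t = "x [^] length q"
  have "?t \<oplus> eval q x = \<zero>" using p(4) q x by simp
  hence eq: "eval q x = \<ominus> ?t" using qc x by (metis minus_equality nat_pow_closed a_comm)
  have "w (eval q x) = int (length q) * w x" unfolding eq using rv_neg[OF nz_pow[OF xnz]] rv_pow[OF xnz] by simp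
  moreover have "eval q x \<noteq> \<zero>" unfolding eq using nzD[OF nz_pow[OF xnz, of "length q"]] by simp
  moreover have "length q \<noteq> 0"
  proof
    assume "length q = 0"
    thus False using p(4) q by simp
  qed
  ultimately have "int (length q) * w x \<ge> int (length q - 1) * w x" using le[OF qv] by simp
  moreover have "int (length q - 1) = int (length q) - 1" using \<open>length q \<noteq> 0\<close> by linarith
  hence "int (length q - 1) * w x = int (length q) * w x - w x" by (simp add: algebra_simps)
  ultimately show False using neg by simp
qed

lemma vring_max_ideal: "ideal {x\<in>vring w. x = \<zero> \<or> 0 < w x} (K\<lparr>carrier := vring w\<rparr>)"
proof (rule subring_carrier_ideal)
  show "ring (K\<lparr>carrier := vring w\<rparr>)" by (rule subring_is_ring[OF vring_subring])
  fix a b assume ab: "a \<in> {x\<in>vring w. x = \<zero> \<or> 0 < w x}" "b \<in> {x\<in>vring w. x = \<zero> \<or> 0 < w x}"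
  hence c: "a \<in> carrier K" "b \<in> carrier K" unfolding vring_def by auto
  have s: "a \<oplus> b \<in> vring w" using ab vring_closed(1) by auto
  have "a \<oplus> b = \<zero> \<or> 0 < w (a \<oplus> b)"
  proof (cases "a = \<zero> \<or> b = \<zero> \<or> a \<oplus> b = \<zero>")
    case True thus ?thesis using ab c by auto
  next
    case False
    thus ?thesis using rv_add[OF nzI nzI, of a b] c ab by auto
  qed
  thus "a \<oplus>\<^bsub>K\<lparr>carrier := vring w\<rparr>\<^esub> b \<in> {x\<in>vring w. x = \<zero> \<or> 0 < w x}" using s by simp
next
  fix a r assume ar: "a \<in> {x\<in>vring w. x = \<zero> \<or> 0 < w x}" "r \<in> carrier (K\<lparr>carrier := vring w\<rparr>)"
  hence c: "a \<in> carrier K" "r \<in> carrier K" unfolding vring_def by auto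
  have s: "r \<otimes> a \<in> vring w" using ar vring_closed(2) by auto
  have "r \<otimes> a = \<zero> \<or> 0 < w (r \<otimes> a)"
  proof (cases "a = \<zero> \<or> r = \<zero>")
    case True thus ?thesis using c by auto
  next
    case False
    thus ?thesis using rv_mult[OF nzI nzI, of r a] c ar vring_nonneg[OF nzI, of r] by auto
  qed
  thus "r \<otimes>\<^bsub>K\<lparr>carrier := vring w\<rparr>\<^esub> a \<in> {x\<in>vring w. x = \<zero> \<or> 0 < w x}"
    "a \<otimes>\<^bsub>K\<lparr>carrier := vring w\<rparr>\<^esub> r \<in> {x\<in>vring w. x = \<zero> \<or> 0 < w x}" using s m_comm[OF c] by simp_all
qed (use vring_closed(5) in auto)

lemma vring_maximal:
  assumes "maximalideal J (K\<lparr>carrier := vring w\<rparr>)" shows "J = {x\<in>vring w. x = \<zero> \<or> 0 < w x}"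
proof -
  let ?V = "K\<lparr>carrier := vring w\<rparr>" and ?M = "{x\<in>vring w. x = \<zero> \<or> 0 < w x}"
  interpret V: domain ?V by (rule subring_is_domain[OF vring_subring])
  interpret J: maximalideal J ?V by (rule assms)
  note Jp = ideal_props[OF J.is_ideal]
  have JM: "J \<subseteq> ?M"
  proof
    fix x assume xJ: "x \<in> J"
    hence xv: "x \<in> vring w" using Jp(1) by auto
    show "x \<in> ?M"
    proof (rule ccontr)
      assume "x \<notin> ?M"
      hence x: "x \<in> nz" "w x = 0" using xv unfolding vring_def nz_def by auto
      hence "inv x \<in> vring w" using vring_nonneg[OF nz_inv] rv_inv by simp
      hence "inv x \<otimes> x \<in> J" using Jp(4)[OF xJ, of "inv x"] by simp
      hence "\<one> \<in> J" using nz_l_inv[OF x(1)] by simp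
      hence "y \<in> J" if "y \<in> vring w" for y using Jp(4)[of "\<one>" y] that by (simp add: vring_def)
      thus False using Jp(1) J.I_notcarr by auto
    qed
  qed
  have "ideal ?M ?V" by (rule vring_max_ideal)
  hence "?M = J \<or> ?M = vring w" using J.I_maximal[of ?M] JM by auto
  moreover have "\<one> \<in> vring w" "\<one> \<notin> ?M" using vring_closed(4) rv_one by auto
  ultimately show ?thesis by blast
qed

lemma vring_PIdl: assumes p: "p \<in> nz" "w p = 1" shows "PIdl\<^bsub>K\<lparr>carrier := vring w\<rparr>\<^esub> p = {x\<in>vring w. x = \<zero> \<or> 0 < w x}"
proof (intro equalityI subsetI)
  fix x assume "x \<in> PIdl\<^bsub>K\<lparr>carrier := vring w\<rparr>\<^esub> p"
  then obtain r where r: "r \<in> vring w" "x = r \<otimes> p" unfolding cgenideal_def by auto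
  have rc: "r \<in> carrier K" using r(1) unfolding vring_def by simp
  have pv: "p \<in> vring w" using vring_nonneg[OF p(1)] p(2) by simp
  have "x \<in> vring w" using vring_closed(2)[OF r(1) pv] r(2) by simp
  moreover have "x = \<zero> \<or> 0 < w x"
  proof (cases "r = \<zero>")
    case True thus ?thesis using r nzD(1)[OF p(1)] by simp
  next
    case False thus ?thesis using rv_mult[OF nzI p(1), of r] rc r p vring_nonneg[OF nzI, of r] by auto
  qed
  ultimately show "x \<in> {x\<in>vring w. x = \<zero> \<or> 0 < w x}" by simp
next
  fix x assume x: "x \<in> {x\<in>vring w. x = \<zero> \<or> 0 < w x}"
  hence xc: "x \<in> carrier K" unfolding vring_def by simp
  have ic: "inv p \<in> carrier K" using nzD(1)[OF nz_inv[OF p(1)]] .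
  have "x \<otimes> inv p \<in> vring w"
  proof (cases "x = \<zero>")
    case True thus ?thesis using ic vring_closed(5) by simp
  next
    case False
    hence "x \<in> nz" using xc nzI by simp
    thus ?thesis using vring_nonneg[OF nz_mult[OF _ nz_inv[OF p(1)]], of x] rv_div[OF _ p(1), of x] p(2) x False by auto
  qed
  moreover have "x = x \<otimes> inv p \<otimes> p" using div_cancel[OF p(1) xc] by simp
  ultimately show "x \<in> PIdl\<^bsub>K\<lparr>carrier := vring w\<rparr>\<^esub> p" unfolding cgenideal_def by auto
qed

lemma vring_PIdl_maximal: assumes p: "p \<in> nz" "w p = 1"
  shows "maximalideal (PIdl\<^bsub>K\<lparr>carrier := vring w\<rparr>\<^esub> p) (K\<lparr>carrier := vring w\<rparr>)"
proof -
  let ?V = "K\<lparr>carrier := vring w\<rparr>" and ?M = "{x\<in>vring w. x = \<zero> \<or> 0 < w x}"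
  show ?thesis unfolding vring_PIdl[OF p]
  proof (rule maximalidealI[OF vring_max_ideal])
    have "\<one> \<in> vring w" "\<one> \<notin> ?M" using vring_closed(4) rv_one by auto
    thus "carrier ?V \<noteq> ?M" by (simp, blast)
    fix J assume J: "ideal J ?V" "?M \<subseteq> J" "J \<subseteq> carrier ?V"
    note Jp = ideal_props[OF J(1)]
    show "J = ?M \<or> J = carrier ?V"
    proof (rule disjCI)
      assume ne: "J \<noteq> carrier ?V"
      have "x \<in> ?M" if xJ: "x \<in> J" for x
      proof (rule ccontr)
        assume "x \<notin> ?M"
        hence x: "x \<in> nz" "w x = 0" using xJ Jp(1) unfolding vring_def nz_def by auto
        hence "inv x \<in> vring w" using vring_nonneg[OF nz_inv] rv_inv by simp
        hence "inv x \<otimes> x \<in> J" using Jp(4)[OF xJ, of "inv x"] by simp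
        hence "\<one> \<in> J" using nz_l_inv[OF x(1)] by simp
        hence "y \<in> J" if "y \<in> vring w" for y using Jp(4)[of "\<one>" y] that by (simp add: vring_def)
        thus False using ne Jp(1) by auto
      qed
      thus "J = ?M" using J(2) by auto
    qed
  qed
qed

lemma rv_int_pow: "x \<in> nz \<Longrightarrow> x [^] (l::int) \<in> nz" "x \<in> nz \<Longrightarrow> w (x [^] (l::int)) = l * w x"
  unfolding int_pow_def2 by (auto simp: nz_pow nz_inv rv_inv rv_pow simp del: pow_nat)

lemma vring_Units: "Units (K\<lparr>carrier := vring w\<rparr>) = {x\<in>nz. w x = 0}"
proof (intro equalityI subsetI)
  fix x assume "x \<in> Units (K\<lparr>carrier := vring w\<rparr>)"
  then obtain y where y: "x \<in> vring w" "y \<in> vring w" "x \<otimes> y = \<one>" unfolding Units_def by auto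
  hence c: "x \<in> carrier K" "y \<in> carrier K" unfolding vring_def by auto
  hence n: "x \<in> nz" "y \<in> nz" using mult_nz[OF c] y(3) nz_one by auto
  thus "x \<in> {x\<in>nz. w x = 0}" using rv_mult[OF n] y rv_one vring_nonneg[OF n(1)] vring_nonneg[OF n(2)] by auto
next
  fix x assume "x \<in> {x\<in>nz. w x = 0}"
  hence x: "x \<in> nz" "w x = 0" by auto
  hence "x \<in> vring w" "inv x \<in> vring w" using vring_nonneg[OF x(1)] vring_nonneg[OF nz_inv[OF x(1)]] rv_inv by auto
  thus "x \<in> Units (K\<lparr>carrier := vring w\<rparr>)" unfolding Units_def using nz_l_inv[OF x(1)] nz_r_inv[OF x(1)] by auto
qed

text \<open>Any generator of the maximal ideal divides an element of value 1 and has positive value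
  itself, so its value is 1. This makes the exponent in the definition of \<open>dvr_ord\<close>
  unique and equal to the value.\<close>

lemma dvr_ord_vring: assumes x: "x \<in> carrier K" shows "dvr_ord K (vring w) x = (if x = \<zero> then \<infinity> else ereal (of_int (w x)))"
proof (cases "x = \<zero>")
  case True thus ?thesis unfolding dvr_ord_def by simp
next
  case False
  hence xn: "x \<in> nz" using x nzI by simp
  let ?V = "K\<lparr>carrier := vring w\<rparr>"
  let ?Q = "\<lambda>l::int. \<exists>\<pi>\<in>vring w. \<exists>u\<in>Units ?V. maximalideal (PIdl\<^bsub>?V\<^esub> \<pi>) ?V \<and> x = u \<otimes> (\<pi> [^] l)"
  obtain p where p: "p \<in> nz" "w p = 1" using rv_ex by auto
  have "?Q (w x)"
  proof -
    let ?u = "x \<otimes> inv (p [^] (w x))"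
    have pn: "p [^] (w x) \<in> nz" "w (p [^] (w x)) = w x" using rv_int_pow[OF p(1)] p(2) by auto
    have "?u \<in> Units ?V" unfolding vring_Units using nz_mult[OF xn nz_inv[OF pn(1)]] rv_div[OF xn pn(1)] pn(2) by simp
    moreover have "x = ?u \<otimes> p [^] (w x)" using div_cancel[OF pn(1) x] by simp
    moreover have "p \<in> vring w" using vring_nonneg[OF p(1)] p(2) by simp
    ultimately show ?thesis using vring_PIdl_maximal[OF p] by blast
  qed
  moreover have "l = w x" if Q: "?Q l" for l
  proof -
    obtain \<pi> u where pu: "\<pi> \<in> vring w" "u \<in> Units ?V" "maximalideal (PIdl\<^bsub>?V\<^esub> \<pi>) ?V" "x = u \<otimes> (\<pi> [^] l)" using Q by blast
    have M: "PIdl\<^bsub>?V\<^esub> \<pi> = {x\<in>vring w. x = \<zero> \<or> 0 < w x}" by (rule vring_maximal[OF pu(3)])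
    have "p \<in> PIdl\<^bsub>?V\<^esub> \<pi>" unfolding M using vring_nonneg[OF p(1)] p(2) by simp
    then obtain r where r: "r \<in> vring w" "p = r \<otimes> \<pi>" unfolding cgenideal_def by auto
    have rc: "r \<in> carrier K" "\<pi> \<in> carrier K" using r(1) pu(1) unfolding vring_def by auto
    have rn: "r \<in> nz" "\<pi> \<in> nz" using mult_nz[OF rc] r(2) p(1) by auto
    have "\<pi> \<in> PIdl\<^bsub>?V\<^esub> \<pi>" unfolding cgenideal_def using vring_closed(4) rc(2) by (intro CollectI exI[of _ \<one>]) simp
    hence "0 < w \<pi>" unfolding M using nzD(2)[OF rn(2)] by simp
    moreover have "w r + w \<pi> = 1" using rv_mult[OF rn] r(2) p(2) by simp
    moreover have "0 \<le> w r" using r(1) vring_nonneg[OF rn(1)] by simp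
    ultimately have "w \<pi> = 1" by linarith
    moreover have "u \<in> nz" "w u = 0" using pu(2) unfolding vring_Units by auto
    ultimately show ?thesis using pu(4) rv_mult[OF _ rv_int_pow(1)[OF rn(2)]] rv_int_pow(2)[OF rn(2)] by simp
  qed
  ultimately have "(THE l. ?Q l) = w x" by (rule the_equality)
  thus ?thesis unfolding dvr_ord_def using False by simp
qed

end

text \<open>An inclusion of discrete valuation rings of the same field is an equality: units go to
  units, so \<open>v\<close> is a multiple of \<open>w\<close>, and normalization fixes the
  factor.\<close>

lemma rval_eqI:
  assumes w: "rval K w" and v: "rval K v" and sub: "vring w \<subseteq> vring v" and x: "x \<in> nz" shows "w x = v x"
proof -
  have le: "0 \<le> v y" if "y \<in> nz" "0 \<le> w y" for y using vring_nonneg[OF w that(1)] vring_nonneg[OF v that(1)] that(2) sub by auto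
  have z: "v y = 0" if y: "y \<in> nz" "w y = 0" for y using le[OF y(1)] le[OF nz_inv[OF y(1)]] rv_inv[OF w y(1)] rv_inv[OF v y(1)] y(2) by simp
  obtain p where p: "p \<in> nz" "w p = 1" using rv_ex[OF w] by auto
  have m: "v y = w y * v p" if y: "y \<in> nz" for y
  proof -
    let ?q = "p [^] (- w y)"
    have q: "?q \<in> nz" "w ?q = - w y" "v ?q = - w y * v p" using rv_int_pow(1)[OF w p(1)] rv_int_pow(2)[OF w p(1)] rv_int_pow(2)[OF v p(1)] p(2) by auto
    have "w (y \<otimes> ?q) = 0" using rv_mult[OF w y q(1)] q(2) by simp
    hence "v (y \<otimes> ?q) = 0" by (rule z[OF nz_mult[OF y q(1)]])
    thus ?thesis using rv_mult[OF v y q(1)] q(3) by simp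
  qed
  obtain q where q: "q \<in> nz" "v q = 1" using rv_ex[OF v] by auto
  have "w q * v p = 1" using m[OF q(1)] q(2) by simp
  moreover have "0 \<le> v p" using le p by auto
  ultimately have "v p = 1" using zmult_eq_1_iff[of "w q" "v p"] by auto
  thus ?thesis using m[OF x] by simp
qed

end

subsection \<open>Height one primes of Krull domains\<close>

declare pow_nat [simp del]

context kfield
begin

definition krull_ring :: "'a set \<Rightarrow> ('a \<Rightarrow> int) set \<Rightarrow> bool" where
  "krull_ring B W \<longleftrightarrow> (\<forall>w\<in>W. rval K w) \<and> (\<forall>x\<in>nz. finite {w\<in>W. w x \<noteq> 0}) \<and>
     B \<subseteq> carrier K \<and> \<zero> \<in> B \<and> (\<forall>x\<in>nz. x \<in> B \<longleftrightarrow> (\<forall>w\<in>W. 0 \<le> w x)) \<and>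
     (\<forall>x\<in>nz. \<exists>a\<in>B \<inter> nz. \<exists>b\<in>B \<inter> nz. x = a \<otimes> inv b)"

definition center :: "'a set \<Rightarrow> ('a \<Rightarrow> int) \<Rightarrow> 'a set" where
  "center B w = {x\<in>B. x = \<zero> \<or> 0 < w x}"

text \<open>\<open>w\<close> cannot be left out of the family: some element has a pole at
  \<open>w\<close> and nowhere else in \<open>W\<close>.\<close>

definition irr :: "('a \<Rightarrow> int) set \<Rightarrow> ('a \<Rightarrow> int) \<Rightarrow> bool" where
  "irr W w \<longleftrightarrow> (\<exists>x\<in>nz. w x < 0 \<and> (\<forall>w'\<in>W - {w}. 0 \<le> w' x))"

context
  fixes B W
  assumes BW: "krull_ring B W"
begin

lemma kr_val: "w \<in> W \<Longrightarrow> rval K w" using BW unfolding krull_ring_def by blast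
lemma kr_fin: "x \<in> nz \<Longrightarrow> finite {w\<in>W. w x \<noteq> 0}" using BW unfolding krull_ring_def by blast
lemma kr_carr: "x \<in> B \<Longrightarrow> x \<in> carrier K" using BW unfolding krull_ring_def by blast
lemma kr_iff: "x \<in> nz \<Longrightarrow> x \<in> B \<longleftrightarrow> (\<forall>w\<in>W. 0 \<le> w x)" using BW unfolding krull_ring_def by blast
lemma kr_zero: "\<zero> \<in> B" using BW unfolding krull_ring_def by blast
lemma kr_frac: "x \<in> nz \<Longrightarrow> \<exists>a\<in>B \<inter> nz. \<exists>b\<in>B \<inter> nz. x = a \<otimes> inv b" using BW unfolding krull_ring_def by blast
lemma kr_nonneg: "x \<in> B \<Longrightarrow> x \<in> nz \<Longrightarrow> w \<in> W \<Longrightarrow> 0 \<le> w x" using kr_iff by blast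

lemma kr_Inter: "B = {x\<in>carrier K. \<forall>w\<in>W. x \<in> vring w}" using kr_carr kr_zero kr_iff nzI unfolding vring_def by (auto simp: nz_def)

lemma kr_closed: "x \<in> B \<Longrightarrow> y \<in> B \<Longrightarrow> x \<oplus> y \<in> B" "x \<in> B \<Longrightarrow> y \<in> B \<Longrightarrow> x \<otimes> y \<in> B"
  "x \<in> B \<Longrightarrow> \<ominus> x \<in> B" "\<one> \<in> B" unfolding kr_Inter using vring_closed[OF kr_val] by auto

lemma kr_subring: "subring B K" by (rule subringI) (use kr_closed kr_carr in auto)

lemma kr_pow: "x \<in> B \<Longrightarrow> x [^] (n::nat) \<in> B" by (induction n) (auto intro: kr_closed)

lemma kr_pos_ex: assumes "w \<in> W" shows "\<exists>q\<in>B \<inter> nz. 0 < w q"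
proof -
  obtain p where p: "p \<in> nz" "w p = 1" using rv_ex[OF kr_val[OF assms]] by auto
  obtain a b where ab: "a \<in> B" "a \<in> nz" "b \<in> B" "b \<in> nz" "p = a \<otimes> inv b" using kr_frac[OF p(1)] by auto
  have "w a - w b = 1" using rv_div[OF kr_val[OF assms] ab(2,4)] ab(5) p(2) by simp
  moreover have "0 \<le> w b" using kr_nonneg[OF ab(3,4) assms] .
  ultimately show ?thesis using ab by (intro bexI[of _ a]) auto
qed

lemma center_prime:
  assumes w: "rval K w" and nn: "\<And>x. x \<in> B \<Longrightarrow> x \<in> nz \<Longrightarrow> 0 \<le> w x"
  shows "primeideal (center B w) (K\<lparr>carrier := B\<rparr>)"
proof -
  let ?B = "K\<lparr>carrier := B\<rparr>"
  interpret B: domain ?B by (rule subring_is_domain[OF kr_subring])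
  have "ideal (center B w) ?B"
  proof (rule subring_carrier_ideal)
    show "ring ?B" by (rule B.ring_axioms)
    show "center B w \<subseteq> carrier ?B" unfolding center_def by auto
    show "\<zero>\<^bsub>?B\<^esub> \<in> center B w" unfolding center_def using kr_zero by simp
    fix a b assume ab: "a \<in> center B w" "b \<in> center B w"
    hence c: "a \<in> B" "b \<in> B" "a \<in> carrier K" "b \<in> carrier K" unfolding center_def using kr_carr by auto
    have "a \<oplus> b = \<zero> \<or> 0 < w (a \<oplus> b)"
    proof (cases "a = \<zero> \<or> b = \<zero> \<or> a \<oplus> b = \<zero>")
      case True thus ?thesis using ab c unfolding center_def by auto
    next
      case False
      thus ?thesis using rv_add[OF w nzI nzI, of a b] c ab unfolding center_def by auto
    qed
    thus "a \<oplus>\<^bsub>?B\<^esub> b \<in> center B w" unfolding center_def using kr_closed(1)[OF c(1,2)] by simp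
  next
    fix a r assume ar: "a \<in> center B w" "r \<in> carrier ?B"
    hence c: "a \<in> B" "r \<in> B" "a \<in> carrier K" "r \<in> carrier K" unfolding center_def using kr_carr by auto
    have "r \<otimes> a = \<zero> \<or> 0 < w (r \<otimes> a)"
    proof (cases "a = \<zero> \<or> r = \<zero>")
      case True thus ?thesis using c by auto
    next
      case False
      hence "r \<in> nz" "a \<in> nz" using c nzI by auto
      thus ?thesis using rv_mult[OF w, of r a] ar False nn[OF c(2)] unfolding center_def by auto
    qed
    hence "r \<otimes> a \<in> center B w" unfolding center_def using kr_closed(2)[OF c(2,1)] by simp
    thus "r \<otimes>\<^bsub>?B\<^esub> a \<in> center B w" "a \<otimes>\<^bsub>?B\<^esub> r \<in> center B w" using m_comm[OF c(3,4)] by simp_all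
  qed
  thus ?thesis
  proof (rule primeidealI)
    show "cring ?B" by (rule B.is_cring)
    have "\<one> \<notin> center B w" unfolding center_def using rv_one[OF w] by simp
    thus "carrier ?B \<noteq> center B w" using kr_closed(4) by auto
    fix a b assume ab: "a \<in> carrier ?B" "b \<in> carrier ?B" "a \<otimes>\<^bsub>?B\<^esub> b \<in> center B w"
    show "a \<in> center B w \<or> b \<in> center B w"
    proof (cases "a = \<zero> \<or> b = \<zero>")
      case True thus ?thesis using kr_zero unfolding center_def by auto
    next
      case False
      hence n: "a \<in> nz" "b \<in> nz" using ab kr_carr nzI by auto
      hence "0 < w (a \<otimes> b)" using ab(3) nzD(2)[OF nz_mult[OF n]] unfolding center_def by auto
      thus ?thesis using rv_mult[OF w n] ab nn n unfolding center_def by (auto intro: ccontr)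
    qed
  qed
qed

lemma zero_prime: "primeideal {\<zero>} (K\<lparr>carrier := B\<rparr>)"
proof -
  interpret B: domain "K\<lparr>carrier := B\<rparr>" by (rule subring_is_domain[OF kr_subring])
  show ?thesis using B.zeroprimeideal by simp
qed

lemma prime_props: assumes "primeideal P (K\<lparr>carrier := B\<rparr>)"
  shows "P \<subseteq> B" "\<zero> \<in> P" "\<one> \<notin> P" "\<And>a r. a \<in> P \<Longrightarrow> r \<in> B \<Longrightarrow> r \<otimes> a \<in> P"
    "\<And>a b. a \<in> B \<Longrightarrow> b \<in> B \<Longrightarrow> a \<otimes> b \<in> P \<Longrightarrow> a \<in> P \<or> b \<in> P"
proof -
  interpret P: primeideal P "K\<lparr>carrier := B\<rparr>" by (rule assms)
  note p = ideal_props[OF P.is_ideal]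
  show "P \<subseteq> B" "\<zero> \<in> P" using p(1,2) by auto
  show m: "\<And>a r. a \<in> P \<Longrightarrow> r \<in> B \<Longrightarrow> r \<otimes> a \<in> P" using p(4) by simp
  show "\<And>a b. a \<in> B \<Longrightarrow> b \<in> B \<Longrightarrow> a \<otimes> b \<in> P \<Longrightarrow> a \<in> P \<or> b \<in> P" using P.I_prime by simp
  show "\<one> \<notin> P"
  proof
    assume "\<one> \<in> P"
    hence "r \<in> P" if "r \<in> B" for r using m[of \<one> r] that kr_carr by simp
    thus False using P.I_notcarr p(1) by auto
  qed
qed

lemma prime_compl_pow: assumes "primeideal P (K\<lparr>carrier := B\<rparr>)" "a \<in> B" "a \<notin> P" shows "a [^] (n::nat) \<notin> P"
proof (induction n)
  case 0 thus ?case using prime_props(3)[OF assms(1)] by simp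
next
  case (Suc n) thus ?case using prime_props(5)[OF assms(1) kr_pow[OF assms(2)] assms(2)] assms(3) by auto
qed

text \<open>If every center at which \<open>a\<close> is positive had an element outside
  \<open>P\<close>, a product of powers of these elements would have at least the value of
  \<open>a\<close> everywhere. It would then be a multiple of \<open>a\<close>, hence in
  \<open>P\<close>, although all its factors are outside.\<close>

lemma prime_contains_center:
  assumes P: "primeideal P (K\<lparr>carrier := B\<rparr>)" and a: "a \<in> P" "a \<in> nz" shows "\<exists>w\<in>W. 0 < w a \<and> center B w \<subseteq> P"
proof (rule ccontr)
  assume n: "\<not> ?thesis"
  note p = prime_props[OF P]
  have aB: "a \<in> B" using p(1) a(1) by auto
  let ?Wa = "{w\<in>W. w a \<noteq> 0}"
  \<comment> \<open>Built over the finite set of valuations not vanishing at \<open>a\<close>: each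
    one contributes the \<open>w a\<close>-th power of an element of its center outside
    \<open>P\<close>.\<close>
  have "\<exists>y\<in>B - P. \<forall>w\<in>F. w a \<le> w y" if "finite F" "F \<subseteq> ?Wa" for F using that
  proof (induction F)
    case empty thus ?case using p(3) kr_closed(4) by auto
  next
    case (insert w F)
    then obtain y where y: "y \<in> B" "y \<notin> P" "\<forall>w\<in>F. w a \<le> w y" by auto
    have w: "w \<in> W" "w a \<noteq> 0" using insert.prems by auto
    have pos: "0 < w a" using kr_nonneg[OF aB a(2) w(1)] w(2) by simp
    then obtain x where x: "x \<in> center B w" "x \<notin> P" using n w(1) by auto
    have xB: "x \<in> B" "x \<in> nz" using x p(2) kr_carr unfolding center_def nz_def by auto
    have yn: "y \<in> nz" using y p(2) kr_carr unfolding nz_def by auto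
    let ?m = "nat (w a)"
    let ?z = "y \<otimes> x [^] ?m"
    have zn: "w' ?z = w' y + int ?m * w' x" if "w' \<in> W" for w' using rv_mult[OF kr_val[OF that] yn nz_pow[OF xB(2)]] rv_pow[OF kr_val[OF that] xB(2)] by simp
    have "?z \<in> B" by (rule kr_closed(2)[OF y(1) kr_pow[OF xB(1)]])
    moreover have "?z \<notin> P" using p(5)[OF y(1) kr_pow[OF xB(1)]] y(2) prime_compl_pow[OF P xB(1) x(2)] by blast
    moreover have "w' a \<le> w' ?z" if "w' \<in> insert w F" for w'
    proof (cases "w' = w")
      case True
      have "1 \<le> w x" using x(1) nzD(2)[OF xB(2)] unfolding center_def by auto
      hence "w a \<le> w a * w x" using pos by simp
      moreover have "0 \<le> w y" by (rule kr_nonneg[OF y(1) yn w(1)])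
      moreover have "w ?z = w y + w a * w x" using zn[OF w(1)] pos by simp
      ultimately show ?thesis unfolding True by linarith
    next
      case False
      hence w': "w' \<in> F" "w' \<in> W" using that insert.prems by auto
      have "0 \<le> w' x" by (rule kr_nonneg[OF xB w'(2)])
      thus ?thesis using zn[OF w'(2)] y(3) w'(1) by (simp add: add_increasing2)
    qed
    ultimately show ?case by blast
  qed
  from this[OF kr_fin[OF a(2)] order.refl] obtain y where y: "y \<in> B" "y \<notin> P" "\<forall>w\<in>?Wa. w a \<le> w y" by auto
  have yn: "y \<in> nz" using y p(2) kr_carr unfolding nz_def by auto
  have "y \<otimes> inv a \<in> B" unfolding kr_iff[OF nz_mult[OF yn nz_inv[OF a(2)]]]
  proof
    fix w assume w: "w \<in> W"
    have "w a \<le> w y" using y(3) w kr_nonneg[OF y(1) yn w] by (cases "w a = 0") auto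
    thus "0 \<le> w (y \<otimes> inv a)" using rv_div[OF kr_val[OF w] yn a(2)] by simp
  qed
  hence "y \<otimes> inv a \<otimes> a \<in> P" by (rule p(4)[OF a(1)])
  thus False using div_cancel[OF a(2) nzD(1)[OF yn]] y(2) by simp
qed

text \<open>Only finitely many members are nonzero at \<open>a\<close>. Among the sets of these that
  still cut out \<open>B\<close> together with the untouched members, one of least cardinality is
  taken; dropping any of its members admits an element outside \<open>B\<close>, whose only pole is
  there.\<close>

lemma irredundant:
  assumes a: "a \<in> nz" shows "\<exists>W'\<subseteq>W. krull_ring B W' \<and> (\<forall>w\<in>W'. w a \<noteq> 0 \<longrightarrow> irr W' w)"
proof -
  let ?Wa = "{w\<in>W. w a \<noteq> 0}"
  define WF where "WF F = (W - ?Wa) \<union> F" for F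
  define ok where "ok F \<longleftrightarrow> F \<subseteq> ?Wa \<and> (\<forall>x\<in>nz. (\<forall>w\<in>WF F. 0 \<le> w x) \<longrightarrow> x \<in> B)" for F
  have "WF ?Wa = W" unfolding WF_def by auto
  hence "ok ?Wa" unfolding ok_def using kr_iff by auto
  hence "\<exists>n F. ok F \<and> card F = n" by blast
  from exists_least_iff[THEN iffD1, OF this] obtain n where
    n: "\<exists>F. ok F \<and> card F = n" "\<forall>m<n. \<not> (\<exists>F. ok F \<and> card F = m)" by blast
  then obtain F where F: "ok F" "card F = n" by blast
  have Fs: "F \<subseteq> ?Wa" using F(1) unfolding ok_def by blast
  have fF: "finite F" by (rule finite_subset[OF Fs kr_fin[OF a]])
  have sub: "WF F \<subseteq> W" unfolding WF_def using Fs by auto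
  have kr: "krull_ring B (WF F)" unfolding krull_ring_def
  proof (intro conjI ballI)
    fix x assume x: "x \<in> nz"
    show "finite {w\<in>WF F. w x \<noteq> 0}" by (rule finite_subset[OF _ kr_fin[OF x]]) (use sub in auto)
    show "x \<in> B \<longleftrightarrow> (\<forall>w\<in>WF F. 0 \<le> w x)" using F(1) x kr_iff[OF x] sub unfolding ok_def by blast
    show "\<exists>a\<in>B \<inter> nz. \<exists>b\<in>B \<inter> nz. x = a \<otimes> inv b" by (rule kr_frac[OF x])
  qed (use kr_val kr_carr kr_zero sub in auto)
  have "irr (WF F) w" if w: "w \<in> WF F" "w a \<noteq> 0" for w
  proof -
    have wF: "w \<in> F" using w unfolding WF_def by auto
    have "card (F - {w}) < n" using F(2) fF wF card_Diff1_less by metis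
    hence "\<not> ok (F - {w})" using n(2) by blast
    then obtain x where x: "x \<in> nz" "\<forall>w'\<in>WF (F - {w}). 0 \<le> w' x" "x \<notin> B" using Fs unfolding ok_def by blast
    have "WF (F - {w}) = WF F - {w}" unfolding WF_def using w(2) by auto
    moreover have "w x < 0"
    proof (rule ccontr)
      assume "\<not> w x < 0"
      hence "\<forall>w'\<in>WF F. 0 \<le> w' x" using x(2) calculation by (metis DiffI linorder_not_less singletonD)
      thus False using F(1) x(1,3) unfolding ok_def by blast
    qed
    ultimately show ?thesis unfolding irr_def using x by (intro bexI[of _ x]) auto
  qed
  thus ?thesis using kr sub by blast
qed

text \<open>The exponents are chosen so that the zero of \<open>q\<close> at \<open>w\<close> and
  the pole of \<open>x\<close> at \<open>w\<close> cancel: \<open>e\<close> is the pole order of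
  \<open>x\<close> and \<open>m\<close> the value of \<open>q\<close>. The product is a unit at
  \<open>w\<close> and still vanishes wherever else \<open>q\<close> does.\<close>

lemma irr_element:
  assumes w: "w \<in> W" "irr W w" and q: "q \<in> B" "q \<in> nz"
  shows "\<exists>x\<in>nz. \<exists>e m. 0 < (e::nat) \<and> q [^] e \<otimes> x [^] (m::nat) \<in> B \<and> w (q [^] e \<otimes> x [^] m) = 0 \<and>
     (\<forall>w'\<in>W - {w}. int e * w' q \<le> w' (q [^] e \<otimes> x [^] m)) \<and> w x = - int e \<and> int m = w q \<and> (\<forall>w'\<in>W - {w}. 0 \<le> w' x)"
proof -
  obtain x where x: "x \<in> nz" "w x < 0" "\<forall>w'\<in>W - {w}. 0 \<le> w' x" using w(2) unfolding irr_def by auto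
  define e where "e = nat (- w x)"
  define m where "m = nat (w q)"
  have m: "int m = w q" unfolding m_def using kr_nonneg[OF q w(1)] by simp
  have e: "int e = - w x" "0 < e" unfolding e_def using x(2) by auto
  let ?y = "q [^] e \<otimes> x [^] m"
  have yn: "?y \<in> nz" by (intro nz_mult nz_pow q x)
  have val: "w' ?y = int e * w' q + int m * w' x" if "w' \<in> W" for w'
    using rv_mult[OF kr_val[OF that] nz_pow[OF q(2)] nz_pow[OF x(1)]] rv_pow[OF kr_val[OF that] q(2)] rv_pow[OF kr_val[OF that] x(1)] by simp
  have w0: "w ?y = 0" using val[OF w(1)] e(1) m by (simp add: algebra_simps)
  have ge: "int e * w' q \<le> w' ?y" if "w' \<in> W - {w}" for w' using val[of w'] x(3) that by simp
  have "?y \<in> B" unfolding kr_iff[OF yn]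
  proof
    fix w' assume w': "w' \<in> W"
    show "0 \<le> w' ?y"
    proof (cases "w' = w")
      case False
      have "0 \<le> int e * w' q" using kr_nonneg[OF q w'] by simp
      thus ?thesis using ge[of w'] w' False by auto
    qed (use w0 in simp)
  qed
  thus ?thesis using x e m w0 ge by (intro bexI[of _ x] exI[of _ e] exI[of _ m]) auto
qed

text \<open>An element of the valuation ring has finitely many poles in \<open>W\<close>, none at
  \<open>w\<close>. They are cleared by a denominator that is a unit at \<open>w\<close>, which
  irredundancy supplies.\<close>

lemma irr_localization:
  assumes w: "w \<in> W" "irr W w" shows "vring w = localization K B (B - center B w)"
proof (intro equalityI subsetI)
  fix z assume z: "z \<in> vring w"
  hence zc: "z \<in> carrier K" unfolding vring_def by simp
  show "z \<in> localization K B (B - center B w)"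
  proof (cases "z = \<zero>")
    case True
    have "\<one> \<in> B - center B w" using kr_closed(4) rv_one[OF kr_val[OF w(1)]] unfolding center_def by auto
    moreover have "z = \<zero> \<otimes> inv \<one>" using True by simp
    ultimately show ?thesis unfolding localization_def using kr_zero by blast
  next
    case False
    hence zn: "z \<in> nz" using zc nzI by simp
    have wz: "0 \<le> w z" using z vring_nonneg[OF kr_val[OF w(1)] zn] by simp
    have "\<exists>s\<in>B \<inter> nz. w s = 0 \<and> (\<forall>w'\<in>F. - w' z \<le> w' s)" if "finite F" "F \<subseteq> W - {w}" for F using that
    proof (induction F)
      case empty thus ?case using kr_closed(4) nz_one rv_one[OF kr_val[OF w(1)]] by auto
    next
      case (insert v F)
      then obtain s where s: "s \<in> B" "s \<in> nz" "w s = 0" "\<forall>w'\<in>F. - w' z \<le> w' s" by auto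
      have v: "v \<in> W" "v \<noteq> w" using insert.prems by auto
      obtain q where q: "q \<in> B" "q \<in> nz" "0 < v q" using kr_pos_ex[OF v(1)] by auto
      \<comment> \<open>An element with a zero at \<open>v\<close> and value 0 at \<open>w\<close>,
        obtained by applying \<open>irr_element\<close> to some \<open>q\<close> positive at
        \<open>v\<close>; a power of it clears the pole of \<open>z\<close> at
        \<open>v\<close>.\<close>
      obtain y where y: "y \<in> B" "y \<in> nz" "w y = 0" "0 < v y"
      proof -
        obtain x e m where xe: "x \<in> nz" "0 < (e::nat)" "q [^] e \<otimes> x [^] (m::nat) \<in> B" "w (q [^] e \<otimes> x [^] m) = 0"
          "\<forall>w'\<in>W - {w}. int e * w' q \<le> w' (q [^] e \<otimes> x [^] m)" using irr_element[OF w q(1,2)] by blast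
        have "0 < int e * v q" using xe(2) q(3) by simp
        also have "\<dots> \<le> v (q [^] e \<otimes> x [^] m)" using xe(5) v by simp
        finally show ?thesis using that[OF xe(3) nz_mult[OF nz_pow[OF q(2)] nz_pow[OF xe(1)]] xe(4)] by simp
      qed
      let ?m = "nat \<bar>v z\<bar>"
      let ?s = "s \<otimes> y [^] ?m"
      have val: "w' ?s = w' s + int ?m * w' y" if "w' \<in> W" for w' using rv_mult[OF kr_val[OF that] s(2) nz_pow[OF y(2)]] rv_pow[OF kr_val[OF that] y(2)] by simp
      have "- w' z \<le> w' ?s" if "w' \<in> insert v F" for w'
      proof (cases "w' = v")
        case True
        have "\<bar>v z\<bar> \<le> \<bar>v z\<bar> * v y" using y(4) by (simp add: mult_le_cancel_left1)
        moreover have "0 \<le> v s" by (rule kr_nonneg[OF s(1,2) v(1)])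
        ultimately show ?thesis using True val[OF v(1)] by simp
      next
        case False
        hence "w' \<in> F" "w' \<in> W" using that insert.prems by auto
        moreover have "0 \<le> w' y" by (rule kr_nonneg[OF y(1,2) calculation(2)])
        ultimately show ?thesis using val[of w'] s(4) by (simp add: add_increasing2)
      qed
      moreover have "w ?s = 0" using val[OF w(1)] s(3) y(3) by simp
      moreover have "?s \<in> B" "?s \<in> nz" using kr_closed(2)[OF s(1) kr_pow[OF y(1)]] nz_mult[OF s(2) nz_pow[OF y(2)]] by auto
      ultimately show ?case by blast
    qed
    from this[of "{w'\<in>W - {w}. w' z \<noteq> 0}"] obtain s where
      s: "s \<in> B" "s \<in> nz" "w s = 0" "\<forall>w'\<in>{w'\<in>W - {w}. w' z \<noteq> 0}. - w' z \<le> w' s"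
      using finite_subset[OF _ kr_fin[OF zn], of "{w'\<in>W - {w}. w' z \<noteq> 0}"] by auto
    have "z \<otimes> s \<in> B" unfolding kr_iff[OF nz_mult[OF zn s(2)]]
    proof
      fix w' assume w': "w' \<in> W"
      have "0 \<le> w' s" by (rule kr_nonneg[OF s(1,2) w'])
      thus "0 \<le> w' (z \<otimes> s)" using rv_mult[OF kr_val[OF w'] zn s(2)] s(3,4) w' wz by (cases "w' = w"; cases "w' z = 0") force+
    qed
    moreover have "s \<in> B - center B w" using s nzD(2)[OF s(2)] unfolding center_def by auto
    moreover have "z = z \<otimes> s \<otimes> inv s" using mult_cancel[OF s(2) zc] m_comm[OF zc nzD(1)[OF s(2)]] by simp
    ultimately show ?thesis unfolding localization_def by blast
  qed
next
  fix z assume "z \<in> localization K B (B - center B w)"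
  then obtain b s where bs: "b \<in> B" "s \<in> B" "s \<notin> center B w" "z = b \<otimes> inv s" unfolding localization_def by auto
  have s: "s \<in> nz" "w s = 0" using bs kr_carr kr_zero kr_nonneg[OF bs(2) _ w(1)] unfolding center_def nz_def by force+
  have ic: "inv s \<in> carrier K" by (rule nzD(1)[OF nz_inv[OF s(1)]])
  show "z \<in> vring w"
  proof (cases "b = \<zero>")
    case True thus ?thesis using bs ic vring_closed(5)[OF kr_val[OF w(1)]] by simp
  next
    case False
    hence b: "b \<in> nz" using kr_carr[OF bs(1)] nzI by simp
    show ?thesis unfolding bs(4) vring_nonneg[OF kr_val[OF w(1)] nz_mult[OF b nz_inv[OF s(1)]]]
      using rv_div[OF kr_val[OF w(1)] b s(1)] s(2) kr_nonneg[OF bs(1) b w(1)] by simp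
  qed
qed

text \<open>For nonzero \<open>q\<close> in \<open>Q\<close>, the element \<open>?y\<close> of
  \<open>irr_element\<close> is a unit at \<open>w\<close>, so it lies outside the center and hence
  outside \<open>Q\<close>. But a power of any \<open>t\<close> in the center carries
  \<open>?y\<close> into \<open>Q\<close>, which forces \<open>t\<close> into
  \<open>Q\<close>.\<close>

lemma irr_center_minimal:
  assumes w: "w \<in> W" "irr W w" and Q: "primeideal Q (K\<lparr>carrier := B\<rparr>)" "Q \<subset> center B w" shows "Q = {\<zero>}"
proof (rule ccontr)
  note p = prime_props[OF Q(1)]
  assume "Q \<noteq> {\<zero>}"
  then obtain q where q: "q \<in> Q" "q \<noteq> \<zero>" using p(2) by auto
  have qB: "q \<in> B" "q \<in> nz" using q p(1) kr_carr nzI by auto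
  obtain t where t: "t \<in> center B w" "t \<notin> Q" using Q(2) by auto
  have tB: "t \<in> B" "t \<in> nz" using t p(2) kr_carr unfolding center_def nz_def by auto
  have tpos: "0 < w t" using t(1) nzD(2)[OF tB(2)] unfolding center_def by auto
  obtain x e m where x: "x \<in> nz" "0 < (e::nat)" "q [^] e \<otimes> x [^] (m::nat) \<in> B" "w (q [^] e \<otimes> x [^] m) = 0"
     "w x = - int e" "int m = w q" "\<forall>w'\<in>W - {w}. 0 \<le> w' x" using irr_element[OF w qB] by blast
  let ?y = "q [^] e \<otimes> x [^] m"
  have yn: "?y \<in> nz" by (intro nz_mult nz_pow qB x)
  \<comment> \<open>Chosen so that \<open>t [^] ?N\<close> cancels the pole of
    \<open>x [^] m\<close> at \<open>w\<close>, which has order \<open>m * e\<close>, while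
    \<open>t\<close> has value at least 1 there.\<close>
  let ?N = "m * e"
  let ?u = "t [^] ?N \<otimes> x [^] m"
  have un: "?u \<in> nz" by (intro nz_mult nz_pow tB x)
  have val: "w' ?u = int ?N * w' t + int m * w' x" if "w' \<in> W" for w'
    using rv_mult[OF kr_val[OF that] nz_pow[OF tB(2)] nz_pow[OF x(1)]] rv_pow[OF kr_val[OF that] tB(2)] rv_pow[OF kr_val[OF that] x(1)] by simp
  have uB: "?u \<in> B" unfolding kr_iff[OF un]
  proof
    fix w' assume w': "w' \<in> W"
    show "0 \<le> w' ?u"
    proof (cases "w' = w")
      case True
      have "int ?N * w t + int m * w x = int m * int e * (w t - 1)" using x(5) by (simp add: algebra_simps)
      moreover have "0 \<le> int m * int e * (w t - 1)" using tpos by simp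
      ultimately show ?thesis using val[OF w'] True by simp
    next
      case False
      thus ?thesis using val[OF w'] kr_nonneg[OF tB w'] x(7) w' by simp
    qed
  qed
  have c: "q \<in> carrier K" "x \<in> carrier K" "t \<in> carrier K" using nzD(1) qB x(1) tB by auto
  have "t [^] ?N \<otimes> ?y = q [^] e \<otimes> ?u" using c by (simp add: m_lcomm)
  moreover have "q [^] e \<otimes> ?u \<in> Q"
  proof -
    obtain e' where e': "e = Suc e'" using x(2) by (cases e) auto
    have "q [^] e \<otimes> ?u = (q [^] e' \<otimes> ?u) \<otimes> q" using c e' by (simp add: m_ac)
    moreover have "q [^] e' \<otimes> ?u \<in> B" by (rule kr_closed(2)[OF kr_pow[OF qB(1)] uB])
    ultimately show ?thesis using p(4)[OF q(1)] by simp
  qed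
  ultimately have "t [^] ?N \<in> Q \<or> ?y \<in> Q" using p(5)[OF kr_pow[OF tB(1)] x(3)] by simp
  hence "?y \<in> Q" using prime_compl_pow[OF Q(1) tB(1) t(2)] by blast
  hence "?y \<in> center B w" using Q(2) by auto
  thus False using x(4) nzD(2)[OF yn] unfolding center_def by simp
qed

lemma center_height:
  assumes w: "w \<in> W" "irr W w" shows "prime_height (K\<lparr>carrier := B\<rparr>) (center B w) = 1"
proof -
  let ?B = "K\<lparr>carrier := B\<rparr>"
  have cp: "primeideal (center B w) ?B" using center_prime[OF kr_val[OF w(1)]] kr_nonneg w(1) by blast
  obtain q where q: "q \<in> B" "q \<in> nz" "0 < w q" using kr_pos_ex[OF w(1)] by auto
  have ne: "{\<zero>} \<subset> center B w" using q nzD(2)[OF q(2)] kr_zero unfolding center_def by auto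
  let ?S = "{enat l | l. \<exists>P. prime_chain ?B P l \<and> P l = center B w}"
  have "prime_chain ?B (\<lambda>i. if i = 0 then {\<zero>} else center B w) 1" unfolding prime_chain_def using cp zero_prime ne by auto
  hence 1: "enat 1 \<in> ?S" by (intro CollectI exI[of _ 1] conjI exI[of _ "\<lambda>i. if i = 0 then {\<zero>} else center B w"]) auto
  have "y \<le> 1" if y: "y \<in> ?S" for y
  proof -
    obtain l P where l: "y = enat l" "prime_chain ?B P l" "P l = center B w" using y by auto
    have "l \<le> 1"
    proof (rule ccontr)
      assume "\<not> l \<le> 1"
      then obtain l' where l': "l = Suc (Suc l')" by (metis One_nat_def less_eq_Suc_le not_less old.nat.exhaust zero_le)
      have c: "primeideal (P (Suc l')) ?B" "primeideal (P l') ?B" "P l' \<subset> P (Suc l')" "P (Suc l') \<subset> center B w"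
        using l(2,3) l' unfolding prime_chain_def by auto
      have "P (Suc l') = {\<zero>}" by (rule irr_center_minimal[OF w c(1,4)])
      thus False using c(3) prime_props(2)[OF c(2)] by auto
    qed
    thus ?thesis using l(1) by (simp add: one_enat_def)
  qed
  hence "Sup ?S \<le> 1" by (rule Sup_least)
  moreover have "enat 1 \<le> Sup ?S" by (rule Sup_upper[OF 1])
  ultimately show ?thesis unfolding prime_height_def by (simp add: one_enat_def)
qed

end

text \<open>A nonzero \<open>a\<close> in \<open>P\<close> leaves finitely many candidates, which
  are made irredundant. One of their centers is contained in \<open>P\<close>, and it is all of
  \<open>P\<close> by the height.\<close>

lemma height_one_dvr:
  assumes BW: "krull_ring B W" and P: "primeideal P (K\<lparr>carrier := B\<rparr>)" "prime_height (K\<lparr>carrier := B\<rparr>) P = 1"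
  shows "\<exists>w\<in>W. localization K B (B - P) = vring w"
proof -
  let ?B = "K\<lparr>carrier := B\<rparr>"
  let ?S = "{enat l | l. \<exists>Q. prime_chain ?B Q l \<and> Q l = P}"
  have S: "Sup ?S = 1" using P(2) unfolding prime_height_def .
  have no2: "\<not> prime_chain ?B Q 2" if "Q 2 = P" for Q
  proof
    assume "prime_chain ?B Q 2"
    hence "enat 2 \<in> ?S" using that by blast
    hence "enat 2 \<le> 1" using Sup_upper[of "enat 2" ?S] S by simp
    thus False by (simp add: one_enat_def)
  qed
  note p = prime_props[OF BW P(1)]
  have "P \<noteq> {\<zero>}"
  proof
    assume P0: "P = {\<zero>}"
    have "y \<le> 0" if y: "y \<in> ?S" for y
    proof -
      obtain l Q where l: "y = enat l" "prime_chain ?B Q l" "Q l = P" using y by auto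
      have "l = 0"
      proof (rule ccontr)
        assume "l \<noteq> 0"
        then obtain l' where "l = Suc l'" by (cases l) auto
        hence "primeideal (Q l') ?B" "Q l' \<subset> P" using l(2,3) unfolding prime_chain_def by auto
        thus False using prime_props(2)[OF BW] P0 by auto
      qed
      thus ?thesis using l(1) by (simp add: zero_enat_def)
    qed
    hence "Sup ?S \<le> 0" by (rule Sup_least)
    thus False using S by simp
  qed
  then obtain a where a: "a \<in> P" "a \<noteq> \<zero>" using p(2) by auto
  hence an: "a \<in> nz" using p(1) kr_carr[OF BW] nzI by auto
  obtain W' where W': "W' \<subseteq> W" "krull_ring B W'" "\<forall>w\<in>W'. w a \<noteq> 0 \<longrightarrow> irr W' w" using irredundant[OF BW an] by blast
  obtain w where w: "w \<in> W'" "0 < w a" "center B w \<subseteq> P" using prime_contains_center[OF W'(2) P(1) a(1) an] by blast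
  have cp: "primeideal (center B w) ?B" using center_prime[OF W'(2) kr_val[OF W'(2) w(1)]] kr_nonneg[OF W'(2)] w(1) by blast
  have aC: "a \<in> center B w" using a p(1) w(2) unfolding center_def by auto
  have "center B w = P"
  proof (rule ccontr)
    assume "center B w \<noteq> P"
    hence lt: "center B w \<subset> P" using w(3) by auto
    have "{\<zero>} \<subset> center B w" using aC a(2) prime_props(2)[OF W'(2) cp] by auto
    hence "prime_chain ?B (\<lambda>i. if i = 0 then {\<zero>} else if i = 1 then center B w else P) 2"
      unfolding prime_chain_def using cp zero_prime[OF BW] P(1) lt by (auto simp: less_Suc_eq numeral_2_eq_2)
    thus False using no2[of "\<lambda>i. if i = 0 then {\<zero>} else if i = 1 then center B w else P"] by simp
  qed
  moreover have "irr W' w" using W'(3) w(1,2) by auto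
  ultimately have "localization K B (B - P) = vring w" using irr_localization[OF W'(2) w(1)] by simp
  thus ?thesis using w(1) W'(1) by blast
qed

end

subsection \<open>Normalized charts and Rees valuations\<close>

context kfield
begin

text \<open>Multiplies successive coefficients by \<open>c\<close>, \<open>c t\<close>,
  \<open>c t^2\<close> and so on. With \<open>t\<close> the inverse of \<open>s\<close> it turns an
  equation for \<open>s x\<close> into one for \<open>x\<close>, up to a power of \<open>s\<close>,
  and it stays monic for \<open>c = 1\<close>.\<close>

fun scale_poly :: "'a \<Rightarrow> 'a \<Rightarrow> 'a list \<Rightarrow> 'a list" where
  "scale_poly c t [] = []"
| "scale_poly c t (a # p) = (a \<otimes> c) # scale_poly (c \<otimes> t) t p"

lemma scale_poly_set: "c \<in> A \<Longrightarrow> t \<in> A \<Longrightarrow> set p \<subseteq> A \<Longrightarrow> (\<And>x y. x \<in> A \<Longrightarrow> y \<in> A \<Longrightarrow> x \<otimes> y \<in> A) \<Longrightarrow> set (scale_poly c t p) \<subseteq> A"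
  by (induction p arbitrary: c) auto

lemma scale_poly_carrier: "c \<in> carrier K \<Longrightarrow> t \<in> carrier K \<Longrightarrow> set p \<subseteq> carrier K \<Longrightarrow> set (scale_poly c t p) \<subseteq> carrier K"
  by (rule scale_poly_set) auto

lemma length_scale_poly [simp]: "length (scale_poly c t p) = length p" by (induction p arbitrary: c) auto

lemma scale_poly_eval:
  assumes x: "x \<in> carrier K" and s: "s \<in> carrier K" "t \<in> carrier K" "s \<otimes> t = \<one>"
  shows "set p \<subseteq> carrier K \<Longrightarrow> c \<in> carrier K \<Longrightarrow> d \<in> carrier K \<Longrightarrow> p = [] \<or> d \<otimes> c = s [^] (length p - 1) \<Longrightarrow>
     eval p (s \<otimes> x) = d \<otimes> eval (scale_poly c t p) x"
proof (induction p arbitrary: c)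
  case Nil thus ?case by simp
next
  case (Cons a p)
  have ac: "a \<in> carrier K" "set p \<subseteq> carrier K" using Cons.prems by auto
  have dc: "d \<otimes> c = s [^] length p" using Cons.prems(4) by simp
  have ec: "eval (scale_poly (c \<otimes> t) t p) x \<in> carrier K"
    using scale_poly_carrier[of "c \<otimes> t" t p] ac s Cons.prems(2) x by (intro eval_in_carrier) auto
  have "p = [] \<or> d \<otimes> (c \<otimes> t) = s [^] (length p - 1)"
  proof (cases "p = []")
    case False
    then obtain l where l: "length p = Suc l" by (cases p) auto
    have "d \<otimes> (c \<otimes> t) = d \<otimes> c \<otimes> t" by (rule m_assoc[symmetric]) (use Cons.prems(2,3) s in auto)
    also have "\<dots> = s [^] l \<otimes> s \<otimes> t" unfolding dc l using s by simp
    also have "\<dots> = s [^] l \<otimes> (s \<otimes> t)" using s by (intro m_assoc) auto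
    finally show ?thesis using s l by simp
  qed simp
  hence IH: "eval p (s \<otimes> x) = d \<otimes> eval (scale_poly (c \<otimes> t) t p) x" using Cons.IH[of "c \<otimes> t"] ac Cons.prems s by simp
  have "eval (a # p) (s \<otimes> x) = a \<otimes> (s \<otimes> x) [^] length p \<oplus> eval p (s \<otimes> x)" by simp
  also have "(s \<otimes> x) [^] length p = d \<otimes> c \<otimes> x [^] length p" using dc x s nat_pow_distrib[of s x] by simp
  also have "a \<otimes> (d \<otimes> c \<otimes> x [^] length p) = d \<otimes> (a \<otimes> c \<otimes> x [^] length p)"
    using ac(1) Cons.prems(2,3) x by (simp add: m_ac)
  finally show ?case using IH ec ac Cons.prems x by (simp add: r_distr)
qed

lemma integral_closure_scale:
  assumes A: "subring A K" and C: "C \<subseteq> A" and s: "s \<in> nz" "inv s \<in> A" and x: "x \<in> carrier K" and sx: "s \<otimes> x \<in> integral_closure K C"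
  shows "x \<in> integral_closure K A"
proof -
  note Ap = subringE[OF A]
  obtain p where p: "set p \<subseteq> C" "p \<noteq> []" "hd p = \<one>" "eval p (s \<otimes> x) = \<zero>"
    using sx unfolding integral_closure_def polynomial_def by auto
  have pA: "set p \<subseteq> A" "set p \<subseteq> carrier K" using p(1) C Ap(1) by auto
  have sc: "s \<in> carrier K" "inv s \<in> carrier K" using nzD(1)[OF s(1)] nzD(1)[OF nz_inv[OF s(1)]] by auto
  let ?d = "s [^] (length p - 1)"
  let ?q = "scale_poly \<one> (inv s) p"
  have "eval p (s \<otimes> x) = ?d \<otimes> eval ?q x" by (rule scale_poly_eval[OF x sc nz_r_inv[OF s(1)] pA(2)]) (use sc in auto)
  moreover have ec: "eval ?q x \<in> carrier K" using scale_poly_carrier[OF one_closed sc(2) pA(2)] x by (rule eval_in_carrier)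
  ultimately have "eval ?q x = \<zero>" using p(4) integral[of ?d "eval ?q x"] nzD[OF nz_pow[OF s(1)]] by auto
  moreover have "set ?q \<subseteq> A" by (rule scale_poly_set[OF Ap(3) s(2) pA(1) Ap(6)])
  moreover have "?q \<noteq> []" using p(2) by (cases p) auto
  moreover have "hd ?q = \<one>" using p(2,3) by (cases p) auto
  ultimately show ?thesis unfolding integral_closure_def polynomial_def using x by auto
qed

end

locale chart_setup = kfield K for K :: "('a, 'b) ring_scheme" (structure) +
  fixes R k I S W :: "'a set"
  assumes R: "subring R K" and fracR: "carrier K = localization K R (R - {\<zero>})" and k: "subfield k K" and char0: "char0 K"
    and S: "finite S" "S \<subseteq> carrier K" and W: "submonoid W K" "W \<subseteq> generate_ring K (k \<union> S)" "\<zero> \<notin> W"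
    and RW: "R = localization K (generate_ring K (k \<union> S)) W" and noeth: "noetherian_ring (K\<lparr>carrier := R\<rparr>)"
    and I: "ideal I (K\<lparr>carrier := R\<rparr>)"
begin

abbreviation "RR \<equiv> K\<lparr>carrier := R\<rparr>"

definition chart_ring :: "'a \<Rightarrow> 'a set" where
  "chart_ring f = generate_ring K (R \<union> {g \<otimes> inv f | g. g \<in> I})"

lemma Rc: "r \<in> R \<Longrightarrow> r \<in> carrier K" using subringE(1)[OF R] by auto
lemma IR: "g \<in> I \<Longrightarrow> g \<in> R" using ideal_props(1)[OF I] by auto
lemma Ic: "g \<in> I \<Longrightarrow> g \<in> carrier K" using IR Rc by auto

lemma kc: "k \<subseteq> carrier K" using subringE(1)[OF subfieldE(1)[OF k]] .

lemma W_inv: "s \<in> W \<Longrightarrow> s \<in> nz" "s \<in> W \<Longrightarrow> inv s \<in> R"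
proof -
  assume s: "s \<in> W"
  have "s \<in> carrier K" "s \<noteq> \<zero>" using s submonoid.subset[OF W(1)] W(3) by auto
  thus sn: "s \<in> nz" by (rule nzI)
  have "inv s = \<one> \<otimes> inv s" using nzD(1)[OF nz_inv[OF sn]] by simp
  thus "inv s \<in> R" unfolding RW localization_def using s generate_ring.one[of K "k \<union> S"] by blast
qed

lemma gen_R: "c \<in> generate_ring K (k \<union> S) \<Longrightarrow> c \<in> R"
proof -
  assume c: "c \<in> generate_ring K (k \<union> S)"
  have "c \<in> carrier K" using generate_ring_in_carrier[OF _ c] kc S(2) by auto
  hence "c = c \<otimes> inv \<one>" by simp
  thus ?thesis unfolding RW localization_def using c submonoid.one_closed[OF W(1)] by blast
qed

lemma I_fg: "\<exists>G. finite G \<and> G \<subseteq> I \<and> I = Idl\<^bsub>RR\<^esub> G"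
proof -
  interpret N: noetherian_ring RR by (rule noeth)
  obtain G where G: "G \<subseteq> R" "finite G" "I = Idl\<^bsub>RR\<^esub> G" using N.finetely_gen[OF I] by auto
  have "G \<subseteq> I" unfolding G(3) using G(1) by (intro N.genideal_self) simp
  thus ?thesis using G by blast
qed

text \<open>The elements \<open>g\<close> of \<open>R\<close> with \<open>g / f\<close> in the
  valuation ring form an ideal, so the condition may be tested on generators of
  \<open>I\<close>.\<close>

lemma val_ideal_min:
  assumes w: "rval K w" and Rn: "R \<subseteq> vring w" and G: "G \<subseteq> I" "I = Idl\<^bsub>RR\<^esub> G" and f: "f \<in> nz"
    and gf: "\<forall>g\<in>G. g \<otimes> inv f \<in> vring w" and g: "g \<in> I" shows "g \<otimes> inv f \<in> vring w"
proof -
  interpret RR: ring RR by (rule subring_is_ring[OF R])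
  define J where "J = {g\<in>R. g \<otimes> inv f \<in> vring w}"
  have fi: "inv f \<in> carrier K" by (rule nzD(1)[OF nz_inv[OF f]])
  note v = vring_closed[OF w]
  have "ideal J RR"
  proof (rule subring_carrier_ideal)
    show "ring RR" by (rule RR.ring_axioms)
    show "J \<subseteq> carrier RR" unfolding J_def by auto
    show "\<zero>\<^bsub>RR\<^esub> \<in> J" unfolding J_def using subringE(2)[OF R] fi v(5) by simp
    fix a b assume ab: "a \<in> J" "b \<in> J"
    thus "a \<oplus>\<^bsub>RR\<^esub> b \<in> J" unfolding J_def using Rc fi v(1)[of "a \<otimes> inv f" "b \<otimes> inv f"] subringE(7)[OF R]
      by (auto simp: l_distr)
  next
    fix a r assume ar: "a \<in> J" "r \<in> carrier RR"
    hence c: "a \<in> R" "r \<in> R" "a \<otimes> inv f \<in> vring w" "r \<in> vring w" using Rn unfolding J_def by auto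
    have "r \<otimes> (a \<otimes> inv f) \<in> vring w" by (rule v(2)[OF c(4,3)])
    hence "r \<otimes> a \<in> J" unfolding J_def using subringE(6)[OF R c(2,1)] c Rc fi by (simp add: m_assoc)
    thus "r \<otimes>\<^bsub>RR\<^esub> a \<in> J" "a \<otimes>\<^bsub>RR\<^esub> r \<in> J" using m_comm[OF Rc Rc, OF c(1,2)] by simp_all
  qed
  moreover have "G \<subseteq> J" unfolding J_def using G(1) gf IR by auto
  ultimately have "I \<subseteq> J" unfolding G(2) by (rule RR.genideal_minimal)
  thus ?thesis using g unfolding J_def by auto
qed

lemma chart_vring:
  assumes w: "rval K w" and "R \<subseteq> vring w" "\<forall>g\<in>I. g \<otimes> inv f \<in> vring w" "f \<in> nz"
  shows "normalized_chart K R I f \<subseteq> vring w"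
proof
  have "x \<in> vring w" if "x \<in> chart_ring f" for x using that unfolding chart_ring_def
  proof (induction rule: generate_ring.induct)
    case (incl h) thus ?case using assms by auto
  qed (use vring_closed[OF w] in auto)
  hence c: "chart_ring f \<subseteq> vring w" by auto
  fix x assume "x \<in> normalized_chart K R I f"
  then obtain p where "x \<in> carrier K" "set p \<subseteq> chart_ring f" "p \<noteq> []" "hd p = \<one>" "eval p x = \<zero>"
    unfolding normalized_chart_def integral_closure_def polynomial_def chart_ring_def by auto
  thus "x \<in> vring w" using monic_nonneg[OF w, of p x] c by auto
qed

lemma chart_ring_carrier: "f \<in> nz \<Longrightarrow> R \<union> {g \<otimes> inv f | g. g \<in> I} \<subseteq> carrier K" using Rc Ic nzD(1)[OF nz_inv] by auto

lemma chart_subring: "f \<in> nz \<Longrightarrow> subring (chart_ring f) K" unfolding chart_ring_def by (rule generate_ring_is_subring[OF chart_ring_carrier])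

text \<open>\<open>R\<close> inverts the set \<open>W\<close> in an affine algebra, so the chart
  ring is the localization at \<open>W\<close> of the affine algebra \<open>?C\<close> generated by
  \<open>S\<close> and the quotients of generators of \<open>I\<close> by \<open>f\<close>. Its
  valuations are those of the integral closure of \<open>?C\<close> at which \<open>W\<close>
  consists of units.\<close>

lemma chart_krull:
  assumes f: "f \<in> I" "f \<noteq> \<zero>" shows "\<exists>V. krull_ring (normalized_chart K R I f) V"
proof -
  have fn: "f \<in> nz" using f Ic nzI by auto
  have fi: "inv f \<in> carrier K" by (rule nzD(1)[OF nz_inv[OF fn]])
  obtain G where G: "finite G" "G \<subseteq> I" "I = Idl\<^bsub>RR\<^esub> G" using I_fg by blast
  define S' where "S' = S \<union> (\<lambda>g. g \<otimes> inv f) ` G"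
  let ?C = "generate_ring K (k \<union> S')"
  have S': "finite S'" "S' \<subseteq> carrier K" unfolding S'_def using S G Ic fi by auto
  have kS': "k \<union> S' \<subseteq> carrier K" using kc S'(2) by simp
  note kp = subringE[OF subfieldE(1)[OF k]]
  have CC: "c \<in> ?C" if "c \<in> generate_ring K (k \<union> S)" for c using that
  proof (induction rule: generate_ring.induct)
    case (incl h) thus ?case unfolding S'_def by (auto intro: generate_ring.incl)
  qed (auto intro: generate_ring.intros)
  have Cc: "c \<in> carrier K" if "c \<in> ?C" for c using generate_ring_in_carrier[OF kS' that] .
  have fr: "\<forall>x\<in>carrier K. \<exists>a\<in>?C. \<exists>b\<in>?C - {\<zero>}. x = a \<otimes> inv b"
  proof
    fix x assume "x \<in> carrier K"
    then obtain a b where ab: "a \<in> R" "b \<in> R" "b \<noteq> \<zero>" "x = a \<otimes> inv b" using fracR unfolding localization_def by auto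
    obtain a1 s1 where a: "a1 \<in> generate_ring K (k \<union> S)" "s1 \<in> W" "a = a1 \<otimes> inv s1" using ab(1) unfolding RW localization_def by auto
    obtain b1 t1 where b: "b1 \<in> generate_ring K (k \<union> S)" "t1 \<in> W" "b = b1 \<otimes> inv t1" using ab(2) unfolding RW localization_def by auto
    have n: "s1 \<in> nz" "t1 \<in> nz" using W_inv a b by auto
    have c: "a1 \<in> carrier K" "b1 \<in> carrier K" "s1 \<in> carrier K" "t1 \<in> carrier K" "inv s1 \<in> carrier K" "inv t1 \<in> carrier K"
      using Cc CC a b nzD(1) n nz_inv by auto
    have bn: "b \<in> nz" using ab Rc nzI by auto
    have b1n: "b1 \<in> nz" using mult_nz[OF c(2,6)] bn b(3) by simp
    have "x \<otimes> (s1 \<otimes> b1) = a1 \<otimes> t1"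
    proof -
      have "x \<otimes> b = a" using div_cancel[OF bn Rc[OF ab(1)]] ab(4) by simp
      moreover have "b1 = b \<otimes> t1" using div_cancel[OF n(2) c(2)] b(3) by simp
      moreover have "a1 = a \<otimes> s1" using div_cancel[OF n(1) c(1)] a(3) by simp
      ultimately show ?thesis using \<open>x \<in> carrier K\<close> Rc ab c by (metis (no_types, lifting) m_assoc m_comm m_closed)
    qed
    moreover have sb: "s1 \<otimes> b1 \<in> nz" by (rule nz_mult[OF n(1) b1n])
    ultimately have "x = (a1 \<otimes> t1) \<otimes> inv (s1 \<otimes> b1)"
      using mult_cancel[OF sb \<open>x \<in> carrier K\<close>] m_comm[OF \<open>x \<in> carrier K\<close> nzD(1)[OF sb]] by simp
    moreover have "a1 \<otimes> t1 \<in> ?C" "s1 \<otimes> b1 \<in> ?C" using a b W(2) CC by (auto intro!: generate_ring.eng_mult)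
    ultimately show "\<exists>a\<in>?C. \<exists>b\<in>?C - {\<zero>}. x = a \<otimes> inv b" using nzD(2)[OF sb] by blast
  qed
  have "krull_for K ?C" by (rule affine_krull[OF field_axioms char0, unfolded affine_krull_def, rule_format])
      (use kc kp subfield_m_inv(1)[OF k] S' fr in "auto simp: a_minus_def")
  then obtain U where U: "\<forall>w\<in>U. rval K w" "\<forall>x\<in>nz. finite {w\<in>U. w x \<noteq> 0}" "\<forall>c\<in>?C - {\<zero>}. \<forall>w\<in>U. 0 \<le> w c"
    "\<forall>x\<in>nz. (\<forall>w\<in>U. 0 \<le> w x) \<longrightarrow> x \<in> integral_closure K ?C" unfolding krull_for_def nz_def by blast
  define V where "V = {w\<in>U. \<forall>s\<in>W. w s = 0}"
  let ?B = "normalized_chart K R I f"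
  have VU: "V \<subseteq> U" unfolding V_def by auto
  have val: "rval K w" if "w \<in> V" for w using that U(1) VU by auto
  have CV: "c \<in> vring w" if "c \<in> ?C" "w \<in> U" for c w using that U(3) Cc unfolding vring_def by auto
  have RV: "R \<subseteq> vring w" if w: "w \<in> V" for w
  proof
    fix r assume "r \<in> R"
    then obtain a s where a: "a \<in> generate_ring K (k \<union> S)" "s \<in> W" "r = a \<otimes> inv s" unfolding RW localization_def by auto
    have "inv s \<in> vring w" using vring_nonneg[OF val[OF w] nz_inv] W_inv(1)[OF a(2)] rv_inv[OF val[OF w]] w a(2) unfolding V_def by simp
    thus "r \<in> vring w" using vring_closed(2)[OF val[OF w]] CV CC a w VU by auto
  qed
  have BV: "?B \<subseteq> vring w" if w: "w \<in> V" for w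
  proof (rule chart_vring[OF val[OF w] RV[OF w] _ fn], rule ballI)
    fix g assume g: "g \<in> I"
    have "g \<otimes> inv f \<in> ?C" if "g \<in> G" for g using that unfolding S'_def by (auto intro: generate_ring.incl)
    thus "g \<otimes> inv f \<in> vring w" using CV w VU by (intro val_ideal_min[OF val[OF w] RV[OF w] G(2,3) fn _ g]) auto
  qed
  have BVn: "x \<in> ?B" if x: "x \<in> nz" "\<forall>w\<in>V. 0 \<le> w x" for x
  proof -
    \<comment> \<open>A pole of \<open>x\<close> is at a valuation outside \<open>V\<close>, so some
      element of \<open>W\<close> is positive there. A product of powers of such elements clears all
      poles, finitely many in number.\<close>
    have clear: "\<exists>s\<in>W. \<forall>w\<in>F. 0 \<le> w s + w x" if "finite F" "F \<subseteq> U" "\<forall>w\<in>F. w x < 0" for F using that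
    proof (induction F)
      case empty thus ?case using submonoid.one_closed[OF W(1)] by auto
    next
      case (insert w F)
      then obtain s where s: "s \<in> W" "\<forall>w\<in>F. 0 \<le> w s + w x" by auto
      have wU: "w \<in> U" "w x < 0" using insert.prems by auto
      hence "w \<notin> V" using x(2) by fastforce
      then obtain t where t: "t \<in> W" "w t \<noteq> 0" using wU unfolding V_def by auto
      have tC: "0 \<le> v t" if "v \<in> U" for v using U(3) that t(1) W(2,3) CC by auto
      have tp: "0 < w t" using tC[OF wU(1)] t(2) by simp
      let ?m = "nat (- w x)"
      have tW: "t [^] n \<in> W" for n :: nat by (induction n) (auto intro: submonoid.m_closed[OF W(1)] submonoid.one_closed[OF W(1)] t(1))
      let ?s = "s \<otimes> t [^] ?m"
      have v: "v ?s = v s + int ?m * v t" if "v \<in> U" for v using rv_mult[of v s "t [^] ?m"] rv_pow[of v t] U(1) that W_inv(1) s(1) t(1) nz_pow by auto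
      have "0 \<le> v ?s + v x" if "v \<in> insert w F" for v
      proof (cases "v = w")
        case True
        have "- w x \<le> - w x * w t" using tp wU(2) by (simp add: mult_le_cancel_left1)
        moreover have "0 \<le> w s" using U(3) wU(1) s(1) W(2,3) CC by auto
        moreover have "w ?s = w s + (- w x) * w t" using v[OF wU(1)] wU(2) by simp
        ultimately show ?thesis unfolding True by linarith
      next
        case False
        hence "v \<in> F" "v \<in> U" using that insert.prems by auto
        hence "0 \<le> v s + v x" "0 \<le> int ?m * v t" using s(2) tC by auto
        thus ?thesis using v[OF \<open>v \<in> U\<close>] by linarith
      qed
      moreover have "?s \<in> W" by (rule submonoid.m_closed[OF W(1) s(1) tW])
      ultimately show ?case by blast
    qed
    have "finite {w\<in>U. w x < 0}" by (rule finite_subset[OF _ bspec[OF U(2) x(1)]]) auto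
    from clear[OF this] obtain s where s: "s \<in> W" "\<forall>w\<in>{w\<in>U. w x < 0}. 0 \<le> w s + w x" by blast
    have sn: "s \<in> nz" by (rule W_inv(1)[OF s(1)])
    have "0 \<le> w (s \<otimes> x)" if w: "w \<in> U" for w
    proof -
      have "0 \<le> w s" using U(3) w s(1) W(2,3) CC by auto
      thus ?thesis using rv_mult[OF _ sn x(1), of w] U(1) w s(2) by (cases "w x < 0") auto
    qed
    hence "s \<otimes> x \<in> integral_closure K ?C" using U(4) nz_mult[OF sn x(1)] by auto
    moreover have "?C \<subseteq> chart_ring f"
    proof -
      have "c \<in> chart_ring f" if "c \<in> ?C" for c using that
      proof (induction rule: generate_ring.induct)
        case (incl h)
        hence "h \<in> R \<union> {g \<otimes> inv f | g. g \<in> I}" using gen_R[OF generate_ring.incl, of h] G(2) unfolding S'_def by auto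
        thus ?case unfolding chart_ring_def by (rule generate_ring.incl)
      qed (auto simp: chart_ring_def intro: generate_ring.intros)
      thus ?thesis by auto
    qed
    moreover have "inv s \<in> chart_ring f" unfolding chart_ring_def by (rule generate_ring.incl) (simp add: W_inv(2)[OF s(1)])
    ultimately have "x \<in> integral_closure K (chart_ring f)" using integral_closure_scale[OF chart_subring[OF fn] _ sn _ nzD(1)[OF x(1)]] by blast
    thus ?thesis unfolding normalized_chart_def chart_ring_def .
  qed
  have Bc: "?B \<subseteq> carrier K" unfolding normalized_chart_def integral_closure_def by auto
  have Rn: "r \<in> ?B" if "r \<in> R" "r \<noteq> \<zero>" for r using BVn[OF nzI[OF Rc]] that RV vring_nonneg[OF val nzI[OF Rc]] by blast
  have "\<zero> \<in> ?B"
  proof -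
    have "set [\<one>, \<zero>] \<subseteq> chart_ring f" using subringE(2,3)[OF chart_subring[OF fn]] by auto
    moreover have "eval [\<one>, \<zero>] \<zero> = \<zero>" by simp
    ultimately show ?thesis unfolding normalized_chart_def integral_closure_def polynomial_def chart_ring_def
      by (intro CollectI conjI exI[of _ "[\<one>, \<zero>]"]) auto
  qed
  hence "krull_ring ?B V" unfolding krull_ring_def
  proof (intro conjI ballI)
    fix x assume x: "x \<in> nz"
    show "finite {w\<in>V. w x \<noteq> 0}" by (rule finite_subset[of _ "{w\<in>U. w x \<noteq> 0}"]) (use VU U(2) x in auto)
    show "x \<in> ?B \<longleftrightarrow> (\<forall>w\<in>V. 0 \<le> w x)" using BVn[OF x] BV vring_nonneg[OF val x] by blast
    have "x \<in> localization K R (R - {\<zero>})" using nzD(1)[OF x] fracR by simp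
    then obtain a b where ab: "a \<in> R" "b \<in> R" "b \<noteq> \<zero>" "x = a \<otimes> inv b" unfolding localization_def by blast
    have bn: "b \<in> nz" using ab Rc nzI by auto
    have "a \<noteq> \<zero>" using ab(4) nzD(2)[OF x] nzD(1)[OF nz_inv[OF bn]] by auto
    thus "\<exists>a\<in>?B \<inter> nz. \<exists>b\<in>?B \<inter> nz. x = a \<otimes> inv b" using ab Rn Rc nzI by blast
  qed (use val Bc in auto)
  thus ?thesis by blast
qed

end

section \<open>Rees valuations: values on the ideal, finiteness, valuative criterion\<close>

context chart_setup
begin

abbreviation "nchart f \<equiv> normalized_chart K R I f"

lemma chart_incl: assumes "f \<in> nz" "x \<in> chart_ring f" shows "x \<in> nchart f"
proof -
  note c = subringE[OF chart_subring[OF assms(1)]]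
  have xc: "x \<in> carrier K" using c(1) assms(2) by auto
  have "set [\<one>, \<ominus> x] \<subseteq> chart_ring f" using c(3,5) assms(2) by auto
  moreover have "eval [\<one>, \<ominus> x] x = \<zero>" using xc by (simp add: r_neg)
  ultimately show ?thesis unfolding normalized_chart_def integral_closure_def polynomial_def chart_ring_def
    using xc by (intro CollectI conjI exI[of _ "[\<one>, \<ominus> x]"]) auto
qed

lemma chart_R: "f \<in> nz \<Longrightarrow> r \<in> R \<Longrightarrow> r \<in> nchart f" by (rule chart_incl) (auto simp: chart_ring_def intro: generate_ring.incl)

lemma chart_quot: "f \<in> nz \<Longrightarrow> g \<in> I \<Longrightarrow> g \<otimes> inv f \<in> nchart f"
  by (rule chart_incl) (auto simp: chart_ring_def intro: generate_ring.incl)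

lemma val_of_ideal_eq:
  assumes w: "rval K w" and f: "f \<in> I" "f \<in> nz" and le: "\<And>g. g \<in> I \<Longrightarrow> g \<in> nz \<Longrightarrow> w f \<le> w g"
  shows "val_of_ideal (dvr_ord K (vring w)) I = ereal (of_int (w f))" unfolding val_of_ideal_def
proof (rule antisym)
  have "dvr_ord K (vring w) f = ereal (of_int (w f))" using dvr_ord_vring[OF w Ic[OF f(1)]] nzD(2)[OF f(2)] by simp
  thus "(INF g\<in>I. dvr_ord K (vring w) g) \<le> ereal (of_int (w f))" using INF_lower[OF f(1), of "dvr_ord K (vring w)"] by simp
  show "ereal (of_int (w f)) \<le> (INF g\<in>I. dvr_ord K (vring w) g)"
  proof (rule INF_greatest)
    fix g assume "g \<in> I"
    thus "ereal (of_int (w f)) \<le> dvr_ord K (vring w) g" using dvr_ord_vring[OF w Ic] le[of g] nzI[OF Ic] by auto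
  qed
qed

text \<open>On the chart of \<open>f\<close> the ideal is generated by \<open>f\<close>, so
  \<open>f\<close> attains the minimal order of \<open>I\<close> along every divisor of the
  chart.\<close>

lemma chart_min: assumes "krull_ring (nchart f) V" "w \<in> V" "f \<in> nz" "g \<in> I" "g \<in> nz" shows "w f \<le> w g"
proof -
  have "0 \<le> w (g \<otimes> inv f)" by (rule kr_nonneg[OF assms(1) chart_quot[OF assms(3,4)] nz_mult[OF assms(5) nz_inv[OF assms(3)]] assms(2)])
  thus ?thesis using rv_div[OF kr_val[OF assms(1,2)] assms(5,3)] by simp
qed

lemma rees_chart:
  assumes "\<nu> \<in> rees_valuations K R I"
  shows "\<exists>f V w P. f \<in> I \<and> f \<in> nz \<and> krull_ring (nchart f) V \<and> w \<in> V \<and> 0 < w f \<and> \<nu> = dvr_ord K (vring w) \<and>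
    primeideal P (K\<lparr>carrier := nchart f\<rparr>) \<and>
    vring w = localization K (nchart f) (nchart f - P)"
proof -
  obtain Q where Q: "\<nu> = dvr_ord K Q" "Q \<in> blowup_prime_divisors K R I" "0 < val_of_ideal (dvr_ord K Q) I" using assms unfolding rees_valuations_def by auto
  obtain f P where f: "f \<in> I" "f \<noteq> \<zero>" "Q = localization K (nchart f) (nchart f - P)"
    "primeideal P (K\<lparr>carrier := nchart f\<rparr>)" "prime_height (K\<lparr>carrier := nchart f\<rparr>) P = 1"
    using Q(2) unfolding blowup_prime_divisors_def by auto
  have fn: "f \<in> nz" using nzI[OF Ic[OF f(1)] f(2)] .
  obtain V where V: "krull_ring (nchart f) V" using chart_krull[OF f(1,2)] by auto
  obtain w where w: "w \<in> V" "Q = vring w" using height_one_dvr[OF V f(4,5)] f(3) by auto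
  have "val_of_ideal (dvr_ord K Q) I = ereal (of_int (w f))" unfolding w(2) by (rule val_of_ideal_eq[OF kr_val[OF V w(1)] f(1) fn]) (rule chart_min[OF V w(1) fn])
  hence "0 < w f" using Q(3) by simp
  thus ?thesis using f(1,3,4) fn V w(1,2) Q(1) by (intro exI[of _ f] exI[of _ V] exI[of _ w] exI[of _ P] conjI) simp_all
qed

lemma rees_valuation_props:
  assumes "\<nu> \<in> rees_valuations K R I"
  shows "\<exists>w e. rval K w \<and> R \<subseteq> vring w \<and> \<nu> = dvr_ord K (vring w) \<and> 0 < (e::nat) \<and>
     val_of_ideal \<nu> I = ereal (real e) \<and> (\<forall>g\<in>I. g \<in> nz \<longrightarrow> int e \<le> w g)"
proof -
  obtain f V w where f: "f \<in> I" "f \<in> nz" "krull_ring (nchart f) V" "w \<in> V" "0 < w f" "\<nu> = dvr_ord K (vring w)"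
    using rees_chart[OF assms] by (elim exE conjE)
  note v = kr_val[OF f(3,4)]
  have "R \<subseteq> vring w"
  proof
    fix r assume r: "r \<in> R"
    show "r \<in> vring w"
    proof (cases "r = \<zero>")
      case True thus ?thesis using vring_closed(5)[OF v] by simp
    next
      case False
      hence "r \<in> nz" using Rc[OF r] nzI by simp
      thus ?thesis using vring_nonneg[OF v] kr_nonneg[OF f(3) chart_R[OF f(2) r] _ f(4)] by simp
    qed
  qed
  moreover have "val_of_ideal \<nu> I = ereal (real (nat (w f)))" unfolding f(6) using val_of_ideal_eq[OF v f(1,2) chart_min[OF f(3,4,2)]] f(5) by simp
  moreover have "\<forall>g\<in>I. g \<in> nz \<longrightarrow> int (nat (w f)) \<le> w g" using chart_min[OF f(3,4,2)] f(5) by auto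
  ultimately show ?thesis using v f(5,6) by (intro exI[of _ w] exI[of _ "nat (w f)"]) auto
qed

text \<open>Every Rees valuation is already visible on the chart of one of finitely many generators
  of \<open>I\<close>, and there it is among the finitely many valuations of the chosen family that
  do not vanish at this generator.\<close>

lemma rees_finite: "finite (rees_valuations K R I)"
proof -
  obtain G where G: "finite G" "G \<subseteq> I" "I = Idl\<^bsub>RR\<^esub> G" using I_fg by blast
  have "\<forall>g\<in>G - {\<zero>}. \<exists>V. krull_ring (nchart g) V" using chart_krull G(2) by blast
  then obtain V where V: "\<And>g. g \<in> G \<Longrightarrow> g \<noteq> \<zero> \<Longrightarrow> krull_ring (nchart g) (V g)" by (metis DiffI singletonD)
  define T where "T = (\<Union>g\<in>G - {\<zero>}. (\<lambda>w. dvr_ord K (vring w)) ` {w\<in>V g. w g \<noteq> 0})"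
  have fT: "finite T" unfolding T_def
  proof (rule finite_UN_I)
    fix g assume "g \<in> G - {\<zero>}"
    hence "krull_ring (nchart g) (V g)" "g \<in> nz" using V G(2) Ic nzI by auto
    thus "finite ((\<lambda>w. dvr_ord K (vring w)) ` {w\<in>V g. w g \<noteq> 0})" using kr_fin by blast
  qed (use G(1) in simp)
  have "\<nu> \<in> T" if nu: "\<nu> \<in> rees_valuations K R I" for \<nu>
  proof -
    obtain f U w P where f: "f \<in> I" "f \<in> nz" "krull_ring (nchart f) U" "w \<in> U" "0 < w f" "\<nu> = dvr_ord K (vring w)"
      "primeideal P (K\<lparr>carrier := nchart f\<rparr>)"
      "vring w = localization K (nchart f) (nchart f - P)" using rees_chart[OF nu] by (elim exE conjE)
    let ?Bf = "nchart f"
    note v = kr_val[OF f(3,4)]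
    have Rv: "R \<subseteq> vring w" if V: "krull_ring (nchart h) V" "w \<in> V" "h \<in> nz" for h V w
    proof
      fix r assume r: "r \<in> R"
      show "r \<in> vring w"
      proof (cases "r = \<zero>")
        case True thus ?thesis using vring_closed(5)[OF kr_val[OF V(1,2)]] by simp
      next
        case False
        hence "r \<in> nz" using Rc[OF r] nzI by simp
        thus ?thesis using vring_nonneg[OF kr_val[OF V(1,2)]] kr_nonneg[OF V(1) chart_R[OF V(3) r] _ V(2)] by simp
      qed
    qed
    have "G - {\<zero>} \<noteq> {}"
    proof
      assume "G - {\<zero>} = {}"
      hence G0: "G \<subseteq> {\<zero>}" by auto
      have "f \<otimes> inv f \<in> {x\<in>vring w. x = \<zero>} \<or> True" by simp
      interpret RR: ring RR by (rule subring_is_ring[OF R])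
      have "ideal {\<zero>} RR" using RR.zeroideal by simp
      hence "I \<subseteq> {\<zero>}" unfolding G(3) using G0 by (rule RR.genideal_minimal)
      thus False using f(1) nzD(2)[OF f(2)] by auto
    qed
    \<comment> \<open>A generator \<open>j\<close> of least value: all quotients
      \<open>g / j\<close> are integral at \<open>w\<close>, so the center of \<open>w\<close> on
      the blow-up lies in the chart of \<open>j\<close>.\<close>
    hence "Min (w ` (G - {\<zero>})) \<in> w ` (G - {\<zero>})" using G(1) by (intro Min_in) auto
    then obtain j where "Min (w ` (G - {\<zero>})) = w j" "j \<in> G - {\<zero>}" by (rule imageE)
    hence j: "j \<in> G" "j \<noteq> \<zero>" "w j = Min (w ` (G - {\<zero>}))" by simp_all
    have jmin: "w j \<le> w g" if "g \<in> G" "g \<noteq> \<zero>" for g using j(3) that G(1) by simp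
    have jI: "j \<in> I" using j(1) G(2) by auto
    have jn: "j \<in> nz" by (rule nzI[OF Ic[OF jI] j(2)])
    let ?Bj = "nchart j"
    have kj: "krull_ring ?Bj (V j)" by (rule V[OF j(1,2)])
    have gj: "g \<otimes> inv j \<in> vring w" if g: "g \<in> I" for g
    proof (rule val_ideal_min[OF v Rv[OF f(3,4,2)] G(2,3) jn _ g], rule ballI)
      fix g assume gG: "g \<in> G"
      show "g \<otimes> inv j \<in> vring w"
      proof (cases "g = \<zero>")
        case True thus ?thesis using nzD(1)[OF nz_inv[OF jn]] vring_closed(5)[OF v] by simp
      next
        case False
        hence gn: "g \<in> nz" using gG G(2) Ic nzI by auto
        show ?thesis unfolding vring_nonneg[OF v nz_mult[OF gn nz_inv[OF jn]]] using rv_div[OF v gn jn] jmin[OF gG False] by simp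
      qed
    qed
    have Bjv: "?Bj \<subseteq> vring w" by (rule chart_vring[OF v Rv[OF f(3,4,2)] _ jn]) (use gj in blast)
    have wjf: "w j = w f"
    proof (rule antisym)
      show "w f \<le> w j" by (rule chart_min[OF f(3,4,2) jI jn])
      show "w j \<le> w f" using gj[OF f(1)] vring_nonneg[OF v nz_mult[OF f(2) nz_inv[OF jn]]] rv_div[OF v f(2) jn] by simp
    qed
    let ?P = "center ?Bj w"
    have nnw: "0 \<le> w x" if "x \<in> ?Bj" "x \<in> nz" for x using that Bjv vring_nonneg[OF v that(2)] by auto
    have Pp: "primeideal ?P (K\<lparr>carrier := ?Bj\<rparr>)" by (rule center_prime[OF kj v nnw])
    have jP: "j \<in> ?P" unfolding center_def using chart_R[OF jn IR[OF jI]] wjf f(5) by simp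
    obtain w' where w': "w' \<in> V j" "0 < w' j" "center ?Bj w' \<subseteq> ?P" using prime_contains_center[OF kj Pp jP jn] by blast
    note v' = kr_val[OF kj w'(1)]
    let ?u = "f \<otimes> inv j"
    have un: "?u \<in> nz" by (rule nz_mult[OF f(2) nz_inv[OF jn]])
    have uB: "?u \<in> ?Bj" by (rule chart_quot[OF jn f(1)])
    have wu: "w ?u = 0" using rv_div[OF v f(2) jn] wjf by simp
    \<comment> \<open>Both charts agree where \<open>?u = f / j\<close> is a unit. Where
      \<open>?u\<close> vanishes, a high power of it outweighs the finitely many poles of
      \<open>b\<close>.\<close>
    have clear: "\<exists>c::nat. \<forall>n\<ge>c. ?u [^] n \<otimes> b \<in> ?Bj" if b: "b \<in> ?Bf" "b \<in> nz" for b
    proof -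
      let ?F = "{x\<in>V j. x b \<noteq> 0}"
      have fF: "finite ?F" by (rule kr_fin[OF kj b(2)])
      define c where "c = nat (\<Sum>x\<in>?F. \<bar>x b\<bar>)"
      have "?u [^] n \<otimes> b \<in> ?Bj" if n: "c \<le> n" for n unfolding kr_iff[OF kj nz_mult[OF nz_pow[OF un] b(2)]]
      proof
        fix x assume x: "x \<in> V j"
        note vx = kr_val[OF kj x]
        have val: "x (?u [^] n \<otimes> b) = int n * x ?u + x b" using rv_mult[OF vx nz_pow[OF un] b(2)] rv_pow[OF vx un] by simp
        have u0: "0 \<le> x ?u" by (rule kr_nonneg[OF kj uB un x])
        show "0 \<le> x (?u [^] n \<otimes> b)"
        proof (cases "x ?u = 0")
          case True
          have xfj: "x f = x j" using rv_div[OF vx f(2) jn] True by simp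
          have "?Bf \<subseteq> vring x"
          proof (rule chart_vring[OF vx Rv[OF kj x jn] _ f(2)], rule ballI)
            fix g assume g: "g \<in> I"
            show "g \<otimes> inv f \<in> vring x"
            proof (cases "g = \<zero>")
              case True thus ?thesis using nzD(1)[OF nz_inv[OF f(2)]] vring_closed(5)[OF vx] by simp
            next
              case False
              hence gn: "g \<in> nz" using Ic[OF g] nzI by simp
              show ?thesis unfolding vring_nonneg[OF vx nz_mult[OF gn nz_inv[OF f(2)]]] using rv_div[OF vx gn f(2)] chart_min[OF kj x jn g gn] xfj by simp
            qed
          qed
          hence "0 \<le> x b" using b vring_nonneg[OF vx b(2)] by auto
          thus ?thesis using val u0 by simp
        next
          case False
          hence u1: "1 \<le> x ?u" using u0 by simp
          have "- x b \<le> int n"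
          proof (cases "x b = 0")
            case False
            hence "x \<in> ?F" using x by simp
            hence "\<bar>x b\<bar> \<le> (\<Sum>x\<in>?F. \<bar>x b\<bar>)" using fF by (intro member_le_sum[of x ?F "\<lambda>x. \<bar>x b\<bar>"]) auto
            thus ?thesis using n unfolding c_def by linarith
          qed simp
          moreover have "int n * 1 \<le> int n * x ?u" using u1 by (intro mult_left_mono) auto
          ultimately show ?thesis using val by linarith
        qed
      qed
      thus ?thesis by blast
    qed
    \<comment> \<open>Numerator and denominator of an element of the localization are moved into the
      chart of \<open>j\<close> by a power of \<open>?u\<close>. The denominator stays a unit at
      \<open>w\<close>, hence at \<open>w'\<close>, whose center is the smaller one.\<close>
    have sub: "vring w \<subseteq> vring w'"
    proof
      fix z assume z: "z \<in> vring w"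
      hence zc: "z \<in> carrier K" unfolding vring_def by simp
      show "z \<in> vring w'"
      proof (cases "z = \<zero>")
        case True thus ?thesis using vring_closed(5)[OF v'] by simp
      next
        case False
        hence zn: "z \<in> nz" using zc nzI by simp
        obtain b s where bs: "b \<in> ?Bf" "s \<in> ?Bf" "s \<notin> P" "z = b \<otimes> inv s" using z f(8) unfolding localization_def by auto
        have s0: "s \<noteq> \<zero>" using bs(3) prime_props(2)[OF f(3,7)] by auto
        have sn: "s \<in> nz" using kr_carr[OF f(3) bs(2)] s0 nzI by simp
        have "b \<in> carrier K" using kr_carr[OF f(3) bs(1)] .
        moreover have "b \<noteq> \<zero>" using bs(4) False nzD(1)[OF nz_inv[OF sn]] by auto
        ultimately have bn: "b \<in> nz" by (rule nzI)
        have "inv s = \<one> \<otimes> inv s" using nzD(1)[OF nz_inv[OF sn]] by simp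
        hence "inv s \<in> vring w" unfolding f(8) localization_def using bs(2,3) kr_closed(4)[OF f(3)] by blast
        hence ws: "w s = 0" using vring_nonneg[OF v nz_inv[OF sn]] rv_inv[OF v sn] kr_nonneg[OF f(3) bs(2) sn f(4)] by simp
        obtain c1 :: nat where c1: "\<forall>n\<ge>c1. ?u [^] n \<otimes> b \<in> ?Bj" using clear[OF bs(1) bn] by auto
        obtain c2 :: nat where c2: "\<forall>n\<ge>c2. ?u [^] n \<otimes> s \<in> ?Bj" using clear[OF bs(2) sn] by auto
        define c where "c = max c1 c2"
        let ?b = "?u [^] c \<otimes> b" and ?s = "?u [^] c \<otimes> s"
        have B: "?b \<in> ?Bj" "?s \<in> ?Bj" using c1 c2 unfolding c_def by auto
        have n: "?b \<in> nz" "?s \<in> nz" using nz_mult[OF nz_pow[OF un]] bn sn by auto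
        have "w ?s = 0" using rv_mult[OF v nz_pow[OF un] sn] rv_pow[OF v un] wu ws by simp
        hence "?s \<notin> ?P" using nzD(2)[OF n(2)] unfolding center_def by simp
        hence "?s \<notin> center ?Bj w'" using w'(3) by auto
        hence "w' ?s = 0" using B(2) kr_nonneg[OF kj B(2) n(2) w'(1)] unfolding center_def by auto
        moreover have "0 \<le> w' ?b" by (rule kr_nonneg[OF kj B(1) n(1) w'(1)])
        moreover have "w' ?b = w' (?u [^] c) + w' b" "w' ?s = w' (?u [^] c) + w' s" using rv_mult[OF v' nz_pow[OF un]] bn sn by auto
        ultimately have "0 \<le> w' z" unfolding bs(4) using rv_div[OF v' bn sn] by simp
        thus ?thesis using vring_nonneg[OF v' zn] by simp
      qed
    qed
    have "w x = w' x" if "x \<in> nz" for x by (rule rval_eqI[OF v v' sub that])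
    hence "vring w = vring w'" unfolding vring_def using nzI by auto
    hence "\<nu> = dvr_ord K (vring w')" using f(6) by simp
    thus ?thesis unfolding T_def using j(1,2) w'(1,2) by (intro UN_I[of j] image_eqI[of _ _ w']) simp_all
  qed
  thus ?thesis using finite_subset[OF _ fT] by blast
qed

text \<open>The valuative criterion on the chart of \<open>f\<close>. Where \<open>f\<close> is a
  unit, nonnegativity of \<open>g\<close> is enough; where \<open>f\<close> vanishes, the valuation
  of an irredundant family is a Rees valuation and the assumption on \<open>g\<close>
  applies.\<close>

lemma rees_integral:
  assumes g: "g \<in> R" "g \<in> nz" and f: "f \<in> I" "f \<in> nz"
    and le: "\<And>\<nu>. \<nu> \<in> rees_valuations K R I \<Longrightarrow> ereal (real m) * val_of_ideal \<nu> I \<le> \<nu> g"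
  shows "g \<otimes> inv (f [^] m) \<in> nchart f"
proof -
  let ?B = "nchart f"
  obtain V where V: "krull_ring ?B V" using chart_krull[OF f(1) nzD(2)[OF f(2)]] by auto
  obtain V' where V': "V' \<subseteq> V" "krull_ring ?B V'" "\<forall>w\<in>V'. w f \<noteq> 0 \<longrightarrow> irr V' w" using irredundant[OF V f(2)] by auto
  have fm: "f [^] m \<in> nz" by (rule nz_pow[OF f(2)])
  show ?thesis unfolding kr_iff[OF V'(2) nz_mult[OF g(2) nz_inv[OF fm]]]
  proof
    fix w assume w: "w \<in> V'"
    note v = kr_val[OF V'(2) w]
    have val: "w (g \<otimes> inv (f [^] m)) = w g - int m * w f" using rv_div[OF v g(2) fm] rv_pow[OF v f(2)] by simp
    have g0: "0 \<le> w g" by (rule kr_nonneg[OF V'(2) chart_R[OF f(2) g(1)] g(2) w])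
    show "0 \<le> w (g \<otimes> inv (f [^] m))"
    proof (cases "w f = 0")
      case True thus ?thesis using val g0 by simp
    next
      case False
      have "0 \<le> w f" by (rule kr_nonneg[OF V'(2) chart_R[OF f(2) IR[OF f(1)]] f(2) w])
      hence wf: "0 < w f" using False by simp
      have ir: "irr V' w" using V'(3) w False by simp
      have voi: "val_of_ideal (dvr_ord K (vring w)) I = ereal (of_int (w f))" by (rule val_of_ideal_eq[OF v f chart_min[OF V'(2) w f(2)]])
      have "vring w \<in> blowup_prime_divisors K R I" unfolding blowup_prime_divisors_def using irr_localization[OF V'(2) w ir] center_height[OF V'(2) w ir]
          center_prime[OF V'(2) v kr_nonneg[OF V'(2) _ _ w]] f(1) nzD(2)[OF f(2)]
        by (intro CollectI exI[of _ ?B] exI[of _ "center ?B w"] conjI bexI[of _ f]) simp_all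
      hence "dvr_ord K (vring w) \<in> rees_valuations K R I" unfolding rees_valuations_def using voi wf by auto
      from le[OF this] have "ereal (real m) * ereal (of_int (w f)) \<le> ereal (of_int (w g))"
        unfolding voi using dvr_ord_vring[OF v Rc[OF g(1)]] nzD(2)[OF g(2)] by simp
      hence "real m * of_int (w f) \<le> of_int (w g)" by simp
      hence "int m * w f \<le> w g" by (metis of_int_le_iff of_int_mult of_int_of_nat_eq)
      thus ?thesis using val by simp
    qed
  qed
qed

end

section \<open>Length of quotient rings\<close>

text \<open>Chains of submodules of \<open>R / J\<close> seen as chains of ideals of
  \<open>R\<close> above \<open>J\<close>, which keeps cosets out of all length
  computations.\<close>

definition ideal_chain :: "('a, 'b) ring_scheme \<Rightarrow> 'a set \<Rightarrow> nat \<Rightarrow> bool" where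
  "ideal_chain R J l \<longleftrightarrow> (\<exists>N. (\<forall>i\<le>l. ideal (N i) R \<and> J \<subseteq> N i) \<and> (\<forall>i<l. N i \<subset> N (Suc i)))"

definition has_length :: "('a, 'b) ring_scheme \<Rightarrow> 'a set \<Rightarrow> nat \<Rightarrow> bool" where
  "has_length R J m \<longleftrightarrow> ideal_chain R J m \<and> (\<forall>l. ideal_chain R J l \<longrightarrow> l \<le> m)"

lemma quot_module_simps:
  "carrier (quot_module R J) = carrier (R Quot J)"
  "subgroup H (add_monoid (quot_module R J)) \<longleftrightarrow> subgroup H (add_monoid (R Quot J))"
  "r \<odot>\<^bsub>quot_module R J\<^esub> c = (J +>\<^bsub>R\<^esub> r) \<otimes>\<^bsub>R Quot J\<^esub> c"
  unfolding quot_module_def by (simp_all add: ring.defs module.defs subgroup_def m_inv_def)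

lemma quot_cases: assumes "c \<in> carrier (R Quot J)" obtains a where "a \<in> carrier R" "c = J +>\<^bsub>R\<^esub> a"
  using assms unfolding FactRing_def partial_object.select_convs A_RCOSETS_def' by (elim UN_E singletonE)

context cring
begin

lemma idealI': assumes "J \<subseteq> carrier R" "\<zero> \<in> J" "\<And>a b. a \<in> J \<Longrightarrow> b \<in> J \<Longrightarrow> a \<oplus> b \<in> J"
    "\<And>a r. a \<in> J \<Longrightarrow> r \<in> carrier R \<Longrightarrow> r \<otimes> a \<in> J" shows "ideal J R"
proof (rule subring_carrier_ideal[OF ring_axioms assms(1,2)])
  show "a \<oplus> b \<in> J" if "a \<in> J" "b \<in> J" for a b using assms(3) that .
  show r: "r \<otimes> a \<in> J" if "a \<in> J" "r \<in> carrier R" for a r using assms(4) that .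
  show "a \<otimes> r \<in> J" if "a \<in> J" "r \<in> carrier R" for a r using r[OF that] m_comm[OF subsetD[OF assms(1) that(1)] that(2)] by simp
qed

lemma idD: assumes "ideal J R"
  shows "a \<in> J \<Longrightarrow> a \<in> carrier R" "\<zero> \<in> J" "a \<in> J \<Longrightarrow> b \<in> J \<Longrightarrow> a \<oplus> b \<in> J" "a \<in> J \<Longrightarrow> b \<in> J \<Longrightarrow> a \<ominus> b \<in> J"
    "a \<in> J \<Longrightarrow> r \<in> carrier R \<Longrightarrow> r \<otimes> a \<in> J" "a \<in> J \<Longrightarrow> r \<in> carrier R \<Longrightarrow> a \<otimes> r \<in> J"
proof -
  interpret ideal J R by (rule assms)
  show "a \<in> J \<Longrightarrow> a \<in> carrier R" "\<zero> \<in> J" "a \<in> J \<Longrightarrow> b \<in> J \<Longrightarrow> a \<oplus> b \<in> J"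
    "a \<in> J \<Longrightarrow> r \<in> carrier R \<Longrightarrow> r \<otimes> a \<in> J" "a \<in> J \<Longrightarrow> r \<in> carrier R \<Longrightarrow> a \<otimes> r \<in> J"
    using Icarr zero_closed a_closed I_l_closed I_r_closed by simp_all
  show "a \<in> J \<Longrightarrow> b \<in> J \<Longrightarrow> a \<ominus> b \<in> J" unfolding a_minus_def by (rule a_closed[OF _ a_inv_closed])
qed

lemma submodule_preimage:
  assumes J: "ideal J R" and N: "submodule N R (quot_module R J)"
  shows "ideal {a \<in> carrier R. J +> a \<in> N} R" "J \<subseteq> {a \<in> carrier R. J +> a \<in> N}"
    "N = (+>) J ` {a \<in> carrier R. J +> a \<in> N}"
proof -
  interpret h: ring_hom_ring R "R Quot J" "(+>) J" by (rule ideal.rcos_ring_hom_ring[OF J])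
  interpret N: submodule N R "quot_module R J" by (rule N)
  let ?A = "{a \<in> carrier R. J +> a \<in> N}"
  have sg: "subgroup N (add_monoid (R Quot J))" by (rule iffD1[OF quot_module_simps(2) N.subgroup_axioms])
  have sub: "N \<subseteq> carrier (R Quot J)" using subgroup.subset[OF sg] by simp
  have zero: "\<zero>\<^bsub>R Quot J\<^esub> \<in> N" using subgroup.one_closed[OF sg] by simp
  have add: "a \<oplus>\<^bsub>R Quot J\<^esub> b \<in> N" if "a \<in> N" "b \<in> N" for a b using subgroup.m_closed[OF sg that] by simp
  show "ideal ?A R"
  proof (rule idealI')
    show "?A \<subseteq> carrier R" by (rule subsetI) simp
    show "\<zero> \<in> ?A" using zero h.hom_zero by simp
    fix a b assume ab: "a \<in> ?A" "b \<in> ?A"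
    thus "a \<oplus> b \<in> ?A" using add[of "J +> a" "J +> b"] by simp
  next
    fix a r assume ar: "a \<in> ?A" "r \<in> carrier R"
    hence "r \<odot>\<^bsub>quot_module R J\<^esub> (J +> a) \<in> N" by (intro N.smult_closed) simp_all
    thus "r \<otimes> a \<in> ?A" using ar by (simp add: quot_module_simps)
  qed
  show "J \<subseteq> ?A"
  proof
    fix a assume a: "a \<in> J"
    have ac: "a \<in> carrier R" by (rule idD(1)[OF J a])
    have "a \<ominus> \<zero> \<in> J" by (rule idD(4)[OF J a idD(2)[OF J]])
    hence "J +> a = J +> \<zero>" unfolding quotient_eq_iff_same_a_r_cos[OF J ac zero_closed] .
    hence "J +> a = \<zero>\<^bsub>R Quot J\<^esub>" using h.hom_zero by simp
    thus "a \<in> ?A" using zero ac by simp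
  qed
  show "N = (+>) J ` ?A"
  proof
    show "N \<subseteq> (+>) J ` ?A"
    proof
      fix c assume c: "c \<in> N"
      from subsetD[OF sub c] obtain a where a: "a \<in> carrier R" "c = J +> a" by (rule quot_cases)
      have "a \<in> carrier R \<and> J +> a \<in> N" using a(1) c[unfolded a(2)] by (rule conjI)
      hence "a \<in> ?A" by (rule CollectI)
      thus "c \<in> (+>) J ` ?A" unfolding a(2) by (rule imageI)
    qed
    show "(+>) J ` ?A \<subseteq> N"
    proof (rule image_subsetI)
      fix a assume "a \<in> ?A"
      hence "a \<in> carrier R \<and> J +> a \<in> N" by (rule CollectD)
      thus "J +> a \<in> N" by (rule conjunct2)
    qed
  qed
qed

lemma submodule_image:
  assumes J: "ideal J R" and N: "ideal N R" "J \<subseteq> N" shows "submodule ((+>) J ` N) R (quot_module R J)"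
    "a \<in> carrier R \<Longrightarrow> J +> a \<in> (+>) J ` N \<longleftrightarrow> a \<in> N"
proof -
  interpret h: ring_hom_ring R "R Quot J" "(+>) J" by (rule ideal.rcos_ring_hom_ring[OF J])
  have sg: "subgroup N (add_monoid R)" by (rule additive_subgroup.a_subgroup[OF ideal.axioms(1)[OF N(1)]])
  have "subgroup ((+>) J ` N) (add_monoid (quot_module R J))" by (rule iffD2[OF quot_module_simps(2)], rule group_hom.subgroup_img_is_subgroup[OF h.a_group_hom sg])
  moreover have "r \<odot>\<^bsub>quot_module R J\<^esub> c \<in> (+>) J ` N" if r: "r \<in> carrier R" and c: "c \<in> (+>) J ` N" for r c
  proof -
    obtain a where a: "a \<in> N" "c = J +> a" using c by (rule imageE)
    have "r \<odot>\<^bsub>quot_module R J\<^esub> c = J +> (r \<otimes> a)" unfolding quot_module_simps a(2) using r idD(1)[OF N(1) a(1)] by simp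
    thus ?thesis using idD(5)[OF N(1) a(1) r] by simp
  qed
  ultimately show "submodule ((+>) J ` N) R (quot_module R J)" by (simp add: submodule_def submodule_axioms_def)
  assume a: "a \<in> carrier R"
  show "J +> a \<in> (+>) J ` N \<longleftrightarrow> a \<in> N"
  proof
    assume "J +> a \<in> (+>) J ` N"
    then obtain b where b: "J +> a = J +> b" "b \<in> N" by (rule imageE)
    have "a \<ominus> b \<in> J" using quotient_eq_iff_same_a_r_cos[OF J a idD(1)[OF N(1) b(2)]] b(1) by simp
    hence "(a \<ominus> b) \<oplus> b \<in> N" using idD(3)[OF N(1) subsetD[OF N(2)] b(2)] by simp
    moreover have "(a \<ominus> b) \<oplus> b = a" using a idD(1)[OF N(1) b(2)] by (simp add: a_minus_def a_assoc l_neg)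
    ultimately show "a \<in> N" by simp
  qed (rule imageI)
qed

lemma module_length_eq_chains:
  assumes J: "ideal J R"
  shows "(\<exists>N. (\<forall>i\<le>l. submodule (N i) R (quot_module R J)) \<and> (\<forall>i<l. N i \<subset> N (Suc i))) \<longleftrightarrow> ideal_chain R J l"
proof
  assume "\<exists>N. (\<forall>i\<le>l. submodule (N i) R (quot_module R J)) \<and> (\<forall>i<l. N i \<subset> N (Suc i))"
  then obtain N where N: "\<And>i. i \<le> l \<Longrightarrow> submodule (N i) R (quot_module R J)" "\<And>i. i < l \<Longrightarrow> N i \<subset> N (Suc i)" by auto
  let ?P = "\<lambda>i. {a \<in> carrier R. J +> a \<in> N i}"
  have "?P i \<subset> ?P (Suc i)" if i: "i < l" for i
  proof (rule psubsetI)
    show "?P i \<subseteq> ?P (Suc i)" using N(2)[OF i] by (intro subsetI) (simp add: psubset_imp_subset[THEN subsetD])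
    show "?P i \<noteq> ?P (Suc i)" using submodule_preimage(3)[OF J N(1)[of i]] submodule_preimage(3)[OF J N(1)[of "Suc i"]] N(2)[OF i] i
      by (metis Suc_leI less_imp_le psubset_eq)
  qed
  thus "ideal_chain R J l" unfolding ideal_chain_def using submodule_preimage(1,2)[OF J N(1)] by (intro exI[of _ ?P] conjI allI impI)
next
  assume "ideal_chain R J l"
  then obtain N where N: "\<And>i. i \<le> l \<Longrightarrow> ideal (N i) R" "\<And>i. i \<le> l \<Longrightarrow> J \<subseteq> N i" "\<And>i. i < l \<Longrightarrow> N i \<subset> N (Suc i)"
    unfolding ideal_chain_def by auto
  have "(+>) J ` N i \<subset> (+>) J ` N (Suc i)" if i: "i < l" for i
  proof -
    obtain a where a': "a \<in> N (Suc i) - N i" using psubset_imp_ex_mem[OF N(3)[OF i]] by (rule exE)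
    hence a: "a \<in> N (Suc i)" "a \<notin> N i" by simp_all
    have ac: "a \<in> carrier R" by (rule idD(1)[OF N(1) a(1)]) (use i in simp)
    have "J +> a \<notin> (+>) J ` N i" using submodule_image(2)[OF J N(1,2) ac, of i] a(2) i by simp
    moreover have "J +> a \<in> (+>) J ` N (Suc i)" using a(1) by (rule imageI)
    moreover have "(+>) J ` N i \<subseteq> (+>) J ` N (Suc i)" using N(3)[OF i] by (intro image_mono psubset_imp_subset)
    ultimately show ?thesis by (metis psubsetI)
  qed
  thus "\<exists>N. (\<forall>i\<le>l. submodule (N i) R (quot_module R J)) \<and> (\<forall>i<l. N i \<subset> N (Suc i))"
    using submodule_image(1)[OF J N(1,2)] by (intro exI[of _ "\<lambda>i. (+>) J ` N i"] conjI allI impI)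
qed

lemma has_length_module_length:
  assumes J: "ideal J R" and m: "has_length R J m" shows "module_length R (quot_module R J) = enat m" unfolding module_length_def module_length_eq_chains[OF J]
proof (rule antisym)
  show "Sup {enat l |l. ideal_chain R J l} \<le> enat m" by (rule Sup_least) (use m in "auto simp: has_length_def")
  show "enat m \<le> Sup {enat l |l. ideal_chain R J l}" by (rule Sup_upper) (use m in "auto simp: has_length_def")
qed

subsection \<open>Additivity\<close>

definition add_elt :: "'a set \<Rightarrow> 'a \<Rightarrow> 'a set" where
  "add_elt J x = {j \<oplus> x \<otimes> r | j r. j \<in> J \<and> r \<in> carrier R}"

definition colon :: "'a set \<Rightarrow> 'a \<Rightarrow> 'a set" where
  "colon J x = {r \<in> carrier R. x \<otimes> r \<in> J}"

lemma add_mul_ideal: assumes J: "ideal J R" and x: "x \<in> carrier R" and N: "ideal N R"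
  shows "ideal {j \<oplus> x \<otimes> r | j r. j \<in> J \<and> r \<in> N} R" (is "ideal ?X R") "J \<subseteq> {j \<oplus> x \<otimes> r | j r. j \<in> J \<and> r \<in> N}"
proof -
  note i = idD[OF J]
  show "ideal ?X R"
  proof (rule idealI')
    show "?X \<subseteq> carrier R" using i(1) idD(1)[OF N] x by auto
    have "\<zero> = \<zero> \<oplus> x \<otimes> \<zero>" using x by simp
    thus "\<zero> \<in> ?X" using i(2) idD(2)[OF N] by blast
    fix u assume u: "u \<in> ?X"
    then obtain j r where jr: "u = j \<oplus> x \<otimes> r" "j \<in> J" "r \<in> N" by auto
    note rc = idD(1)[OF N jr(3)]
    { fix v assume "v \<in> ?X"
      then obtain j' r' where jr': "v = j' \<oplus> x \<otimes> r'" "j' \<in> J" "r' \<in> N" by auto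
      note rc' = idD(1)[OF N jr'(3)]
      have "u \<oplus> v = (j \<oplus> j') \<oplus> x \<otimes> (r \<oplus> r')" unfolding jr(1) jr'(1) using i(1)[OF jr(2)] i(1)[OF jr'(2)] rc rc' x by algebra
      thus "u \<oplus> v \<in> ?X" using i(3)[OF jr(2) jr'(2)] idD(3)[OF N jr(3) jr'(3)] by blast }
    fix s assume s: "s \<in> carrier R"
    have "s \<otimes> u = s \<otimes> j \<oplus> x \<otimes> (s \<otimes> r)" unfolding jr(1) using i(1)[OF jr(2)] rc s x by algebra
    thus "s \<otimes> u \<in> ?X" using i(5)[OF jr(2) s] idD(5)[OF N jr(3) s] by blast
  qed
  show "J \<subseteq> ?X"
  proof
    fix j assume j: "j \<in> J"
    have "j = j \<oplus> x \<otimes> \<zero>" using i(1)[OF j] x by simp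
    thus "j \<in> ?X" using j idD(2)[OF N] by blast
  qed
qed

lemma add_elt_ideal: assumes J: "ideal J R" and x: "x \<in> carrier R" shows "ideal (add_elt J x) R" "J \<subseteq> add_elt J x" "x \<in> add_elt J x"
proof -
  show "ideal (add_elt J x) R" "J \<subseteq> add_elt J x" unfolding add_elt_def by (rule add_mul_ideal[OF J x oneideal])+
  have "x = \<zero> \<oplus> x \<otimes> \<one>" using x by simp
  thus "x \<in> add_elt J x" unfolding add_elt_def using idD(2)[OF J] by blast
qed

lemma colon_ideal: assumes J: "ideal J R" and x: "x \<in> carrier R" shows "ideal (colon J x) R" "J \<subseteq> colon J x"
proof -
  note i = idD[OF J]
  show "ideal (colon J x) R"
  proof (rule idealI')
    show "colon J x \<subseteq> carrier R" unfolding colon_def by (rule subsetI) simp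
    show "\<zero> \<in> colon J x" unfolding colon_def using i(2) x by simp
    fix a assume a: "a \<in> colon J x"
    { fix b assume "b \<in> colon J x"
      thus "a \<oplus> b \<in> colon J x" using a i(3) x unfolding colon_def by (simp add: r_distr) }
    fix s assume s: "s \<in> carrier R"
    have "x \<otimes> (s \<otimes> a) = s \<otimes> (x \<otimes> a)" using a s x unfolding colon_def by (simp add: m_lcomm)
    thus "s \<otimes> a \<in> colon J x" using i(5)[of "x \<otimes> a" s] a s unfolding colon_def by simp
  qed
  show "J \<subseteq> colon J x" unfolding colon_def using i(1,5) x by (intro subsetI) simp
qed

text \<open>An element of \<open>N'\<close> is \<open>s \<oplus> x \<otimes> t\<close> with
  \<open>s\<close> in \<open>N\<close>; then \<open>t\<close> is in the colon ideal of
  \<open>N'\<close>, which is that of \<open>N\<close>, so \<open>x \<otimes> t\<close> is in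
  \<open>N\<close>.\<close>

lemma modular: assumes N: "ideal N R" "ideal N' R" "N \<subseteq> N'" and x: "x \<in> carrier R" and e: "add_elt N x = add_elt N' x" "colon N x = colon N' x"
  shows "N = N'"
proof (rule antisym[OF N(3) subsetI])
  fix r assume r: "r \<in> N'"
  hence "r \<in> add_elt N x" using add_elt_ideal(2)[OF N(2) x] e(1) by (metis subsetD)
  then obtain s t where st: "r = s \<oplus> x \<otimes> t" "s \<in> N" "t \<in> carrier R" unfolding add_elt_def by auto
  have c: "s \<in> carrier R" using idD(1)[OF N(1) st(2)] .
  have "x \<otimes> t = r \<ominus> s" unfolding st(1) using c st(3) x by algebra
  hence "x \<otimes> t \<in> N'" using idD(4)[OF N(2) r subsetD[OF N(3) st(2)]] by simp
  hence "t \<in> colon N x" unfolding e(2) unfolding colon_def using st(3) by simp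
  hence "x \<otimes> t \<in> N" unfolding colon_def by simp
  thus "r \<in> N" unfolding st(1) using idD(3)[OF N(1) st(2)] by simp
qed

lemma weak_chain:
  assumes "\<And>i. i \<le> l \<Longrightarrow> ideal (N i) R \<and> J \<subseteq> N i" "\<And>i. i < l \<Longrightarrow> N i \<subseteq> N (Suc i)"
  shows "ideal_chain R J (card {i. i < l \<and> N i \<noteq> N (Suc i)})"
proof -
  have "\<exists>P. (\<forall>i\<le>card {i. i < l \<and> N i \<noteq> N (Suc i)}. ideal (P i) R \<and> J \<subseteq> P i) \<and>
      (\<forall>i<card {i. i < l \<and> N i \<noteq> N (Suc i)}. P i \<subset> P (Suc i)) \<and> P (card {i. i < l \<and> N i \<noteq> N (Suc i)}) = N l" using assms
  proof (induction l)
    case 0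
    thus ?case by (intro exI[of _ N]) simp
  next
    case (Suc l)
    let ?c = "card {i. i < l \<and> N i \<noteq> N (Suc i)}"
    obtain P where P: "\<forall>i\<le>?c. ideal (P i) R \<and> J \<subseteq> P i" "\<forall>i<?c. P i \<subset> P (Suc i)" "P ?c = N l"
    proof -
      have "\<exists>P. (\<forall>i\<le>?c. ideal (P i) R \<and> J \<subseteq> P i) \<and> (\<forall>i<?c. P i \<subset> P (Suc i)) \<and> P ?c = N l"
        by (rule Suc.IH) (use Suc.prems in simp_all)
      thus thesis by (elim exE conjE) (rule that)
    qed
    show ?case
    proof (cases "N l = N (Suc l)")
      case True
      hence "{i. i < Suc l \<and> N i \<noteq> N (Suc i)} = {i. i < l \<and> N i \<noteq> N (Suc i)}" by (intro Collect_cong) (auto simp: less_Suc_eq)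
      thus ?thesis using P True by (intro exI[of _ P]) (simp only: simp_thms)
    next
      case False
      have "{i. i < Suc l \<and> N i \<noteq> N (Suc i)} = insert l {i. i < l \<and> N i \<noteq> N (Suc i)}" using False by (auto simp: less_Suc_eq)
      hence c: "card {i. i < Suc l \<and> N i \<noteq> N (Suc i)} = Suc ?c" by simp
      have "N l \<subset> N (Suc l)" using Suc.prems(2)[of l] False by (simp add: psubset_eq)
      thus ?thesis unfolding c using P Suc.prems(1)[of "Suc l"]
        by (intro exI[of _ "\<lambda>i. if i \<le> ?c then P i else N (Suc l)"]) (auto simp: le_Suc_eq less_Suc_eq)
    qed
  qed
  thus ?thesis unfolding ideal_chain_def by (elim exE conjE) (intro exI conjI)
qed

text \<open>Additivity for the exact sequence that multiplication by \<open>x\<close> embeds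
  \<open>R / (J : x)\<close> into \<open>R / J\<close> with cokernel
  \<open>R / (J + x R)\<close>.\<close>

lemma has_length_add:
  assumes J: "ideal J R" and x: "x \<in> carrier R" and a: "has_length R (add_elt J x) a" and b: "has_length R (colon J x) b" shows "has_length R J (a + b)"
  unfolding has_length_def
proof (intro conjI allI impI)
  obtain A where A: "\<And>i. i \<le> a \<Longrightarrow> ideal (A i) R" "\<And>i. i \<le> a \<Longrightarrow> add_elt J x \<subseteq> A i" "\<And>i. i < a \<Longrightarrow> A i \<subset> A (Suc i)"
    using a unfolding has_length_def ideal_chain_def by auto
  obtain B where B: "\<And>i. i \<le> b \<Longrightarrow> ideal (B i) R" "\<And>i. i \<le> b \<Longrightarrow> colon J x \<subseteq> B i" "\<And>i. i < b \<Longrightarrow> B i \<subset> B (Suc i)"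
    using b unfolding has_length_def ideal_chain_def by auto
  let ?X = "\<lambda>N. {j \<oplus> x \<otimes> r | j r. j \<in> J \<and> r \<in> N}"
  note i = idD[OF J] have X: "ideal (?X N) R" "J \<subseteq> ?X N" if N: "ideal N R" for N by (rule add_mul_ideal[OF J x N])+
  have X3: "?X N \<subseteq> add_elt J x" if N: "ideal N R" for N unfolding add_elt_def using idD(1)[OF N] by blast
  have Xs: "?X N \<subset> ?X N'" if N: "ideal N R" "ideal N' R" "colon J x \<subseteq> N" "N \<subset> N'" for N N'
  proof (rule psubsetI)
    show "?X N \<subseteq> ?X N'" using N(4) by blast
    obtain r where r': "r \<in> N' - N" using psubset_imp_ex_mem[OF N(4)] by (rule exE)
    hence r: "r \<in> N'" "r \<notin> N" by simp_all
    note rc = idD(1)[OF N(2) r(1)]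
    have "x \<otimes> r = \<zero> \<oplus> x \<otimes> r" using x rc by simp
    hence "x \<otimes> r \<in> ?X N'" using r(1) i(2) by blast
    moreover have "x \<otimes> r \<notin> ?X N"
    proof
      assume "x \<otimes> r \<in> ?X N"
      then obtain j s where js: "x \<otimes> r = j \<oplus> x \<otimes> s" "j \<in> J" "s \<in> N" by auto
      note sc = idD(1)[OF N(1) js(3)]
      have "x \<otimes> (r \<ominus> s) = j"
      proof -
        have "x \<otimes> (r \<ominus> s) = x \<otimes> r \<ominus> x \<otimes> s" using x rc sc by algebra
        also have "\<dots> = j" unfolding js(1) using x sc i(1)[OF js(2)] by algebra
        finally show ?thesis .
      qed
      hence "r \<ominus> s \<in> colon J x" unfolding colon_def using js(2) rc sc by simp
      hence "(r \<ominus> s) \<oplus> s \<in> N" by (rule idD(3)[OF N(1) subsetD[OF N(3)] js(3)])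
      moreover have "(r \<ominus> s) \<oplus> s = r" using rc sc by algebra
      ultimately show False using r(2) by simp
    qed
    ultimately show "?X N \<noteq> ?X N'" by metis
  qed
  \<comment> \<open>The chain above the colon ideal, multiplied by \<open>x\<close> and enlarged by
    \<open>J\<close>, followed by the chain above \<open>J + x R\<close>. The bottom of the second
    chain is left out, because it contains the top of the first and may coincide with it.\<close>
  let ?N = "\<lambda>i. if i \<le> b then ?X (B i) else A (i - b)"
  show "ideal_chain R J (a + b)" unfolding ideal_chain_def
  proof (intro exI[of _ ?N] conjI allI impI)
    fix k assume k: "k \<le> a + b"
    show "ideal (?N k) R" using X(1)[OF B(1)] A(1)[of "k - b"] k by simp
    have "J \<subseteq> A (k - b)" using A(2)[of "k - b"] add_elt_ideal(2)[OF J x] k by (meson order_trans le_diff_conv)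
    thus "J \<subseteq> ?N k" using X(2)[OF B(1)] by simp
  next
    fix k assume k: "k < a + b"
    consider "k < b" | "k = b" | "b < k" by linarith
    thus "?N k \<subset> ?N (Suc k)"
    proof cases
      case 1
      thus ?thesis using Xs[OF B(1) B(1) B(2) B(3)] by simp
    next
      case 2
      have "?X (B b) \<subseteq> A 0" using X3[OF B(1)[of b]] A(2)[of 0] by simp
      also have "A 0 \<subset> A (Suc 0)" using A(3)[of 0] k 2 by simp
      finally show ?thesis using 2 by simp
    next
      case 3
      thus ?thesis using A(3)[of "k - b"] k by (simp add: Suc_diff_le)
    qed
  qed
next
  fix l assume "ideal_chain R J l"
  then obtain N where N: "\<And>i. i \<le> l \<Longrightarrow> ideal (N i) R" "\<And>i. i \<le> l \<Longrightarrow> J \<subseteq> N i" "\<And>i. i < l \<Longrightarrow> N i \<subset> N (Suc i)"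
    unfolding ideal_chain_def by auto
  have am: "add_elt N1 x \<subseteq> add_elt N2 x" "colon N1 x \<subseteq> colon N2 x" if "N1 \<subseteq> N2" for N1 N2
    using that unfolding add_elt_def colon_def by blast+
  \<comment> \<open>By \<open>modular\<close>, every strict inclusion in the chain is strict after
    adding \<open>x\<close> or after passing to the colon ideal.\<close>
  let ?A = "{i. i < l \<and> add_elt (N i) x \<noteq> add_elt (N (Suc i)) x}" and ?B = "{i. i < l \<and> colon (N i) x \<noteq> colon (N (Suc i)) x}"
  have "ideal_chain R (add_elt J x) (card ?A)"
    by (rule weak_chain) (use add_elt_ideal(1)[OF N(1) x] am(1)[OF N(2)] am(1)[OF psubset_imp_subset[OF N(3)]] in simp_all)
  hence "card ?A \<le> a" using a unfolding has_length_def by simp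
  moreover have "ideal_chain R (colon J x) (card ?B)"
    by (rule weak_chain) (use colon_ideal(1)[OF N(1) x] am(2)[OF N(2)] am(2)[OF psubset_imp_subset[OF N(3)]] in simp_all)
  hence "card ?B \<le> b" using b unfolding has_length_def by simp
  moreover have "{..<l} \<subseteq> ?A \<union> ?B"
  proof (rule subsetI, rule ccontr)
    fix i assume i: "i \<in> {..<l}" "i \<notin> ?A \<union> ?B"
    hence "N i = N (Suc i)" using modular[OF N(1)[of i] N(1)[of "Suc i"] psubset_imp_subset[OF N(3)[of i]] x] by simp
    thus False using N(3)[of i] i(1) by simp
  qed
  hence "card {..<l} \<le> card (?A \<union> ?B)" by (rule card_mono[rotated]) simp
  moreover have "card (?A \<union> ?B) \<le> card ?A + card ?B" by (rule card_Un_le)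
  ultimately show "l \<le> a + b" by simp
qed

end

section \<open>Graded families of monomial ideals\<close>

abbreviation vecs :: "nat \<Rightarrow> nat list set" where "vecs n \<equiv> {as. length as = n}"
abbreviation vplus :: "nat list \<Rightarrow> nat list \<Rightarrow> nat list" where "vplus \<equiv> map2 (+)"
abbreviation vscale :: "nat \<Rightarrow> nat list \<Rightarrow> nat list" where "vscale t \<equiv> map ((*) t)"

text \<open>The exponent sets of a graded family of monomial ideals whose \<open>m\<close>-th member
  contains the \<open>c * m\<close>-th power of every variable. The last clause confines the gaps at
  level \<open>m\<close> to a box of side \<open>c * m\<close>.\<close>

definition gfam :: "nat \<Rightarrow> nat \<Rightarrow> (nat \<Rightarrow> nat list set) \<Rightarrow> bool" where
  "gfam n c E \<longleftrightarrow> (\<forall>m. E m \<subseteq> vecs n) \<and> (\<forall>m l. \<forall>a\<in>E m. \<forall>b\<in>E l. vplus a b \<in> E (m + l)) \<and>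
     (\<forall>m. \<forall>a\<in>E m. \<forall>b\<in>vecs n. vplus a b \<in> E m) \<and> (\<forall>l m. l \<le> m \<longrightarrow> E m \<subseteq> E l) \<and>
     (\<forall>m. \<forall>a\<in>vecs n. (\<exists>i<n. c * m \<le> a ! i) \<longrightarrow> a \<in> E m)"

definition gaps :: "nat \<Rightarrow> (nat \<Rightarrow> nat list set) \<Rightarrow> nat \<Rightarrow> nat list set" where
  "gaps n E m = vecs n - E m"

text \<open>Written as an infimum, since that is how the proof finds the limit of the densities:
  scaling never raises them.\<close>

definition covol :: "nat \<Rightarrow> (nat \<Rightarrow> nat list set) \<Rightarrow> real" where
  "covol n E = (INF m\<in>{1..}. real (card (gaps n E m)) / real m ^ n)"

text \<open>How far out along the ray of \<open>q\<close> the family is reached, per unit of level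
  and in multiples of \<open>q\<close>. By homogeneity, finitely many witnesses can be brought to a
  common level.\<close>

definition rad :: "(nat \<Rightarrow> nat list set) \<Rightarrow> nat list \<Rightarrow> real" where
  "rad E q = Inf {real t / real m | t m. 0 < m \<and> vscale t q \<in> E m}"

lemma real_div_le: "real (k div m) \<le> real k / real m"
proof (cases "m = 0")
  case False
  have "real (k div m * m) \<le> real k" by (simp only: of_nat_le_iff div_times_less_eq_dividend)
  thus ?thesis using False by (simp add: pos_le_divide_eq)
qed simp

lemma card_bounded_lists: "card {as. length as = n \<and> set as \<subseteq> {..<b::nat}} = b ^ n"
  using card_lists_length_eq[of "{..<b}" n] by (simp add: conj_commute)

lemma finite_bounded_lists: "finite {as. length as = n \<and> set as \<subseteq> {..<b::nat}}"
  using finite_lists_length_eq[of "{..<b}" n] by (simp add: conj_commute)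

lemma card_div_fibre: "t > 0 \<Longrightarrow> finite {b\<in>vecs n. map (\<lambda>x. x div t) b = a} \<and> card {b\<in>vecs n. map (\<lambda>x. x div t) b = a} \<le> t ^ n"
proof -
  assume t: "t > 0"
  let ?S = "{b\<in>vecs n. map (\<lambda>x. x div t) b = a}"
  let ?T = "{as. length as = n \<and> set as \<subseteq> {..<t}}"
  have inj: "inj_on (map (\<lambda>x. x mod t)) ?S"
  proof (rule inj_onI)
    fix x y assume xy: "x \<in> ?S" "y \<in> ?S" "map (\<lambda>x. x mod t) x = map (\<lambda>x. x mod t) y"
    show "x = y"
    proof (rule nth_equalityI)
      show "length x = length y" using xy by simp
      fix i assume i: "i < length x"
      have l: "i < length y" using i xy by simp
      have "map (\<lambda>x. x div t) x = map (\<lambda>x. x div t) y" using xy by simp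
      hence "x ! i div t = y ! i div t" "x ! i mod t = y ! i mod t" using arg_cong[of _ _ "\<lambda>l. l ! i"] xy(3) nth_map[OF i] nth_map[OF l] by metis+
      thus "x ! i = y ! i" by (metis div_mult_mod_eq)
    qed
  qed
  have sub: "map (\<lambda>x. x mod t) ` ?S \<subseteq> ?T" using t by auto
  have fT: "finite ?T" by (rule finite_bounded_lists)
  have "finite ?S" by (rule finite_imageD[OF finite_subset[OF sub fT] inj])
  moreover have "card ?S \<le> t ^ n" using card_inj_on_le[OF inj sub fT] unfolding card_bounded_lists .
  ultimately show ?thesis by (rule conjI)
qed

context
  fixes n c E
  assumes g: "gfam n c E" and n: "0 < n"
begin

lemma gf_vec: "a \<in> E m \<Longrightarrow> length a = n" using g[unfolded gfam_def, THEN conjunct1, THEN spec, THEN subsetD] by (simp only: mem_Collect_eq)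
lemma gf_plus: "a \<in> E m \<Longrightarrow> b \<in> E l \<Longrightarrow> vplus a b \<in> E (m + l)"
  using g[unfolded gfam_def, THEN conjunct2, THEN conjunct1] by simp
lemma gf_ideal: "a \<in> E m \<Longrightarrow> length b = n \<Longrightarrow> vplus a b \<in> E m"
  using g[unfolded gfam_def, THEN conjunct2, THEN conjunct2, THEN conjunct1] by simp
lemma gf_anti: "l \<le> m \<Longrightarrow> a \<in> E m \<Longrightarrow> a \<in> E l"
  by (rule subsetD[OF g[unfolded gfam_def, THEN conjunct2, THEN conjunct2, THEN conjunct2, THEN conjunct1, rule_format]])
lemma gf_big: "length a = n \<Longrightarrow> i < n \<Longrightarrow> c * m \<le> a ! i \<Longrightarrow> a \<in> E m"
  using g[unfolded gfam_def, THEN conjunct2, THEN conjunct2, THEN conjunct2, THEN conjunct2, rule_format, of a m] by auto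

lemma gf_up: assumes a: "a \<in> E m" and b: "length b = n" "\<And>i. i < n \<Longrightarrow> a ! i \<le> b ! i" shows "b \<in> E m"
proof -
  have "b = vplus a (map2 (-) b a)" by (rule nth_equalityI) (use b gf_vec[OF a] in auto)
  moreover have "vplus a (map2 (-) b a) \<in> E m" by (rule gf_ideal[OF a]) (use b gf_vec[OF a] in simp)
  ultimately show ?thesis by simp
qed

lemma gf_0: "length a = n \<Longrightarrow> a \<in> E 0" using gf_big[of a 0 0] n by simp

lemma gf_scale: assumes "a \<in> E m" shows "vscale t a \<in> E (t * m)"
proof (induction t)
  case 0
  have "vscale 0 a \<in> E 0" by (rule gf_0) (use gf_vec[OF assms] in simp)
  moreover have "0 * m = 0" by simp
  ultimately show ?case by (simp only:)
next
  case (Suc t)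
  have "vscale (Suc t) a = vplus a (vscale t a)" by (rule nth_equalityI) auto
  moreover have "Suc t * m = m + t * m" by simp
  ultimately show ?case using gf_plus[OF assms Suc] by (simp only:)
qed

lemma gaps_bound: "a \<in> gaps n E m \<Longrightarrow> length a = n \<and> set a \<subseteq> {..<c * m}"
  unfolding gaps_def using gf_big[of a _ m] by (auto simp: in_set_conv_nth not_le[symmetric])

lemma gaps_finite: "finite (gaps n E m)"
proof (rule finite_subset)
  show "gaps n E m \<subseteq> {as. set as \<subseteq> {..<c * m} \<and> length as = n}" by (rule subsetI) (use gaps_bound in "simp only: mem_Collect_eq")
qed (rule finite_lists_length_eq, simp)

lemma gaps_mono: "l \<le> m \<Longrightarrow> gaps n E l \<subseteq> gaps n E m" unfolding gaps_def using gf_anti by auto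

text \<open>If the quotients of \<open>b\<close> by \<open>t\<close> form a vector in
  \<open>E m\<close>, then \<open>b\<close> is in \<open>E (t * m)\<close>. So a gap at level
  \<open>t * m\<close> lies in one of the boxes of side \<open>t\<close> over the gaps at level
  \<open>m\<close>.\<close>

lemma gaps_scale: assumes t: "0 < t" shows "card (gaps n E (t * m)) \<le> t ^ n * card (gaps n E m)"
proof -
  let ?F = "\<lambda>a. {b\<in>vecs n. map (\<lambda>x. x div t) b = a}"
  have "gaps n E (t * m) \<subseteq> (\<Union>a\<in>gaps n E m. ?F a)"
  proof
    fix b assume b: "b \<in> gaps n E (t * m)"
    hence lb: "length b = n" unfolding gaps_def by simp
    let ?a = "map (\<lambda>x. x div t) b"
    have "?a \<notin> E m"
    proof
      assume "?a \<in> E m"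
      hence "vscale t ?a \<in> E (t * m)" by (rule gf_scale)
      hence "b \<in> E (t * m)" by (rule gf_up) (use lb in "auto simp: div_times_less_eq_dividend")
      thus False using b unfolding gaps_def by simp
    qed
    thus "b \<in> (\<Union>a\<in>gaps n E m. ?F a)" using lb unfolding gaps_def by auto
  qed
  hence "card (gaps n E (t * m)) \<le> card (\<Union>a\<in>gaps n E m. ?F a)" using card_div_fibre[OF t] gaps_finite by (intro card_mono finite_UN_I) auto
  also have "\<dots> \<le> (\<Sum>a\<in>gaps n E m. card (?F a))" by (rule card_UN_le[OF gaps_finite])
  also have "\<dots> \<le> (\<Sum>a\<in>gaps n E m. t ^ n)" using card_div_fibre[OF t] by (intro sum_mono) auto
  finally show ?thesis by (simp add: mult.commute)
qed

lemma covol_le: "0 < m \<Longrightarrow> covol n E \<le> real (card (gaps n E m)) / real m ^ n"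
  unfolding covol_def by (rule cINF_lower) (auto intro!: bdd_belowI[of _ 0])

lemma covol_nonneg: "0 \<le> covol n E" unfolding covol_def by (rule cINF_greatest) auto

theorem covol_limit: "(\<lambda>m. real (card (gaps n E m)) / real m ^ n) \<longlonglongrightarrow> covol n E"
proof (rule order_tendstoI)
  fix y assume y: "y < covol n E"
  show "\<forall>\<^sub>F m in sequentially. y < real (card (gaps n E m)) / real m ^ n"
    using eventually_gt_at_top[of 0] by (rule eventually_mono) (use covol_le y less_le_trans in blast)
next
  fix y assume y: "covol n E < y"
  hence "\<exists>m\<in>{1..}. real (card (gaps n E m)) / real m ^ n < y" unfolding covol_def by (subst (asm) cINF_less_iff) (auto intro!: bdd_belowI[of _ 0])
  then obtain m where m': "m \<in> {1..}" and m2: "real (card (gaps n E m)) / real m ^ n < y" by (rule bexE)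
  have m1: "0 < m" using m' by simp
  note m = m1 m2
  let ?N = "real (card (gaps n E m))"
  have "(\<lambda>k. (1 / real m + 1 / real k) ^ n * ?N) \<longlonglongrightarrow> (1 / real m + 0) ^ n * ?N" by (intro tendsto_intros lim_1_over_n)
  moreover have "(1 / real m + 0) ^ n * ?N < y" using m by (simp add: power_one_over field_simps)
  ultimately have "\<forall>\<^sub>F k in sequentially. (1 / real m + 1 / real k) ^ n * ?N < y" by (rule order_tendstoD)
  thus "\<forall>\<^sub>F k in sequentially. real (card (gaps n E k)) / real k ^ n < y"
  proof (rule eventually_elim2[OF _ eventually_gt_at_top[of 0]])
    fix k :: nat assume k: "(1 / real m + 1 / real k) ^ n * ?N < y" "0 < k"
    \<comment> \<open>Rounded up, so that level \<open>k\<close> is at most \<open>t * m\<close>;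
      the excess is the term \<open>1 / real k\<close> above.\<close>
    define t where "t = k div m + 1"
    have "k \<le> t * m" unfolding t_def using m(1) by (metis Suc_eq_plus1 dividend_less_div_times less_imp_le mult.commute mult_Suc add.commute)
    hence "card (gaps n E k) \<le> card (gaps n E (t * m))" by (intro card_mono gaps_finite gaps_mono)
    also have "\<dots> \<le> t ^ n * card (gaps n E m)" by (rule gaps_scale) (simp add: t_def)
    finally have "real (card (gaps n E k)) \<le> real t ^ n * ?N" by (metis of_nat_le_iff of_nat_mult of_nat_power)
    hence "real (card (gaps n E k)) / real k ^ n \<le> (real t / real k) ^ n * ?N" using k(2) by (simp add: power_divide field_simps)
    also have "\<dots> \<le> (1 / real m + 1 / real k) ^ n * ?N"
    proof (intro mult_right_mono power_mono)
      have "real t \<le> real k / real m + 1" unfolding t_def using real_div_le[of k m] by simp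
      hence "real t / real k \<le> (real k / real m + 1) / real k" by (intro divide_right_mono) auto
      also have "\<dots> = 1 / real m + 1 / real k" using k(2) m(1) by (simp add: field_simps)
      finally show "real t / real k \<le> 1 / real m + 1 / real k" .
    qed auto
    finally show "real (card (gaps n E k)) / real k ^ n < y" using k(1) by simp
  qed
qed

lemma rad_le: "0 < m \<Longrightarrow> vscale t q \<in> E m \<Longrightarrow> rad E q \<le> real t / real m"
  unfolding rad_def by (rule cInf_lower) (auto intro!: bdd_belowI[of _ 0])

lemma rad_set_nonempty: assumes "length q = n" "\<forall>x\<in>set q. 0 < x" shows "{real t / real m | t m. 0 < m \<and> vscale t q \<in> E m} \<noteq> {}"
proof -
  have "1 \<le> q ! 0" using assms n nth_mem[of 0 q] by fastforce
  hence "c * 1 \<le> c * q ! 0" by (rule mult_le_mono2)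
  hence "c * 1 \<le> vscale c q ! 0" using assms n by simp
  hence "vscale c q \<in> E 1" using gf_big[of "vscale c q" 0 1] assms n by simp
  thus ?thesis by (metis (mono_tags, lifting) empty_iff mem_Collect_eq zero_less_one)
qed

lemma rad_nonneg: assumes "length q = n" "\<forall>x\<in>set q. 0 < x" shows "0 \<le> rad E q"
  unfolding rad_def by (rule cInf_greatest[OF rad_set_nonempty[OF assms]]) auto

lemma rad_less: assumes "length q = n" "\<forall>x\<in>set q. 0 < x" "rad E q < r" shows "\<exists>t m. 0 < m \<and> vscale t q \<in> E m \<and> real t / real m < r"
  using assms(3) unfolding rad_def by (subst (asm) cInf_less_iff[OF rad_set_nonempty[OF assms(1,2)]]) (auto intro!: bdd_belowI[of _ 0])

end

subsection \<open>Counting lattice points in cones\<close>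

lemma pow_diff_le: fixes x y :: real assumes "0 \<le> y" "y \<le> x"
  shows "x ^ Suc k - y ^ Suc k \<le> real (Suc k) * x ^ k * (x - y)" "real (Suc k) * y ^ k * (x - y) \<le> x ^ Suc k - y ^ Suc k"
proof -
  have e: "x ^ Suc k - y ^ Suc k = (x - y) * (\<Sum>i<Suc k. y ^ i * x ^ (k - i))" using diff_power_eq_sum[of y k x] by (metis minus_diff_eq minus_mult_left)
  have "(\<Sum>i<Suc k. y ^ i * x ^ (k - i)) \<le> (\<Sum>i<Suc k. x ^ k)"
  proof (rule sum_mono)
    fix i assume "i \<in> {..<Suc k}"
    hence "x ^ k = x ^ i * x ^ (k - i)" by (simp add: power_add[symmetric])
    thus "y ^ i * x ^ (k - i) \<le> x ^ k" using assms by (simp add: mult_right_mono power_mono)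
  qed
  thus "x ^ Suc k - y ^ Suc k \<le> real (Suc k) * x ^ k * (x - y)"
    unfolding e using assms mult_left_mono[of "\<Sum>i<Suc k. y ^ i * x ^ (k - i)" "\<Sum>i<Suc k. x ^ k" "x - y"] by (simp add: mult_ac del: sum.lessThan_Suc)
  have "(\<Sum>i<Suc k. y ^ k) \<le> (\<Sum>i<Suc k. y ^ i * x ^ (k - i))"
  proof (rule sum_mono)
    fix i assume "i \<in> {..<Suc k}"
    hence "y ^ k = y ^ i * y ^ (k - i)" by (simp add: power_add[symmetric])
    thus "y ^ k \<le> y ^ i * x ^ (k - i)" using assms by (simp add: mult_left_mono power_mono)
  qed
  thus "real (Suc k) * y ^ k * (x - y) \<le> x ^ Suc k - y ^ Suc k"
    unfolding e using assms mult_left_mono[of "\<Sum>i<Suc k. y ^ k" "\<Sum>i<Suc k. y ^ i * x ^ (k - i)" "x - y"] by (simp add: mult_ac del: sum.lessThan_Suc)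
qed

lemma scale_le: fixes A B C D :: real assumes "0 < C" "0 < D"
  shows "C * A * (1 / D) \<le> B \<Longrightarrow> A \<le> D / C * B" "B \<le> C * A * (1 / D) \<Longrightarrow> D / C * B \<le> A"
  using assms by (simp_all add: field_simps)

text \<open>The comparison of the sum with the integral of the \<open>k\<close>-th power, by
  induction instead of integration.\<close>

lemma sum_pow_upper: assumes T: "0 < (T::nat)" shows "(\<Sum>s<N. (real s / real T + 1) ^ k) \<le> real T / real (Suc k) * (real N / real T + 1) ^ Suc k"
proof (induction N)
  case (Suc N)
  let ?x = "real (Suc N) / real T + 1" and ?y = "real N / real T + 1"
  have "?x - ?y = 1 / real T" using T by (simp add: field_simps)
  moreover have "real (Suc k) * ?y ^ k * (?x - ?y) \<le> ?x ^ Suc k - ?y ^ Suc k" by (rule pow_diff_le(2)) (auto intro: divide_right_mono)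
  ultimately have "?y ^ k \<le> real T / real (Suc k) * (?x ^ Suc k - ?y ^ Suc k)" using T by (intro scale_le(1)) (simp_all del: of_nat_Suc power_Suc)
  thus ?case using Suc by (simp add: right_diff_distrib del: of_nat_Suc power_Suc)
qed simp

text \<open>The summation starts at \<open>T\<close>, where the base of the power becomes
  nonnegative.\<close>

lemma sum_pow_lower: assumes T: "0 < (T::nat)" and N: "T < N"
  shows "real T / real (Suc k) * ((real N - 1) / real T - 1) ^ Suc k \<le> (\<Sum>s\<in>{T..<N}. (real s / real T - 1) ^ k)" using N
proof (induction N)
  case (Suc N)
  show ?case
  proof (cases "T < N")
    case False
    hence "N = T" using Suc by simp
    thus ?thesis using T by (auto intro: sum_nonneg)
  next
    case True
    let ?x = "real N / real T - 1" and ?y = "(real N - 1) / real T - 1"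
    have y0: "0 \<le> ?y" using True T by (simp add: field_simps)
    have d: "?x - ?y = 1 / real T" using T by (simp add: field_simps)
    have "?x ^ Suc k - ?y ^ Suc k \<le> real (Suc k) * ?x ^ k * (?x - ?y)" by (rule pow_diff_le(1)[OF y0]) (use d T in "simp add: field_simps")
    hence "real T / real (Suc k) * (?x ^ Suc k - ?y ^ Suc k) \<le> ?x ^ k" unfolding d using T by (intro scale_le(2)) (simp_all del: of_nat_Suc power_Suc)
    thus ?thesis using Suc True by (simp add: right_diff_distrib del: power_Suc)
  qed
qed simp

definition slot :: "nat \<Rightarrow> nat \<Rightarrow> nat \<Rightarrow> nat set" where
  "slot T s d = {a. d * s \<le> T * a \<and> T * a < Suc d * s}"

text \<open>The points \<open>s # bs\<close> of the cone in which each ratio of an entry of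
  \<open>bs\<close> to \<open>s\<close> lies in the interval from \<open>d / T\<close> to
  \<open>(d + 1) / T\<close>. So a cell is a slice of a cone, with about \<open>(s / T)^k\<close>
  points.\<close>

definition cell :: "nat \<Rightarrow> nat list \<Rightarrow> nat \<Rightarrow> nat list set" where
  "cell T ds s = {bs. list_all2 (\<lambda>d b. b \<in> slot T s d) ds bs}"

lemma slot_card: assumes T: "0 < T"
  shows "finite (slot T s d)" "real (card (slot T s d)) \<le> real s / real T + 1" "real s / real T - 1 \<le> real (card (slot T s d))"
proof -
  define lo where "lo = nat \<lceil>real (d * s) / real T\<rceil>"
  define hi where "hi = nat \<lceil>real (Suc d * s) / real T\<rceil>"
  have ce: "(x \<le> T * a) \<longleftrightarrow> nat \<lceil>real x / real T\<rceil> \<le> a" for x a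
  proof -
    have "(x \<le> T * a) \<longleftrightarrow> real x \<le> real T * real a" by (metis of_nat_le_iff of_nat_mult)
    thus ?thesis using T by (simp add: nat_ceiling_le_eq pos_divide_le_eq mult.commute)
  qed
  have "slot T s d = {lo..<hi}" unfolding slot_def lo_def hi_def
    using ce[of "d * s"] ce[of "Suc d * s"] by (intro Set.set_eqI) (simp only: mem_Collect_eq atLeastLessThan_iff not_le[symmetric])
  hence c: "finite (slot T s d)" "card (slot T s d) = hi - lo" by auto
  have ce2: "y \<le> real (nat \<lceil>y\<rceil>)" "real (nat \<lceil>y\<rceil>) \<le> y + 1" if "0 \<le> y" for y :: real using that by linarith+
  have lo1: "real (d * s) / real T \<le> real lo" "real lo \<le> real (d * s) / real T + 1" unfolding lo_def by (rule ce2, simp)+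
  have hi1: "real (Suc d * s) / real T \<le> real hi" "real hi \<le> real (Suc d * s) / real T + 1" unfolding hi_def by (rule ce2, simp)+
  have e: "real (Suc d * s) / real T = real (d * s) / real T + real s / real T" by (simp add: add_divide_distrib[symmetric] distrib_right)
  have "lo \<le> hi" unfolding lo_def hi_def using T by (intro nat_mono ceiling_mono divide_right_mono) auto
  hence "real (hi - lo) = real hi - real lo" by simp
  thus "finite (slot T s d)" "real (card (slot T s d)) \<le> real s / real T + 1" "real s / real T - 1 \<le> real (card (slot T s d))" using c lo1 hi1 e by simp_all
qed

lemma cell_Cons: "cell T (d # ds) s = (\<lambda>(b, bs). b # bs) ` (slot T s d \<times> cell T ds s)" unfolding cell_def by (auto simp: list_all2_Cons1 image_iff)

lemma cell_card: assumes T: "0 < T" shows "finite (cell T ds s)" "real (card (cell T ds s)) \<le> (real s / real T + 1) ^ length ds"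
    "T \<le> s \<Longrightarrow> (real s / real T - 1) ^ length ds \<le> real (card (cell T ds s))"
proof (induction ds)
  case Nil
  have "cell T [] s = {[]}" unfolding cell_def by auto
  thus "finite (cell T [] s)" "real (card (cell T [] s)) \<le> (real s / real T + 1) ^ length []"
    "T \<le> s \<Longrightarrow> (real s / real T - 1) ^ length [] \<le> real (card (cell T [] s))" by simp_all
next
  case (Cons d ds)
  have inj: "inj_on (\<lambda>(b, bs). b # bs) (slot T s d \<times> cell T ds s)" by (rule inj_onI) auto
  have c: "real (card (cell T (d # ds) s)) = real (card (slot T s d)) * real (card (cell T ds s))"
    unfolding cell_Cons card_image[OF inj] by (simp add: card_cartesian_product)
  show "finite (cell T (d # ds) s)" unfolding cell_Cons using slot_card(1)[OF T] Cons.IH(1) by simp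
  show "real (card (cell T (d # ds) s)) \<le> (real s / real T + 1) ^ length (d # ds)"
    unfolding c using slot_card(2)[OF T, of s d] Cons.IH(2) by (simp add: mult_mono)
  show "(real s / real T - 1) ^ length (d # ds) \<le> real (card (cell T (d # ds) s))" if "T \<le> s"
  proof -
    have "0 \<le> real s / real T - 1" using that T by (simp add: field_simps)
    thus ?thesis unfolding c using slot_card(3)[OF T, of s d] Cons.IH(3)[OF that] by (simp add: mult_mono)
  qed
qed

lemma cell_disjoint: assumes "bs \<in> cell T ds s" "bs \<in> cell T ds' s" shows "ds = ds'"
proof (rule nth_equalityI)
  have l: "length ds = length bs" "length ds' = length bs" using assms unfolding cell_def by (auto dest: list_all2_lengthD)
  thus "length ds = length ds'" by simp
  fix i assume i: "i < length ds"
  have "bs ! i \<in> slot T s (ds ! i)" "bs ! i \<in> slot T s (ds' ! i)" using assms i l unfolding cell_def by (auto dest: list_all2_nthD)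
  hence "ds ! i * s < Suc (ds' ! i) * s" "ds' ! i * s < Suc (ds ! i) * s" unfolding slot_def by auto
  thus "ds ! i = ds' ! i" by (metis mult_less_cancel2 less_Suc_eq_le le_antisym)
qed

lemma cell_length: "bs \<in> cell T ds s \<Longrightarrow> length bs = length ds" unfolding cell_def by (auto dest: list_all2_lengthD)

lemma cell_nth: "bs \<in> cell T ds s \<Longrightarrow> i < length ds \<Longrightarrow> ds ! i * s \<le> T * bs ! i \<and> T * bs ! i < Suc (ds ! i) * s"
  unfolding cell_def slot_def by (auto dest: list_all2_nthD)

text \<open>The steepest corner of the cone of \<open>ds\<close>, which is also the flattest corner
  of the cone of \<open>map Suc ds\<close>. The same rays thus serve for a lower bound and, one cone
  further, for an upper bound.\<close>

abbreviation dir :: "nat \<Rightarrow> nat list \<Rightarrow> nat list" where "dir T ds \<equiv> T # map Suc ds"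

lemma dir_pos: "0 < T \<Longrightarrow> \<forall>x\<in>set (dir T ds). 0 < x" by auto

text \<open>If a point of the cone of \<open>d\<close> with first coordinate \<open>s\<close> is in
  \<open>E m\<close>, so is, after scaling by \<open>T\<close>, the point over it on the steepest
  ray. Hence all points of the cone with \<open>s\<close> below \<open>T\<close> times
  \<open>m\<close> times the radius are gaps, and they are counted slice by slice.\<close>

lemma covol_lower:
  assumes g: "gfam (Suc k) c E" and T: "0 < T" and D: "finite D" "D \<subseteq> vecs k"
  shows "real T / real (Suc k) * (\<Sum>d\<in>D. rad E (dir T d) ^ Suc k) \<le> covol (Suc k) E"
proof -
  have Dl: "length d = k" if "d \<in> D" for d using subsetD[OF D(2) that] by simp
  let ?r = "\<lambda>d. rad E (dir T d)"
  have r0: "0 \<le> ?r d" if "d \<in> D" for d using rad_nonneg[OF g _ _ dir_pos[OF T]] Dl[OF that] by simp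
  define N where "N m d = nat \<lceil>real T * real m * ?r d\<rceil>" for m d
  \<comment> \<open>The correction by \<open>(1 / T + 1) / m\<close> collects the rounding of
    \<open>N\<close> and the loss of one in each slot; \<open>max 0\<close> covers rays on which
    nothing remains.\<close>
  define B where "B m = (\<Sum>d\<in>D. real T / real (Suc k) * (max 0 (?r d - (1 / real T + 1) * (1 / real m))) ^ Suc k)" for m :: nat
  have bnd: "B m
      \<le> real (card (gaps (Suc k) E m)) / real m ^ Suc k" if m: "0 < m" for m
  proof -
    let ?X = "Sigma D (\<lambda>d. Sigma {T..<N m d} (\<lambda>s. cell T d s))"
    let ?f = "\<lambda>(d, s, bs). s # (bs :: nat list)"
    have fX: "finite ?X" by (intro finite_SigmaI D(1) cell_card(1)[OF T] finite_atLeastLessThan)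
    have inj: "inj_on ?f ?X"
    proof (rule inj_onI)
      fix x y assume xy: "x \<in> ?X" "y \<in> ?X" "?f x = ?f y"
      obtain d s bs where x: "x = (d, s, bs)" by (cases x)
      obtain d' s' bs' where y: "y = (d', s', bs')" by (cases y)
      have "s = s'" "bs = bs'" using xy(3) x y by simp_all
      moreover have "d = d'" by (rule cell_disjoint[of bs T d s]) (use xy(1,2) x y \<open>s = s'\<close> \<open>bs = bs'\<close> in simp_all)
      ultimately show "x = y" using x y by simp
    qed
    have "?f ` ?X \<subseteq> gaps (Suc k) E m"
    proof (rule image_subsetI)
      fix x assume x1: "x \<in> ?X"
      obtain d s bs where x: "x = (d, s, bs)" by (cases x)
      have d: "d \<in> D" and s: "T \<le> s" "s < N m d" and bs: "bs \<in> cell T d s" using x1 x by simp_all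
      have "int s < \<lceil>real T * real m * ?r d\<rceil>" using s(2) unfolding N_def by linarith
      hence sr: "real s < real T * real m * ?r d" by (simp add: less_ceiling_iff)
      have l: "length (s # bs) = Suc k" using cell_length[OF bs] Dl[OF d] by simp
      have "s # bs \<notin> E m"
      proof
        assume a: "s # bs \<in> E m"
        have "vscale s (dir T d) \<in> E (T * m)"
        proof (rule gf_up[OF g _ gf_scale[OF g _ a]])
          show "length (vscale s (dir T d)) = Suc k" using Dl[OF d] by simp
          fix i assume i: "i < Suc k"
          show "vscale T (s # bs) ! i \<le> vscale s (dir T d) ! i"
          proof (cases i)
            case (Suc j)
            hence j: "j < length d" "j < length bs" using i Dl[OF d] cell_length[OF bs] by simp_all
            have "T * bs ! j < Suc (d ! j) * s" using cell_nth[OF bs j(1)] by simp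
            thus ?thesis using Suc j by (simp add: mult.commute)
          qed simp
        qed simp_all
        hence "?r d \<le> real s / real (T * m)" by (rule rad_le[OF g, rotated 2]) (use T m in simp_all)
        hence "?r d * (real T * real m) \<le> real s" using T m by (simp add: pos_le_divide_eq)
        thus False using sr by (simp add: mult.commute)
      qed
      thus "?f x \<in> gaps (Suc k) E m" unfolding gaps_def x using l by simp
    qed
    hence "card ?X \<le> card (gaps (Suc k) E m)" by (rule card_inj_on_le[OF inj]) (rule gaps_finite[OF g], simp)
    moreover have "card ?X = (\<Sum>d\<in>D. \<Sum>s\<in>{T..<N m d}. card (cell T d s))" using D(1) cell_card(1)[OF T] by (subst card_SigmaI) auto
    ultimately have A: "(\<Sum>d\<in>D. \<Sum>s\<in>{T..<N m d}. real (card (cell T d s))) \<le> real (card (gaps (Suc k) E m))"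
      by (metis (mono_tags, lifting) of_nat_le_iff of_nat_sum sum.cong)
    have Bd: "real m ^ Suc k * (real T / real (Suc k) * (max 0 (?r d - (1 / real T + 1) * (1 / real m))) ^ Suc k)
        \<le> (\<Sum>s\<in>{T..<N m d}. real (card (cell T d s)))" if d: "d \<in> D" for d
    proof -
      define z where "z = ?r d - (1 / real T + 1) * (1 / real m)"
      have mz: "real m * z = real m * ?r d - (1 / real T + 1)" using m unfolding z_def by (simp add: right_diff_distrib)
      have Nr: "real T * real m * ?r d \<le> real (N m d)" unfolding N_def by linarith
      have nn: "0 \<le> (\<Sum>s\<in>{T..<N m d}. real (card (cell T d s)))" by (rule sum_nonneg) simp
      show ?thesis
      proof (cases "0 < z")
        case False
        thus ?thesis using nn by (simp add: z_def max_def)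
      next
        case True
        hence "0 < real m * z" using m by simp
        have zz: "real m * z \<le> (real (N m d) - 1) / real T - 1" unfolding mz using Nr T by (simp add: field_simps)
        hence "0 < (real (N m d) - 1) / real T - 1" using \<open>0 < real m * z\<close> by linarith
        hence TN: "T < N m d" using T by (simp add: field_simps)
        have "real m ^ Suc k * (real T / real (Suc k) * (max 0 z) ^ Suc k) = real T / real (Suc k) * (real m * z) ^ Suc k"
          using True by (simp add: power_mult_distrib)
        also have "\<dots> \<le> real T / real (Suc k) * ((real (N m d) - 1) / real T - 1) ^ Suc k"
          using zz \<open>0 < real m * z\<close> by (intro mult_left_mono power_mono) auto
        also have "\<dots> \<le> (\<Sum>s\<in>{T..<N m d}. (real s / real T - 1) ^ k)" by (rule sum_pow_lower[OF T TN])
        also have "\<dots> \<le> (\<Sum>s\<in>{T..<N m d}. real (card (cell T d s)))" using cell_card(3)[OF T, of _ d] Dl[OF d] by (intro sum_mono) simp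
        finally show ?thesis unfolding z_def .
      qed
    qed
    have "real m ^ Suc k * B m
       \<le> (\<Sum>d\<in>D. \<Sum>s\<in>{T..<N m d}. real (card (cell T d s)))" unfolding B_def sum_distrib_left[of "real m ^ Suc k"] by (rule sum_mono) (rule Bd)
    thus ?thesis using A m by (simp add: pos_le_divide_eq mult.commute del: power_Suc of_nat_Suc)
  qed
  have "B
      \<longlonglongrightarrow> (\<Sum>d\<in>D. real T / real (Suc k) * (max 0 (?r d - (1 / real T + 1) * 0)) ^ Suc k)"
    unfolding B_def by (intro tendsto_intros lim_1_over_n)
  moreover have "(\<Sum>d\<in>D. real T / real (Suc k) * (max 0 (?r d - (1 / real T + 1) * 0)) ^ Suc k)
      = real T / real (Suc k) * (\<Sum>d\<in>D. ?r d ^ Suc k)" unfolding sum_distrib_left by (rule sum.cong) (use r0 in "auto simp: max_def")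
  moreover have "\<exists>M. \<forall>m\<ge>M. B m
      \<le> real (card (gaps (Suc k) E m)) / real m ^ Suc k" using bnd by (intro exI[of _ 1]) simp
  ultimately show ?thesis using LIMSEQ_le[OF _ covol_limit[OF g]] by simp
qed

text \<open>Vectors with a small entry: a neighbourhood of the coordinate hyperplanes, negligible in
  the count but out of reach of the rays with positive entries.\<close>

definition slim :: "nat \<Rightarrow> nat \<Rightarrow> nat \<Rightarrow> nat list set" where
  "slim l N b = {bs. length bs = l \<and> set bs \<subseteq> {..<N} \<and> (\<exists>x\<in>set bs. x < b)}"

lemma slim_card: "finite (slim l N b) \<and> N * card (slim l N b) \<le> l * b * N ^ l"
proof (induction l)
  case 0
  have "slim 0 N b = {}" unfolding slim_def by auto
  thus ?case by simp
next
  case (Suc l)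
  let ?L = "{bs. length bs = l \<and> set bs \<subseteq> {..<N}}"
  have fL: "finite ?L" by (rule finite_bounded_lists)
  let ?A = "(\<lambda>(x, bs). x # bs) ` ({..<b} \<times> ?L)" and ?B = "(\<lambda>(x, bs). x # bs) ` ({..<N} \<times> slim l N b)"
  have sub: "slim (Suc l) N b \<subseteq> ?A \<union> ?B"
  proof
    fix a assume a: "a \<in> slim (Suc l) N b"
    then obtain x bs where x: "a = x # bs" unfolding slim_def by (cases a) auto
    show "a \<in> ?A \<union> ?B"
    proof (cases "x < b")
      case True
      hence "(x, bs) \<in> {..<b} \<times> ?L" using a x unfolding slim_def by simp
      thus ?thesis using x by force
    next
      case False
      hence "(x, bs) \<in> {..<N} \<times> slim l N b" using a x unfolding slim_def by auto
      thus ?thesis using x by force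
    qed
  qed
  have fin: "finite (?A \<union> ?B)" using fL Suc by simp
  have "card (slim (Suc l) N b) \<le> card (?A \<union> ?B)" by (rule card_mono[OF fin sub])
  also have "\<dots> \<le> card ?A + card ?B" by (rule card_Un_le)
  also have "\<dots> \<le> card ({..<b} \<times> ?L) + card ({..<N} \<times> slim l N b)" using fL Suc by (intro add_mono card_image_le) auto
  also have "\<dots> = b * N ^ l + N * card (slim l N b)" unfolding card_cartesian_product card_bounded_lists by simp
  also have "\<dots> \<le> b * N ^ l + l * b * N ^ l" using Suc by simp
  finally have "N * card (slim (Suc l) N b) \<le> N * (b * N ^ l + l * b * N ^ l)" by (rule mult_le_mono2)
  also have "\<dots> = Suc l * b * N ^ Suc l" by (simp add: algebra_simps)
  finally show ?case using finite_subset[OF sub fin] by simp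
qed

text \<open>Apart from gaps with small first coordinate and gaps with some ratio below
  \<open>1 / T\<close>, whose share is of order \<open>1 / T\<close>, every gap lies in the cone of
  some \<open>map Suc d\<close>, above the ray \<open>dir T d\<close>. There it is confined by any
  witness that the ray reaches the family.\<close>

lemma covol_upper_aux:
  assumes g: "gfam (Suc k) c E" and T: "0 < T" and D: "D = {ds. length ds = k \<and> set ds \<subseteq> {..<c * T * T}}"
    and w: "\<And>d. d \<in> D \<Longrightarrow> 0 < \<mu> d \<and> vscale (\<tau> d) (dir T d) \<in> E (\<mu> d)"
  shows "covol (Suc k) E \<le> (real c ^ k + real k * real c ^ Suc k) / real T
     + real T / real (Suc k) * (\<Sum>d\<in>D. (real (\<tau> d) / real (\<mu> d)) ^ Suc k)"
proof -
  have fD: "finite D" unfolding D by (rule finite_bounded_lists)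
  have Dl: "length d = k" if "d \<in> D" for d using that unfolding D by simp
  \<comment> \<open>A point of the cone with first coordinate at least \<open>M m d\<close>
    dominates \<open>m div \<mu> d + 1\<close> times the witness, whose level is at least
    \<open>m\<close>; so it is not a gap.\<close>
  define M where "M m d = T * (\<tau> d * (m div \<mu> d + 1))" for m d
  define B where "B m = (1 / real T + 1 / real m) * real c ^ k + real k * (real c / real T + 1 / real m) * real c ^ k
       + (\<Sum>d\<in>D. real T / real (Suc k) * (real (\<tau> d) * (1 / real (\<mu> d) + 1 / real m) + 1 / real m) ^ Suc k)" for m :: nat
  have bnd: "real (card (gaps (Suc k) E m)) / real m ^ Suc k \<le>
       B m"
    if m: "0 < m" for m
  proof -
    define N where "N = c * m"
    let ?L = "{bs. length bs = k \<and> set bs \<subseteq> {..<N}}"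
    let ?C = "\<lambda>(x, bs :: nat list). x # bs"
    let ?A = "?C ` ({..<m div T + 1} \<times> ?L)" and ?B = "?C ` ({..<N} \<times> slim k N (N div T + 1))"
    let ?G = "\<Union>d\<in>D. ?C ` Sigma {..<M m d} (\<lambda>s. cell T (map Suc d) s)"
    have fL: "finite ?L" by (rule finite_bounded_lists)
    have fC: "finite (Sigma {..<M m d} (\<lambda>s. cell T (map Suc d) s))" for d by (intro finite_SigmaI cell_card(1)[OF T]) simp
    have sub: "gaps (Suc k) E m \<subseteq> ?A \<union> ?B \<union> ?G"
    proof
      fix a assume a: "a \<in> gaps (Suc k) E m"
      have la: "length a = Suc k" and sa: "set a \<subseteq> {..<N}" using gaps_bound[OF g _ a] unfolding N_def by simp_all
      obtain s bs where x: "a = s # bs" using la by (cases a) auto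
      have lb: "length bs = k" and sb: "set bs \<subseteq> {..<N}" and sN: "s < N" using la sa x by simp_all
      have ltT: "y < z div T + 1" if "T * y \<le> z" for y z using div_le_mono[OF that, of T] T by simp
      consider "T * s < m" | "\<exists>y\<in>set bs. T * y < s" | "m \<le> T * s" "\<forall>y\<in>set bs. s \<le> T * y" by (meson not_le)
      thus "a \<in> ?A \<union> ?B \<union> ?G"
      proof cases
        case 1
        hence "(s, bs) \<in> {..<m div T + 1} \<times> ?L" using ltT[of s m] lb sb by simp
        hence "a \<in> ?A" unfolding x by (rule image_eqI[rotated]) simp
        thus ?thesis by simp
      next
        case 2
        then obtain y where y: "y \<in> set bs" "T * y < s" by (rule bexE)
        have "y < N div T + 1" using ltT[of y N] y sN by simp
        hence "\<exists>y\<in>set bs. y < N div T + 1" using y(1) by (rule bexI)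
        hence "(s, bs) \<in> {..<N} \<times> slim k N (N div T + 1)" unfolding slim_def using sN lb sb by simp
        hence "a \<in> ?B" unfolding x by (rule image_eqI[rotated]) simp
        thus ?thesis by simp
      next
        case 3
        have s0: "0 < s" using 3(1) m by (cases s) auto
        define d where "d = map (\<lambda>y. T * y div s - 1) bs"
        have dv: "1 \<le> T * y div s" if "y \<in> set bs" for y using 3(2) that s0 by (simp add: Suc_le_eq div_greater_zero_iff)
        have ms: "map Suc d = map (\<lambda>y. T * y div s) bs" unfolding d_def map_map o_def
        proof (rule map_cong[OF refl])
          fix y assume "y \<in> set bs"
          from dv[OF this] show "Suc (T * y div s - 1) = T * y div s" by linarith
        qed
        \<comment> \<open>The entries are bounded by \<open>c * T * T\<close> because an entry of
          \<open>bs\<close> is below \<open>c * m\<close>, and \<open>m\<close> is at most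
          \<open>T * s\<close> outside the first exceptional set.\<close>
        have dD: "d \<in> D" unfolding D
        proof (intro CollectI conjI subsetI)
          show "length d = k" unfolding d_def using lb by simp
          fix z assume "z \<in> set d"
          then obtain y where y: "y \<in> set bs" "z = T * y div s - 1" unfolding d_def by auto
          have "y < c * m" using sb y(1) unfolding N_def by auto
          also have "\<dots> \<le> c * (T * s)" using 3(1) by simp
          finally have "T * y < T * (c * (T * s))" using T by simp
          hence "T * y < c * T * T * s" by (simp add: mult_ac)
          hence "T * y div s < c * T * T" by (rule less_mult_imp_div_less)
          thus "z \<in> {..<c * T * T}" using y(2) dv[OF y(1)] by simp
        qed
        have bc: "bs \<in> cell T (map Suc d) s" unfolding ms cell_def slot_def using dividend_less_times_div[OF s0] s0
          by (auto simp: list_all2_conv_all_nth div_times_less_eq_dividend mult.commute[of _ s])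
        have "s < M m d"
        proof (rule ccontr)
          assume "\<not> s < M m d"
          hence sM: "M m d \<le> s" by simp
          have "m \<le> (m div \<mu> d + 1) * \<mu> d" using w[OF dD] by (metis add.commute dividend_less_div_times less_imp_le mult_Suc plus_1_eq_Suc Suc_eq_plus1)
          moreover have "vscale (m div \<mu> d + 1) (vscale (\<tau> d) (dir T d)) \<in> E ((m div \<mu> d + 1) * \<mu> d)"
            by (rule gf_scale[OF g]) (use w[OF dD] in simp_all)
          ultimately have v: "vscale (m div \<mu> d + 1) (vscale (\<tau> d) (dir T d)) \<in> E m" using gf_anti[OF g] by blast
          have "s # bs \<in> E m"
          proof (rule gf_up[OF g _ v])
            show "length (s # bs) = Suc k" using lb by simp
            fix i assume i: "i < Suc k"
            show "vscale (m div \<mu> d + 1) (vscale (\<tau> d) (dir T d)) ! i \<le> (s # bs) ! i"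
            proof (cases i)
              case 0
              thus ?thesis using sM unfolding M_def by (simp add: algebra_simps)
            next
              case (Suc j)
              hence j: "j < length d" using i Dl[OF dD] by simp
              have "T * ((m div \<mu> d + 1) * (\<tau> d * Suc (d ! j))) = M m d * Suc (d ! j)" unfolding M_def by (simp add: algebra_simps)
              also have "\<dots> \<le> s * Suc (d ! j)" using sM by (rule mult_le_mono1)
              also have "\<dots> \<le> T * bs ! j" using cell_nth[OF bc, of j] j by (simp add: mult_ac)
              finally have "(m div \<mu> d + 1) * (\<tau> d * Suc (d ! j)) \<le> bs ! j" using T by (metis mult_le_cancel1)
              thus ?thesis using Suc j by simp
            qed
          qed simp_all
          thus False using a x unfolding gaps_def by simp
        qed
        hence "(s, bs) \<in> Sigma {..<M m d} (\<lambda>s. cell T (map Suc d) s)" using bc by simp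
        hence "a \<in> ?C ` Sigma {..<M m d} (\<lambda>s. cell T (map Suc d) s)" unfolding x by (rule image_eqI[rotated]) simp
        hence "a \<in> ?G" using dD by (rule UN_I[rotated])
        thus ?thesis by simp
      qed
    qed
    have fA: "finite (?A \<union> ?B \<union> ?G)" using fL fC fD slim_card by (intro finite_UnI finite_imageI finite_UN_I finite_cartesian_product) simp_all
    have "card (gaps (Suc k) E m) \<le> card (?A \<union> ?B \<union> ?G)" by (rule card_mono[OF fA sub])
    also have "\<dots> \<le> card ?A + card ?B + card ?G" by (intro order.trans[OF card_Un_le] add_mono card_Un_le order.refl)
    also have "\<dots> \<le> card ({..<m div T + 1} \<times> ?L) + card ({..<N} \<times> slim k N (N div T + 1)) + (\<Sum>d\<in>D. card (Sigma {..<M m d} (\<lambda>s. cell T (map Suc d) s)))"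
    proof (intro add_mono)
      show "card ?A \<le> card ({..<m div T + 1} \<times> ?L)" using fL by (intro card_image_le) simp
      show "card ?B \<le> card ({..<N} \<times> slim k N (N div T + 1))" using slim_card by (intro card_image_le) simp
      have "card ?G \<le> (\<Sum>d\<in>D. card (?C ` Sigma {..<M m d} (\<lambda>s. cell T (map Suc d) s)))" by (rule card_UN_le[OF fD])
      also have "\<dots> \<le> (\<Sum>d\<in>D. card (Sigma {..<M m d} (\<lambda>s. cell T (map Suc d) s)))" by (intro sum_mono card_image_le fC)
      finally show "card ?G \<le> (\<Sum>d\<in>D. card (Sigma {..<M m d} (\<lambda>s. cell T (map Suc d) s)))" .
    qed
    also have "\<dots> \<le> (m div T + 1) * N ^ k + k * (N div T + 1) * N ^ k + (\<Sum>d\<in>D. \<Sum>s<M m d. card (cell T (map Suc d) s))"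
      unfolding card_cartesian_product card_bounded_lists using slim_card[of k N "N div T + 1"] cell_card(1)[OF T] by (intro add_mono sum_mono) simp_all
    finally have "real (card (gaps (Suc k) E m)) \<le> real ((m div T + 1) * N ^ k + k * (N div T + 1) * N ^ k + (\<Sum>d\<in>D. \<Sum>s<M m d. card (cell T (map Suc d) s)))"
      by (simp only: of_nat_le_iff)
    also have "\<dots> = (real (m div T) + 1) * real N ^ k + real k * (real (N div T) + 1) * real N ^ k + (\<Sum>d\<in>D. \<Sum>s<M m d. real (card (cell T (map Suc d) s)))"
      by (simp add: algebra_simps)
    also have "\<dots> \<le> (real m / real T + 1) * real N ^ k + real k * (real N / real T + 1) * real N ^ k
        + (\<Sum>d\<in>D. real T / real (Suc k) * (real (\<tau> d) * (real m / real (\<mu> d) + 1) + 1) ^ Suc k)"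
    proof (intro add_mono mult_right_mono mult_left_mono sum_mono)
      fix d assume d: "d \<in> D"
      have "(\<Sum>s<M m d. real (card (cell T (map Suc d) s))) \<le> (\<Sum>s<M m d. (real s / real T + 1) ^ k)"
        using cell_card(2)[OF T, of "map Suc d"] Dl[OF d] by (intro sum_mono) simp
      also have "\<dots> \<le> real T / real (Suc k) * (real (M m d) / real T + 1) ^ Suc k" by (rule sum_pow_upper[OF T])
      also have "real (M m d) / real T = real (\<tau> d) * (real (m div \<mu> d) + 1)"
      proof -
        have "real (M m d) = real T * (real (\<tau> d) * (real (m div \<mu> d) + 1))" unfolding M_def by (simp only: of_nat_mult of_nat_add of_nat_1)
        thus ?thesis using T by simp
      qed
      also have "real T / real (Suc k) * (real (\<tau> d) * (real (m div \<mu> d) + 1) + 1) ^ Suc k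
          \<le> real T / real (Suc k) * (real (\<tau> d) * (real m / real (\<mu> d) + 1) + 1) ^ Suc k" by (intro mult_left_mono power_mono add_mono real_div_le) auto
      finally show "(\<Sum>s<M m d. real (card (cell T (map Suc d) s))) \<le> real T / real (Suc k) * (real (\<tau> d) * (real m / real (\<mu> d) + 1) + 1) ^ Suc k" .
    qed (auto intro: real_div_le)
    also have "\<dots> = real m ^ Suc k * B m"
    proof -
      have a: "(real m / real T + 1) = real m * (1 / real T + 1 / real m)" "(real N / real T + 1) = real m * (real c / real T + 1 / real m)"
        unfolding N_def using m by (simp_all add: distrib_left)
      have b: "real (\<tau> d) * (real m / real (\<mu> d) + 1) + 1 = real m * (real (\<tau> d) * (1 / real (\<mu> d) + 1 / real m) + 1 / real m)" for d
        using m by (simp add: distrib_left)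
      have c: "real N ^ k = real m ^ k * real c ^ k" unfolding N_def by (simp add: power_mult_distrib)
      show ?thesis unfolding B_def a b c power_mult_distrib distrib_left[of "real m ^ Suc k"] sum_distrib_left[of "real m ^ Suc k"]
        by (intro arg_cong2[of _ _ _ _ "(+)"] sum.cong refl) (simp_all add: mult_ac)
    qed
    finally show ?thesis using m by (simp add: pos_divide_le_eq mult.commute del: power_Suc of_nat_Suc)
  qed
  have "B
    \<longlonglongrightarrow> (1 / real T + 0) * real c ^ k + real k * (real c / real T + 0) * real c ^ k
       + (\<Sum>d\<in>D. real T / real (Suc k) * (real (\<tau> d) * (1 / real (\<mu> d) + 0) + 0) ^ Suc k)" unfolding B_def by (intro tendsto_intros lim_1_over_n)
  moreover have "(1 / real T + 0) * real c ^ k + real k * (real c / real T + 0) * real c ^ k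
       + (\<Sum>d\<in>D. real T / real (Suc k) * (real (\<tau> d) * (1 / real (\<mu> d) + 0) + 0) ^ Suc k)
     = (real c ^ k + real k * real c ^ Suc k) / real T + real T / real (Suc k) * (\<Sum>d\<in>D. (real (\<tau> d) / real (\<mu> d)) ^ Suc k)"
    unfolding sum_distrib_left by (simp add: add_divide_distrib mult_ac)
  moreover have "\<exists>M. \<forall>m\<ge>M. real (card (gaps (Suc k) E m)) / real m ^ Suc k \<le>
       B m" using bnd by (intro exI[of _ 1]) (simp del: power_Suc of_nat_Suc)
  ultimately show ?thesis using LIMSEQ_le[OF covol_limit[OF g]] by (simp only: zero_less_Suc)
qed

text \<open>The radius is an infimum and may not be attained, so witnesses within
  \<open>1 / real (Suc j)\<close> of it are used and \<open>j\<close> is sent to infinity.\<close>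

lemma covol_upper:
  assumes g: "gfam (Suc k) c E" and T: "0 < T"
  defines "D \<equiv> {ds. length ds = k \<and> set ds \<subseteq> {..<c * T * T}}" shows "covol (Suc k) E \<le> (real c ^ k + real k * real c ^ Suc k) / real T
     + real T / real (Suc k) * (\<Sum>d\<in>D. rad E (dir T d) ^ Suc k)"
proof -
  let ?r = "\<lambda>d. rad E (dir T d)" and ?A = "(real c ^ k + real k * real c ^ Suc k) / real T"
  have le: "covol (Suc k) E \<le> ?A + real T / real (Suc k) * (\<Sum>d\<in>D. (?r d + 1 / real (Suc j)) ^ Suc k)" for j
  proof -
    have "\<forall>d\<in>D. \<exists>p. 0 < snd p \<and> vscale (fst p) (dir T d) \<in> E (snd p) \<and> real (fst p) / real (snd p) < ?r d + 1 / real (Suc j)"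
    proof
      fix d assume "d \<in> D"
      hence l: "length (dir T d) = Suc k" unfolding D_def by simp
      have "?r d < ?r d + 1 / real (Suc j)" by simp
      from rad_less[OF g _ l dir_pos[OF T] this]
      obtain t m where "0 < m" "vscale t (dir T d) \<in> E m" "real t / real m < ?r d + 1 / real (Suc j)" by auto
      thus "\<exists>p. 0 < snd p \<and> vscale (fst p) (dir T d) \<in> E (snd p) \<and> real (fst p) / real (snd p) < ?r d + 1 / real (Suc j)"
        by (intro exI[of _ "(t, m)"]) simp
    qed
    from bchoice[OF this] obtain p where p: "\<forall>d\<in>D. 0 < snd (p d) \<and> vscale (fst (p d)) (dir T d) \<in> E (snd (p d))
        \<and> real (fst (p d)) / real (snd (p d)) < ?r d + 1 / real (Suc j)" by (elim exE)
    have "covol (Suc k) E \<le> ?A + real T / real (Suc k) * (\<Sum>d\<in>D. (real (fst (p d)) / real (snd (p d))) ^ Suc k)"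
      by (rule covol_upper_aux[OF g T D_def[THEN meta_eq_to_obj_eq]]) (use p in simp)
    also have "\<dots> \<le> ?A + real T / real (Suc k) * (\<Sum>d\<in>D. (?r d + 1 / real (Suc j)) ^ Suc k)"
      using p by (intro add_left_mono mult_left_mono sum_mono power_mono) (auto intro: less_imp_le)
    finally show ?thesis .
  qed
  have "(\<lambda>j. ?A + real T / real (Suc k) * (\<Sum>d\<in>D. (?r d + 1 / real (Suc j)) ^ Suc k))
      \<longlonglongrightarrow> ?A + real T / real (Suc k) * (\<Sum>d\<in>D. (?r d + 0) ^ Suc k)" by (intro tendsto_intros LIMSEQ_Suc[OF lim_1_over_n])
  hence "covol (Suc k) E \<le> ?A + real T / real (Suc k) * (\<Sum>d\<in>D. (?r d + 0) ^ Suc k)" by (rule LIMSEQ_le_const) (use le in "intro exI allI impI")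
  thus ?thesis by simp
qed

subsection \<open>Minkowski's inequality for covolumes\<close>

lemma power_convex: fixes x y a b :: real assumes "0 \<le> x" "0 \<le> y" "0 \<le> a" "0 \<le> b" "a + b = 1" shows "(a * x + b * y) ^ n \<le> a * x ^ n + b * y ^ n"
proof (induction n)
  case (Suc n)
  have mono: "0 \<le> (x - y) * (x ^ n - y ^ n)"
  proof (cases "x \<le> y")
    case True
    thus ?thesis using power_mono[OF True assms(1), of n] by (intro mult_nonpos_nonpos) simp_all
  next
    case False
    thus ?thesis using power_mono[of y x n] assms(2) by (intro mult_nonneg_nonneg) simp_all
  qed
  have b: "b = 1 - a" using assms(5) by simp
  have "(a * x + b * y) ^ Suc n \<le> (a * x + b * y) * (a * x ^ n + b * y ^ n)" using mult_left_mono[OF Suc, of "a * x + b * y"] assms by simp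
  also have "\<dots> = a * x ^ Suc n + b * y ^ Suc n - (a * b) * ((x - y) * (x ^ n - y ^ n))" unfolding b by (simp add: algebra_simps)
  also have "\<dots> \<le> a * x ^ Suc n + b * y ^ Suc n" using mono assms by simp
  finally show ?case .
qed (use assms in simp)

lemma root_le_iff_le_power: assumes "0 < n" "0 \<le> b" shows "root n a \<le> b \<longleftrightarrow> a \<le> b ^ n"
  using real_root_le_iff[OF assms(1), of a "b ^ n"] real_root_power_cancel[OF assms] by simp

text \<open>With \<open>a\<close> and \<open>b\<close> the two norms, \<open>x + y\<close> is
  \<open>a + b\<close> times the convex combination of \<open>x / a\<close> and \<open>y / b\<close>
  with weights \<open>a / (a + b)\<close> and \<open>b / (a + b)\<close>; convexity of the power is
  summed over \<open>D\<close>.\<close>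

lemma minkowski2: fixes x y :: "'d \<Rightarrow> real"
  assumes n: "0 < n" and D: "finite D" and nn: "\<And>d. d \<in> D \<Longrightarrow> 0 \<le> x d" "\<And>d. d \<in> D \<Longrightarrow> 0 \<le> y d"
  shows "root n (\<Sum>d\<in>D. (x d + y d) ^ n) \<le> root n (\<Sum>d\<in>D. x d ^ n) + root n (\<Sum>d\<in>D. y d ^ n)"
proof -
  let ?A = "root n (\<Sum>d\<in>D. x d ^ n)" and ?B = "root n (\<Sum>d\<in>D. y d ^ n)"
  have s: "0 \<le> (\<Sum>d\<in>D. x d ^ n)" "0 \<le> (\<Sum>d\<in>D. y d ^ n)" using nn by (simp_all add: sum_nonneg)
  have AB: "0 \<le> ?A" "0 \<le> ?B" using s n by simp_all
  have An: "?A ^ n = (\<Sum>d\<in>D. x d ^ n)" "?B ^ n = (\<Sum>d\<in>D. y d ^ n)" using s n by simp_all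
  have zero: "z d = 0" if "root n (\<Sum>d\<in>D. z d ^ n) = 0" "d \<in> D" "\<And>d. d \<in> D \<Longrightarrow> 0 \<le> z d" for z :: "'d \<Rightarrow> real" and d
  proof -
    have "(\<Sum>d\<in>D. z d ^ n) = 0" using that(1) n by simp
    hence "z d ^ n = 0" using that D by (subst (asm) sum_nonneg_eq_0_iff) simp_all
    thus ?thesis by simp
  qed
  consider "?A = 0" | "?B = 0" | "0 < ?A" "0 < ?B" using AB by linarith
  thus ?thesis
  proof cases
    case 1
    have "(\<Sum>d\<in>D. (x d + y d) ^ n) = (\<Sum>d\<in>D. y d ^ n)" using zero[OF 1 _ nn(1)] by (intro sum.cong) simp_all
    thus ?thesis using 1 by simp
  next
    case 2
    have "(\<Sum>d\<in>D. (x d + y d) ^ n) = (\<Sum>d\<in>D. x d ^ n)" using zero[OF 2 _ nn(2)] by (intro sum.cong) simp_all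
    thus ?thesis using 2 by simp
  next
    case 3
    obtain a b where ab: "a = ?A" "b = ?B" by blast
    have abn: "a ^ n = (\<Sum>d\<in>D. x d ^ n)" "b ^ n = (\<Sum>d\<in>D. y d ^ n)" unfolding ab by (rule An)+
    have a: "0 < a" and b: "0 < b" using 3 ab by simp_all
    let ?s = "a + b"
    have s0: "0 < ?s" using a b by simp
    have e: "u * (v / u * (w / v)) = w" if "0 < u" "0 < v" for u v w :: real using that by simp
    have one: "a / ?s + b / ?s = 1" using s0 by (simp add: add_divide_distrib[symmetric])
    have "(x d + y d) ^ n \<le> ?s ^ n * (a / ?s * (x d ^ n / a ^ n) + b / ?s * (y d ^ n / b ^ n))" if d: "d \<in> D" for d
    proof -
      have "x d + y d = ?s * (a / ?s * (x d / a) + b / ?s * (y d / b))" by (simp only: distrib_left e[OF s0 a] e[OF s0 b])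
      hence "(x d + y d) ^ n = ?s ^ n * (a / ?s * (x d / a) + b / ?s * (y d / b)) ^ n" by (simp only: power_mult_distrib)
      also have "\<dots> \<le> ?s ^ n * (a / ?s * (x d / a) ^ n + b / ?s * (y d / b) ^ n)" using a b s0 nn[OF d] one by (intro mult_left_mono power_convex) simp_all
      finally show ?thesis by (simp only: power_divide)
    qed
    hence "(\<Sum>d\<in>D. (x d + y d) ^ n) \<le> (\<Sum>d\<in>D. ?s ^ n * (a / ?s * (x d ^ n / a ^ n) + b / ?s * (y d ^ n / b ^ n)))" by (rule sum_mono)
    also have "\<dots> = ?s ^ n * (a / ?s * ((\<Sum>d\<in>D. x d ^ n) / a ^ n) + b / ?s * ((\<Sum>d\<in>D. y d ^ n) / b ^ n))"
      by (simp only: sum_distrib_left[symmetric] sum.distrib sum_divide_distrib[symmetric])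
    also have "\<dots> = ?s ^ n * (a / ?s + b / ?s)" unfolding abn[symmetric] using a b by (simp del: add_divide_distrib)
    also have "\<dots> = ?s ^ n" unfolding one by simp
    finally show ?thesis unfolding ab[symmetric] using s0 by (subst root_le_iff_le_power[OF n]) simp_all
  qed
qed

lemma minkowski: fixes x :: "'i \<Rightarrow> 'd \<Rightarrow> real"
  assumes n: "0 < n" and D: "finite D" and "finite \<Lambda>" and nn: "\<And>i d. i \<in> \<Lambda> \<Longrightarrow> d \<in> D \<Longrightarrow> 0 \<le> x i d"
  shows "root n (\<Sum>d\<in>D. (\<Sum>i\<in>\<Lambda>. x i d) ^ n) \<le> (\<Sum>i\<in>\<Lambda>. root n (\<Sum>d\<in>D. x i d ^ n))" using assms(3) nn
proof (induction \<Lambda> rule: finite_induct)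
  case empty
  thus ?case using n by (simp add: zero_power)
next
  case (insert i \<Lambda>)
  have "root n (\<Sum>d\<in>D. (\<Sum>i\<in>insert i \<Lambda>. x i d) ^ n) = root n (\<Sum>d\<in>D. (x i d + (\<Sum>i\<in>\<Lambda>. x i d)) ^ n)"
    using insert(1,2) by simp
  also have "\<dots> \<le> root n (\<Sum>d\<in>D. x i d ^ n) + root n (\<Sum>d\<in>D. (\<Sum>i\<in>\<Lambda>. x i d) ^ n)"
    by (rule minkowski2[OF n D]) (use insert(4) in "auto intro: sum_nonneg")
  also have "\<dots> \<le> root n (\<Sum>d\<in>D. x i d ^ n) + (\<Sum>i\<in>\<Lambda>. root n (\<Sum>d\<in>D. x i d ^ n))"
    by (rule add_left_mono, rule insert(3)) (use insert(4) in simp)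
  finally show ?case using insert(1,2) by simp
qed

text \<open>The hypothesis on \<open>EI\<close> says that witnesses add up to a witness, with
  bounded losses \<open>D\<close> and \<open>c0\<close>. Dividing by \<open>L * t\<close> and
  letting \<open>t\<close> grow removes the losses.\<close>

lemma rad_sum_le:
  fixes e :: "'i \<Rightarrow> nat"
  assumes gI: "gfam n cI EI" and n: "0 < n" and \<Lambda>: "finite \<Lambda>" and g: "\<And>i. i \<in> \<Lambda> \<Longrightarrow> gfam n (c i) (E i)"
    and q: "length q = n" "\<forall>x\<in>set q. 0 < x"
    and H: "\<And>L s. 1 \<le> L \<Longrightarrow> (\<And>i. i \<in> \<Lambda> \<Longrightarrow> vscale (s i) q \<in> E i (e i * L)) \<Longrightarrow>
       \<exists>D c0. \<forall>t. vscale (t * (\<Sum>i\<in>\<Lambda>. s i) + c0) q \<in> EI (L * (t - D))"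
  shows "rad EI q \<le> (\<Sum>i\<in>\<Lambda>. real (e i) * rad (E i) q)"
proof -
  have le: "rad EI q \<le> (\<Sum>i\<in>\<Lambda>. real (e i) * (rad (E i) q + 1 / real (Suc j)))" for j
  proof -
    have "\<forall>i\<in>\<Lambda>. \<exists>p. 0 < snd p \<and> vscale (fst p) q \<in> E i (snd p) \<and> real (fst p) / real (snd p) < rad (E i) q + 1 / real (Suc j)"
    proof
      fix i assume i: "i \<in> \<Lambda>"
      have "rad (E i) q < rad (E i) q + 1 / real (Suc j)" by simp
      from rad_less[OF g[OF i] n q this]
      obtain t m where "0 < m" "vscale t q \<in> E i m" "real t / real m < rad (E i) q + 1 / real (Suc j)" by auto
      thus "\<exists>p. 0 < snd p \<and> vscale (fst p) q \<in> E i (snd p) \<and> real (fst p) / real (snd p) < rad (E i) q + 1 / real (Suc j)"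
        by (intro exI[of _ "(t, m)"]) simp
    qed
    from bchoice[OF this] obtain p where p: "\<forall>i\<in>\<Lambda>. 0 < snd (p i) \<and> vscale (fst (p i)) q \<in> E i (snd (p i))
        \<and> real (fst (p i)) / real (snd (p i)) < rad (E i) q + 1 / real (Suc j)" by (elim exE)
    \<comment> \<open>A common multiple of all levels; \<open>s i\<close> is the witness brought to
      level \<open>e i * L\<close>, so that \<open>s i / L\<close> is \<open>e i\<close> times the
      chosen approximation of the radius.\<close>
    define L where "L = (\<Prod>i\<in>\<Lambda>. snd (p i))"
    define s where "s i = e i * (L div snd (p i)) * fst (p i)" for i
    have L1: "1 \<le> L" unfolding L_def using p by (simp add: Suc_le_eq prod_pos)
    have dv: "snd (p i) * (L div snd (p i)) = L" if "i \<in> \<Lambda>" for i unfolding L_def by (rule dvd_mult_div_cancel[OF dvd_prodI[OF \<Lambda> that]])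
    have "vscale (s i) q \<in> E i (e i * L)" if i: "i \<in> \<Lambda>" for i
    proof -
      have "vscale (e i * (L div snd (p i))) (vscale (fst (p i)) q) \<in> E i (e i * (L div snd (p i)) * snd (p i))"
        by (rule gf_scale[OF g[OF i] n]) (use p i in simp)
      moreover have "e i * (L div snd (p i)) * snd (p i) = e i * L" using dv[OF i] by (simp add: mult_ac)
      moreover have "vscale (e i * (L div snd (p i))) (vscale (fst (p i)) q) = vscale (s i) q" unfolding s_def by (simp add: mult_ac)
      ultimately show ?thesis by (simp only:)
    qed
    from H[OF L1 this] obtain D c0 where Dc: "\<forall>t. vscale (t * (\<Sum>i\<in>\<Lambda>. s i) + c0) q \<in> EI (L * (t - D))" by auto
    let ?S = "\<Sum>i\<in>\<Lambda>. s i"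
    have bnd: "rad EI q \<le> real ?S / real L + (real D * real ?S + real c0) / real L * (1 / real t)" if t: "0 < t" for t
    proof -
      have "rad EI q \<le> real ((D + t) * ?S + c0) / real (L * t)" by (rule rad_le[OF gI n]) (use L1 t Dc[THEN spec, of "D + t"] in simp_all)
      also have "\<dots> = real ?S / real L + (real D * real ?S + real c0) / real L * (1 / real t)" using L1 t by (simp add: field_simps del: of_nat_sum)
      finally show ?thesis .
    qed
    have "(\<lambda>t. real ?S / real L + (real D * real ?S + real c0) / real L * (1 / real t)) \<longlonglongrightarrow> real ?S / real L + (real D * real ?S + real c0) / real L * 0"
      by (intro tendsto_intros lim_1_over_n)
    hence "rad EI q \<le> real ?S / real L + (real D * real ?S + real c0) / real L * 0" by (rule LIMSEQ_le_const) (use bnd in "intro exI[of _ 1] allI impI, simp")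
    also have "\<dots> = (\<Sum>i\<in>\<Lambda>. real (e i) * (real (fst (p i)) / real (snd (p i))))"
    proof -
      have "real (s i) / real L = real (e i) * (real (fst (p i)) / real (snd (p i)))" if i: "i \<in> \<Lambda>" for i
      proof -
        have "real L = real (snd (p i)) * real (L div snd (p i))" using dv[OF i] by (metis of_nat_mult)
        thus ?thesis unfolding s_def using L1 by (auto simp: field_simps)
      qed
      thus ?thesis by (simp add: sum_divide_distrib)
    qed
    also have "\<dots> \<le> (\<Sum>i\<in>\<Lambda>. real (e i) * (rad (E i) q + 1 / real (Suc j)))"
      using p by (intro sum_mono mult_left_mono) (auto intro: less_imp_le)
    finally show ?thesis .
  qed
  have "(\<lambda>j. \<Sum>i\<in>\<Lambda>. real (e i) * (rad (E i) q + 1 / real (Suc j))) \<longlonglongrightarrow> (\<Sum>i\<in>\<Lambda>. real (e i) * (rad (E i) q + 0))"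
    by (intro tendsto_intros LIMSEQ_Suc[OF lim_1_over_n])
  hence "rad EI q \<le> (\<Sum>i\<in>\<Lambda>. real (e i) * (rad (E i) q + 0))" by (rule LIMSEQ_le_const) (use le in "intro exI allI impI")
  thus ?thesis by simp
qed

text \<open>The upper bound for \<open>EI\<close> and the lower bounds for the \<open>E i\<close>
  use the same rays and the same factor \<open>T / n\<close>, so Minkowski's inequality for sums
  applies ray by ray; the remaining error \<open>C / T\<close> tends to 0.\<close>

theorem covol_minkowski:
  fixes e :: "'i \<Rightarrow> nat"
  assumes gI: "gfam n cI EI" and n: "0 < n" and \<Lambda>: "finite \<Lambda>" and g: "\<And>i. i \<in> \<Lambda> \<Longrightarrow> gfam n (c i) (E i)"
    and H: "\<And>q L s. length q = n \<Longrightarrow> \<forall>x\<in>set q. 0 < x \<Longrightarrow> 1 \<le> L \<Longrightarrow> (\<And>i. i \<in> \<Lambda> \<Longrightarrow> vscale (s i) q \<in> E i (e i * L)) \<Longrightarrow>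
       \<exists>D c0. \<forall>t. vscale (t * (\<Sum>i\<in>\<Lambda>. s i) + c0) q \<in> EI (L * (t - D))"
  shows "root n (covol n EI) \<le> (\<Sum>i\<in>\<Lambda>. real (e i) * root n (covol n (E i)))"
proof -
  obtain k where k: "n = Suc k" using n by (cases n) auto
  define C where "C = real cI ^ k + real k * real cI ^ Suc k"
  define S where "S = (\<Sum>i\<in>\<Lambda>. real (e i) * root n (covol n (E i)))"
  have S0: "0 \<le> S" unfolding S_def using covol_nonneg[OF g n] n by (intro sum_nonneg mult_nonneg_nonneg) simp_all
  have bnd: "covol n EI \<le> C * (1 / real T) + S ^ n" if T: "0 < T" for T
  proof -
    define D where "D = {ds. length ds = k \<and> set ds \<subseteq> {..<cI * T * T}}"
    have fD: "finite D" unfolding D_def by (rule finite_bounded_lists)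
    have Dv: "D \<subseteq> vecs k" unfolding D_def by (rule subsetI) simp
    have l: "length (dir T d) = n" if "d \<in> D" for d using that k unfolding D_def by simp
    have r0: "0 \<le> rad (E i) (dir T d)" if "i \<in> \<Lambda>" "d \<in> D" for i d by (rule rad_nonneg[OF g n l dir_pos[OF T]]) (rule that)+
    let ?a = "real T / real n"
    have a0: "0 \<le> ?a" by simp
    have "(\<Sum>d\<in>D. rad EI (dir T d) ^ n) \<le> (\<Sum>d\<in>D. (\<Sum>i\<in>\<Lambda>. real (e i) * rad (E i) (dir T d)) ^ n)"
    proof (intro sum_mono power_mono)
      fix d assume d: "d \<in> D"
      show "rad EI (dir T d) \<le> (\<Sum>i\<in>\<Lambda>. real (e i) * rad (E i) (dir T d))"
        by (rule rad_sum_le[OF gI n \<Lambda> g l[OF d] dir_pos[OF T] H[OF l[OF d] dir_pos[OF T]]])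
      show "0 \<le> rad EI (dir T d)" by (rule rad_nonneg[OF gI n l[OF d] dir_pos[OF T]])
    qed
    hence "root n (\<Sum>d\<in>D. rad EI (dir T d) ^ n) \<le> root n (\<Sum>d\<in>D. (\<Sum>i\<in>\<Lambda>. real (e i) * rad (E i) (dir T d)) ^ n)"
      by (rule real_root_le_mono[OF n])
    also have "\<dots> \<le> (\<Sum>i\<in>\<Lambda>. root n (\<Sum>d\<in>D. (real (e i) * rad (E i) (dir T d)) ^ n))"
      by (rule minkowski[OF n fD \<Lambda>]) (use r0 in simp)
    also have "\<dots> = (\<Sum>i\<in>\<Lambda>. real (e i) * root n (\<Sum>d\<in>D. rad (E i) (dir T d) ^ n))"
      unfolding power_mult_distrib sum_distrib_left[symmetric] real_root_mult by (intro sum.cong refl arg_cong2[of _ _ _ _ "(*)"] real_root_power_cancel[OF n]) simp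
    finally have A: "root n (\<Sum>d\<in>D. rad EI (dir T d) ^ n) \<le> (\<Sum>i\<in>\<Lambda>. real (e i) * root n (\<Sum>d\<in>D. rad (E i) (dir T d) ^ n))" .
    have "root n (?a * (\<Sum>d\<in>D. rad EI (dir T d) ^ n)) \<le> root n ?a * (\<Sum>i\<in>\<Lambda>. real (e i) * root n (\<Sum>d\<in>D. rad (E i) (dir T d) ^ n))"
      unfolding real_root_mult by (rule mult_left_mono[OF A]) (use n in simp)
    also have "\<dots> = (\<Sum>i\<in>\<Lambda>. real (e i) * root n (?a * (\<Sum>d\<in>D. rad (E i) (dir T d) ^ n)))"
      unfolding real_root_mult unfolding sum_distrib_left by (intro sum.cong refl) (rule mult.left_commute)
    also have "\<dots> \<le> S" unfolding S_def
    proof (intro sum_mono mult_left_mono real_root_le_mono[OF n])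
      fix i assume i: "i \<in> \<Lambda>"
      show "?a * (\<Sum>d\<in>D. rad (E i) (dir T d) ^ n) \<le> covol n (E i)" using covol_lower[OF g[OF i, unfolded k] T fD Dv] unfolding k .
    qed simp
    finally have "?a * (\<Sum>d\<in>D. rad EI (dir T d) ^ n) \<le> S ^ n" unfolding root_le_iff_le_power[OF n S0] .
    moreover have "covol n EI \<le> C / real T + ?a * (\<Sum>d\<in>D. rad EI (dir T d) ^ n)" using covol_upper[OF gI[unfolded k] T] unfolding k D_def C_def .
    ultimately show ?thesis by (simp only: times_divide_eq_right mult_1_right)
  qed
  have "(\<lambda>T. C * (1 / real T) + S ^ n) \<longlonglongrightarrow> C * 0 + S ^ n" by (intro tendsto_intros lim_1_over_n)
  hence "covol n EI \<le> C * 0 + S ^ n" by (rule LIMSEQ_le_const) (use bnd in "intro exI[of _ 1] allI impI, simp")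
  hence "covol n EI \<le> S ^ n" by simp
  thus ?thesis unfolding S_def[symmetric] root_le_iff_le_power[OF n S0] .
qed

section \<open>Leading exponents\<close>

text \<open>In a regular local ring with parameters \<open>xs\<close>, the elements \<open>f\<close> with \<open>lead R xs as f\<close> play the
  role of power series with lexicographically smallest monomial \<open>xs ^ as\<close> and coefficient \<open>1\<close>.\<close>

fun lead :: "('a, 'b) ring_scheme \<Rightarrow> 'a list \<Rightarrow> nat list \<Rightarrow> 'a \<Rightarrow> bool" where
  "lead R [] [] f \<longleftrightarrow> f = \<one>\<^bsub>R\<^esub>"
| "lead R (x # xs) (a # as) f \<longleftrightarrow> (\<exists>f'. \<exists>r\<in>carrier R. lead R xs as f' \<and> f = x [^]\<^bsub>R\<^esub> a \<otimes>\<^bsub>R\<^esub> (f' \<oplus>\<^bsub>R\<^esub> x \<otimes>\<^bsub>R\<^esub> r))"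
| "lead R _ _ f \<longleftrightarrow> False"

definition lexps :: "('a, 'b) ring_scheme \<Rightarrow> 'a list \<Rightarrow> 'a set \<Rightarrow> nat list set" where
  "lexps R xs J = {as. \<exists>f\<in>J. lead R xs as f}"

context cring
begin

lemma lead_carrier: "lead R xs as f \<Longrightarrow> set xs \<subseteq> carrier R \<Longrightarrow> f \<in> carrier R \<and> length as = length xs"
proof (induction xs arbitrary: as f)
  case Nil
  thus ?case by (cases as) simp_all
next
  case (Cons x xs)
  obtain a bs where as: "as = a # bs" using Cons.prems(1) by (cases as) simp_all
  obtain f' r where f: "r \<in> carrier R" "lead R xs bs f'" "f = x [^] a \<otimes> (f' \<oplus> x \<otimes> r)" using Cons.prems(1) unfolding as by auto
  have "f' \<in> carrier R" "length bs = length xs" using Cons.IH[OF f(2)] Cons.prems(2) by simp_all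
  thus ?case unfolding as f(3) using f(1) Cons.prems(2) by simp
qed

lemma lead_mult: "lead R xs as f \<Longrightarrow> lead R xs bs g \<Longrightarrow> set xs \<subseteq> carrier R \<Longrightarrow> lead R xs (vplus as bs) (f \<otimes> g)"
proof (induction xs arbitrary: as bs f g)
  case Nil
  thus ?case by (cases as; cases bs) simp_all
next
  case (Cons x xs)
  have x: "x \<in> carrier R" and xs: "set xs \<subseteq> carrier R" using Cons.prems(3) by simp_all
  obtain a as' where as: "as = a # as'" using Cons.prems(1) by (cases as) simp_all
  obtain b bs' where bs: "bs = b # bs'" using Cons.prems(2) by (cases bs) simp_all
  obtain f' r where f: "r \<in> carrier R" "lead R xs as' f'" "f = x [^] a \<otimes> (f' \<oplus> x \<otimes> r)" using Cons.prems(1) unfolding as by auto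
  obtain g' s where g: "s \<in> carrier R" "lead R xs bs' g'" "g = x [^] b \<otimes> (g' \<oplus> x \<otimes> s)" using Cons.prems(2) unfolding bs by auto
  have c: "f' \<in> carrier R" "g' \<in> carrier R" using lead_carrier[OF f(2) xs] lead_carrier[OF g(2) xs] by simp_all
  have pc: "x [^] a \<in> carrier R" "x [^] b \<in> carrier R" using x by simp_all
  have "f \<otimes> g = (x [^] a \<otimes> x [^] b) \<otimes> (f' \<otimes> g' \<oplus> x \<otimes> (f' \<otimes> s \<oplus> r \<otimes> g' \<oplus> x \<otimes> r \<otimes> s))"
    unfolding f(3) g(3) using x c pc f(1) g(1) by algebra
  hence "f \<otimes> g = x [^] (a + b) \<otimes> (f' \<otimes> g' \<oplus> x \<otimes> (f' \<otimes> s \<oplus> r \<otimes> g' \<oplus> x \<otimes> r \<otimes> s))" using x by (simp add: nat_pow_mult)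
  moreover have "lead R xs (vplus as' bs') (f' \<otimes> g')" by (rule Cons.IH[OF f(2) g(2) xs])
  moreover have "f' \<otimes> s \<oplus> r \<otimes> g' \<oplus> x \<otimes> r \<otimes> s \<in> carrier R" using x c f(1) g(1) by simp
  ultimately show ?case unfolding as bs by (simp only: zip_Cons_Cons list.map prod.case lead.simps) blast
qed

text \<open>The witness is the monomial itself. It is divisible by every power of a parameter up to
  the exponent, hence in each ideal that contains such a power.\<close>

lemma lead_monomial: "length as = length xs \<Longrightarrow> set xs \<subseteq> carrier R \<Longrightarrow>
   \<exists>f. lead R xs as f \<and> (\<forall>i J N. i < length xs \<longrightarrow> ideal J R \<longrightarrow> N \<le> as ! i \<longrightarrow> (xs ! i) [^] N \<in> J \<longrightarrow> f \<in> J)"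
proof (induction xs arbitrary: as)
  case (Cons x xs)
  have x: "x \<in> carrier R" and xs: "set xs \<subseteq> carrier R" using Cons.prems(2) by simp_all
  obtain a bs where as: "as = a # bs" using Cons.prems(1) by (cases as) simp_all
  obtain f' where f': "lead R xs bs f'" "\<And>i J N. i < length xs \<Longrightarrow> ideal J R \<Longrightarrow> N \<le> bs ! i \<Longrightarrow> (xs ! i) [^] N \<in> J \<Longrightarrow> f' \<in> J"
    using Cons.IH[of bs] Cons.prems(1) xs unfolding as by auto
  have c: "f' \<in> carrier R" using lead_carrier[OF f'(1) xs] by simp
  let ?f = "x [^] a \<otimes> (f' \<oplus> x \<otimes> \<zero>)"
  have e: "?f = x [^] a \<otimes> f'" using x c by simp
  have "?f \<in> J" if i: "i < length (x # xs)" and J: "ideal J R" and N: "N \<le> as ! i" "((x # xs) ! i) [^] N \<in> J" for i J N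
  proof (cases i)
    case 0
    hence N': "x [^] N \<in> J" "N \<le> a" using N as by simp_all
    have "x [^] a = x [^] (a - N) \<otimes> x [^] N" using x N'(2) by (simp add: nat_pow_mult)
    hence "x [^] a \<in> J" using idD(5)[OF J N'(1), of "x [^] (a - N)"] x by simp
    thus ?thesis unfolding e by (rule idD(6)[OF J]) (rule c)
  next
    case (Suc j)
    hence "f' \<in> J" using f'(2)[of j J N] i J N as by simp
    thus ?thesis unfolding e by (rule idD(5)[OF J]) (use x in simp)
  qed
  moreover have "lead R (x # xs) as ?f" unfolding as using f'(1) by auto
  ultimately show ?case by (intro exI[of _ ?f] conjI allI impI)
qed simp

lemma lexps_vecs: "set xs \<subseteq> carrier R \<Longrightarrow> lexps R xs J \<subseteq> vecs (length xs)"
  unfolding lexps_def using lead_carrier[of xs] by (intro subsetI) auto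

lemma lexps_carrier: assumes "set xs \<subseteq> carrier R" shows "lexps R xs (carrier R) = vecs (length xs)"
proof (rule antisym[OF lexps_vecs[OF assms] subsetI])
  fix as assume "as \<in> vecs (length xs)"
  then obtain f where "lead R xs as f" using lead_monomial[OF _ assms, of as] by auto
  thus "as \<in> lexps R xs (carrier R)" unfolding lexps_def using lead_carrier[OF _ assms, of as f] by auto
qed

lemma colon_one: "ideal J R \<Longrightarrow> colon J \<one> = J" unfolding colon_def using idD(1) by auto

lemma colon_colon: "x \<in> carrier R \<Longrightarrow> y \<in> carrier R \<Longrightarrow> colon (colon J x) y = colon J (x \<otimes> y)"
  unfolding colon_def by (auto simp: m_assoc)

text \<open>Cancelling \<open>x [^] a\<close>: the element
  \<open>x [^] a \<otimes> (f' \<oplus> x \<otimes> r)\<close> lies in \<open>J\<close> for some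
  \<open>r\<close> exactly if \<open>f'\<close> lies in the colon ideal of \<open>J\<close> by
  \<open>x [^] a\<close>, enlarged by \<open>x\<close>.\<close>

lemma lexps_Cons:
  assumes J: "ideal J R" and x: "x \<in> carrier R" and xs: "set xs \<subseteq> carrier R"
  shows "a # as \<in> lexps R (x # xs) J \<longleftrightarrow> as \<in> lexps R xs (add_elt (colon J (x [^] a)) x)"
proof
  assume "a # as \<in> lexps R (x # xs) J"
  then obtain f' r where f: "r \<in> carrier R" "lead R xs as f'" "x [^] a \<otimes> (f' \<oplus> x \<otimes> r) \<in> J" unfolding lexps_def by auto
  have c: "f' \<in> carrier R" using lead_carrier[OF f(2) xs] by simp
  have "f' \<oplus> x \<otimes> r \<in> colon J (x [^] a)" unfolding colon_def using f c x by simp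
  moreover have "f' = (f' \<oplus> x \<otimes> r) \<oplus> x \<otimes> (\<ominus> r)" using c x f(1) by algebra
  ultimately have "f' \<in> add_elt (colon J (x [^] a)) x" unfolding add_elt_def using a_inv_closed[OF f(1)] by blast
  thus "as \<in> lexps R xs (add_elt (colon J (x [^] a)) x)" unfolding lexps_def using f(2) by auto
next
  assume "as \<in> lexps R xs (add_elt (colon J (x [^] a)) x)"
  then obtain f' j r where f: "lead R xs as f'" "f' = j \<oplus> x \<otimes> r" "j \<in> carrier R" "x [^] a \<otimes> j \<in> J" "r \<in> carrier R"
    unfolding lexps_def add_elt_def colon_def by auto
  have "j = f' \<oplus> x \<otimes> (\<ominus> r)" unfolding f(2) using f(3,5) x by algebra
  hence "x [^] a \<otimes> (f' \<oplus> x \<otimes> (\<ominus> r)) \<in> J" using f(4) by simp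
  moreover have "lead R (x # xs) (a # as) (x [^] a \<otimes> (f' \<oplus> x \<otimes> (\<ominus> r)))" using f(1) a_inv_closed[OF f(5)] by auto
  ultimately show "a # as \<in> lexps R (x # xs) J" unfolding lexps_def by blast
qed

lemma has_length_carrier: "has_length R (carrier R) 0"
proof -
  have "ideal_chain R (carrier R) 0" unfolding ideal_chain_def using oneideal by (intro exI[of _ "\<lambda>_. carrier R"]) simp
  moreover have "l = 0" if "ideal_chain R (carrier R) l" for l
  proof (rule ccontr)
    assume l: "l \<noteq> 0"
    obtain N where N: "\<forall>i\<le>l. ideal (N i) R \<and> carrier R \<subseteq> N i" "\<forall>i<l. N i \<subset> N (Suc i)"
      using \<open>ideal_chain R (carrier R) l\<close> unfolding ideal_chain_def by auto
    have "N 1 \<subseteq> carrier R" using N(1) l idD(1)[of "N 1"] by (intro subsetI) simp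
    also have "carrier R \<subseteq> N 0" using N(1) by simp
    finally show False using N(2)[rule_format, of 0] l by simp
  qed
  ultimately show ?thesis unfolding has_length_def by simp
qed

lemma has_length_maximal: assumes M: "maximalideal M R" shows "has_length R M 1"
proof -
  interpret M: maximalideal M R by (rule M)
  have "M \<subset> carrier R" using M.I_notcarr M.a_subset by simp
  hence "ideal_chain R M 1" unfolding ideal_chain_def using oneideal M.is_ideal by (intro exI[of _ "\<lambda>i. if i = 0 then M else carrier R"]) auto
  moreover have "l \<le> 1" if "ideal_chain R M l" for l
  proof (rule ccontr)
    assume l: "\<not> l \<le> 1"
    obtain N where N: "\<forall>i\<le>l. ideal (N i) R \<and> M \<subseteq> N i" "\<forall>i<l. N i \<subset> N (Suc i)"
      using \<open>ideal_chain R M l\<close> unfolding ideal_chain_def by auto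
    have s: "N 0 \<subset> N 1" "N 1 \<subset> N 2" using N(2)[rule_format, of 0] N(2)[rule_format, of 1] l by (simp_all add: numeral_2_eq_2)
    have c: "N 1 \<subseteq> carrier R" "N 2 \<subseteq> carrier R" using N(1) l idD(1)[of "N 1"] idD(1)[of "N 2"] by (auto intro!: subsetI)
    have "N 1 = M \<or> N 1 = carrier R" using M.I_maximal[of "N 1"] N(1) l c(1) by simp
    thus False using s c(2) N(1)[rule_format, of 0] by auto
  qed
  ultimately show ?thesis unfolding has_length_def by simp
qed

text \<open>Splitting off \<open>J + x R\<close> and replacing \<open>J\<close> by its colon ideal
  by \<open>x\<close>, again and again, until the colon ideal is the whole ring.\<close>

lemma has_length_slices: fixes c :: nat
  assumes "ideal J R" "x \<in> carrier R" "x [^] c \<in> J" "\<And>a. a < c \<Longrightarrow> has_length R (add_elt (colon J (x [^] a)) x) (h a)"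
  shows "has_length R J (\<Sum>a<c. h a)" using assms
proof (induction c arbitrary: J h)
  case 0
  hence "J = carrier R" using ideal.one_imp_carrier[OF 0(1)] by simp
  thus ?case using has_length_carrier by simp
next
  case (Suc c)
  have x: "x \<in> carrier R" by (rule Suc.prems(2))
  have p: "x \<otimes> x [^] a = x [^] Suc a" for a :: nat using x by (metis nat_pow_Suc2)
  have "has_length R (colon J x) (\<Sum>a<c. h (Suc a))"
  proof (rule Suc.IH)
    show "ideal (colon J x) R" by (rule colon_ideal(1)[OF Suc.prems(1) x])
    show "x [^] c \<in> colon J x" unfolding colon_def using x p[of c] Suc.prems(3) by simp
    fix a assume "a < c"
    thus "has_length R (add_elt (colon (colon J x) (x [^] a)) x) (h (Suc a))" unfolding colon_colon[OF x nat_pow_closed[OF x]] p by (intro Suc.prems(4)) simp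
  qed (rule x)
  moreover have "has_length R (add_elt J x) (h 0)" using Suc.prems(4)[of 0] colon_one[OF Suc.prems(1)] by simp
  ultimately show ?case unfolding sum.lessThan_Suc_shift using has_length_add[OF Suc.prems(1) x] by simp
qed

text \<open>Both sides are sums over the exponent \<open>a\<close> of the first parameter: lengths
  by \<open>has_length_slices\<close>, gaps by \<open>lexps_Cons\<close>. Without parameters left,
  the ideal contains \<open>M\<close>, so it is \<open>M\<close> with one gap or the ring with
  none.\<close>

lemma has_length_lexps: fixes c :: nat
  assumes M: "maximalideal M R"
  shows "ideal J R \<Longrightarrow> set xs \<subseteq> carrier R \<Longrightarrow> (\<And>x. x \<in> set xs \<Longrightarrow> x [^] c \<in> J) \<Longrightarrow>
    (\<And>N. ideal N R \<Longrightarrow> J \<subseteq> N \<Longrightarrow> set xs \<subseteq> N \<Longrightarrow> M \<subseteq> N) \<Longrightarrow>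
    finite (vecs (length xs) - lexps R xs J) \<and> has_length R J (card (vecs (length xs) - lexps R xs J))"
proof (induction xs arbitrary: J)
  case Nil
  have "(\<exists>f\<in>J. lead R [] as f) \<longleftrightarrow> as \<in> (if \<one> \<in> J then {[]} else {})" for as by (cases as) auto
  hence "{as. \<exists>f\<in>J. lead R [] as f} = {as. as \<in> (if \<one> \<in> J then {[]} else {})}" by (rule Collect_cong)
  hence l: "lexps R [] J = (if \<one> \<in> J then {[]} else {})" unfolding lexps_def Collect_mem_eq .
  have v: "vecs (length []) = {[]}" by auto
  have "M \<subseteq> J" by (rule Nil.prems(4)) (use Nil.prems(1) in simp_all)
  then consider "J = M" | "J = carrier R" using maximalideal.I_maximal[OF M Nil.prems(1)] idD(1)[OF Nil.prems(1)] by auto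
  thus ?case
  proof cases
    case 1
    hence "\<one> \<notin> J" using maximalideal.I_notcarr[OF M] ideal.one_imp_carrier[OF Nil.prems(1)] by auto
    thus ?thesis unfolding l v using has_length_maximal[OF M] 1 by simp
  next
    case 2
    thus ?thesis unfolding l v using has_length_carrier by simp
  qed
next
  case (Cons x xs)
  have J: "ideal J R" and x: "x \<in> carrier R" and xs: "set xs \<subseteq> carrier R" using Cons.prems by simp_all
  let ?S = "\<lambda>a. add_elt (colon J (x [^] a)) x" and ?n = "length xs"
  define G where "G a = vecs ?n - lexps R xs (?S a)" for a :: nat
  have ci: "ideal (colon J (x [^] a)) R" "J \<subseteq> colon J (x [^] a)" for a :: nat using colon_ideal[OF J, of "x [^] a"] x by simp_all
  have S: "ideal (?S a) R" "J \<subseteq> ?S a" "x \<in> ?S a" for a :: nat using add_elt_ideal[OF ci(1) x] ci(2) by (simp_all, meson subset_trans)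
  have IH: "finite (G a) \<and> has_length R (?S a) (card (G a))" for a :: nat unfolding G_def
  proof (rule Cons.IH[OF S(1) xs])
    fix y assume "y \<in> set xs"
    thus "y [^] c \<in> ?S a" using subsetD[OF S(2) Cons.prems(3)[of y]] by simp
  next
    fix N assume N: "ideal N R" "?S a \<subseteq> N" "set xs \<subseteq> N"
    have "J \<subseteq> N" by (rule order_trans[OF S(2) N(2)])
    moreover have "set (x # xs) \<subseteq> N" using subsetD[OF N(2) S(3)] N(3) by simp
    ultimately show "M \<subseteq> N" by (rule Cons.prems(4)[OF N(1)])
  qed
  have xc: "x [^] c \<in> J" using Cons.prems(3) by simp
  have len: "has_length R J (\<Sum>a<c. card (G a))" by (rule has_length_slices[OF J x xc]) (use IH in simp)
  have Ge: "vecs (length (x # xs)) - lexps R (x # xs) J = (\<Union>a<c. (#) a ` G a)"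
  proof (rule Set.set_eqI)
    fix bs
    show "bs \<in> vecs (length (x # xs)) - lexps R (x # xs) J \<longleftrightarrow> bs \<in> (\<Union>a<c. (#) a ` G a)"
    proof (cases bs)
      case Nil
      have "[] \<notin> vecs (length (x # xs)) - lexps R (x # xs) J" by simp
      moreover have "[] \<notin> (\<Union>a<c. (#) a ` G a)" by auto
      ultimately show ?thesis unfolding Nil by (simp only:)
    next
      case (Cons a as)
      have "a < c" if "as \<in> G a"
      proof (rule ccontr)
        assume ac: "\<not> a < c"
        have "x [^] a = x [^] (a - c) \<otimes> x [^] c" using x ac by (simp add: nat_pow_mult)
        hence "x [^] a \<in> J" using idD(5)[OF J xc, of "x [^] (a - c)"] x by simp
        hence "\<one> \<in> colon J (x [^] a)" unfolding colon_def using x by simp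
        hence "\<one> \<in> ?S a" by (rule subsetD[OF add_elt_ideal(2)[OF ci(1) x]])
        hence "?S a = carrier R" by (rule ideal.one_imp_carrier[OF S(1)])
        thus False using that lexps_carrier[OF xs] unfolding G_def by simp
      qed
      moreover have "bs \<in> vecs (length (x # xs)) - lexps R (x # xs) J \<longleftrightarrow> as \<in> G a"
        unfolding Cons G_def using lexps_Cons[OF J x xs, of a as] by simp
      moreover have "bs \<in> (\<Union>a<c. (#) a ` G a) \<longleftrightarrow> a < c \<and> as \<in> G a" unfolding Cons by auto
      ultimately show ?thesis by metis
    qed
  qed
  have "card (\<Union>a<c. (#) a ` G a) = (\<Sum>a<c. card ((#) a ` G a))" by (rule card_UN_disjoint) (use IH in auto)
  also have "\<dots> = (\<Sum>a<c. card (G a))" by (intro sum.cong refl card_image) simp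
  finally show ?case unfolding Ge using len IH by simp
qed

lemma lexps_gfam:
  assumes xs: "set xs \<subseteq> carrier R" and J: "\<And>m. ideal (J m) R"
    and mult: "\<And>m l f g. f \<in> J m \<Longrightarrow> g \<in> J l \<Longrightarrow> f \<otimes> g \<in> J (m + l)" and anti: "\<And>l m. l \<le> m \<Longrightarrow> J m \<subseteq> J l"
    and c: "\<And>m x. x \<in> set xs \<Longrightarrow> x [^] (c * m) \<in> J m" shows "gfam (length xs) c (\<lambda>m. lexps R xs (J m))" unfolding gfam_def
proof (intro conjI allI impI ballI)
  show "lexps R xs (J m) \<subseteq> vecs (length xs)" for m by (rule lexps_vecs[OF xs])
next
  fix m l a b assume "a \<in> lexps R xs (J m)" "b \<in> lexps R xs (J l)"
  then obtain f g where fg: "f \<in> J m" "lead R xs a f" "g \<in> J l" "lead R xs b g" unfolding lexps_def by auto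
  thus "vplus a b \<in> lexps R xs (J (m + l))" unfolding lexps_def using mult[OF fg(1,3)] lead_mult[OF fg(2,4) xs] by auto
next
  fix m a b assume a: "a \<in> lexps R xs (J m)" and b: "b \<in> vecs (length xs)"
  obtain f where f: "f \<in> J m" "lead R xs a f" using a unfolding lexps_def by auto
  obtain g where g: "lead R xs b g" using lead_monomial[OF _ xs, of b] b by auto
  have "f \<otimes> g \<in> J m" by (rule idD(6)[OF J f(1)]) (use lead_carrier[OF g xs] in simp)
  thus "vplus a b \<in> lexps R xs (J m)" unfolding lexps_def using lead_mult[OF f(2) g xs] by auto
next
  fix l m :: nat assume "l \<le> m"
  from anti[OF this] show "lexps R xs (J m) \<subseteq> lexps R xs (J l)" unfolding lexps_def by auto
next
  fix m a assume a: "a \<in> vecs (length xs)" "\<exists>i<length xs. c * m \<le> a ! i"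
  then obtain i where i: "i < length xs" "c * m \<le> a ! i" by auto
  obtain f where f: "lead R xs a f" "\<And>i J N. i < length xs \<Longrightarrow> ideal J R \<Longrightarrow> N \<le> a ! i \<Longrightarrow> (xs ! i) [^] N \<in> J \<Longrightarrow> f \<in> J"
    using lead_monomial[OF _ xs, of a] a(1) by auto
  have "f \<in> J m" by (rule f(2)[OF i(1) J i(2)]) (use c[of "xs ! i" m] i(1) in simp)
  thus "a \<in> lexps R xs (J m)" unfolding lexps_def using f(1) by auto
qed

lemma lead_one: "length as = length xs \<Longrightarrow> set xs \<subseteq> carrier R \<Longrightarrow> lead R xs (map (\<lambda>_. 0) as) \<one>"
proof (induction xs arbitrary: as)
  case (Cons x xs)
  obtain a bs where as: "as = a # bs" using Cons.prems(1) by (cases as) simp_all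
  have "lead R xs (map (\<lambda>_. 0) bs) \<one>" using Cons.IH[of bs] Cons.prems as by simp
  moreover have "\<one> = x [^] (0 :: nat) \<otimes> (\<one> \<oplus> x \<otimes> \<zero>)" using Cons.prems(2) by simp
  ultimately have "lead R (x # xs) (0 # map (\<lambda>_. 0) bs) \<one>" unfolding lead.simps using zero_closed by blast
  thus ?case unfolding as by simp
qed simp

lemma lead_pow: assumes "lead R xs as g" "set xs \<subseteq> carrier R" shows "lead R xs (vscale t as) (g [^] t)"
proof (induction t)
  case 0
  show ?case using lead_one[OF conjunct2[OF lead_carrier[OF assms]] assms(2)] by simp
next
  case (Suc t)
  have "vscale (Suc t) as = vplus (vscale t as) as" by (rule nth_equalityI) auto
  thus ?case using lead_mult[OF Suc assms(1) assms(2)] by (simp only: nat_pow_Suc)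
qed

text \<open>\<open>h\<close> is the product of the \<open>g i\<close>; being a multiple of each
  factor, it inherits the valuation bounds of all of them.\<close>

lemma lead_prod:
  assumes "finite \<Lambda>" and q: "length q = length xs" and xs: "set xs \<subseteq> carrier R"
    and l: "\<And>i. i \<in> \<Lambda> \<Longrightarrow> lead R xs (vscale (s i) q) (g i)"
  shows "\<exists>h. lead R xs (vscale (\<Sum>i\<in>\<Lambda>. s i) q) h \<and> (\<forall>i\<in>\<Lambda>. \<exists>u\<in>carrier R. h = g i \<otimes> u)"
  using assms(1) l
proof (induction \<Lambda> rule: finite_induct)
  case empty
  show ?case using lead_one[OF q xs] by (intro exI[of _ \<one>]) simp
next
  case (insert i \<Lambda>)
  obtain h where h: "lead R xs (vscale (\<Sum>i\<in>\<Lambda>. s i) q) h" "\<forall>i\<in>\<Lambda>. \<exists>u\<in>carrier R. h = g i \<otimes> u"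
    using insert.IH insert.prems by auto
  have gi: "lead R xs (vscale (s i) q) (g i)" using insert.prems by simp
  have c: "h \<in> carrier R" "g i \<in> carrier R" using lead_carrier[OF h(1) xs] lead_carrier[OF gi xs] by simp_all
  have "vscale (\<Sum>i\<in>insert i \<Lambda>. s i) q = vplus (vscale (s i) q) (vscale (\<Sum>i\<in>\<Lambda>. s i) q)"
    using insert.hyps by (intro nth_equalityI) (auto simp: distrib_right)
  hence "lead R xs (vscale (\<Sum>i\<in>insert i \<Lambda>. s i) q) (g i \<otimes> h)" using lead_mult[OF gi h(1) xs] by simp
  moreover have "\<exists>u\<in>carrier R. g i \<otimes> h = g j \<otimes> u" if j: "j \<in> insert i \<Lambda>" for j
  proof (cases "j = i")
    case True
    thus ?thesis using c(1) by (intro bexI[of _ h]) simp_all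
  next
    case False
    then obtain u where u: "u \<in> carrier R" "h = g j \<otimes> u" using h(2) j by auto
    have gj: "g j \<in> carrier R" using insert.prems[OF j] lead_carrier[OF _ xs] by blast
    have "g i \<otimes> h = g j \<otimes> (g i \<otimes> u)" unfolding u(2) using c(2) u(1) gj by (simp add: m_lcomm)
    thus ?thesis using c(2) u(1) by (intro bexI[of _ "g i \<otimes> u"]) simp_all
  qed
  ultimately show ?case by (intro exI[of _ "g i \<otimes> h"] conjI ballI)
qed

end

section \<open>Powers of the ideal and integral dependence\<close>

context chart_setup
begin

lemma RR_cring: "cring RR" by (rule iffD1[OF subcring_iff[OF subringE(1)[OF R]] subcringI'[OF R]])

definition Pw :: "nat \<Rightarrow> 'a set" where "Pw n = I [^]\<^bsub>ideals_set RR\<^esub> n"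

lemma Pw_0: "Pw 0 = R" and Pw_Suc: "Pw (Suc n) = ideal_prod RR (Pw n) I" unfolding Pw_def by (simp_all add: nat_pow_def ideals_set_def)

lemma Pw_ideal: "ideal (Pw n) RR"
proof (induction n)
  case 0
  interpret RR: cring RR by (rule RR_cring)
  show ?case using RR.oneideal Pw_0 by simp
next
  case (Suc n)
  interpret RR: cring RR by (rule RR_cring)
  show ?case unfolding Pw_Suc by (rule RR.ideal_prod_is_ideal[OF Suc I])
qed

lemma Pw_props: "a \<in> Pw n \<Longrightarrow> a \<in> R" "\<zero> \<in> Pw n" "a \<in> Pw n \<Longrightarrow> b \<in> Pw n \<Longrightarrow> a \<oplus> b \<in> Pw n" "a \<in> Pw n \<Longrightarrow> r \<in> R \<Longrightarrow> r \<otimes> a \<in> Pw n"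
  using ideal_props[OF Pw_ideal[of n]] by (auto dest: subsetD)

lemma Pwc: "a \<in> Pw n \<Longrightarrow> a \<in> carrier K" using Pw_props(1) Rc by blast

lemma Pw_mult: assumes f: "f \<in> Pw m" shows "g \<in> Pw l \<Longrightarrow> f \<otimes> g \<in> Pw (m + l)"
proof (induction l arbitrary: g)
  case 0
  have "g \<otimes> f \<in> Pw m" by (rule Pw_props(4)[OF f]) (use 0 Pw_0 in simp)
  thus ?case using m_comm[OF Pwc[OF f] Pwc[OF 0]] by simp
next
  case (Suc l)
  have "g \<in> carrier K \<and> f \<otimes> g \<in> ideal_prod RR (Pw (m + l)) I" using Suc.prems unfolding Pw_Suc
  proof (induction rule: ideal_prod.induct)
    case (prod i j)
    have "(f \<otimes> i) \<otimes>\<^bsub>RR\<^esub> j \<in> ideal_prod RR (Pw (m + l)) I" by (rule ideal_prod.prod[OF Suc.IH[OF prod(1)] prod(2)])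
    thus ?case using Pwc[OF f] Pwc[OF prod(1)] Ic[OF prod(2)] by (simp add: m_assoc)
  next
    case (sum s1 s2)
    have "(f \<otimes> s1) \<oplus>\<^bsub>RR\<^esub> (f \<otimes> s2) \<in> ideal_prod RR (Pw (m + l)) I" by (rule ideal_prod.sum) (use sum in simp_all)
    thus ?case using Pwc[OF f] sum by (simp add: r_distr)
  qed
  thus ?case by (simp add: Pw_Suc)
qed

lemma Pw_anti: "l \<le> m \<Longrightarrow> Pw m \<subseteq> Pw l"
proof (rule lift_Suc_antimono_le[of Pw])
  fix n
  interpret RR: cring RR by (rule RR_cring)
  show "Pw (Suc n) \<subseteq> Pw n" using RR.ideal_prod_inter[OF Pw_ideal I] unfolding Pw_Suc by (rule order_trans) simp
qed

lemma one_R: "\<one> \<in> R" and mult_R: "a \<in> R \<Longrightarrow> b \<in> R \<Longrightarrow> a \<otimes> b \<in> R" using subringE(3,6)[OF R] by auto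

lemma pow_R: "a \<in> R \<Longrightarrow> a [^] (n::nat) \<in> R" by (induction n) (auto intro: one_R mult_R)

lemma Pw_1: assumes "f \<in> I" shows "f \<in> Pw 1"
proof -
  have "\<one> \<otimes>\<^bsub>RR\<^esub> f \<in> ideal_prod RR (Pw 0) I" by (rule ideal_prod.prod[OF _ assms]) (use Pw_0 one_R in simp)
  thus ?thesis using Ic[OF assms] by (simp add: Pw_Suc)
qed

lemma Pw_pow: "f \<in> I \<Longrightarrow> f [^] c \<in> Pw c"
proof (induction c)
  case 0 thus ?case using one_R Pw_0 by simp
next
  case (Suc c)
  thus ?case using Pw_mult[OF Suc.IH Pw_1] by simp
qed

section \<open>Additive spans and generators of the powers of the ideal\<close>

definition add_closed :: "'a set \<Rightarrow> bool" where
  "add_closed C \<longleftrightarrow> \<zero> \<in> C \<and> (\<forall>a\<in>C. \<forall>b\<in>C. a \<oplus> b \<in> C)"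

text \<open>The additive monoid generated by \<open>B\<close>, as an intersection: membership
  statements are then proved on generators, without finite sums.\<close>

definition asp :: "'a set \<Rightarrow> 'a set" where
  "asp B = \<Inter>{C. C \<subseteq> carrier K \<and> add_closed C \<and> B \<subseteq> C}"

lemma asp_incl: "b \<in> B \<Longrightarrow> b \<in> asp B" unfolding asp_def by blast

lemma asp_closed: "add_closed (asp B)" unfolding asp_def add_closed_def by blast

lemma asp_least: "C \<subseteq> carrier K \<Longrightarrow> add_closed C \<Longrightarrow> B \<subseteq> C \<Longrightarrow> asp B \<subseteq> C" unfolding asp_def by blast

lemma asp_carrier: assumes "B \<subseteq> carrier K" shows "asp B \<subseteq> carrier K" by (rule asp_least[OF order.refl _ assms]) (simp add: add_closed_def)

lemma asp_add: "a \<in> asp B \<Longrightarrow> b \<in> asp B \<Longrightarrow> a \<oplus> b \<in> asp B" using asp_closed unfolding add_closed_def by blast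
lemma asp_zero: "\<zero> \<in> asp B" using asp_closed unfolding add_closed_def by blast

lemma asp_mult: assumes B: "B \<subseteq> carrier K" and y: "y \<in> asp B" and z: "z \<in> carrier K"
    and C: "add_closed C" "\<And>b. b \<in> B \<Longrightarrow> z \<otimes> b \<in> C" shows "z \<otimes> y \<in> C"
proof -
  have "asp B \<subseteq> {y \<in> carrier K. z \<otimes> y \<in> C}"
  proof (rule asp_least)
    show "add_closed {y \<in> carrier K. z \<otimes> y \<in> C}" using C(1) z unfolding add_closed_def by (simp add: r_distr)
    show "B \<subseteq> {y \<in> carrier K. z \<otimes> y \<in> C}" by (rule subsetI) (use C(2) subsetD[OF B] in simp)
  qed (rule subsetI, simp)
  from subsetD[OF this y] show ?thesis by simp
qed

lemma asp_sub: assumes "B \<subseteq> carrier K" "y \<in> asp B" "add_closed C" "\<And>b. b \<in> B \<Longrightarrow> b \<in> C" shows "y \<in> C"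
proof -
  have "\<one> \<otimes> y \<in> C" by (rule asp_mult[OF assms(1,2) one_closed assms(3)]) (use assms(4) subsetD[OF assms(1)] in simp)
  thus ?thesis using subsetD[OF asp_carrier[OF assms(1)] assms(2)] by simp
qed

lemma Pw_closed: "add_closed (Pw n)" unfolding add_closed_def using Pw_props(2,3) by blast

lemma Pw_add: "y \<in> Pw (N + l) \<Longrightarrow> y \<in> asp {u \<otimes> v | u v. u \<in> Pw N \<and> v \<in> Pw l}"
proof (induction l arbitrary: y)
  case 0
  hence "y = y \<otimes> \<one>" using Pwc[OF 0] by simp
  thus ?case using 0 one_R Pw_0 by (intro asp_incl) auto
next
  case (Suc l)
  let ?B = "\<lambda>l. {u \<otimes> v | u v. u \<in> Pw N \<and> v \<in> Pw l}"
  have Bc: "?B l \<subseteq> carrier K" for l using Pwc by blast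
  have "y \<in> ideal_prod RR (Pw (N + l)) I" using Suc.prems by (simp add: Pw_Suc)
  thus ?case
  proof (induction rule: ideal_prod.induct)
    case (prod i j)
    have i: "i \<in> asp (?B l)" by (rule Suc.IH[OF prod(1)])
    have "j \<otimes> i \<in> asp (?B (Suc l))"
    proof (rule asp_mult[OF Bc i Ic[OF prod(2)] asp_closed])
      fix b assume "b \<in> ?B l"
      then obtain u v where uv: "b = u \<otimes> v" "u \<in> Pw N" "v \<in> Pw l" by blast
      have "j \<otimes> b = u \<otimes> (v \<otimes> j)" unfolding uv(1) using Pwc[OF uv(2)] Pwc[OF uv(3)] Ic[OF prod(2)] by (simp add: m_ac)
      moreover have "v \<otimes> j \<in> Pw (Suc l)" using Pw_mult[OF uv(3) Pw_1[OF prod(2)]] by simp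
      ultimately show "j \<otimes> b \<in> asp (?B (Suc l))" using uv(2) by (intro asp_incl) blast
    qed
    thus ?case using m_comm[OF Ic[OF prod(2)] Pwc[OF prod(1)]] by simp
  next
    case (sum s1 s2)
    thus ?case using asp_add by simp
  qed
qed

definition prodl :: "'a list \<Rightarrow> 'a" where "prodl l = foldr (\<otimes>) l \<one>"

lemma prodl_Pw: "set l \<subseteq> I \<Longrightarrow> prodl l \<in> Pw (length l)"
proof (induction l)
  case Nil
  thus ?case using one_R Pw_0 unfolding prodl_def by simp
next
  case (Cons a l)
  thus ?case using Pw_mult[OF Pw_1[of a], of "prodl l" "length l"] unfolding prodl_def by simp
qed

lemma prodl_count: "set l \<subseteq> I \<Longrightarrow> f \<in> I \<Longrightarrow> prodl l = f [^] count_list l f \<otimes> prodl (removeAll f l) \<and> count_list l f + length (removeAll f l) = length l"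
proof (induction l)
  case Nil
  thus ?case unfolding prodl_def by simp
next
  case (Cons a l)
  have IH: "prodl l = f [^] count_list l f \<otimes> prodl (removeAll f l)" "count_list l f + length (removeAll f l) = length l" using Cons by simp_all
  have "set (removeAll f l) \<subseteq> I" using Cons.prems(1) by auto
  hence c: "prodl (removeAll f l) \<in> carrier K" "f \<in> carrier K" "a \<in> carrier K" "f [^] count_list l f \<in> carrier K"
    using Pwc[OF prodl_Pw] Ic Cons.prems by simp_all
  have e: "prodl (a # l) = a \<otimes> prodl l" for a l unfolding prodl_def by simp
  show ?case
  proof (cases "a = f")
    case True
    thus ?thesis using IH c by (simp add: e m_ac)
  next
    case False
    thus ?thesis using IH(2) c unfolding e IH(1) by (simp add: e m_lcomm)
  qed
qed

text \<open>Zero is removed from the generators because each remaining one has to serve as the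
  denominator of a chart.\<close>

lemma I_span:
  assumes F: "F \<subseteq> I" "I = Idl\<^bsub>RR\<^esub> F" shows "I \<subseteq> asp {r \<otimes> f | r f. r \<in> R \<and> f \<in> F - {\<zero>}}"
proof -
  interpret RR: cring RR by (rule RR_cring)
  define B where "B = {r \<otimes> f | r f. r \<in> R \<and> f \<in> F - {\<zero>}}"
  have FI: "f \<in> I" if "f \<in> F" for f using subsetD[OF F(1) that] .
  have Bc: "B \<subseteq> carrier K" unfolding B_def using Rc Ic FI by blast
  have BR: "b \<in> R" if "b \<in> B" for b using that mult_R IR FI unfolding B_def by blast
  have cR: "carrier RR = R" by simp
  have "ideal (asp B) RR"
  proof (rule RR.idealI')
    have "add_closed R" unfolding add_closed_def using subringE(2,7)[OF R] by blast
    thus "asp B \<subseteq> carrier RR" unfolding cR by (rule asp_least[OF subringE(1)[OF R]]) (rule subsetI, rule BR)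
    show "\<zero>\<^bsub>RR\<^esub> \<in> asp B" using asp_zero by simp
    show "a \<oplus>\<^bsub>RR\<^esub> b \<in> asp B" if "a \<in> asp B" "b \<in> asp B" for a b using asp_add[OF that] by simp
    fix a s assume a: "a \<in> asp B" "s \<in> carrier RR"
    hence s: "s \<in> R" unfolding cR by simp
    have "s \<otimes> a \<in> asp B"
    proof (rule asp_mult[OF Bc a(1) Rc[OF s] asp_closed])
      fix b assume "b \<in> B"
      then obtain r f where rf: "b = r \<otimes> f" "r \<in> R" "f \<in> F - {\<zero>}" unfolding B_def by blast
      hence "s \<otimes> b = (s \<otimes> r) \<otimes> f" using Rc s Ic FI by (simp add: m_assoc)
      thus "s \<otimes> b \<in> asp B" using mult_R[OF s rf(2)] rf(3) unfolding B_def by (intro asp_incl) blast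
    qed
    thus "s \<otimes>\<^bsub>RR\<^esub> a \<in> asp B" by simp
  qed
  moreover have "F \<subseteq> asp B"
  proof
    fix f assume f: "f \<in> F"
    show "f \<in> asp B"
    proof (cases "f = \<zero>")
      case False
      have "f = \<one> \<otimes> f" using Ic[OF FI[OF f]] by simp
      thus ?thesis using f False one_R unfolding B_def by (intro asp_incl) blast
    qed (simp add: asp_zero)
  qed
  ultimately have "Idl\<^bsub>RR\<^esub> F \<subseteq> asp B" by (rule RR.genideal_minimal)
  thus ?thesis unfolding B_def using F(2) by simp
qed

lemma Pw_span:
  assumes F: "F \<subseteq> I" "I = Idl\<^bsub>RR\<^esub> F"
  shows "y \<in> Pw N \<Longrightarrow> y \<in> asp {r \<otimes> prodl l | r l. r \<in> R \<and> set l \<subseteq> F - {\<zero>} \<and> length l = N}"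
proof (induction N arbitrary: y)
  case 0
  have "y = y \<otimes> prodl []" using Pwc[OF 0] unfolding prodl_def by simp
  thus ?case using 0 Pw_0 by (intro asp_incl CollectI exI[of _ y] exI[of _ "[]"]) simp
next
  case (Suc N)
  let ?B = "\<lambda>N. {r \<otimes> prodl l | r l. r \<in> R \<and> set l \<subseteq> F - {\<zero>} \<and> length l = N}"
  have lI: "set l \<subseteq> I" if "set l \<subseteq> F - {\<zero>}" for l by (rule order_trans[OF that]) (use F(1) in blast)
  have Bc: "?B N \<subseteq> carrier K" for N using Rc Pwc[OF prodl_Pw[OF lI]] by blast
  let ?C = "{r \<otimes> f | r f. r \<in> R \<and> f \<in> F - {\<zero>}}"
  have Cc: "?C \<subseteq> carrier K" using Rc Ic F(1) by blast
  have "y \<in> ideal_prod RR (Pw N) I" using Suc.prems by (simp add: Pw_Suc)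
  thus ?case
  proof (induction rule: ideal_prod.induct)
    case (prod i j)
    have i: "i \<in> asp (?B N)" by (rule Suc.IH[OF prod(1)])
    have j: "j \<in> asp ?C" by (rule subsetD[OF I_span[OF F] prod(2)])
    have "i \<otimes> j \<in> asp (?B (Suc N))"
    proof (rule asp_mult[OF Cc j Pwc[OF prod(1)] asp_closed])
      fix b assume "b \<in> ?C"
      then obtain s f where sf: "b = s \<otimes> f" "s \<in> R" "f \<in> F" "f \<noteq> \<zero>" by blast
      have fI: "f \<in> I" using subsetD[OF F(1) sf(3)] .
      have bc: "b \<in> carrier K" unfolding sf(1) using Rc[OF sf(2)] Ic[OF fI] by simp
      have "b \<otimes> i \<in> asp (?B (Suc N))"
      proof (rule asp_mult[OF Bc i bc asp_closed])
        fix d assume "d \<in> ?B N"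
        then obtain r l where rl: "d = r \<otimes> prodl l" "r \<in> R" "set l \<subseteq> F - {\<zero>}" "length l = N" by blast
        have pc: "prodl l \<in> carrier K" using Pwc[OF prodl_Pw[OF lI[OF rl(3)]]] .
        have "b \<otimes> d = (s \<otimes> r) \<otimes> prodl (f # l)" unfolding rl(1) sf(1) prodl_def foldr.simps comp_apply
          using Rc[OF sf(2)] Rc[OF rl(2)] Ic[OF fI] pc unfolding prodl_def by (simp add: m_ac)
        moreover have "set (f # l) \<subseteq> F - {\<zero>}" "length (f # l) = Suc N" using rl(3,4) sf(3,4) by simp_all
        ultimately show "b \<otimes> d \<in> asp (?B (Suc N))" using mult_R[OF sf(2) rl(2)] by (intro asp_incl) blast
      qed
      thus "i \<otimes> b \<in> asp (?B (Suc N))" using m_comm[OF Pwc[OF prod(1)] bc] by simp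
    qed
    thus ?case by simp
  next
    case (sum s1 s2)
    thus ?case using asp_add by simp
  qed
qed

section \<open>Integral dependence after clearing denominators\<close>

text \<open>An element of \<open>R[I/f]\<close> is a quotient of an element of \<open>I^c\<close> by
  \<open>f^c\<close>. The claim covers all larger exponents too, so that sums can be given a common
  one.\<close>

lemma chart_clear:
  assumes f: "f \<in> I" "f \<in> nz" and b: "b \<in> chart_ring f" shows "\<exists>c. \<forall>c'\<ge>c. f [^] c' \<otimes> b \<in> Pw c'"
  using b unfolding chart_ring_def
proof (induction rule: generate_ring.induct)
  case one
  thus ?case using Pw_pow[OF f(1)] Pwc[OF Pw_pow[OF f(1)]] by simp
next
  case (incl h)
  have fc: "f \<in> carrier K" by (rule Ic[OF f(1)])
  consider "h \<in> R" | g where "h = g \<otimes> inv f" "g \<in> I" using incl by blast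
  thus ?case
  proof cases
    case 1
    have "f [^] c' \<otimes> h \<in> Pw c'" for c' using Pw_mult[OF Pw_pow[OF f(1), of c'], of h 0] 1 Pw_0 by simp
    thus ?thesis by blast
  next
    case 2
    have "f [^] c' \<otimes> h \<in> Pw c'" if c: "1 \<le> c'" for c'
    proof -
      obtain d where d: "c' = Suc d" using c by (cases c') auto
      have "f [^] c' \<otimes> h = f [^] d \<otimes> (f \<otimes> g \<otimes> inv f)" unfolding d 2(1)
        using fc Ic[OF 2(2)] nzD(1)[OF nz_inv[OF f(2)]] by (simp add: m_assoc)
      also have "\<dots> = f [^] d \<otimes> g" using mult_cancel[OF f(2) Ic[OF 2(2)]] by simp
      also have "\<dots> \<in> Pw c'" using Pw_mult[OF Pw_pow[OF f(1), of d] Pw_1[OF 2(2)]] unfolding d by simp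
      finally show ?thesis .
    qed
    thus ?thesis by blast
  qed
next
  case (a_inv h)
  then obtain c where c: "\<forall>c'\<ge>c. f [^] c' \<otimes> h \<in> Pw c'" by blast
  have hc: "h \<in> carrier K" using subringE(1)[OF chart_subring[OF f(2)]] a_inv.hyps unfolding chart_ring_def by blast
  have mo: "\<ominus> \<one> \<in> R" using subringE(5)[OF R one_R] .
  have "f [^] c' \<otimes> (\<ominus> h) \<in> Pw c'" if "c \<le> c'" for c'
  proof -
    have "(\<ominus> \<one>) \<otimes> (f [^] c' \<otimes> h) \<in> Pw c'" using c that by (intro Pw_props(4)[OF _ mo]) simp
    moreover have "(\<ominus> \<one>) \<otimes> (f [^] c' \<otimes> h) = f [^] c' \<otimes> (\<ominus> h)" using hc Ic[OF f(1)] by (simp add: l_minus r_minus)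
    ultimately show ?thesis by simp
  qed
  thus ?case by blast
next
  case (eng_add h1 h2)
  obtain c1 where c1: "\<forall>c'\<ge>c1. f [^] c' \<otimes> h1 \<in> Pw c'" using eng_add.IH(1) by blast
  obtain c2 where c2: "\<forall>c'\<ge>c2. f [^] c' \<otimes> h2 \<in> Pw c'" using eng_add.IH(2) by blast
  have hc: "h1 \<in> carrier K" "h2 \<in> carrier K" using subringE(1)[OF chart_subring[OF f(2)]] eng_add.hyps unfolding chart_ring_def by blast+
  have "f [^] c' \<otimes> (h1 \<oplus> h2) \<in> Pw c'" if "max c1 c2 \<le> c'" for c'
    using Pw_props(3)[of "f [^] c' \<otimes> h1" c' "f [^] c' \<otimes> h2"] c1 c2 that hc Ic[OF f(1)] by (simp add: r_distr)
  thus ?case by blast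
next
  case (eng_mult h1 h2)
  obtain c1 where c1: "\<forall>c'\<ge>c1. f [^] c' \<otimes> h1 \<in> Pw c'" using eng_mult.IH(1) by blast
  obtain c2 where c2: "\<forall>c'\<ge>c2. f [^] c' \<otimes> h2 \<in> Pw c'" using eng_mult.IH(2) by blast
  have hc: "h1 \<in> carrier K" "h2 \<in> carrier K" using subringE(1)[OF chart_subring[OF f(2)]] eng_mult.hyps unfolding chart_ring_def by blast+
  have "f [^] c' \<otimes> (h1 \<otimes> h2) \<in> Pw c'" if c: "c1 + c2 \<le> c'" for c'
  proof -
    have "f [^] c' = f [^] c1 \<otimes> f [^] (c' - c1)" using Ic[OF f(1)] c by (simp add: nat_pow_mult)
    hence "f [^] c' \<otimes> (h1 \<otimes> h2) = (f [^] c1 \<otimes> h1) \<otimes> (f [^] (c' - c1) \<otimes> h2)" using hc Ic[OF f(1)] by (simp add: m_ac)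
    moreover have "f [^] c1 \<otimes> h1 \<in> Pw c1" "f [^] (c' - c1) \<otimes> h2 \<in> Pw (c' - c1)" using c1 c2 c by simp_all
    hence "(f [^] c1 \<otimes> h1) \<otimes> (f [^] (c' - c1) \<otimes> h2) \<in> Pw (c1 + (c' - c1))" by (rule Pw_mult)
    ultimately show ?thesis using c by simp
  qed
  thus ?case by blast
qed

text \<open>The terms allowed on the right of an equation for \<open>g [^] t\<close> that is
  homogeneous of degree \<open>m * t\<close>, when \<open>g\<close> counts with degree
  \<open>m\<close>. The number \<open>c\<close> is an extra power of \<open>I\<close>, carried along
  from cleared denominators; for \<open>i > t\<close> the truncated difference leaves only this
  power.\<close>

definition dep :: "'a \<Rightarrow> nat \<Rightarrow> nat \<Rightarrow> nat \<Rightarrow> nat \<Rightarrow> 'a set" where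
  "dep g m D t c = {g [^] i \<otimes> u | i u. i < D \<and> u \<in> Pw (m * (t - i) + c)}"

lemma dep_carrier: "g \<in> R \<Longrightarrow> dep g m D t c \<subseteq> carrier K" unfolding dep_def using Rc[OF pow_R] Pwc by blast

lemma depI: "i < D \<Longrightarrow> u \<in> Pw (m * (t - i) + c) \<Longrightarrow> g [^] i \<otimes> u \<in> asp (dep g m D t c)"
  by (rule asp_incl) (unfold dep_def, blast)

lemma dep_mult: assumes g: "g \<in> R" and y: "y \<in> asp (dep g m D t c)" and w: "w \<in> Pw l" shows "w \<otimes> y \<in> asp (dep g m D t (c + l))"
proof (rule asp_mult[OF dep_carrier[OF g] y Pwc[OF w] asp_closed])
  fix b assume "b \<in> dep g m D t c"
  then obtain i u where iu: "b = g [^] i \<otimes> u" "i < D" "u \<in> Pw (m * (t - i) + c)" unfolding dep_def by blast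
  have "w \<otimes> b = g [^] i \<otimes> (u \<otimes> w)" unfolding iu(1) using Rc[OF pow_R[OF g]] Pwc[OF iu(3)] Pwc[OF w] by (simp add: m_ac)
  moreover have "u \<otimes> w \<in> Pw (m * (t - i) + (c + l))" using Pw_mult[OF iu(3) w] by (simp add: add.assoc)
  ultimately show "w \<otimes> b \<in> asp (dep g m D t (c + l))" using depI[OF iu(2)] by simp
qed

lemma dep_shift: assumes g: "g \<in> R" and y: "y \<in> asp (dep g m D t c)" shows "g \<otimes> y \<in> asp (dep g m (Suc D) (Suc t) c)"
proof (rule asp_mult[OF dep_carrier[OF g] y Rc[OF g] asp_closed])
  fix b assume "b \<in> dep g m D t c"
  then obtain i u where iu: "b = g [^] i \<otimes> u" "i < D" "u \<in> Pw (m * (t - i) + c)" unfolding dep_def by blast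
  have "g \<otimes> b = g [^] Suc i \<otimes> u" unfolding iu(1) using Rc[OF g] Rc[OF pow_R[OF g]] Pwc[OF iu(3)] by (simp add: m_ac)
  thus "g \<otimes> b \<in> asp (dep g m (Suc D) (Suc t) c)" using depI[of "Suc i" "Suc D" u m "Suc t" c g] iu by simp
qed

text \<open>The term with \<open>x [^] l\<close> becomes \<open>g [^] l\<close> times an element of
  the required power of \<open>I\<close>: the factor \<open>f [^] (m * l)\<close> clears
  \<open>x [^] l\<close>, the remaining powers of \<open>f\<close> are in the ideal, and
  \<open>f [^] c'\<close> clears the coefficient.\<close>

lemma eval_dep:
  assumes f: "f \<in> I" "f \<in> nz" and g: "g \<in> R" and x: "x = g \<otimes> inv (f [^] m)"
  shows "set q \<subseteq> chart_ring f \<Longrightarrow> \<exists>c. \<forall>c'\<ge>c. \<forall>D\<ge>length q. \<forall>L\<ge>length q. (f [^] c' \<otimes> f [^] (m * D)) \<otimes> eval q x \<in> asp (dep g m L D c')"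
proof (induction q)
  case Nil
  have "(f [^] c' \<otimes> f [^] (m * D)) \<otimes> \<zero> = \<zero>" for c' D :: nat using Ic[OF f(1)] by simp
  thus ?case using asp_zero by simp
next
  case (Cons a q)
  have fc: "f \<in> carrier K" and gc: "g \<in> carrier K" using Ic[OF f(1)] Rc[OF g] .
  have fm: "f [^] m \<in> nz" by (rule nz_pow[OF f(2)])
  have xc: "x \<in> carrier K" unfolding x using gc nzD(1)[OF nz_inv[OF fm]] by simp
  have cs: "chart_ring f \<subseteq> carrier K" by (rule subringE(1)[OF chart_subring[OF f(2)]])
  have qs: "set q \<subseteq> chart_ring f" and a: "a \<in> chart_ring f" using Cons.prems by simp_all
  have ac: "a \<in> carrier K" using subsetD[OF cs a] .
  have ec: "eval q x \<in> carrier K" by (rule eval_in_carrier[OF order_trans[OF qs cs] xc])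
  obtain c1 where c1: "\<forall>c'\<ge>c1. \<forall>D\<ge>length q. \<forall>L\<ge>length q. (f [^] c' \<otimes> f [^] (m * D)) \<otimes> eval q x \<in> asp (dep g m L D c')"
    using Cons.IH[OF qs] by blast
  obtain c2 where c2: "\<forall>c'\<ge>c2. f [^] c' \<otimes> a \<in> Pw c'" using chart_clear[OF f a] by blast
  let ?l = "length q"
  have fx: "f [^] m \<otimes> x = g"
  proof -
    have "f [^] m \<otimes> x = (f [^] m \<otimes> g) \<otimes> inv (f [^] m)" unfolding x using fc gc nzD(1)[OF nz_inv[OF fm]] by (simp add: m_assoc)
    thus ?thesis using mult_cancel[OF fm gc] by simp
  qed
  have fxl: "f [^] (m * j) \<otimes> x [^] j = g [^] j" for j
  proof -
    have "f [^] (m * j) \<otimes> x [^] j = (f [^] m \<otimes> x) [^] j" using fc xc by (simp add: nat_pow_pow nat_pow_distrib)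
    thus ?thesis unfolding fx .
  qed
  have "(f [^] c' \<otimes> f [^] (m * D)) \<otimes> eval (a # q) x \<in> asp (dep g m L D c')"
    if c: "max c1 c2 \<le> c'" and D: "length (a # q) \<le> D" and L: "length (a # q) \<le> L" for c' D L
  proof -
    let ?F = "f [^] c' \<otimes> f [^] (m * D)"
    have "m * D = m * (D - ?l) + m * ?l" using D by (simp add: distrib_left[symmetric])
    hence s: "f [^] (m * D) = f [^] (m * (D - ?l)) \<otimes> f [^] (m * ?l)" using fc by (simp add: nat_pow_mult)
    have cc: "f [^] c' \<in> carrier K" "f [^] (m * (D - ?l)) \<in> carrier K" "f [^] (m * ?l) \<in> carrier K" "x [^] ?l \<in> carrier K" using fc xc by simp_all
    have "?F \<otimes> (a \<otimes> x [^] ?l) = (f [^] (m * ?l) \<otimes> x [^] ?l) \<otimes> ((f [^] c' \<otimes> a) \<otimes> f [^] (m * (D - ?l)))"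
      unfolding s using cc ac by (simp add: m_ac)
    hence e: "?F \<otimes> (a \<otimes> x [^] ?l) = g [^] ?l \<otimes> ((f [^] c' \<otimes> a) \<otimes> f [^] (m * (D - ?l)))" unfolding fxl .
    have u: "(f [^] c' \<otimes> a) \<otimes> f [^] (m * (D - ?l)) \<in> Pw (m * (D - ?l) + c')"
      using Pw_mult[of "f [^] c' \<otimes> a" c', OF _ Pw_pow[OF f(1), of "m * (D - ?l)"]] c2 c by (simp add: add.commute)
    have "?F \<otimes> (a \<otimes> x [^] ?l) \<in> asp (dep g m L D c')" unfolding e by (rule depI[OF _ u]) (use L in simp)
    moreover have "?F \<otimes> eval q x \<in> asp (dep g m L D c')" using c1 c D L by simp
    ultimately have "?F \<otimes> (a \<otimes> x [^] ?l) \<oplus> ?F \<otimes> eval q x \<in> asp (dep g m L D c')" by (rule asp_add)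
    moreover have "?F \<otimes> eval (a # q) x = ?F \<otimes> (a \<otimes> x [^] ?l) \<oplus> ?F \<otimes> eval q x" using cc ac ec fc xc by (simp add: r_distr)
    ultimately show ?thesis by simp
  qed
  thus ?case by blast
qed

text \<open>The monic equation of \<open>g / f^m\<close> over the chart ring, multiplied by
  \<open>f^(m D + c)\<close>: an equation of integral dependence of \<open>g\<close> on
  \<open>I^m\<close> up to the factor \<open>f^c\<close>.\<close>

lemma integral_dep:
  assumes f: "f \<in> I" "f \<in> nz" and g: "g \<in> R" and x: "g \<otimes> inv (f [^] m) \<in> normalized_chart K R I f"
  shows "\<exists>D c. f [^] c \<otimes> g [^] D \<in> asp (dep g m D D c)"
proof -
  let ?x = "g \<otimes> inv (f [^] m)"
  obtain p where p: "?x \<in> carrier K" "set p \<subseteq> chart_ring f" "p \<noteq> []" "hd p = \<one>" "eval p ?x = \<zero>"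
    using x unfolding normalized_chart_def integral_closure_def polynomial_def chart_ring_def by auto
  obtain q where pq: "p = \<one> # q" using p(3,4) by (cases p) auto
  have qs: "set q \<subseteq> chart_ring f" using p(2) pq by simp
  obtain c where c: "\<forall>c'\<ge>c. \<forall>D\<ge>length q. \<forall>L\<ge>length q. (f [^] c' \<otimes> f [^] (m * D)) \<otimes> eval q ?x \<in> asp (dep g m L D c')"
    using eval_dep[OF f g refl qs] by blast
  let ?D = "length q"
  have fc: "f \<in> carrier K" and gc: "g \<in> carrier K" using Ic[OF f(1)] Rc[OF g] .
  have fm: "f [^] m \<in> nz" by (rule nz_pow[OF f(2)])
  have ec: "eval q ?x \<in> carrier K" by (rule eval_in_carrier[OF order_trans[OF qs subringE(1)[OF chart_subring[OF f(2)]]] p(1)])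
  have "f [^] m \<otimes> ?x = (f [^] m \<otimes> g) \<otimes> inv (f [^] m)" using fc gc nzD(1)[OF nz_inv[OF fm]] by (simp add: m_assoc)
  hence fx: "f [^] m \<otimes> ?x = g" using mult_cancel[OF fm gc] by simp
  have "f [^] (m * ?D) \<otimes> ?x [^] ?D = (f [^] m \<otimes> ?x) [^] ?D" using fc p(1) by (simp only: nat_pow_pow nat_pow_distrib nat_pow_closed)
  hence gD: "f [^] (m * ?D) \<otimes> ?x [^] ?D = g [^] ?D" unfolding fx .
  have "?x [^] ?D \<oplus> eval q ?x = \<zero>" using p(5) p(1) unfolding pq by simp
  hence xd: "?x [^] ?D = \<ominus> eval q ?x" using p(1) ec by (intro minus_equality[symmetric]) simp_all
  have "f [^] c \<otimes> g [^] ?D = (\<ominus> \<one>) \<otimes> ((f [^] c \<otimes> f [^] (m * ?D)) \<otimes> eval q ?x)"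
    unfolding gD[symmetric] xd using fc ec by (simp add: l_minus r_minus m_assoc)
  moreover have "(\<ominus> \<one>) \<otimes> ((f [^] c \<otimes> f [^] (m * ?D)) \<otimes> eval q ?x) \<in> asp (dep g m ?D ?D (c + 0))"
    by (rule dep_mult[OF g]) (use c subringE(5)[OF R one_R] Pw_0 in simp_all)
  ultimately show ?thesis by (intro exI[of _ ?D] exI[of _ c]) simp
qed

text \<open>Multiplying by \<open>g\<close> raises the degree and multiplying by \<open>f\<close>
  raises the extra power, so finitely many charts can share the same \<open>D\<close> and
  \<open>c\<close>.\<close>

lemma dep_mono:
  assumes f: "f \<in> I" and g: "g \<in> R" and d: "f [^] c \<otimes> g [^] D \<in> asp (dep g m D D c)" and le: "D \<le> D'" "c \<le> c'"
  shows "f [^] c' \<otimes> g [^] D' \<in> asp (dep g m D' D' c')"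
proof -
  have fc: "f \<in> carrier K" and gc: "g \<in> carrier K" using Ic[OF f] Rc[OF g] .
  have 1: "f [^] c \<otimes> g [^] (D + j) \<in> asp (dep g m (D + j) (D + j) c)" for j
  proof (induction j)
    case (Suc j)
    have "g \<otimes> (f [^] c \<otimes> g [^] (D + j)) = f [^] c \<otimes> g [^] (D + Suc j)" using fc gc by (simp add: m_ac)
    thus ?case using dep_shift[OF g Suc] by simp
  qed (use d in simp)
  have "f [^] (c' - c) \<otimes> (f [^] c \<otimes> g [^] D') \<in> asp (dep g m D' D' (c + (c' - c)))"
    by (rule dep_mult[OF g _ Pw_pow[OF f]]) (use 1[of "D' - D"] le(1) in simp)
  moreover have "f [^] (c' - c) \<otimes> (f [^] c \<otimes> g [^] D') = f [^] c' \<otimes> g [^] D'"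
    using fc gc le(2) by (simp add: m_assoc[symmetric] nat_pow_mult)
  ultimately show ?thesis using le(2) by simp
qed

text \<open>The equations on the charts still carry powers of the respective \<open>f\<close>.
  Multiplying by \<open>I^N\<close> instead, with \<open>N\<close> large, absorbs them all: every
  product of \<open>N\<close> generators contains one of them at least \<open>c\<close> times. The
  equation thus obtained is iterated to all powers of \<open>g\<close>.\<close>

theorem power_absorption:
  assumes g: "g \<in> R" and x: "\<And>f. f \<in> I \<Longrightarrow> f \<in> nz \<Longrightarrow> g \<otimes> inv (f [^] m) \<in> normalized_chart K R I f"
  shows "\<exists>D N. \<forall>h\<in>Pw N. \<forall>t. h \<otimes> g [^] t \<in> Pw (m * (t - D))"
proof -
  obtain F where F: "finite F" "F \<subseteq> I" "I = Idl\<^bsub>RR\<^esub> F" using I_fg by blast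
  let ?F = "F - {\<zero>}"
  have FI: "f \<in> I" "f \<in> nz" if "f \<in> ?F" for f using that subsetD[OF F(2)] nzI[OF Ic] by blast+
  have "\<exists>D c. \<forall>f\<in>G. f [^] c \<otimes> g [^] D \<in> asp (dep g m D D c)" if "finite G" "G \<subseteq> ?F" for G using that
  proof (induction G rule: finite_induct)
    case (insert f G)
    obtain D c where Dc: "\<forall>f\<in>G. f [^] c \<otimes> g [^] D \<in> asp (dep g m D D c)" using insert by blast
    have f: "f \<in> ?F" using insert.prems by blast
    obtain D' c' where Dc': "f [^] c' \<otimes> g [^] D' \<in> asp (dep g m D' D' c')" using integral_dep[OF FI[OF f] g x[OF FI[OF f]]] by blast
    have "\<forall>h\<in>insert f G. h [^] max c c' \<otimes> g [^] max D D' \<in> asp (dep g m (max D D') (max D D') (max c c'))"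
    proof
      fix h assume h: "h \<in> insert f G"
      hence hI: "h \<in> I" using FI(1) insert.prems by blast
      show "h [^] max c c' \<otimes> g [^] max D D' \<in> asp (dep g m (max D D') (max D D') (max c c'))"
      proof (cases "h = f")
        case True
        show ?thesis unfolding True by (rule dep_mono[OF _ g Dc']) (use hI True in simp_all)
      next
        case False
        hence "h [^] c \<otimes> g [^] D \<in> asp (dep g m D D c)" using Dc h by blast
        thus ?thesis by (rule dep_mono[OF hI g]) simp_all
      qed
    qed
    thus ?case by blast
  qed simp
  from this[of ?F] obtain D0 c where "\<forall>f\<in>?F. f [^] c \<otimes> g [^] D0 \<in> asp (dep g m D0 D0 c)" using F(1) by auto
  hence St: "f [^] c \<otimes> g [^] Suc D0 \<in> asp (dep g m (Suc D0) (Suc D0) c)" if "f \<in> ?F" for f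
    using dep_mono[OF FI(1)[OF that] g, of c D0 m "Suc D0" c] that by simp
  \<comment> \<open>Kept positive, so that the range of exponents below \<open>D\<close> is nonempty
    at the start of the iteration.\<close>
  define D where "D = Suc D0"
  \<comment> \<open>The pigeonhole bound for \<open>card ?F\<close> generators; the additional 1
    excludes that each occurs at most \<open>c\<close> times.\<close>
  define N where "N = card ?F * c + 1"
  have gp: "g [^] t \<in> carrier K" for t :: nat using Rc[OF pow_R[OF g]] .
  have base: "h \<otimes> g [^] D \<in> asp (dep g m D D N)" if h: "h \<in> Pw N" for h
  proof -
    let ?B = "{r \<otimes> prodl l | r l. r \<in> R \<and> set l \<subseteq> ?F \<and> length l = N}"
    have lI: "set l \<subseteq> I" if "set l \<subseteq> ?F" for l using that FI(1) by blast
    have Bc: "?B \<subseteq> carrier K" using Rc Pwc[OF prodl_Pw[OF lI]] by blast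
    have "g [^] D \<otimes> h \<in> asp (dep g m D D N)"
    proof (rule asp_mult[OF Bc Pw_span[OF F(2,3) h] gp asp_closed])
      fix b assume "b \<in> ?B"
      then obtain r l where rl: "b = r \<otimes> prodl l" "r \<in> R" "set l \<subseteq> ?F" "length l = N" by blast
      have "\<exists>f\<in>?F. c \<le> count_list l f"
      proof (rule ccontr)
        assume "\<not> (\<exists>f\<in>?F. c \<le> count_list l f)"
        hence "sum (count_list l) ?F \<le> (\<Sum>f\<in>?F. c)" by (intro sum_mono) (meson linear)
        moreover have "sum (count_list l) ?F = N" using sum_count_set[OF rl(3)] F(1) rl(4) by simp
        ultimately show False unfolding N_def by simp
      qed
      then obtain f where f: "f \<in> ?F" "c \<le> count_list l f" by blast
      let ?k = "count_list l f" and ?w = "prodl (removeAll f l)"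
      have pl: "prodl l = f [^] ?k \<otimes> ?w" "?k + length (removeAll f l) = N" using prodl_count[OF lI[OF rl(3)] FI(1)[OF f(1)]] rl(4) by simp_all
      have w: "?w \<in> Pw (length (removeAll f l))" by (rule prodl_Pw) (use lI[OF rl(3)] in auto)
      have fc: "f \<in> carrier K" by (rule Ic[OF FI(1)[OF f(1)]])
      have v: "r \<otimes> (f [^] (?k - c) \<otimes> ?w) \<in> Pw (N - c)"
      proof -
        have "f [^] (?k - c) \<otimes> ?w \<in> Pw (?k - c + length (removeAll f l))" by (rule Pw_mult[OF Pw_pow[OF FI(1)[OF f(1)]] w])
        moreover have "?k - c + length (removeAll f l) = N - c" using pl(2) f(2) by simp
        ultimately show ?thesis by (intro Pw_props(4)[OF _ rl(2)]) simp
      qed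
      have fs: "f [^] ?k = f [^] (?k - c) \<otimes> f [^] c" using fc f(2) by (simp add: nat_pow_mult)
      have fcc: "f [^] (?k - c) \<in> carrier K" "f [^] c \<in> carrier K" using fc by simp_all
      have "g [^] D \<otimes> b = (r \<otimes> (f [^] (?k - c) \<otimes> ?w)) \<otimes> (f [^] c \<otimes> g [^] D)"
        unfolding rl(1) pl(1) fs using Rc[OF rl(2)] Pwc[OF w] gp fcc by (simp add: m_ac)
      moreover have "(r \<otimes> (f [^] (?k - c) \<otimes> ?w)) \<otimes> (f [^] c \<otimes> g [^] D) \<in> asp (dep g m D D (c + (N - c)))"
        by (rule dep_mult[OF g St[OF f(1), folded D_def] v])
      moreover have "c + (N - c) = N" using pl(2) f(2) by simp
      ultimately show "g [^] D \<otimes> b \<in> asp (dep g m D D N)" by simp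
    qed
    thus ?thesis using m_comm[OF gp Pwc[OF h], of D] by simp
  qed
  \<comment> \<open>Multiplication by \<open>g\<close> leaves the range of exponents only at
    \<open>i = D - 1\<close>. There the coefficient is split into parts from
    \<open>I^(m (t - i))\<close> and \<open>I^N\<close>, and the second part allows
    \<open>base\<close> to lower the exponent again.\<close>
  have iter: "h \<otimes> g [^] t \<in> asp (dep g m D t N)" if h: "h \<in> Pw N" for h t
  proof (induction t)
    case 0
    have "g [^] (0 :: nat) \<otimes> h \<in> asp (dep g m D 0 N)" by (rule depI) (use h D_def in simp_all)
    thus ?case using m_comm[OF gp Pwc[OF h], of 0] by simp
  next
    case (Suc t)
    show ?case
    proof (cases "Suc t < D")
      case True
      have "g [^] Suc t \<otimes> h \<in> asp (dep g m D (Suc t) N)" by (rule depI[OF True]) (use h in simp)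
      thus ?thesis using m_comm[OF gp Pwc[OF h], of "Suc t"] by simp
    next
      case False
      have "g \<otimes> (h \<otimes> g [^] t) \<in> asp (dep g m D (Suc t) N)"
      proof (rule asp_mult[OF dep_carrier[OF g] Suc Rc[OF g] asp_closed])
        fix b assume "b \<in> dep g m D t N"
        then obtain i u where iu: "b = g [^] i \<otimes> u" "i < D" "u \<in> Pw (m * (t - i) + N)" unfolding dep_def by blast
        have gb: "g \<otimes> b = g [^] Suc i \<otimes> u" unfolding iu(1) using Rc[OF g] gp[of i] Pwc[OF iu(3)] by (simp add: m_ac)
        show "g \<otimes> b \<in> asp (dep g m D (Suc t) N)"
        proof (cases "Suc i < D")
          case True
          show ?thesis unfolding gb by (rule depI[OF True]) (use iu(3) in simp)
        next
          case False
          hence iD: "Suc i = D" using iu(2) by simp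
          let ?e = "m * (t - i)"
          have u: "u \<in> asp {u \<otimes> v | u v. u \<in> Pw ?e \<and> v \<in> Pw N}" by (rule Pw_add[OF iu(3)])
          have c: "{u \<otimes> v | u v. u \<in> Pw ?e \<and> v \<in> Pw N} \<subseteq> carrier K" using Pwc by blast
          have "g [^] D \<otimes> u \<in> asp (dep g m D (Suc t) N)"
          proof (rule asp_mult[OF c u gp asp_closed])
            fix d assume "d \<in> {u \<otimes> v | u v. u \<in> Pw ?e \<and> v \<in> Pw N}"
            then obtain w v where wv: "d = w \<otimes> v" "w \<in> Pw ?e" "v \<in> Pw N" by blast
            have "g [^] D \<otimes> d = w \<otimes> (v \<otimes> g [^] D)" unfolding wv(1) using Pwc[OF wv(2)] Pwc[OF wv(3)] gp[of D] by (simp add: m_ac)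
            moreover have "w \<otimes> (v \<otimes> g [^] D) \<in> asp (dep g m D (Suc t) N)"
            proof (rule asp_mult[OF dep_carrier[OF g] base[OF wv(3)] Pwc[OF wv(2)] asp_closed])
              fix z assume "z \<in> dep g m D D N"
              then obtain j y where jy: "z = g [^] j \<otimes> y" "j < D" "y \<in> Pw (m * (D - j) + N)" unfolding dep_def by blast
              have "w \<otimes> z = g [^] j \<otimes> (w \<otimes> y)" unfolding jy(1) using Pwc[OF wv(2)] Pwc[OF jy(3)] gp[of j] by (simp add: m_ac)
              moreover have "w \<otimes> y \<in> Pw (m * (Suc t - j) + N)"
              proof -
                have "(t - i) + (D - j) = Suc t - j" using iD jy(2) \<open>\<not> Suc t < D\<close> by simp
                hence e: "?e + (m * (D - j) + N) = m * (Suc t - j) + N" by (metis add.assoc distrib_left)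
                show ?thesis using Pw_mult[OF wv(2) jy(3)] unfolding e .
              qed
              ultimately show "w \<otimes> z \<in> asp (dep g m D (Suc t) N)" using depI[OF jy(2)] by simp
            qed
            ultimately show "g [^] D \<otimes> d \<in> asp (dep g m D (Suc t) N)" by simp
          qed
          thus ?thesis unfolding gb iD .
        qed
      qed
      moreover have "g \<otimes> (h \<otimes> g [^] t) = h \<otimes> g [^] Suc t" using Rc[OF g] gp[of t] Pwc[OF h] by (simp add: m_ac)
      ultimately show ?thesis by simp
    qed
  qed
  have "h \<otimes> g [^] t \<in> Pw (m * (t - D))" if h: "h \<in> Pw N" for h t
  proof (rule asp_sub[OF dep_carrier[OF g] iter[OF h] Pw_closed])
    fix b assume "b \<in> dep g m D t N"
    then obtain i u where iu: "b = g [^] i \<otimes> u" "i < D" "u \<in> Pw (m * (t - i) + N)" unfolding dep_def by blast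
    have "m * (t - D) \<le> m * (t - i) + N" using iu(2) by (simp add: diff_le_mono2 trans_le_add1)
    from subsetD[OF Pw_anti[OF this] iu(3)] show "b \<in> Pw (m * (t - D))" unfolding iu(1) by (rule Pw_props(4)) (rule pow_R[OF g])
  qed
  thus ?thesis by blast
qed

end

section \<open>Comparison of the multiplicity with the volumes\<close>

text \<open>The normalizations differ by the factor \<open>fact n\<close>: multiplicity and volume
  divide by \<open>m^n / n!\<close>, the covolume by \<open>m^n\<close>.\<close>

lemma length_limit:
  assumes g: "gfam n c E" and n: "0 < n" and l: "\<And>m. l m = enat (card (gaps n E m))"
  shows "(\<lambda>m. ereal_of_enat (l m) / ereal (real m ^ n / fact n)) \<longlonglongrightarrow> ereal (fact n * covol n E)"
proof -
  have "(\<lambda>m. fact n * (real (card (gaps n E m)) / real m ^ n)) \<longlonglongrightarrow> fact n * covol n E" by (intro tendsto_intros covol_limit[OF g n])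
  hence "(\<lambda>m. ereal (fact n * (real (card (gaps n E m)) / real m ^ n))) \<longlonglongrightarrow> ereal (fact n * covol n E)" by (rule tendsto_ereal)
  thus ?thesis
  proof (rule Lim_transform_eventually)
    show "\<forall>\<^sub>F m in sequentially. ereal (fact n * (real (card (gaps n E m)) / real m ^ n)) = ereal_of_enat (l m) / ereal (real m ^ n / fact n)"
      using eventually_gt_at_top[of 0]
    proof (rule eventually_mono)
      fix m :: nat assume "0 < m"
      thus "ereal (fact n * (real (card (gaps n E m)) / real m ^ n)) = ereal_of_enat (l m) / ereal (real m ^ n / fact n)" unfolding l by (simp add: mult.commute)
    qed
  qed
qed

context chart_setup
begin

lemma pow_RR: "x [^]\<^bsub>RR\<^esub> (j::nat) = x [^] j" by (rule nat_pow_consistent[symmetric])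

text \<open>The facts that make the valuation ideals a graded family of the same kind as the powers
  of \<open>I\<close>, with \<open>I\<close> inside the first member because the order of
  \<open>I\<close> is a positive integer.\<close>

lemma val_ideal_props:
  assumes nu: "\<nu> \<in> rees_valuations K R I"
  shows "ideal (val_ideal RR \<nu> m) RR" "f \<in> val_ideal RR \<nu> m \<Longrightarrow> g \<in> val_ideal RR \<nu> l \<Longrightarrow> f \<otimes> g \<in> val_ideal RR \<nu> (m + l)"
    "l \<le> m \<Longrightarrow> val_ideal RR \<nu> m \<subseteq> val_ideal RR \<nu> l" "val_ideal RR \<nu> 0 = R" "I \<subseteq> val_ideal RR \<nu> 1"
    "\<exists>e::nat. val_of_ideal \<nu> I = ereal (real e)"
proof -
  let ?A = "val_ideal RR \<nu>"
  obtain w e where w: "rval K w" "R \<subseteq> vring w" "\<nu> = dvr_ord K (vring w)" "0 < (e::nat)" "val_of_ideal \<nu> I = ereal (real e)"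
    "\<forall>g\<in>I. g \<in> nz \<longrightarrow> int e \<le> w g" using rees_valuation_props[OF nu] by (elim exE conjE)
  have mem: "g \<in> ?A m \<longleftrightarrow> g \<in> R \<and> (g = \<zero> \<or> int m \<le> w g)" for g m
  proof (cases "g \<in> R")
    case True
    have "\<nu> g = (if g = \<zero> then \<infinity> else ereal (of_int (w g)))" unfolding w(3) by (rule dvr_ord_vring[OF w(1) Rc[OF True]])
    moreover have "real m \<le> of_int (w g) \<longleftrightarrow> int m \<le> w g" by linarith
    ultimately show ?thesis using True unfolding val_ideal_def by simp
  qed (simp add: val_ideal_def)
  have w0: "0 \<le> w g" if "g \<in> R" "g \<noteq> \<zero>" for g using vring_nonneg[OF w(1) nzI[OF Rc[OF that(1)] that(2)]] subsetD[OF w(2) that(1)] by simp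
  have mul: "f \<otimes> g \<in> ?A (m + l)" if "f \<in> ?A m" "g \<in> ?A l" for f g m l
  proof -
    have fg: "f \<in> R" "g \<in> R" "f = \<zero> \<or> int m \<le> w f" "g = \<zero> \<or> int l \<le> w g" using that unfolding mem by simp_all
    have "f \<otimes> g = \<zero> \<or> int (m + l) \<le> w (f \<otimes> g)"
    proof (cases "f = \<zero> \<or> g = \<zero>")
      case True
      thus ?thesis using Rc[OF fg(1)] Rc[OF fg(2)] by auto
    next
      case False
      thus ?thesis using rv_mult[OF w(1) nzI nzI, of f g] Rc[OF fg(1)] Rc[OF fg(2)] fg(3,4) by simp
    qed
    thus ?thesis unfolding mem using mult_R[OF fg(1,2)] by simp
  qed
  show "f \<in> ?A m \<Longrightarrow> g \<in> ?A l \<Longrightarrow> f \<otimes> g \<in> ?A (m + l)" by (rule mul)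
  show v0: "?A 0 = R"
  proof (rule Set.set_eqI)
    fix g show "g \<in> ?A 0 \<longleftrightarrow> g \<in> R" unfolding mem using w0[of g] by auto
  qed
  show "l \<le> m \<Longrightarrow> ?A m \<subseteq> ?A l" by (rule subsetI) (unfold mem, auto)
  show "I \<subseteq> ?A 1"
  proof
    fix g assume g: "g \<in> I"
    thus "g \<in> ?A 1" unfolding mem using IR[OF g] w(4) w(6)[rule_format, OF g] nzI[OF Ic[OF g]] by auto
  qed
  show "\<exists>e::nat. val_of_ideal \<nu> I = ereal (real e)" using w(5) by blast
  interpret RR: cring RR by (rule RR_cring)
  show "ideal (?A m) RR"
  proof (rule RR.idealI')
    show "?A m \<subseteq> carrier RR" by (rule subsetI) (unfold mem, simp)
    show "\<zero>\<^bsub>RR\<^esub> \<in> ?A m" unfolding mem using subringE(2)[OF R] by simp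
    fix a assume a: "a \<in> ?A m"
    { fix b assume b: "b \<in> ?A m"
      have ab: "a \<in> R" "b \<in> R" "a = \<zero> \<or> int m \<le> w a" "b = \<zero> \<or> int m \<le> w b" using a b unfolding mem by simp_all
      have "a \<oplus> b = \<zero> \<or> int m \<le> w (a \<oplus> b)"
      proof (cases "a = \<zero> \<or> b = \<zero> \<or> a \<oplus> b = \<zero>")
        case True
        thus ?thesis using ab Rc[OF ab(1)] Rc[OF ab(2)] by auto
      next
        case False
        thus ?thesis using rv_add[OF w(1) nzI nzI, of a b] Rc[OF ab(1)] Rc[OF ab(2)] ab(3,4) by auto
      qed
      thus "a \<oplus>\<^bsub>RR\<^esub> b \<in> ?A m" unfolding mem using subringE(7)[OF R ab(1,2)] by simp }
    fix r assume "r \<in> carrier RR"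
    hence "r \<in> ?A 0" unfolding v0 by simp
    from mul[OF this a] show "r \<otimes>\<^bsub>RR\<^esub> a \<in> ?A m" by simp
  qed
qed

theorem multiplicity_le:
  assumes reg: "regular_local_ring RR M" and kd: "krull_dim RR = enat n" and n: "n \<ge> 1" and prim: "primary_ideal RR M I"
  shows "root n (real_of_ereal (hs_multiplicity RR n I))
    \<le> (\<Sum>\<nu>\<in>rees_valuations K R I. real_of_ereal (val_of_ideal \<nu> I) * root n (real_of_ereal (val_volume RR n \<nu>)))"
proof -
  interpret RR: cring RR by (rule RR_cring)
  let ?V = "rees_valuations K R I"
  have n0: "0 < n" using n by simp
  have M: "maximalideal M RR" using reg unfolding regular_local_ring_def local_ring_def by (elim conjE)
  obtain Y where Y: "Y \<subseteq> carrier RR" "finite Y" "enat (card Y) = krull_dim RR" "M = Idl\<^bsub>RR\<^esub> Y"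
    using reg unfolding regular_local_ring_def by (elim conjE exE)
  obtain xs where xs: "set xs = Y" "distinct xs" using finite_distinct_list[OF Y(2)] by (elim exE conjE)
  have len: "length xs = n" using distinct_card[OF xs(2)] Y(3) kd xs(1) by simp
  have xsc: "set xs \<subseteq> carrier RR" using Y(1) xs(1) by simp
  have xR: "x \<in> R" if "x \<in> set xs" for x using subsetD[OF xsc that] by simp
  have MN: "M \<subseteq> N" if "ideal N RR" "set xs \<subseteq> N" for N unfolding Y(4) using RR.genideal_minimal[OF that(1)] that(2) xs(1) by simp
  have "\<exists>j::nat. x [^] j \<in> I" if x: "x \<in> set xs" for x
  proof -
    have "x \<in> M" unfolding Y(4) by (rule subsetD[OF RR.genideal_self[OF Y(1)]]) (use x xs(1) in simp)
    hence "x \<in> ideal_radical RR I" using prim unfolding primary_ideal_def by simp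
    hence "\<exists>j::nat. x [^]\<^bsub>RR\<^esub> j \<in> I" unfolding ideal_radical_def by simp
    thus ?thesis unfolding pow_RR .
  qed
  hence "\<forall>x\<in>set xs. \<exists>j::nat. x [^] j \<in> I" by blast
  from bchoice[OF this] obtain jj :: "'a \<Rightarrow> nat" where jj: "\<forall>x\<in>set xs. x [^] jj x \<in> I" by (elim exE)
  \<comment> \<open>One exponent for all parameters, by primariness of \<open>I\<close>. It is the
    constant of all families that occur: the powers of \<open>I\<close> and the valuation ideals of
    each Rees valuation.\<close>
  define c where "c = (\<Sum>x\<in>set xs. jj x)"
  have xc: "x [^] c \<in> I" if x: "x \<in> set xs" for x
  proof -
    have le: "jj x \<le> c" unfolding c_def by (rule member_le_sum[OF x]) simp_all
    have "x [^] c = x [^] (c - jj x) \<otimes> x [^] jj x" using Rc[OF xR[OF x]] le by (simp add: nat_pow_mult)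
    moreover have "x [^] (c - jj x) \<otimes>\<^bsub>RR\<^esub> x [^] jj x \<in> I" by (rule ideal_props(4)[OF I]) (use jj x pow_R[OF xR[OF x]] in simp_all)
    ultimately show ?thesis by simp
  qed
  have gfJ: "gfam n c (\<lambda>m. lexps RR xs (J m)) \<and> (\<forall>m. module_length RR (quot_module RR (J m)) = enat (card (gaps n (\<lambda>m. lexps RR xs (J m)) m)))"
    if J: "\<And>m. ideal (J m) RR" and mul: "\<And>m l f g. f \<in> J m \<Longrightarrow> g \<in> J l \<Longrightarrow> f \<otimes> g \<in> J (m + l)"
      and anti: "\<And>l m. l \<le> m \<Longrightarrow> J m \<subseteq> J l" and J0: "J 0 = R" and J1: "I \<subseteq> J 1" for J :: "nat \<Rightarrow> 'a set"
  proof -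
    have p: "y [^] m \<in> J m" if y: "y \<in> I" for y m
    proof (induction m)
      case 0
      show ?case using one_R J0 by simp
    next
      case (Suc m)
      show ?case using mul[OF Suc subsetD[OF J1 y]] by simp
    qed
    have xm: "x [^]\<^bsub>RR\<^esub> (c * m) \<in> J m" if x: "x \<in> set xs" for x m
      using p[OF xc[OF x], of m] Rc[OF xR[OF x]] unfolding pow_RR by (simp add: nat_pow_pow)
    have "gfam (length xs) c (\<lambda>m. lexps RR xs (J m))" by (rule RR.lexps_gfam[OF xsc J _ anti xm]) (use mul in simp)
    moreover have "module_length RR (quot_module RR (J m)) = enat (card (gaps n (\<lambda>m. lexps RR xs (J m)) m))" for m
    proof -
      have "has_length RR (J m) (card (vecs (length xs) - lexps RR xs (J m)))"
        by (rule conjunct2[OF RR.has_length_lexps[OF M J xsc, of "c * m"]]) (use xm MN in simp_all)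
      from RR.has_length_module_length[OF J this] show ?thesis unfolding gaps_def len .
    qed
    ultimately show ?thesis unfolding len by simp
  qed
  define EI where "EI = (\<lambda>m. lexps RR xs (Pw m))"
  define E where "E \<nu> = (\<lambda>m. lexps RR xs (val_ideal RR \<nu> m))" for \<nu>
  have gI: "gfam n c EI" and lI: "module_length RR (quot_module RR (Pw m)) = enat (card (gaps n EI m))" for m
    unfolding EI_def using gfJ[of Pw, OF Pw_ideal Pw_mult Pw_anti Pw_0] Pw_1 by blast+
  have gE: "gfam n c (E \<nu>)" and lE: "module_length RR (quot_module RR (val_ideal RR \<nu> m)) = enat (card (gaps n (E \<nu>) m))"
    if nu: "\<nu> \<in> ?V" for \<nu> m unfolding E_def using gfJ[of "val_ideal RR \<nu>", OF val_ideal_props(1-5)[OF nu]] by blast+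
  define e where "e \<nu> = nat \<lfloor>real_of_ereal (val_of_ideal \<nu> I)\<rfloor>" for \<nu>
  have e: "val_of_ideal \<nu> I = ereal (real (e \<nu>))" if nu: "\<nu> \<in> ?V" for \<nu> using val_ideal_props(6)[OF nu] unfolding e_def by auto
  \<comment> \<open>Elements \<open>g \<nu>\<close> with exponents on the ray of \<open>q\<close>
    are multiplied to \<open>h\<close>, which has value at least \<open>L\<close> times the order of
    \<open>I\<close> at every Rees valuation. So it is integral over \<open>I^L\<close>, and the
    powers of \<open>h\<close> yield exponents of the family of \<open>I\<close> along the same
    ray.\<close>
  have absorb: "\<exists>D c0. \<forall>t. vscale (t * (\<Sum>\<nu>\<in>?V. s \<nu>) + c0) q \<in> EI (L * (t - D))"
    if q: "length q = n" "\<forall>x\<in>set q. 0 < x" and s: "\<And>\<nu>. \<nu> \<in> ?V \<Longrightarrow> vscale (s \<nu>) q \<in> E \<nu> (e \<nu> * L)"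
    for q L and s :: "('a \<Rightarrow> ereal) \<Rightarrow> nat"
  proof -
    let ?S = "\<Sum>\<nu>\<in>?V. s \<nu>"
    have "\<forall>\<nu>\<in>?V. \<exists>g. g \<in> val_ideal RR \<nu> (e \<nu> * L) \<and> lead RR xs (vscale (s \<nu>) q) g"
      using s unfolding E_def lexps_def by blast
    from bchoice[OF this] obtain g where g: "\<forall>\<nu>\<in>?V. g \<nu> \<in> val_ideal RR \<nu> (e \<nu> * L) \<and> lead RR xs (vscale (s \<nu>) q) (g \<nu>)" by (elim exE)
    obtain h where h: "lead RR xs (vscale ?S q) h" "\<forall>\<nu>\<in>?V. \<exists>u\<in>carrier RR. h = g \<nu> \<otimes>\<^bsub>RR\<^esub> u"
    proof -
      have lq: "length q = length xs" using q(1) len by simp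
      have lg: "lead RR xs (vscale (s \<nu>) q) (g \<nu>)" if "\<nu> \<in> ?V" for \<nu> using g that by simp
      have "\<exists>h. lead RR xs (vscale ?S q) h \<and> (\<forall>\<nu>\<in>?V. \<exists>u\<in>carrier RR. h = g \<nu> \<otimes>\<^bsub>RR\<^esub> u)"
        by (rule RR.lead_prod[OF rees_finite lq xsc]) (rule lg)
      thus thesis by (elim exE conjE) (rule that)
    qed
    have hR: "h \<in> R" using RR.lead_carrier[OF h(1) xsc] by simp
    have hv: "h \<in> val_ideal RR \<nu> (e \<nu> * L)" if nu: "\<nu> \<in> ?V" for \<nu>
    proof -
      obtain u where u: "u \<in> R" "h = g \<nu> \<otimes> u" using h(2)[rule_format, OF nu] by auto
      have "g \<nu> \<otimes> u \<in> val_ideal RR \<nu> (e \<nu> * L + 0)" by (rule val_ideal_props(2)[OF nu]) (use g nu u(1) val_ideal_props(4)[OF nu] in simp_all)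
      thus ?thesis unfolding u(2) by simp
    qed
    have "h \<otimes> inv (f [^] L) \<in> normalized_chart K R I f" if f: "f \<in> I" "f \<in> nz" for f
    proof (cases "h = \<zero>")
      case True
      have "h \<otimes> inv (f [^] L) = \<zero>" unfolding True using nzD(1)[OF nz_inv[OF nz_pow[OF f(2)]]] by simp
      thus ?thesis using chart_R[OF f(2) subringE(2)[OF R]] by simp
    next
      case False
      show ?thesis
      proof (rule rees_integral[OF hR nzI[OF Rc[OF hR] False] f])
        fix \<nu> assume nu: "\<nu> \<in> ?V"
        have "ereal (real (e \<nu> * L)) \<le> \<nu> h" using hv[OF nu] unfolding val_ideal_def by simp
        thus "ereal (real L) * val_of_ideal \<nu> I \<le> \<nu> h" unfolding e[OF nu] by (simp add: mult.commute)
      qed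
    qed
    from power_absorption[OF hR this] obtain D N where DN: "\<forall>z\<in>Pw N. \<forall>t. z \<otimes> h [^] t \<in> Pw (L * (t - D))" by blast
    \<comment> \<open>An exponent that occurs in \<open>I^N\<close>, supplying the factor for
      \<open>power_absorption\<close>. Since the entries of \<open>q\<close> are at least 1, adding
      \<open>c * N\<close> to the multiple of \<open>q\<close> dominates it.\<close>
    let ?w = "replicate n (c * N)"
    have "?w \<in> EI N" by (rule gf_big[OF gI n0, of _ 0]) (use n0 in simp_all)
    then obtain z where z: "z \<in> Pw N" "lead RR xs ?w z" unfolding EI_def lexps_def by blast
    have "vscale (t * ?S + c * N) q \<in> EI (L * (t - D))" for t
    proof (rule gf_up[OF gI n0])
      have "lead RR xs (vplus ?w (vscale t (vscale ?S q))) (z \<otimes>\<^bsub>RR\<^esub> h [^]\<^bsub>RR\<^esub> t)"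
        by (rule RR.lead_mult[OF z(2) RR.lead_pow[OF h(1) xsc] xsc])
      moreover have "z \<otimes>\<^bsub>RR\<^esub> h [^]\<^bsub>RR\<^esub> t \<in> Pw (L * (t - D))" unfolding pow_RR using DN z(1) by simp
      ultimately show "vplus ?w (vscale t (vscale ?S q)) \<in> EI (L * (t - D))" unfolding EI_def lexps_def by blast
      show "length (vscale (t * ?S + c * N) q) = n" using q(1) by simp
      fix i assume i: "i < n"
      have "1 \<le> q ! i" using q i nth_mem[of i q] by (simp add: Suc_le_eq)
      hence "c * N * 1 \<le> c * N * q ! i" by (rule mult_le_mono2)
      thus "vplus ?w (vscale t (vscale ?S q)) ! i \<le> vscale (t * ?S + c * N) q ! i" using i q(1) by (simp add: distrib_right mult.assoc)
    qed
    thus ?thesis by blast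
  qed
  have main: "root n (covol n EI) \<le> (\<Sum>\<nu>\<in>?V. real (e \<nu>) * root n (covol n (E \<nu>)))"
    by (rule covol_minkowski[where c = "\<lambda>_. c", OF gI n0 rees_finite gE absorb])
  have "(\<lambda>m. ereal_of_enat (module_length RR (quot_module RR (Pw m))) / ereal (real m ^ n / fact n)) \<longlonglongrightarrow> ereal (fact n * covol n EI)"
    by (rule length_limit[OF gI n0 lI])
  hence hs: "hs_multiplicity RR n I = ereal (fact n * covol n EI)" unfolding hs_multiplicity_def Pw_def by (rule limI)
  have vol: "val_volume RR n \<nu> = ereal (fact n * covol n (E \<nu>))" if nu: "\<nu> \<in> ?V" for \<nu>
    unfolding val_volume_def by (rule lim_imp_Limsup[OF _ length_limit[OF gE[OF nu] n0 lE[OF nu]]]) simp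
  have "root n (real_of_ereal (hs_multiplicity RR n I)) = root n (fact n) * root n (covol n EI)" unfolding hs by (simp add: real_root_mult)
  also have "\<dots> \<le> root n (fact n) * (\<Sum>\<nu>\<in>?V. real (e \<nu>) * root n (covol n (E \<nu>)))" by (rule mult_left_mono[OF main]) (use n0 in simp)
  also have "\<dots> = (\<Sum>\<nu>\<in>?V. real_of_ereal (val_of_ideal \<nu> I) * root n (real_of_ereal (val_volume RR n \<nu>)))"
    unfolding sum_distrib_left by (rule sum.cong[OF refl]) (simp add: e vol real_root_mult)
  finally show ?thesis .
qed

end

theorem mainTheorem5:
  fixes K :: "('a, 'b) ring_scheme"
    and k R M I :: "'a set"
    and n :: nat
  assumes "field K"
    and "subdomain R K"
    and "carrier K = localization K R (R - {\<zero>\<^bsub>K\<^esub>})"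
    and "subfield k K"
    and "k \<subseteq> R"
    and "\<forall>j::nat. 0 < j \<longrightarrow> add_pow K j \<one>\<^bsub>K\<^esub> \<noteq> \<zero>\<^bsub>K\<^esub>"
    and "ess_finite_type K k R"
    and "regular_local_ring (K\<lparr>carrier := R\<rparr>) M"
    and "krull_dim (K\<lparr>carrier := R\<rparr>) = enat n"
    and "n \<ge> 1"
    and "primary_ideal (K\<lparr>carrier := R\<rparr>) M I"
  shows "root n (real_of_ereal (hs_multiplicity (K\<lparr>carrier := R\<rparr>) n I))
    \<le> (\<Sum>\<nu>\<in>rees_valuations K R I.
         real_of_ereal (val_of_ideal \<nu> I)
           * root n (real_of_ereal (val_volume (K\<lparr>carrier := R\<rparr>) n \<nu>)))"
proof -
  obtain S W where SW: "finite S" "S \<subseteq> carrier K" "submonoid W K" "W \<subseteq> generate_ring K (k \<union> S)" "\<zero>\<^bsub>K\<^esub> \<notin> W"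
    "R = localization K (generate_ring K (k \<union> S)) W"
    using assms(7) unfolding ess_finite_type_def by (elim exE conjE)
  have "subring R K" by (rule subcring.axioms(1)[OF subdomain.axioms(1)[OF assms(2)]])
  moreover have "char0 K" unfolding char0_def by (rule assms(6))
  moreover have "noetherian_ring (K\<lparr>carrier := R\<rparr>)" using assms(8) unfolding regular_local_ring_def by (rule conjunct1)
  moreover have "ideal I (K\<lparr>carrier := R\<rparr>)" using assms(11) unfolding primary_ideal_def by (rule conjunct1)
  ultimately have "chart_setup K R k I S W" by (intro chart_setup.intro kfield.intro chart_setup_axioms.intro assms(1,3,4) SW)
  from chart_setup.multiplicity_le[OF this assms(8-11)] show ?thesis .
qed

end
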